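(* Let $\phi$ solve the inhomogeneous wave equation $\Box_g\phi=f$ in the region $\mathcal M_R$ of the Schwarzschild manifold, with $\phi$ decaying as $r\to\infty$. Then $$E[\phi](\Sigma_R^+)+\sup_{\tilde v\ge 0}E[\phi](\tilde v)+\|\phi\|_{LE_0}^2\lesssim E[\phi](\Sigma_R^-)+\|f\|_{LE_0^*}^2,$$ with an implicit constant independent of $\phi$ and $f$.
   Context: Fix $M>0$ and $0<r_0<2M$. For $r>2M$ let $r^*=r+2M\ln(r-2M)-3M-2M\ln M$, so $dr^*=(1-\frac{2M}{r})^{-1}dr$ and $r^*=0$ at $r=3M$. Fix a smooth function $\mu(r)$ with: $\mu(r)\ge r^*$ for $r>2M$, with equality for $r>5M/2$; and $\mu'(r)>0$, $2-(1-\frac{2M}{r})\mu'(r)>0$. The region $\mathcal M_R=\{(\tilde v,r,\omega):\tilde v\ge0,\ r\ge r_0,\ \omega\in\mathbb S^2\}$ carries the Schwarzschild metric $$ds^2=-\Big(1-\frac{2M}{r}\Big)d\tilde v^2+2\Big(1-\Big(1-\frac{2M}{r}\Big)\mu'\Big)d\tilde v\,dr+\Big(2\mu'-\Big(1-\frac{2M}{r}\Big)\mu'^2\Big)dr^2+r^2d\omega^2$$ (for $r>5M/2$, $\tilde v$ is the usual Schwarzschild time $t$; the surfaces $\tilde v=$ const are space-like). $\Box_g=\nabla^\alpha\partial_\alpha$ is the d'Alembertian of this metric. $|\not\nabla\phi|^2=r^{-2}|\nabla_{\mathbb S^2}\phi|^2$; $\partial_r,\partial_{\tilde v}$ are taken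 in the $(\tilde v,r,\omega)$ coordinates. $\Sigma_R^-=\mathcal M_R\cap\{\tilde v=0\}$, $\Sigma_R^+=\mathcal M_R\cap\{r=r_0\}$. Energies: $$E[\phi](\tilde v_0)=\int_{\mathcal M_R\cap\{\tilde v=\tilde v_0\}}(|\partial_r\phi|^2+|\partial_{\tilde v}\phi|^2+|\not\nabla\phi|^2)\,r^2dr\,d\omega,\qquad E[\phi](\Sigma_R^-)=E[\phi](0),$$ $$E[\phi](\Sigma_R^+)=\int_{\Sigma_R^+}(|\partial_r\phi|^2+|\partial_{\tilde v}\phi|^2+|\not\nabla\phi|^2)\,r_0^2\,d\tilde v\,d\omega .$$ Local energy norms: $$\|\phi\|_{LE_0}^2=\int_{\mathcal M_R}\Big(\frac1{r^2}|\partial_r\phi|^2+\Big(1-\frac{3M}{r}\Big)^2\Big(\frac1{r^2}|\partial_{\tilde v}\phi|^2+\frac1r|\not\nabla\phi|^2\Big)+\frac1{r^4}\phi^2\Big)r^2dr\,d\tilde v\,d\omega,$$ $$\|f\|_{LE_0^*}^2=\int_{\mathcal M_R}\Big(1-\frac{3M}{r}\Big)^{-2}r^2f^2\,r^2dr\,d\tilde v\,d\omega .$$ $A\lesssim B$ means $A\le CB$ with $C$ depending only on $M,r_0,\mu$. *)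

theory Defs
  imports "HOL-Analysis.Analysis"
begin

section \<open>Differential operators in a coordinate chart\<close>

definition partial :: "'n::finite \<Rightarrow> (real^'n \<Rightarrow> real) \<Rightarrow> real^'n \<Rightarrow> real" where
  "partial i F p = frechet_derivative F (at p) (axis i 1)"

definition C2_on :: "(real^'n::finite) set \<Rightarrow> (real^'n \<Rightarrow> real) \<Rightarrow> bool" where
  "C2_on U F \<longleftrightarrow>
     (\<forall>p\<in>U. F differentiable (at p)) \<and>
     (\<forall>i. \<forall>p\<in>U. partial i F differentiable (at p)) \<and>
     (\<forall>i j. continuous_on U (partial j (partial i F)))"

definition christoffel ::
    "(real^'n \<Rightarrow> real^'n^'n) \<Rightarrow> real^'n \<Rightarrow> 'n \<Rightarrow> 'n \<Rightarrow> 'n::finite \<Rightarrow> real" where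
  "christoffel g p k i j =
     (\<Sum>l\<in>UNIV. matrix_inv (g p) $ k $ l *
        (partial i (\<lambda>q. g q $ j $ l) p + partial j (\<lambda>q. g q $ i $ l) p
          - partial l (\<lambda>q. g q $ i $ j) p)) / 2"

text \<open>The d'Alembertian, i.e. the trace (with respect to the metric) of the covariant Hessian
  of the Levi-Civita connection.\<close>

definition dalembertian ::
    "(real^'n \<Rightarrow> real^'n^'n) \<Rightarrow> (real^'n \<Rightarrow> real) \<Rightarrow> real^'n::finite \<Rightarrow> real" where
  "dalembertian g \<phi> p =
     (\<Sum>i\<in>UNIV. \<Sum>j\<in>UNIV. matrix_inv (g p) $ i $ j *
        (partial i (partial j \<phi>) p - (\<Sum>k\<in>UNIV. christoffel g p k i j * partial k \<phi> p)))"


section \<open>The Schwarzschild metric\<close>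

text \<open>The chart has coordinates \<open>(v, x)\<close> with \<open>v\<close> the time function
  and \<open>x = r \<omega>\<close> in Euclidean three-space; unlike polar angles it is regular on the whole
  sphere. The point \<open>(v, r, \<omega>)\<close> is \<open>pt v r \<omega>\<close> (for \<open>r > 0\<close> and \<open>norm \<omega> = 1\<close>).\<close>

definition pt :: "real \<Rightarrow> real \<Rightarrow> real^3 \<Rightarrow> real^4" where
  "pt v r \<omega> = vector [v, r * \<omega>$1, r * \<omega>$2, r * \<omega>$3]"

definition rad :: "real^4 \<Rightarrow> real" where
  "rad p = sqrt ((p$2)^2 + (p$3)^2 + (p$4)^2)"

definition region :: "real \<Rightarrow> (real^4) set" where
  "region r0 = {p. p$1 \<ge> 0 \<and> rad p \<ge> r0}"

definition tortoise :: "real \<Rightarrow> real \<Rightarrow> real" where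
  "tortoise M r = r + 2*M * ln (r - 2*M) - 3*M - 2*M * ln M"

text \<open>Components of the covectors \<open>dv\<close> and \<open>dr = (x \<sqdot> dx) / r\<close>, and of
  \<open>r\<^sup>2 d\<omega>\<^sup>2 = dx\<^sup>2 - dr\<^sup>2\<close>.\<close>

definition dv_cov :: "4 \<Rightarrow> real" where
  "dv_cov i = (if i = 1 then 1 else 0)"

definition dr_cov :: "real^4 \<Rightarrow> 4 \<Rightarrow> real" where
  "dr_cov p i = (if i = 1 then 0 else p$i / rad p)"

definition sphere_part :: "real^4 \<Rightarrow> 4 \<Rightarrow> 4 \<Rightarrow> real" where
  "sphere_part p i j = (if i = j \<and> i \<noteq> 1 then 1 else 0) - dr_cov p i * dr_cov p j"

definition schw_metric :: "real \<Rightarrow> (real \<Rightarrow> real) \<Rightarrow> real^4 \<Rightarrow> real^4^4" where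
  "schw_metric M \<mu> p = (\<chi> i j.
     let r = rad p; h = 1 - 2*M/r; m = deriv \<mu> r in
       - h * (dv_cov i * dv_cov j)
       + (1 - h * m) * (dv_cov i * dr_cov p j + dr_cov p i * dv_cov j)
       + (2 * m - h * m^2) * (dr_cov p i * dr_cov p j)
       + sphere_part p i j)"

lemma vector_4_nth [simp]:
  "(vector [a, b, c, d] :: 'a::zero^4) $ 1 = a"
  "(vector [a, b, c, d] :: 'a::zero^4) $ 2 = b"
  "(vector [a, b, c, d] :: 'a::zero^4) $ 3 = c"
  "(vector [a, b, c, d] :: 'a::zero^4) $ 4 = d"
  unfolding vector_def by simp_all

lemma norm_vec3: "(norm (\<omega>::real^3))^2 = (\<omega>$1)^2 + (\<omega>$2)^2 + (\<omega>$3)^2"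
  unfolding power2_norm_eq_inner by (simp add: inner_vec_def sum_3 power2_eq_square)

lemma rad_pt:
  assumes "r \<ge> 0" "norm \<omega> = 1"
  shows "rad (pt v r \<omega>) = r"
proof -
  have "(r * \<omega>$1)^2 + (r * \<omega>$2)^2 + (r * \<omega>$3)^2 = r^2 * (norm \<omega>)^2"
    unfolding norm_vec3 by (simp add: algebra_simps)
  then show ?thesis
    using assms by (simp add: rad_def pt_def)
qed

text \<open>The line element: the squared length of \<open>a \<partial>\<^sub>v + b \<partial>\<^sub>r + \<eta>\<close> with \<open>\<eta>\<close> tangent to the
  unit sphere.\<close>

lemma schw_metric_line_element:
  fixes M r v a b :: real and \<omega> \<eta> :: "real^3"
  assumes r: "r > 0" and \<omega>: "norm \<omega> = 1" and \<eta>: "\<omega> \<bullet> \<eta> = 0"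
  defines "X \<equiv> vector [a, b * \<omega>$1 + r * \<eta>$1, b * \<omega>$2 + r * \<eta>$2, b * \<omega>$3 + r * \<eta>$3] :: real^4"
  shows "X \<bullet> (schw_metric M \<mu> (pt v r \<omega>) *v X) =
           - (1 - 2*M/r) * a^2
           + 2 * (1 - (1 - 2*M/r) * deriv \<mu> r) * a * b
           + (2 * deriv \<mu> r - (1 - 2*M/r) * (deriv \<mu> r)^2) * b^2
           + r^2 * (norm \<eta>)^2"
proof -
  define p where "p = pt v r \<omega>"
  define h where "h = 1 - 2*M/r"
  define m where "m = deriv \<mu> r"
  have rp: "rad p = r" using r \<omega> by (simp add: p_def rad_pt)
  have one: "(\<omega>$1)^2 + (\<omega>$2)^2 + (\<omega>$3)^2 = 1" using \<omega> norm_vec3[of \<omega>] by simp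
  have orth: "\<omega>$1 * \<eta>$1 + \<omega>$2 * \<eta>$2 + \<omega>$3 * \<eta>$3 = 0"
    using \<eta> by (simp add: inner_vec_def sum_3)
  have dr: "dr_cov p 1 = 0" "dr_cov p 2 = \<omega>$1" "dr_cov p 3 = \<omega>$2" "dr_cov p 4 = \<omega>$3"
    using r unfolding dr_cov_def rp by (simp_all add: p_def pt_def)
  have drX: "(\<Sum>i\<in>UNIV. dr_cov p i * X$i) = b"
  proof -
    have "(\<Sum>i\<in>UNIV. dr_cov p i * X$i)
        = b * ((\<omega>$1)^2 + (\<omega>$2)^2 + (\<omega>$3)^2) + r * (\<omega>$1 * \<eta>$1 + \<omega>$2 * \<eta>$2 + \<omega>$3 * \<eta>$3)"
      unfolding sum_4 dr X_def vector_4_nth by algebra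
    then show ?thesis by (simp add: one orth)
  qed
  have dvX: "(\<Sum>i\<in>UNIV. dv_cov i * X$i) = a"
    by (simp add: sum_4 dv_cov_def X_def)
  have sp: "(X$2)^2 + (X$3)^2 + (X$4)^2 = b^2 + r^2 * (norm \<eta>)^2"
  proof -
    have "(X$2)^2 + (X$3)^2 + (X$4)^2
        = b^2 * ((\<omega>$1)^2 + (\<omega>$2)^2 + (\<omega>$3)^2) + 2 * b * r * (\<omega>$1 * \<eta>$1 + \<omega>$2 * \<eta>$2 + \<omega>$3 * \<eta>$3)
          + r^2 * ((\<eta>$1)^2 + (\<eta>$2)^2 + (\<eta>$3)^2)"
      unfolding X_def vector_4_nth by algebra
    then show ?thesis by (simp add: one orth norm_vec3)
  qed
  have "X \<bullet> (schw_metric M \<mu> p *v X) =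
      - h * (\<Sum>i\<in>UNIV. dv_cov i * X$i)^2
      + 2 * (1 - h * m) * (\<Sum>i\<in>UNIV. dv_cov i * X$i) * (\<Sum>i\<in>UNIV. dr_cov p i * X$i)
      + (2 * m - h * m^2) * (\<Sum>i\<in>UNIV. dr_cov p i * X$i)^2
      + ((X$2)^2 + (X$3)^2 + (X$4)^2 - (\<Sum>i\<in>UNIV. dr_cov p i * X$i)^2)"
    unfolding schw_metric_def Let_def rp h_def[symmetric] m_def[symmetric] inner_vec_def
      matrix_vector_mult_def sphere_part_def
    by (simp add: sum_4 dr dv_cov_def) algebra
  then have "X \<bullet> (schw_metric M \<mu> p *v X) =
      - h * a^2 + 2 * (1 - h * m) * a * b + (2 * m - h * m^2) * b^2 + r^2 * (norm \<eta>)^2"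
    unfolding drX dvX sp by simp
  then show ?thesis
    unfolding p_def h_def m_def .
qed


section \<open>Energies and local energy norms\<close>

text \<open>Surface measure \<open>d\<omega> = sin \<theta> d\<theta> d\<psi>\<close> on the unit sphere of three-space.\<close>

definition sph :: "real \<times> real \<Rightarrow> real^3" where
  "sph = (\<lambda>(\<theta>, \<psi>). vector [sin \<theta> * cos \<psi>, sin \<theta> * sin \<psi>, cos \<theta>])"

definition sphere_measure :: "(real^3) measure" where
  "sphere_measure =
     distr (density lborel
       (\<lambda>(\<theta>, \<psi>). ennreal (sin \<theta>) * indicator ({0..pi} \<times> {0..2*pi}) (\<theta>, \<psi>))) borel sph"

lemma continuous_on_sph: "continuous_on UNIV sph"
proof -
  have nth: "sph x $ 1 = sin (fst x) * cos (snd x)" "sph x $ 2 = sin (fst x) * sin (snd x)"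
    "sph x $ 3 = cos (fst x)" for x
    by (simp_all add: sph_def case_prod_beta)
  have "continuous_on UNIV (\<lambda>x. sph x $ 1)" "continuous_on UNIV (\<lambda>x. sph x $ 2)"
    "continuous_on UNIV (\<lambda>x. sph x $ 3)"
    unfolding nth by (intro continuous_intros)+
  then have "continuous_on UNIV (\<lambda>x. sph x $ i)" for i
    using exhaust_3[of i] by auto
  then have "continuous_on UNIV (\<lambda>x. \<chi> i. sph x $ i)"
    by (intro continuous_on_vec_lambda)
  then show ?thesis by simp
qed

lemma nn_integral_sphere_measure:
  assumes [measurable]: "F \<in> borel_measurable borel"
  shows "(\<integral>\<^sup>+\<omega>. F \<omega> \<partial>sphere_measure) =
         (\<integral>\<^sup>+\<theta>\<in>{0..pi}. (\<integral>\<^sup>+\<psi>\<in>{0..2*pi}. ennreal (sin \<theta>) * F (sph (\<theta>, \<psi>)) \<partial>lborel) \<partial>lborel)"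
proof -
  have [measurable]: "sph \<in> borel_measurable (borel :: (real \<times> real) measure)"
    by (rule borel_measurable_continuous_onI[OF continuous_on_sph])
  have [measurable]: "sph \<in> measurable (borel \<Otimes>\<^sub>M borel) borel"
    by (simp add: borel_prod)
  have [measurable]: "(\<lambda>(\<theta>, \<psi>). ennreal (sin \<theta>) * indicator ({0..pi} \<times> {0..2*pi}) (\<theta>, \<psi>))
      \<in> borel_measurable (borel :: (real \<times> real) measure)"
    unfolding borel_prod[symmetric] by measurable
  have "(\<integral>\<^sup>+\<omega>. F \<omega> \<partial>sphere_measure) =
      (\<integral>\<^sup>+x. (case x of (\<theta>, \<psi>) \<Rightarrow> ennreal (sin \<theta>) * indicator ({0..pi} \<times> {0..2*pi}) (\<theta>, \<psi>))
         * F (sph x) \<partial>(lborel \<Otimes>\<^sub>M lborel))"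
    unfolding sphere_measure_def lborel_prod
    by (subst nn_integral_distr) (auto simp: nn_integral_density)
  also have "\<dots> = (\<integral>\<^sup>+\<theta>. \<integral>\<^sup>+\<psi>. ennreal (sin \<theta>) * indicator ({0..pi} \<times> {0..2*pi}) (\<theta>, \<psi>)
         * F (sph (\<theta>, \<psi>)) \<partial>lborel \<partial>lborel)"
    by (subst lborel.nn_integral_fst[symmetric]) (auto simp: case_prod_beta)
  also have "\<dots> = (\<integral>\<^sup>+\<theta>\<in>{0..pi}. (\<integral>\<^sup>+\<psi>\<in>{0..2*pi}. ennreal (sin \<theta>) * F (sph (\<theta>, \<psi>)) \<partial>lborel) \<partial>lborel)"
    by (intro nn_integral_cong) (auto simp: indicator_def intro!: nn_integral_cong)
  finally show ?thesis .
qed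

text \<open>\<open>\<bar>\<nabla>\<^bsub>S\<^sup>2\<^esub> F\<bar>\<^sup>2\<close>: the gradient of a function on the unit sphere is the Euclidean gradient
  of its extension that is constant along rays (\<open>sgn y = y / norm y\<close>).\<close>

definition sphere_grad_sq :: "(real^3 \<Rightarrow> real) \<Rightarrow> real^3 \<Rightarrow> real" where
  "sphere_grad_sq F \<omega> = (\<Sum>i\<in>UNIV. (partial i (\<lambda>y. F (sgn y)) \<omega>)^2)"

definition d_v :: "(real^4 \<Rightarrow> real) \<Rightarrow> real \<Rightarrow> real \<Rightarrow> real^3 \<Rightarrow> real" where
  "d_v \<phi> v r \<omega> = deriv (\<lambda>s. \<phi> (pt s r \<omega>)) v"

definition d_r :: "(real^4 \<Rightarrow> real) \<Rightarrow> real \<Rightarrow> real \<Rightarrow> real^3 \<Rightarrow> real" where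
  "d_r \<phi> v r \<omega> = deriv (\<lambda>s. \<phi> (pt v s \<omega>)) r"

definition ang_sq :: "(real^4 \<Rightarrow> real) \<Rightarrow> real \<Rightarrow> real \<Rightarrow> real^3 \<Rightarrow> real" where
  "ang_sq \<phi> v r \<omega> = sphere_grad_sq (\<lambda>y. \<phi> (pt v r y)) \<omega> / r^2"

definition energy_density :: "(real^4 \<Rightarrow> real) \<Rightarrow> real \<Rightarrow> real \<Rightarrow> real^3 \<Rightarrow> real" where
  "energy_density \<phi> v r \<omega> = (d_r \<phi> v r \<omega>)^2 + (d_v \<phi> v r \<omega>)^2 + ang_sq \<phi> v r \<omega>"

definition energy :: "real \<Rightarrow> (real^4 \<Rightarrow> real) \<Rightarrow> real \<Rightarrow> ennreal" where
  "energy r0 \<phi> v =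
     (\<integral>\<^sup>+r\<in>{r0..}. (\<integral>\<^sup>+\<omega>. ennreal (energy_density \<phi> v r \<omega> * r^2) \<partial>sphere_measure) \<partial>lborel)"

definition energy_minus :: "real \<Rightarrow> (real^4 \<Rightarrow> real) \<Rightarrow> ennreal" where
  "energy_minus r0 \<phi> = energy r0 \<phi> 0"

definition energy_plus :: "real \<Rightarrow> (real^4 \<Rightarrow> real) \<Rightarrow> ennreal" where
  "energy_plus r0 \<phi> =
     (\<integral>\<^sup>+v\<in>{0..}. (\<integral>\<^sup>+\<omega>. ennreal (energy_density \<phi> v r0 \<omega> * r0^2) \<partial>sphere_measure) \<partial>lborel)"

definition LE0_norm_sq :: "real \<Rightarrow> real \<Rightarrow> (real^4 \<Rightarrow> real) \<Rightarrow> ennreal" where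
  "LE0_norm_sq M r0 \<phi> =
     (\<integral>\<^sup>+v\<in>{0..}. (\<integral>\<^sup>+r\<in>{r0..}. (\<integral>\<^sup>+\<omega>. ennreal (
          ( (d_r \<phi> v r \<omega>)^2 / r^2
          + (1 - 3*M/r)^2 * ((d_v \<phi> v r \<omega>)^2 / r^2 + ang_sq \<phi> v r \<omega> / r)
          + (\<phi> (pt v r \<omega>))^2 / r^4) * r^2)
        \<partial>sphere_measure) \<partial>lborel) \<partial>lborel)"

text \<open>At \<open>r = 3 M\<close> the weight evaluates to \<open>0\<close> instead of infinity; this set is null.\<close>

definition LE0_dual_norm_sq :: "real \<Rightarrow> real \<Rightarrow> (real^4 \<Rightarrow> real) \<Rightarrow> ennreal" where
  "LE0_dual_norm_sq M r0 f =
     (\<integral>\<^sup>+v\<in>{0..}. (\<integral>\<^sup>+r\<in>{r0..}. (\<integral>\<^sup>+\<omega>. ennreal (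
          inverse ((1 - 3*M/r)^2) * r^2 * (f (pt v r \<omega>))^2 * r^2)
        \<partial>sphere_measure) \<partial>lborel) \<partial>lborel)"

end

theory Submission
  imports Defs
begin

text \<open>The solution is tested against a first order multiplier \<open>Y L - B P + q \<phi>\<close> in a null frame
  \<open>L = \<partial>\<^sub>r - \<mu>' \<partial>\<^sub>v\<close>, \<open>P = \<partial>\<^sub>v + (1 - 2M/r) L / 2\<close>, and the resulting divergence identity is averaged over the
  sphere. Outside a radius slightly inside the event horizon the multiplier is the Morawetz field
  \<open>(1 - 3M/r) (1 + 2M/r)\<close> with lower order corrections, plus a small red-shift term, plus a large multiple of the
  Killing field; the zeroth order terms on a time slice are absorbed by a Hardy inequality. From there down to
  \<open>r = r\<^sub>0\<close> the radius is a time function, and an exponential weight in \<open>r\<close> suffices. Since the solution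
  is only assumed to vanish pointwise at infinity, the identities are cut off along \<open>v + \<mu>(r)\<close>, whose level sets
  are null in the far region, and a crude energy bound removes the cut-off in the limit.\<close>

section \<open>The wave operator in the chart\<close>

text \<open>In w = v + \<mu>(r) the metric is - (1 - 2M/r) dw^2 + 2 dw dr + r^2 d\<omega>^2, so
  \<mu> only selects slices: L is the r-derivative at fixed w, and \<mu>' enters the slice densities
  but neither the bulk nor the flux through r = const. Two places resist. At r = 3M trapping makes
  the angular and the time derivative part of the bulk vanish to second order, while the Killing
  part of the multiplier does not vanish; hence the inverse weight on the source. At the horizon the
  Killing energy loses the L direction, so what it has to absorb must carry a factor 1 - 2M/r or be
  left to the small red-shift term: \<open>pq\<close> vanishes at r = 2M, and the Hardy weight is
  anchored at the inner radius. The bare Morawetz choice has a negative zeroth order bulk term below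
  about r = 2.8 M; adding the divergence of multiples of \<phi>^2 repairs it at the price of a cross
  term. All constants come from inequalities between real numbers in which the frame derivatives are
  free variables, so they are fixed before a solution is.\<close>

lemma matrix_inv_eqI:
  fixes A B :: "real^'n^'n"
  assumes "A ** B = mat 1" "B ** A = mat 1"
  shows "matrix_inv A = B"
proof -
  have "A ** matrix_inv A = mat 1 \<and> matrix_inv A ** A = mat 1"
    unfolding matrix_inv_def by (rule someI[of _ B]) (use assms in auto)
  then show ?thesis
    by (metis assms(2) matrix_mul_assoc matrix_mul_lid matrix_mul_rid)
qed

lemma partial_eqI:
  assumes "(F has_derivative F') (at p)"
  shows "partial i F p = F' (axis i 1)"
  unfolding partial_def using frechet_derivative_at[OF assms] by simp

lemma dr_cov_norm:
  assumes "rad p > 0"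
  shows "(dr_cov p 2)\<^sup>2 + (dr_cov p 3)\<^sup>2 + (dr_cov p 4)\<^sup>2 = 1"
proof -
  have "(p$2)\<^sup>2 + (p$3)\<^sup>2 + (p$4)\<^sup>2 = (rad p)\<^sup>2"
    unfolding rad_def by simp
  then show ?thesis
    using assms by (simp add: dr_cov_def power_divide add_divide_distrib[symmetric])
qed

definition lapse :: "real \<Rightarrow> real \<Rightarrow> real" where
  "lapse M r = 1 - 2*M/r"

text \<open>In the time and radial directions the metric is a two by two block of determinant -1, so
  inversion swaps the diagonal entries with a change of sign and keeps the mixed one. The space part
  of the chart is Euclidean, so \<open>dr_cov\<close> serves both as covector and as vector.\<close>

definition schw_inv :: "real \<Rightarrow> (real \<Rightarrow> real) \<Rightarrow> real^4 \<Rightarrow> real^4^4" where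
  "schw_inv M \<mu> p = (\<chi> i j.
     let h = lapse M (rad p); m = deriv \<mu> (rad p) in
       - (2 * m - h * m^2) * (dv_cov i * dv_cov j)
       + (1 - h * m) * (dv_cov i * dr_cov p j + dr_cov p i * dv_cov j)
       + h * (dr_cov p i * dr_cov p j)
       + sphere_part p i j)"

lemma matrix_inv_schw:
  assumes "rad p > 0"
  shows "matrix_inv (schw_metric M \<mu> p) = schw_inv M \<mu> p"
proof (rule matrix_inv_eqI)
  define h where "h = lapse M (rad p)"
  define m where "m = deriv \<mu> (rad p)"
  define a where "a = dr_cov p 2"
  define b where "b = dr_cov p 3"
  define c where "c = dr_cov p 4"
  have one: "a\<^sup>2 + b\<^sup>2 + c\<^sup>2 = 1"
    using dr_cov_norm[OF assms] by (simp add: a_def b_def c_def)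
  have d1: "dr_cov p 1 = 0" by (simp add: dr_cov_def)
  note defs = schw_metric_def schw_inv_def Let_def sphere_part_def dv_cov_def
    h_def[symmetric, unfolded lapse_def] h_def[symmetric] m_def[symmetric]
    a_def[symmetric] b_def[symmetric] c_def[symmetric] d1
  show "schw_metric M \<mu> p ** schw_inv M \<mu> p = mat 1"
    unfolding vec_eq_iff matrix_matrix_mult_def mat_def forall_4 sum_4
    apply (simp add: defs)
    apply (intro conjI)
    using one by algebra+
  show "schw_inv M \<mu> p ** schw_metric M \<mu> p = mat 1"
    unfolding vec_eq_iff matrix_matrix_mult_def mat_def forall_4 sum_4
    apply (simp add: defs)
    apply (intro conjI)
    using one by algebra+
qed

lemma rad_has_derivative:
  assumes "rad p > 0"
  shows "(rad has_derivative (\<lambda>d. \<Sum>l\<in>UNIV. dr_cov p l * d$l)) (at p)"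
proof -
  have pos: "(p$2)^2 + (p$3)^2 + (p$4)^2 > 0"
    using assms unfolding rad_def by simp
  have "((\<lambda>q. sqrt ((q$2)^2 + (q$3)^2 + (q$4)^2)) has_derivative
     (\<lambda>d. \<Sum>l\<in>UNIV. dr_cov p l * d$l)) (at p)"
    using pos
    by (auto intro!: derivative_eq_intros bounded_linear.has_derivative[OF bounded_linear_vec_nth]
        simp: fun_eq_iff sum_4 dr_cov_def rad_def field_simps)
  then show ?thesis by (simp add: rad_def[abs_def])
qed

lemma dr_cov_has_derivative:
  assumes "rad p > 0"
  shows "((\<lambda>q. dr_cov q i) has_derivative
    (\<lambda>d. ((if i = 1 then 0 else d$i) - dr_cov p i * (\<Sum>l\<in>UNIV. dr_cov p l * d$l)) / rad p)) (at p)"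
proof (cases "i = 1")
  case True
  then show ?thesis by (simp add: dr_cov_def)
next
  case False
  have "((\<lambda>q. q$i / rad q) has_derivative
    (\<lambda>d. (d$i - dr_cov p i * (\<Sum>l\<in>UNIV. dr_cov p l * d$l)) / rad p)) (at p)"
    by (rule derivative_eq_intros rad_has_derivative[OF assms] refl
          bounded_linear.has_derivative[OF bounded_linear_vec_nth])+
      (use assms False in \<open>auto simp: fun_eq_iff dr_cov_def field_simps\<close>)
  then show ?thesis using False by (simp add: dr_cov_def)
qed

lemma lapse_has_real_derivative:
  "r \<noteq> 0 \<Longrightarrow> (lapse M has_real_derivative 2*M/r\<^sup>2) (at r)"
  unfolding lapse_def[abs_def]
  by (auto intro!: derivative_eq_intros simp: power2_eq_square)

lemma has_derivative_comp_rad: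
  assumes "rad p > 0" "(F has_real_derivative F') (at (rad p))"
  shows "((\<lambda>q. F (rad q)) has_derivative (\<lambda>d. F' * (\<Sum>l\<in>UNIV. dr_cov p l * d$l))) (at p)"
  using has_derivative_compose[OF rad_has_derivative[OF assms(1)]
      assms(2)[unfolded has_field_derivative_def]] by simp

lemma partial_schw_metric:
  fixes M :: real
  assumes "rad p > 0" and mu: "(deriv \<mu> has_real_derivative m') (at (rad p))"
  defines "h \<equiv> lapse M (rad p)" and "m \<equiv> deriv \<mu> (rad p)" and "h' \<equiv> 2*M/(rad p)\<^sup>2"
  shows "partial l (\<lambda>q. schw_metric M \<mu> q $ i $ j) p =
     dr_cov p l * (- h' * (dv_cov i * dv_cov j)
       - (h' * m + h * m') * (dv_cov i * dr_cov p j + dr_cov p i * dv_cov j)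
       + (2 * m' - h' * m^2 - 2 * h * m * m') * (dr_cov p i * dr_cov p j))
     + (1 - h * m) * (dv_cov i * sphere_part p j l + sphere_part p i l * dv_cov j) / rad p
     + (2 * m - h * m^2 - 1) * (sphere_part p i l * dr_cov p j + dr_cov p i * sphere_part p j l) / rad p"
proof -
  note D = has_derivative_comp_rad[OF assms(1) lapse_has_real_derivative, of M]
    has_derivative_comp_rad[OF assms(1) mu] dr_cov_has_derivative[OF assms(1)]
  have r: "rad p \<noteq> 0" using assms by simp
  define SL where "SL = (\<Sum>k\<in>UNIV. dr_cov p k * (axis l 1 :: real^4) $ k)"
  have sum: "SL = dr_cov p l"
    unfolding SL_def by (simp add: axis_def if_distrib sum.delta cong: if_cong)
  have ax: "(if i = 1 then 0 else (axis l 1 :: real^4) $ i) = sphere_part p i l + dr_cov p i * dr_cov p l" for i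
    by (auto simp: sphere_part_def axis_def dr_cov_def)
  have e: "(\<lambda>q. schw_metric M \<mu> q $ i $ j) = (\<lambda>q.
       - lapse M (rad q) * (dv_cov i * dv_cov j)
       + (1 - lapse M (rad q) * deriv \<mu> (rad q)) * (dv_cov i * dr_cov q j + dr_cov q i * dv_cov j)
       + (2 * deriv \<mu> (rad q) - lapse M (rad q) * (deriv \<mu> (rad q))^2) * (dr_cov q i * dr_cov q j)
       + ((if i = j \<and> i \<noteq> 1 then 1 else 0) - dr_cov q i * dr_cov q j))"
    by (simp only: schw_metric_def Let_def lapse_def sphere_part_def vec_lambda_beta)
  show ?thesis
    unfolding e
    apply (subst partial_eqI)
     apply (rule derivative_eq_intros D refl r)+
    unfolding SL_def[symmetric] sum ax h_def[symmetric] m_def[symmetric] h'_def[symmetric]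
    using r by (simp add: field_simps power2_eq_square)
qed

text \<open>This is twice the contraction of the Christoffel symbols of the first kind with the
  inverse metric. Contracting before the last index is raised leaves only four cases, one for each
  component \<open>l\<close>.\<close>

lemma contracted_christoffel_cov:
  fixes M :: real
  assumes pos: "rad p > 0" and mu: "(deriv \<mu> has_real_derivative m') (at (rad p))"
  defines "h \<equiv> lapse M (rad p)" and "m \<equiv> deriv \<mu> (rad p)" and "h' \<equiv> 2*M/(rad p)\<^sup>2" and "g \<equiv> schw_metric M \<mu>"
  shows "(\<Sum>i\<in>UNIV. \<Sum>j\<in>UNIV. schw_inv M \<mu> p $ i $ j *
      (partial i (\<lambda>q. g q $ j $ l) p + partial j (\<lambda>q. g q $ i $ l) p - partial l (\<lambda>q. g q $ i $ j) p)) =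
    2 * ( (h' * m + h * m' - 2 * (1 - h * m) / rad p) * (- h * dv_cov l + (1 - h * m) * dr_cov p l)
     - (h' + 2 * (h - 1) / rad p) * ((1 - h * m) * dv_cov l + (2 * m - h * m^2) * dr_cov p l))"
proof -
  define a where "a = dr_cov p 2"
  define b where "b = dr_cov p 3"
  define c where "c = dr_cov p 4"
  have one: "a\<^sup>2 + b\<^sup>2 + c\<^sup>2 = 1"
    using dr_cov_norm[OF pos] by (simp add: a_def b_def c_def)
  \<comment> \<open>Used as a rewrite rule, the sphere relation eliminates squares of
    \<open>a\<close> and brings each component into a normal form.\<close>
  have "a * a = 1 - b * b - c * c"
    using one by (simp add: power2_eq_square)
  then have aa: "a * a = 1 - b * b - c * c" "a * (a * x) = x - b * (b * x) - c * (c * x)" for x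
    by (simp, metis left_diff_distrib mult.assoc mult_1)
  have d1: "dr_cov p 1 = 0" by (simp add: dr_cov_def)
  define \<rho> where "\<rho> = 1 / rad p"
  have div: "x / rad p = x * \<rho>" for x by (simp add: \<rho>_def)
  note defs = schw_inv_def Let_def sphere_part_def dv_cov_def h_def[symmetric] m_def[symmetric]
    a_def[symmetric] b_def[symmetric] c_def[symmetric] d1 div
  have "l = 1 \<or> l = 2 \<or> l = 3 \<or> l = 4" using exhaust_4 by blast
  then show ?thesis
    unfolding g_def partial_schw_metric[OF pos mu] h_def[symmetric] m_def[symmetric] h'_def[symmetric] div
    apply (elim disjE)
    subgoal by (simp add: defs sum_4) (simp add: aa algebra_simps power2_eq_square)
    subgoal by (simp add: defs sum_4) (simp add: aa algebra_simps power2_eq_square)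
    subgoal by (simp add: defs sum_4) (simp add: aa algebra_simps power2_eq_square)
    subgoal by (simp add: defs sum_4) (simp add: aa algebra_simps power2_eq_square)
    done
qed

text \<open>The metric has determinant -1 in this chart, so the operator is the divergence of
  \<open>schw_inv\<close> applied to the gradient: the first order coefficients are the divergences
  of the columns of \<open>schw_inv\<close>. The proof obtains them from the contracted Christoffel
  symbols.\<close>

lemma dalembertian_schw:
  fixes M :: real
  assumes pos: "rad p > 0" and mu: "(deriv \<mu> has_real_derivative m') (at (rad p))"
  defines "h \<equiv> lapse M (rad p)" and "m \<equiv> deriv \<mu> (rad p)" and "h' \<equiv> 2*M/(rad p)\<^sup>2"
  shows "dalembertian (schw_metric M \<mu>) \<phi> p =
     (\<Sum>i\<in>UNIV. \<Sum>j\<in>UNIV. schw_inv M \<mu> p $ i $ j * partial i (partial j \<phi>) p)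
     + (2 * (1 - h * m) / rad p - (h' * m + h * m')) * partial 1 \<phi> p
     + (h' + 2 * (h - 1) / rad p) * (\<Sum>k\<in>UNIV. dr_cov p k * partial k \<phi> p)"
proof -
  define g where "g = schw_metric M \<mu>"
  define G where "G = schw_inv M \<mu> p"
  define C where "C l = (h' * m + h * m' - 2 * (1 - h * m) / rad p) * (- h * dv_cov l + (1 - h * m) * dr_cov p l)
     - (h' + 2 * (h - 1) / rad p) * ((1 - h * m) * dv_cov l + (2 * m - h * m^2) * dr_cov p l)" for l
  define T where "T i j l = partial i (\<lambda>q. g q $ j $ l) p + partial j (\<lambda>q. g q $ i $ l) p - partial l (\<lambda>q. g q $ i $ j) p" for i j l
  have inv: "matrix_inv (g p) = G" unfolding g_def G_def by (rule matrix_inv_schw[OF pos])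
  have C: "(\<Sum>i\<in>UNIV. \<Sum>j\<in>UNIV. G $ i $ j * T i j l) = 2 * C l" for l
    unfolding T_def G_def g_def C_def h_def m_def h'_def by (rule contracted_christoffel_cov[OF pos mu])
  have chr: "christoffel g p k i j = (\<Sum>l\<in>UNIV. G $ k $ l * T i j l) / 2" for k i j
    unfolding christoffel_def inv T_def ..
  have "(\<Sum>i\<in>UNIV. \<Sum>j\<in>UNIV. G $ i $ j * (\<Sum>k\<in>UNIV. christoffel g p k i j * partial k \<phi> p))
      = (\<Sum>i\<in>UNIV. \<Sum>j\<in>UNIV. \<Sum>k\<in>UNIV. \<Sum>l\<in>UNIV. G $ i $ j * (G $ k $ l * T i j l / 2 * partial k \<phi> p))"
    unfolding chr by (simp add: sum_distrib_left sum_distrib_right sum_divide_distrib)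
  also have "\<dots> = (\<Sum>k\<in>UNIV. \<Sum>l\<in>UNIV. \<Sum>i\<in>UNIV. \<Sum>j\<in>UNIV. G $ i $ j * (G $ k $ l * T i j l / 2 * partial k \<phi> p))"
    unfolding sum_4 by (simp only: add_ac)
  also have "\<dots> = (\<Sum>k\<in>UNIV. \<Sum>l\<in>UNIV. (\<Sum>i\<in>UNIV. \<Sum>j\<in>UNIV. G $ i $ j * T i j l) * (G $ k $ l / 2 * partial k \<phi> p))"
    by (simp add: sum_distrib_left sum_distrib_right mult_ac sum_divide_distrib)
  also have "\<dots> = (\<Sum>k\<in>UNIV. (\<Sum>l\<in>UNIV. G $ k $ l * C l) * partial k \<phi> p)"
    unfolding C by (simp add: sum_distrib_left sum_distrib_right mult_ac)
  also have "\<dots> = (\<Sum>k\<in>UNIV. ((h' * m + h * m' - 2 * (1 - h * m) / rad p) * dv_cov k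
      - (h' + 2 * (h - 1) / rad p) * dr_cov p k) * partial k \<phi> p)"
  proof (rule sum.cong[OF refl])
    fix k :: 4
    define a where "a = dr_cov p 2"
    define b where "b = dr_cov p 3"
    define c where "c = dr_cov p 4"
    have one: "a\<^sup>2 + b\<^sup>2 + c\<^sup>2 = 1"
      using dr_cov_norm[OF pos] by (simp add: a_def b_def c_def)
    then have "a * a = 1 - b * b - c * c" by (simp add: power2_eq_square)
    then have aa: "a * a = 1 - b * b - c * c" "a * (a * x) = x - b * (b * x) - c * (c * x)" for x
      by (simp, metis left_diff_distrib mult.assoc mult_1)
    have d1: "dr_cov p 1 = 0" by (simp add: dr_cov_def)
    define \<rho> where "\<rho> = 1 / rad p"
    have div: "x / rad p = x * \<rho>" for x by (simp add: \<rho>_def)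
    note defs = schw_inv_def Let_def sphere_part_def dv_cov_def h_def[symmetric] m_def[symmetric]
      a_def[symmetric] b_def[symmetric] c_def[symmetric] d1 div
    have "k = 1 \<or> k = 2 \<or> k = 3 \<or> k = 4" using exhaust_4 by blast
    then have "(\<Sum>l\<in>UNIV. G $ k $ l * C l) = (h' * m + h * m' - 2 * (1 - h * m) / rad p) * dv_cov k
      - (h' + 2 * (h - 1) / rad p) * dr_cov p k"
      unfolding G_def C_def div
      apply (elim disjE)
      subgoal by (simp add: defs sum_4) (simp add: aa algebra_simps power2_eq_square)
      subgoal by (simp add: defs sum_4) (simp add: aa algebra_simps power2_eq_square)
      subgoal by (simp add: defs sum_4) (simp add: aa algebra_simps power2_eq_square)
      subgoal by (simp add: defs sum_4) (simp add: aa algebra_simps power2_eq_square)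
      done
    then show "(\<Sum>l\<in>UNIV. G $ k $ l * C l) * partial k \<phi> p = ((h' * m + h * m' - 2 * (1 - h * m) / rad p) * dv_cov k
      - (h' + 2 * (h - 1) / rad p) * dr_cov p k) * partial k \<phi> p" by simp
  qed
  also have "\<dots> = (h' * m + h * m' - 2 * (1 - h * m) / rad p) * partial 1 \<phi> p
      - (h' + 2 * (h - 1) / rad p) * (\<Sum>k\<in>UNIV. dr_cov p k * partial k \<phi> p)"
    by (simp add: sum_4 dv_cov_def algebra_simps)
  finally have *: "(\<Sum>i\<in>UNIV. \<Sum>j\<in>UNIV. G $ i $ j * (\<Sum>k\<in>UNIV. christoffel g p k i j * partial k \<phi> p)) = \<dots>" .
  have "dalembertian g \<phi> p = (\<Sum>i\<in>UNIV. \<Sum>j\<in>UNIV. G $ i $ j * partial i (partial j \<phi>) p)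
     - (\<Sum>i\<in>UNIV. \<Sum>j\<in>UNIV. G $ i $ j * (\<Sum>k\<in>UNIV. christoffel g p k i j * partial k \<phi> p))"
    unfolding dalembertian_def inv by (simp add: right_diff_distrib sum_subtractf)
  then show ?thesis
    unfolding * by (simp add: g_def G_def algebra_simps)
qed

section \<open>Derivatives along curves and symmetry of second partial derivatives\<close>

lemma has_derivative_partials:
  fixes F :: "real^'n::finite \<Rightarrow> real"
  assumes "F differentiable (at p)"
  shows "(F has_derivative (\<lambda>d. \<Sum>i\<in>UNIV. d$i * partial i F p)) (at p)"
proof -
  have D: "(F has_derivative frechet_derivative F (at p)) (at p)"
    using assms frechet_derivative_works by blast
  then have lin: "linear (frechet_derivative F (at p))"
    by (rule has_derivative_linear)
  have "frechet_derivative F (at p) d = (\<Sum>i\<in>UNIV. d$i * partial i F p)" for d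
  proof -
    have "frechet_derivative F (at p) (\<Sum>i\<in>UNIV. d$i *s axis i 1) = (\<Sum>i\<in>UNIV. d$i * partial i F p)"
      by (simp add: linear_sum[OF lin] partial_def linear_cmul[OF lin] scalar_mult_eq_scaleR)
    then show ?thesis by (simp add: basis_expansion)
  qed
  then have "frechet_derivative F (at p) = (\<lambda>d. \<Sum>i\<in>UNIV. d$i * partial i F p)"
    by (intro ext)
  with D show ?thesis by simp
qed

lemma has_derivative_along_curve:
  fixes F :: "real^'n::finite \<Rightarrow> real" and c :: "real \<Rightarrow> real^'n"
  assumes F: "F differentiable (at (c s))" and c: "(c has_vector_derivative d) (at s)"
  shows "((\<lambda>s. F (c s)) has_real_derivative (\<Sum>i\<in>UNIV. d$i * partial i F (c s))) (at s)"
proof -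
  have "((\<lambda>s. F (c s)) has_derivative (\<lambda>x. \<Sum>i\<in>UNIV. (x *\<^sub>R d)$i * partial i F (c s))) (at s)"
    by (rule has_derivative_compose[OF c[unfolded has_vector_derivative_def] has_derivative_partials[OF F]])
  then show ?thesis
    by (simp add: has_field_derivative_def sum_distrib_left mult_ac)
       (rule back_subst[of "\<lambda>d. ((\<lambda>s. F (c s)) has_derivative d) (at s)"], assumption, auto simp: sum_distrib_left mult_ac)
qed

text \<open>The mean value theorem is applied in direction \<open>i\<close> to the difference of two
  parallel segments, then in direction \<open>j\<close> to \<open>partial i F\<close>.\<close>

lemma second_difference_mvt:
  fixes F :: "real^'n::finite \<Rightarrow> real"
  assumes C2: "C2_on U F" and t: "t > 0"
    and U: "\<And>a b. 0 \<le> a \<Longrightarrow> a \<le> t \<Longrightarrow> 0 \<le> b \<Longrightarrow> b \<le> t \<Longrightarrow> p + a *\<^sub>R axis i 1 + b *\<^sub>R axis j 1 \<in> U"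
  shows "\<exists>a b. 0 \<le> a \<and> a \<le> t \<and> 0 \<le> b \<and> b \<le> t \<and>
    F (p + t *\<^sub>R axis i 1 + t *\<^sub>R axis j 1) - F (p + t *\<^sub>R axis i 1) - F (p + t *\<^sub>R axis j 1) + F p
    = t * t * partial j (partial i F) (p + a *\<^sub>R axis i 1 + b *\<^sub>R axis j 1)"
proof -
  let ?q = "\<lambda>a b. p + a *\<^sub>R axis i 1 + b *\<^sub>R axis j (1::real)"
  have ax: "(\<Sum>k\<in>UNIV. (axis i (1::real)) $ k * X k) = X i" for i :: 'n and X
    by (simp add: axis_def if_distrib[of "\<lambda>x. x * _"] cong: if_cong)
  have F: "F differentiable (at (?q a b))" "partial i F differentiable (at (?q a b))"
    if "0 \<le> a" "a \<le> t" "0 \<le> b" "b \<le> t" for a b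
    using C2 U[OF that] unfolding C2_on_def by auto
  have di: "((\<lambda>a. F (?q a b)) has_real_derivative partial i F (?q a b)) (at a)"
    if "0 \<le> a" "a \<le> t" "0 \<le> b" "b \<le> t" for a b
  proof -
    have "((\<lambda>a. ?q a b) has_vector_derivative axis i 1) (at a)"
      unfolding has_vector_derivative_def by (auto intro!: derivative_eq_intros)
    from has_derivative_along_curve[OF F(1)[OF that] this] show ?thesis by (simp add: ax)
  qed
  have dj: "((\<lambda>b. partial i F (?q a b)) has_real_derivative partial j (partial i F) (?q a b)) (at b)"
    if "0 \<le> a" "a \<le> t" "0 \<le> b" "b \<le> t" for a b
  proof -
    have "((\<lambda>b. ?q a b) has_vector_derivative axis j 1) (at b)"
      unfolding has_vector_derivative_def by (auto intro!: derivative_eq_intros)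
    from has_derivative_along_curve[OF F(2)[OF that] this] show ?thesis by (simp add: ax)
  qed
  have "\<exists>a. a > 0 \<and> a < t \<and> (\<lambda>a. F (?q a t) - F (?q a 0)) t - (\<lambda>a. F (?q a t) - F (?q a 0)) 0
      = (t - 0) * (partial i F (?q a t) - partial i F (?q a 0))"
    by (rule MVT2[OF t]) (use t di[where b = 0] in \<open>auto intro!: derivative_eq_intros di\<close>)
  then obtain a where a: "0 < a" "a < t"
    "F (?q t t) - F (?q t 0) - (F (?q 0 t) - F (?q 0 0)) = t * (partial i F (?q a t) - partial i F (?q a 0))"
    by auto
  have "\<exists>b. b > 0 \<and> b < t \<and> partial i F (?q a t) - partial i F (?q a 0)
      = (t - 0) * partial j (partial i F) (?q a b)"
    by (rule MVT2[OF t]) (use t a in \<open>auto intro!: dj\<close>)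
  then obtain b where b: "0 < b" "b < t" "partial i F (?q a t) - partial i F (?q a 0)
      = t * partial j (partial i F) (?q a b)" by auto
  show ?thesis
    by (rule exI[of _ a], rule exI[of _ b]) (use a b in \<open>auto simp: algebra_simps\<close>)
qed

text \<open>The second difference is symmetric in \<open>i\<close> and \<open>j\<close>, so the two
  mixed derivatives take equal values at two points as close to \<open>p\<close> as desired;
  continuity does the rest. \<open>C2_on\<close> speaks of iterated \<open>partial\<close>, so the
  symmetry has to be derived from continuity.\<close>

lemma partial_commute:
  fixes F :: "real^'n::finite \<Rightarrow> real"
  assumes U: "open U" "p \<in> U" and C2: "C2_on U F"
  shows "partial i (partial j F) p = partial j (partial i F) p"
proof (rule ccontr)
  assume ne: "partial i (partial j F) p \<noteq> partial j (partial i F) p"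
  define e where "e = \<bar>partial i (partial j F) p - partial j (partial i F) p\<bar> / 2"
  have e: "e > 0" using ne by (simp add: e_def)
  have "isCont (partial k (partial l F)) p" for k l
    using C2 U unfolding C2_on_def by (simp add: continuous_on_eq_continuous_at)
  then have "\<forall>k l. \<exists>d>0. \<forall>q. dist q p < d \<longrightarrow> dist (partial k (partial l F) q) (partial k (partial l F) p) < e"
    using e unfolding continuous_at_eps_delta by blast
  then obtain d where d: "\<And>k l. d k l > 0"
    "\<And>k l q. dist q p < d k l \<Longrightarrow> dist (partial k (partial l F) q) (partial k (partial l F) p) < e"
    by metis
  obtain d0 where d0: "d0 > 0" "ball p d0 \<subseteq> U" using U openE by blast
  define dd where "dd = min d0 (min (d i j) (d j i))"
  have dd: "dd > 0" using d d0 by (simp add: dd_def)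
  \<comment> \<open>Two displacements of length at most \<open>t\<close> add up to less than
    \<open>dd\<close>.\<close>
  define t where "t = dd / 3"
  have t: "t > 0" using dd by (simp add: t_def)
  have near: "dist (p + a *\<^sub>R axis k 1 + b *\<^sub>R axis l 1) p < dd"
    if "0 \<le> a" "a \<le> t" "0 \<le> b" "b \<le> t" for a b and k l :: 'n
  proof -
    have "norm (a *\<^sub>R axis k 1 + b *\<^sub>R axis l (1::real)) \<le> a + b"
      using norm_triangle_ineq[of "a *\<^sub>R axis k (1::real)" "b *\<^sub>R axis l 1"] that by (simp add: norm_axis_1)
    also have "\<dots> < dd" using that t by (simp add: t_def)
    finally show ?thesis by (simp add: dist_norm add.assoc)
  qed
  have inU: "p + a *\<^sub>R axis k 1 + b *\<^sub>R axis l 1 \<in> U"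
    if "0 \<le> a" "a \<le> t" "0 \<le> b" "b \<le> t" for a b and k l :: 'n
    using near[OF that, of k l] d0 by (auto simp: dd_def dist_commute subset_eq)
  obtain a b where ab: "0 \<le> a" "a \<le> t" "0 \<le> b" "b \<le> t"
    "F (p + t *\<^sub>R axis i 1 + t *\<^sub>R axis j 1) - F (p + t *\<^sub>R axis i 1) - F (p + t *\<^sub>R axis j 1) + F p
    = t * t * partial j (partial i F) (p + a *\<^sub>R axis i 1 + b *\<^sub>R axis j 1)"
    using second_difference_mvt[OF C2 t inU, of i j] by auto
  obtain a' b' where ab': "0 \<le> a'" "a' \<le> t" "0 \<le> b'" "b' \<le> t"
    "F (p + t *\<^sub>R axis j 1 + t *\<^sub>R axis i 1) - F (p + t *\<^sub>R axis j 1) - F (p + t *\<^sub>R axis i 1) + F p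
    = t * t * partial i (partial j F) (p + a' *\<^sub>R axis j 1 + b' *\<^sub>R axis i 1)"
    using second_difference_mvt[OF C2 t inU, of j i] by auto
  have "t * t * partial j (partial i F) (p + a *\<^sub>R axis i 1 + b *\<^sub>R axis j 1)
    = t * t * partial i (partial j F) (p + a' *\<^sub>R axis j 1 + b' *\<^sub>R axis i 1)"
    using ab(5) ab'(5) by (simp add: algebra_simps)
  then have "partial j (partial i F) (p + a *\<^sub>R axis i 1 + b *\<^sub>R axis j 1)
    = partial i (partial j F) (p + a' *\<^sub>R axis j 1 + b' *\<^sub>R axis i 1)" using t by simp
  moreover have "dist (partial j (partial i F) (p + a *\<^sub>R axis i 1 + b *\<^sub>R axis j 1)) (partial j (partial i F) p) < e"
    using near[OF ab(1-4), of i j] by (intro d) (simp add: dd_def)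
  moreover have "dist (partial i (partial j F) (p + a' *\<^sub>R axis j 1 + b' *\<^sub>R axis i 1)) (partial i (partial j F) p) < e"
    using near[OF ab'(1-4), of j i] by (intro d) (simp add: dd_def)
  moreover have "\<bar>partial i (partial j F) p - partial j (partial i F) p\<bar> = 2 * e"
    by (simp add: e_def)
  ultimately show False
    unfolding dist_real_def by linarith
qed

section \<open>Integration over the sphere\<close>

text \<open>A gauge integral over the parameter rectangle, for which the fundamental theorem and
  differentiation under the integral are at hand; \<open>nn_integral_sphere_int\<close> ties it to
  the measure in the norms.\<close>

definition sphere_int :: "(real^3 \<Rightarrow> real) \<Rightarrow> real" where
  "sphere_int F = integral (cbox (0,0) (pi,2*pi)) (\<lambda>(\<theta>,\<psi>). sin \<theta> * F (sph (\<theta>,\<psi>)))"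

lemma sph_nth:
  "sph x $ 1 = sin (fst x) * cos (snd x)" "sph x $ 2 = sin (fst x) * sin (snd x)" "sph x $ 3 = cos (fst x)"
  by (simp_all add: sph_def case_prod_beta)

lemma norm_sph [simp]: "norm (sph x) = 1"
proof -
  have "(norm (sph x))\<^sup>2 = (sin (fst x))\<^sup>2 * ((cos (snd x))\<^sup>2 + (sin (snd x))\<^sup>2) + (cos (fst x))\<^sup>2"
    unfolding norm_vec3 sph_nth by (simp add: power_mult_distrib distrib_left del: sin_cos_squared_add2)
  then show ?thesis by (simp add: power2_eq_1_iff) (smt (verit) norm_ge_zero)
qed

lemma continuous_on_sphere_sph:
  assumes "continuous_on (sphere 0 1) F"
  shows "continuous_on A (\<lambda>x. F (sph x))"
  by (rule continuous_on_compose2[OF assms continuous_on_subset[OF continuous_on_sph]]) auto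

lemma continuous_on_sphere_int_integrand:
  assumes "continuous_on (sphere 0 1) F"
  shows "continuous_on A (\<lambda>(\<theta>,\<psi>). sin \<theta> * F (sph (\<theta>,\<psi>)))"
  unfolding case_prod_beta using continuous_on_sphere_sph[OF assms, of A]
  by (auto intro!: continuous_intros)

lemma sphere_int_integrable:
  assumes "continuous_on (sphere 0 1) F"
  shows "(\<lambda>(\<theta>,\<psi>). sin \<theta> * F (sph (\<theta>,\<psi>))) integrable_on (cbox (0,0) (pi,2*pi))"
  by (rule integrable_continuous[OF continuous_on_sphere_int_integrand[OF assms]])

lemma sphere_int_cong:
  assumes "\<And>\<omega>. \<omega> \<in> sphere 0 1 \<Longrightarrow> F \<omega> = G \<omega>"
  shows "sphere_int F = sphere_int G"
  unfolding sphere_int_def using assms by (intro integral_cong) auto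

lemma sphere_int_add:
  assumes "continuous_on (sphere 0 1) F" "continuous_on (sphere 0 1) G"
  shows "sphere_int (\<lambda>\<omega>. F \<omega> + G \<omega>) = sphere_int F + sphere_int G"
  unfolding sphere_int_def
  by (subst integral_add[OF sphere_int_integrable[OF assms(1)] sphere_int_integrable[OF assms(2)], symmetric])
     (auto simp: distrib_left intro!: integral_cong)

lemma sphere_int_cmult: "sphere_int (\<lambda>\<omega>. c * F \<omega>) = c * sphere_int F"
proof -
  have "(\<lambda>(\<theta>,\<psi>). sin \<theta> * (c * F (sph (\<theta>,\<psi>)))) = (\<lambda>x. c * (\<lambda>(\<theta>,\<psi>). sin \<theta> * F (sph (\<theta>,\<psi>))) x)"
    by (auto simp: fun_eq_iff)
  then show ?thesis unfolding sphere_int_def by simp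
qed

lemma sphere_int_diff:
  assumes "continuous_on (sphere 0 1) F" "continuous_on (sphere 0 1) G"
  shows "sphere_int (\<lambda>\<omega>. F \<omega> - G \<omega>) = sphere_int F - sphere_int G"
  using sphere_int_add[OF assms(1), of "\<lambda>\<omega>. (-1) * G \<omega>"] sphere_int_cmult[of "-1" G] assms
  by (simp add: continuous_on_minus)

lemma sphere_int_mono:
  assumes "continuous_on (sphere 0 1) F" "continuous_on (sphere 0 1) G"
    and "\<And>\<omega>. \<omega> \<in> sphere 0 1 \<Longrightarrow> F \<omega> \<le> G \<omega>"
  shows "sphere_int F \<le> sphere_int G"
  unfolding sphere_int_def
  by (rule integral_le[OF sphere_int_integrable[OF assms(1)] sphere_int_integrable[OF assms(2)]])
     (auto intro!: mult_left_mono assms sin_ge_zero simp: cbox_Pair_eq)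

lemma sphere_int_zero [simp]: "sphere_int (\<lambda>_. 0) = 0"
  using sphere_int_cmult[of 0 "\<lambda>_. 0"] by simp

lemma sphere_int_nonneg:
  assumes "continuous_on (sphere 0 1) F" "\<And>\<omega>. \<omega> \<in> sphere 0 1 \<Longrightarrow> 0 \<le> F \<omega>"
  shows "0 \<le> sphere_int F"
  using sphere_int_mono[of "\<lambda>_. 0" F] assms by simp

lemma AE_sphere_measure: "AE \<omega> in sphere_measure. \<omega> \<in> sphere 0 1"
proof -
  have [measurable]: "sph \<in> borel_measurable borel"
    by (rule borel_measurable_continuous_onI[OF continuous_on_sph])
  show ?thesis
    unfolding sphere_measure_def by (subst AE_distr_iff) (auto intro!: AE_I2)
qed

lemma nn_integral_sphere_int:
  assumes "continuous_on (sphere 0 1) F" "\<And>\<omega>. \<omega> \<in> sphere 0 1 \<Longrightarrow> 0 \<le> F \<omega>"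
  shows "(\<integral>\<^sup>+\<omega>. ennreal (F \<omega>) \<partial>sphere_measure) = ennreal (sphere_int F)"
proof -
  let ?C = "cbox (0,0) (pi,2*pi) :: (real \<times> real) set"
  let ?g = "\<lambda>(\<theta>,\<psi>). sin \<theta> * F (sph (\<theta>,\<psi>))"
  \<comment> \<open>\<open>F\<close> is controlled on the sphere only. Its extension by zero is
    Borel, and the complement of the sphere is null for \<open>sphere_measure\<close>.\<close>
  define F' where "F' \<omega> = indicator (sphere 0 1) \<omega> *\<^sub>R F \<omega>" for \<omega>
  have [measurable]: "F' \<in> borel_measurable borel"
    unfolding F'_def[abs_def] using assms(1)
    by (intro borel_measurable_continuous_on_indicator) auto
  have [measurable]: "sph \<in> borel_measurable borel"
    by (rule borel_measurable_continuous_onI[OF continuous_on_sph])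
  have [measurable]: "(\<lambda>(\<theta>, \<psi>). ennreal (sin \<theta>) * indicator ({0..pi} \<times> {0..2*pi}) (\<theta>, \<psi>))
      \<in> borel_measurable (borel :: (real \<times> real) measure)"
    unfolding borel_prod[symmetric] by measurable
  have "(\<integral>\<^sup>+\<omega>. ennreal (F \<omega>) \<partial>sphere_measure) = (\<integral>\<^sup>+\<omega>. ennreal (F' \<omega>) \<partial>sphere_measure)"
    by (rule nn_integral_cong_AE) (use AE_sphere_measure in \<open>eventually_elim, auto simp: F'_def\<close>)
  also have "\<dots> = (\<integral>\<^sup>+x. (case x of (\<theta>, \<psi>) \<Rightarrow> ennreal (sin \<theta>) * indicator ({0..pi} \<times> {0..2*pi}) (\<theta>, \<psi>))
         * ennreal (F' (sph x)) \<partial>lborel)"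
    unfolding sphere_measure_def by (subst nn_integral_distr) (auto simp: nn_integral_density)
  also have "\<dots> = (\<integral>\<^sup>+x. ennreal (indicator ?C x *\<^sub>R ?g x) \<partial>lborel)"
    by (intro nn_integral_cong)
       (auto simp: indicator_def F'_def cbox_Pair_eq ennreal_mult sin_ge_zero assms(2) split: if_splits)
  also have "\<dots> = ennreal (\<integral>x. indicator ?C x *\<^sub>R ?g x \<partial>lborel)"
  proof (rule nn_integral_eq_integral)
    show "integrable lborel (\<lambda>x. indicator ?C x *\<^sub>R ?g x)"
      by (rule borel_integrable_compact[OF compact_cbox continuous_on_sphere_int_integrand[OF assms(1)]])
    show "AE x in lborel. 0 \<le> indicator ?C x *\<^sub>R ?g x"
      by (intro AE_I2) (auto simp: indicator_def cbox_Pair_eq intro!: mult_nonneg_nonneg sin_ge_zero assms)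
  qed
  also have "(\<integral>x. indicator ?C x *\<^sub>R ?g x \<partial>lborel) = sphere_int F"
    unfolding sphere_int_def
    using set_borel_integral_eq_integral(2)[of ?C ?g]
      borel_integrable_compact[OF compact_cbox continuous_on_sphere_int_integrand[OF assms(1)], of "(0,0)" "(pi,2*pi)"]
    unfolding set_integrable_def set_lebesgue_integral_def by blast
  finally show ?thesis .
qed

lemma continuous_on_fst_sph_snd: "continuous_on A (\<lambda>z. (fst z, sph (snd z)))"
  by (intro continuous_on_Pair continuous_on_fst continuous_on_id
      continuous_on_compose2[OF continuous_on_sph] continuous_on_snd) auto

lemma continuous_on_sphere_int:
  fixes K :: "'a::real_normed_vector \<Rightarrow> real^3 \<Rightarrow> real"
  assumes "continuous_on (V \<times> sphere 0 1) (\<lambda>(x,\<omega>). K x \<omega>)"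
  shows "continuous_on V (\<lambda>x. sphere_int (K x))"
  unfolding sphere_int_def
proof (rule integral_continuous_on_param)
  have "continuous_on (V \<times> cbox (0,0) (pi,2*pi)) (\<lambda>z. K (fst z) (sph (snd z)))"
    by (rule continuous_on_compose2[OF assms continuous_on_fst_sph_snd, unfolded case_prod_beta fst_conv snd_conv]) auto
  then show "continuous_on (V \<times> cbox (0, 0) (pi, 2 * pi))
     (\<lambda>(x, t). case t of (\<theta>, \<psi>) \<Rightarrow> sin \<theta> * K x (sph (\<theta>, \<psi>)))"
    unfolding case_prod_beta by (intro continuous_on_mult continuous_on_sin continuous_on_fst continuous_on_snd continuous_on_id) simp
qed

lemma sphere_int_has_derivative:
  fixes K K' :: "real \<Rightarrow> real^3 \<Rightarrow> real"
  assumes V: "convex V" "x0 \<in> V"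
    and D: "\<And>x \<omega>. x \<in> V \<Longrightarrow> \<omega> \<in> sphere 0 1 \<Longrightarrow> ((\<lambda>x. K x \<omega>) has_real_derivative K' x \<omega>) (at x within V)"
    and K: "\<And>x. x \<in> V \<Longrightarrow> continuous_on (sphere 0 1) (K x)"
    and K': "continuous_on (V \<times> sphere 0 1) (\<lambda>(x,\<omega>). K' x \<omega>)"
  shows "((\<lambda>x. sphere_int (K x)) has_real_derivative sphere_int (K' x0)) (at x0 within V)"
  unfolding sphere_int_def
proof (rule leibniz_rule_field_derivative[OF _ _ _ V(2,1)])
  have "continuous_on (V \<times> cbox (0,0) (pi,2*pi)) (\<lambda>z. K' (fst z) (sph (snd z)))"
    by (rule continuous_on_compose2[OF K' continuous_on_fst_sph_snd, unfolded case_prod_beta fst_conv snd_conv]) auto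
  then show "continuous_on (V \<times> cbox (0, 0) (pi, 2 * pi))
     (\<lambda>(x, t). case t of (\<theta>, \<psi>) \<Rightarrow> sin \<theta> * K' x (sph (\<theta>, \<psi>)))"
    unfolding case_prod_beta by (auto intro!: continuous_intros)
next
  fix x t assume "x \<in> V"
  then show "((\<lambda>x. case t of (\<theta>, \<psi>) \<Rightarrow> sin \<theta> * K x (sph (\<theta>, \<psi>))) has_real_derivative
         (case t of (\<theta>, \<psi>) \<Rightarrow> sin \<theta> * K' x (sph (\<theta>, \<psi>)))) (at x within V)"
    unfolding case_prod_beta by (intro DERIV_cmult D) auto
next
  fix x assume "x \<in> V"
  then show "(\<lambda>(\<theta>, \<psi>). sin \<theta> * K x (sph (\<theta>, \<psi>))) integrable_on cbox (0, 0) (pi, 2 * pi)"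
    by (intro sphere_int_integrable K)
qed

section \<open>Rotation fields have mean zero on the sphere\<close>

lemma box_integral_deriv_snd:
  fixes X X' :: "real \<Rightarrow> real \<Rightarrow> real"
  assumes "c \<le> d" and cont: "continuous_on (cbox (a,c) (b,d)) (\<lambda>(x,y). X' x y)"
    and D: "\<And>x y. x \<in> {a..b} \<Longrightarrow> y \<in> {c..d} \<Longrightarrow> ((\<lambda>y. X x y) has_real_derivative X' x y) (at y within {c..d})"
  shows "integral (cbox (a,c) (b,d)) (\<lambda>(x,y). X' x y) = integral {a..b} (\<lambda>x. X x d - X x c)"
proof -
  have "integral (cbox (a,c) (b,d)) (\<lambda>(x,y). X' x y) = integral {a..b} (\<lambda>x. integral {c..d} (\<lambda>y. X' x y))"
    using integral_prod_continuous[OF cont] by simp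
  also have "\<dots> = integral {a..b} (\<lambda>x. X x d - X x c)"
    by (intro integral_cong integral_unique fundamental_theorem_of_calculus assms(1))
       (use D in \<open>auto simp: has_real_derivative_iff_has_vector_derivative\<close>)
  finally show ?thesis .
qed

lemma box_integral_deriv_fst:
  fixes X X' :: "real \<Rightarrow> real \<Rightarrow> real"
  assumes "a \<le> b" and cont: "continuous_on (cbox (a,c) (b,d)) (\<lambda>(x,y). X' x y)"
    and D: "\<And>x y. x \<in> {a..b} \<Longrightarrow> y \<in> {c..d} \<Longrightarrow> ((\<lambda>x. X x y) has_real_derivative X' x y) (at x within {a..b})"
  shows "integral (cbox (a,c) (b,d)) (\<lambda>(x,y). X' x y) = integral {c..d} (\<lambda>y. X b y - X a y)"
proof -
  have "integral (cbox (a,c) (b,d)) (\<lambda>(x,y). X' x y) = integral {a..b} (\<lambda>x. integral {c..d} (\<lambda>y. X' x y))"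
    using integral_prod_continuous[OF cont] by simp
  also have "\<dots> = integral {c..d} (\<lambda>y. integral {a..b} (\<lambda>x. X' x y))"
    using integral_swap_continuous[OF cont] by simp
  also have "\<dots> = integral {c..d} (\<lambda>y. X b y - X a y)"
    by (intro integral_cong integral_unique fundamental_theorem_of_calculus assms(1))
       (use D in \<open>auto simp: has_real_derivative_iff_has_vector_derivative\<close>)
  finally show ?thesis .
qed

lemma sph_has_vector_derivative:
  "((\<lambda>\<theta>. sph (\<theta>,\<psi>)) has_vector_derivative vector [cos \<theta> * cos \<psi>, cos \<theta> * sin \<psi>, - sin \<theta>]) (at \<theta>)"
  "((\<lambda>\<psi>. sph (\<theta>,\<psi>)) has_vector_derivative vector [- sin \<theta> * sin \<psi>, sin \<theta> * cos \<psi>, 0]) (at \<psi>)"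
proof -
  have vec: "((\<lambda>s. c s) has_vector_derivative d) (at x)"
    if "\<forall>i. ((\<lambda>s. c s $ i) has_real_derivative d $ i) (at x)" for c :: "real \<Rightarrow> real^3" and d x
  proof -
    have "((\<lambda>s. c s $ i) has_derivative (\<lambda>x. x * d $ i)) (at x)" for i
      by (rule has_derivative_eq_rhs[OF that[rule_format, of i, unfolded has_field_derivative_def]])
        (simp add: fun_eq_iff mult.commute)
    then show ?thesis
      unfolding has_vector_derivative_def
      by (subst has_derivative_componentwise_within)
         (auto simp: Basis_vec_def cart_eq_inner_axis[symmetric])
  qed
  show "((\<lambda>\<theta>. sph (\<theta>,\<psi>)) has_vector_derivative vector [cos \<theta> * cos \<psi>, cos \<theta> * sin \<psi>, - sin \<theta>]) (at \<theta>)"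
    apply (rule vec)
    apply (simp only: forall_3 sph_nth fst_conv snd_conv vector_3)
    apply (intro conjI; (rule derivative_eq_intros refl)+; simp)
    done
  show "((\<lambda>\<psi>. sph (\<theta>,\<psi>)) has_vector_derivative vector [- sin \<theta> * sin \<psi>, sin \<theta> * cos \<psi>, 0]) (at \<psi>)"
    apply (rule vec)
    apply (simp only: forall_3 sph_nth fst_conv snd_conv vector_3)
    apply (intro conjI; (rule derivative_eq_intros refl)+; simp)
    done
qed

text \<open>Rotations preserve the surface measure, so their generators are divergence free. In the
  angles each integrand is a \<theta>-derivative plus a \<psi>-derivative; the first boundary term
  vanishes because sin \<theta> is zero at both poles or because there is no such term, the second
  by periodicity in \<psi>.\<close>

lemma sphere_int_rotation:
  fixes k :: "real^3 \<Rightarrow> real" and dk :: "3 \<Rightarrow> real^3 \<Rightarrow> real"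
  assumes D: "\<And>\<omega>. \<omega> \<in> sphere 0 1 \<Longrightarrow> (k has_derivative (\<lambda>d. \<Sum>i\<in>UNIV. d$i * dk i \<omega>)) (at \<omega>)"
    and C: "\<And>i. continuous_on (sphere 0 1) (dk i)"
  shows "sphere_int (\<lambda>\<omega>. \<omega>$2 * dk 3 \<omega> - \<omega>$3 * dk 2 \<omega>) = 0"
    "sphere_int (\<lambda>\<omega>. \<omega>$3 * dk 1 \<omega> - \<omega>$1 * dk 3 \<omega>) = 0"
    "sphere_int (\<lambda>\<omega>. \<omega>$1 * dk 2 \<omega> - \<omega>$2 * dk 1 \<omega>) = 0"
proof -
  define K where "K \<theta> \<psi> = k (sph (\<theta>,\<psi>))" for \<theta> \<psi>
  define A where "A \<theta> \<psi> = cos \<theta> * cos \<psi> * dk 1 (sph (\<theta>,\<psi>)) + cos \<theta> * sin \<psi> * dk 2 (sph (\<theta>,\<psi>))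
    - sin \<theta> * dk 3 (sph (\<theta>,\<psi>))" for \<theta> \<psi>
  define B where "B \<theta> \<psi> = - sin \<theta> * sin \<psi> * dk 1 (sph (\<theta>,\<psi>)) + sin \<theta> * cos \<psi> * dk 2 (sph (\<theta>,\<psi>))" for \<theta> \<psi>
  have curve: "((\<lambda>s. k (c s)) has_real_derivative (\<Sum>i\<in>UNIV. d$i * dk i (c s))) (at s within S)"
    if "c s \<in> sphere 0 1" "(c has_vector_derivative d) (at s)" for c d s S
  proof -
    have "((\<lambda>s. k (c s)) has_derivative (\<lambda>x. \<Sum>i\<in>UNIV. (x *\<^sub>R d)$i * dk i (c s))) (at s)"
      by (rule has_derivative_compose[OF that(2)[unfolded has_vector_derivative_def] D[OF that(1)]])
    then show ?thesis
      unfolding has_field_derivative_def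
      by (rule has_derivative_at_withinI[OF has_derivative_eq_rhs])
         (simp add: fun_eq_iff sum_distrib_left sum_distrib_right mult_ac)
  qed
  have KA: "((\<lambda>\<theta>. K \<theta> \<psi>) has_real_derivative A \<theta> \<psi>) (at \<theta> within S)" for \<theta> \<psi> S
    using curve[OF _ sph_has_vector_derivative(1)[of \<psi> \<theta>], of S] by (simp add: K_def A_def sum_3)
  have KB: "((\<lambda>\<psi>. K \<theta> \<psi>) has_real_derivative B \<theta> \<psi>) (at \<psi> within S)" for \<theta> \<psi> S
    using curve[OF _ sph_has_vector_derivative(2)[of \<theta> \<psi>], of S] by (simp add: K_def B_def sum_3)
  have ck: "continuous_on (sphere 0 1) k"
    using D by (meson continuous_at_imp_continuous_on has_derivative_continuous)
  have cK: "continuous_on S (\<lambda>x. K (fst x) (snd x))" for S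
    unfolding K_def using continuous_on_sphere_sph[OF ck, of S] by simp
  have cdk: "continuous_on S (\<lambda>x. dk i (sph x))" for i S
    by (rule continuous_on_sphere_sph[OF C])
  have cA: "continuous_on S (\<lambda>x. A (fst x) (snd x))" for S
    unfolding A_def using cdk by (auto intro!: continuous_intros)
  have cB: "continuous_on S (\<lambda>x. B (fst x) (snd x))" for S
    unfolding B_def using cdk by (auto intro!: continuous_intros)
  have per: "K \<theta> (2*pi) = K \<theta> 0" for \<theta>
    by (simp add: K_def sph_def)
  have box: "integral (cbox (0,0) (pi,2*pi)) (\<lambda>x. X' (fst x) (snd x) + Y' (fst x) (snd x)) = 0"
    if cX: "continuous_on (cbox (0,0) (pi,2*pi)) (\<lambda>x. X' (fst x) (snd x))"
      and cY: "continuous_on (cbox (0,0) (pi,2*pi)) (\<lambda>x. Y' (fst x) (snd x))"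
      and X: "\<And>\<theta> \<psi>. ((\<lambda>\<theta>. X \<theta> \<psi>) has_real_derivative X' \<theta> \<psi>) (at \<theta> within {0..pi})"
      and Y: "\<And>\<theta> \<psi>. ((\<lambda>\<psi>. Y \<theta> \<psi>) has_real_derivative Y' \<theta> \<psi>) (at \<psi> within {0..2*pi})"
      and XY: "\<And>\<psi>. X pi \<psi> = X 0 \<psi>" "\<And>\<theta>. Y \<theta> (2*pi) = Y \<theta> 0" for X X' Y Y' :: "real \<Rightarrow> real \<Rightarrow> real"
  proof -
    have "integral (cbox (0,0) (pi,2*pi)) (\<lambda>x. X' (fst x) (snd x)) = 0"
      using box_integral_deriv_fst[of 0 pi 0 "2*pi" X' X] cX X XY by (simp add: case_prod_unfold)
    moreover have "integral (cbox (0,0) (pi,2*pi)) (\<lambda>x. Y' (fst x) (snd x)) = 0"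
      using box_integral_deriv_snd[of 0 "2*pi" 0 pi Y' Y] cY Y XY by (simp add: case_prod_unfold)
    ultimately show ?thesis
      using integral_add[OF integrable_continuous[OF cX] integrable_continuous[OF cY]] by simp
  qed
  note cint = continuous_intros cA cB cK
  have sc: "sin x * sin x = 1 - cos x * cos x" "sin x * (sin x * y) = y - cos x * (cos x * y)" for x y :: real
    using sin_squared_eq[of x] by (simp_all add: power2_eq_square mult.assoc[symmetric] left_diff_distrib)
  \<comment> \<open>The factor sin \<theta> of the measure cancels the 1/sin \<theta> that rotations
    have in angular coordinates, so the integrands are regular at the poles.\<close>
  have eqs: "sphere_int (\<lambda>\<omega>. \<omega>$2 * dk 3 \<omega> - \<omega>$3 * dk 2 \<omega>) = integral (cbox (0,0) (pi,2*pi))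
     (\<lambda>x. - (cos (fst x) * sin (snd x) * K (fst x) (snd x) + sin (fst x) * sin (snd x) * A (fst x) (snd x))
       + (cos (fst x) * sin (snd x) * K (fst x) (snd x) - cos (fst x) * cos (snd x) * B (fst x) (snd x)))"
    "sphere_int (\<lambda>\<omega>. \<omega>$3 * dk 1 \<omega> - \<omega>$1 * dk 3 \<omega>) = integral (cbox (0,0) (pi,2*pi))
     (\<lambda>x. (cos (fst x) * cos (snd x) * K (fst x) (snd x) + sin (fst x) * cos (snd x) * A (fst x) (snd x))
       + - (cos (fst x) * cos (snd x) * K (fst x) (snd x) + cos (fst x) * sin (snd x) * B (fst x) (snd x)))"
    "sphere_int (\<lambda>\<omega>. \<omega>$1 * dk 2 \<omega> - \<omega>$2 * dk 1 \<omega>) = integral (cbox (0,0) (pi,2*pi))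
     (\<lambda>x. 0 + sin (fst x) * B (fst x) (snd x))"
    unfolding sphere_int_def case_prod_unfold sph_nth A_def B_def prod.collapse fst_conv snd_conv
    subgoal
      apply (rule integral_cong)
      subgoal for x using sin_cos_squared_add[of "fst x"] sin_cos_squared_add[of "snd x"] by algebra
      done
    subgoal
      apply (rule integral_cong)
      subgoal for x using sin_cos_squared_add[of "fst x"] sin_cos_squared_add[of "snd x"] by algebra
      done
    subgoal by (rule integral_cong) algebra
    done
  show "sphere_int (\<lambda>\<omega>. \<omega>$2 * dk 3 \<omega> - \<omega>$3 * dk 2 \<omega>) = 0"
    unfolding eqs
    by (rule box[where X = "\<lambda>\<theta> \<psi>. - (sin \<theta> * sin \<psi> * K \<theta> \<psi>)" and Y = "\<lambda>\<theta> \<psi>. - (cos \<theta> * cos \<psi> * K \<theta> \<psi>)"])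
       (simp_all add: per, (intro cint; simp)+, (rule derivative_eq_intros KA KB refl | simp)+)
  show "sphere_int (\<lambda>\<omega>. \<omega>$3 * dk 1 \<omega> - \<omega>$1 * dk 3 \<omega>) = 0"
    unfolding eqs
    by (rule box[where X = "\<lambda>\<theta> \<psi>. sin \<theta> * cos \<psi> * K \<theta> \<psi>" and Y = "\<lambda>\<theta> \<psi>. - (cos \<theta> * sin \<psi> * K \<theta> \<psi>)"])
       (simp_all add: per, (intro cint; simp)+, (rule derivative_eq_intros KA KB refl | simp)+)
  show "sphere_int (\<lambda>\<omega>. \<omega>$1 * dk 2 \<omega> - \<omega>$2 * dk 1 \<omega>) = 0"
    unfolding eqs
    by (rule box[where X = "\<lambda>\<theta> \<psi>. 0" and X' = "\<lambda>\<theta> \<psi>. 0" and Y = "\<lambda>\<theta> \<psi>. sin \<theta> * K \<theta> \<psi>"])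
       (simp_all add: per, (intro cint; simp)+, (rule derivative_eq_intros KA KB refl | simp)+)
qed

section \<open>Polar form of a solution\<close>

text \<open>The components of the cross product of \<omega> and \<open>d\<close>. With
  \<open>d\<close> a gradient these are the three rotation fields applied to the function; together
  they span the tangent space at every point, which no global frame of two fields could do.\<close>

definition rot :: "3 \<Rightarrow> (3 \<Rightarrow> real) \<Rightarrow> real^3 \<Rightarrow> real" where
  "rot a d \<omega> = (if a = 1 then \<omega>$2 * d 3 - \<omega>$3 * d 2
     else if a = 2 then \<omega>$3 * d 1 - \<omega>$1 * d 3 else \<omega>$1 * d 2 - \<omega>$2 * d 1)"

lemma sphere_int_rot:
  assumes "\<And>\<omega>. \<omega> \<in> sphere 0 1 \<Longrightarrow> (k has_derivative (\<lambda>d. \<Sum>i\<in>UNIV. d$i * dk i \<omega>)) (at \<omega>)"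
    and "\<And>i. continuous_on (sphere 0 1) (dk i)"
  shows "sphere_int (\<lambda>\<omega>. rot a (\<lambda>i. dk i \<omega>) \<omega>) = 0"
  using sphere_int_rotation[OF assms] exhaust_3[of a] by (auto simp: rot_def)

lemma sphere_int_by_parts:
  assumes X: "\<And>\<omega>. \<omega> \<in> sphere 0 1 \<Longrightarrow> (X has_derivative (\<lambda>d. \<Sum>i\<in>UNIV. d$i * dX i \<omega>)) (at \<omega>)"
    and Z: "\<And>\<omega>. \<omega> \<in> sphere 0 1 \<Longrightarrow> (Z has_derivative (\<lambda>d. \<Sum>i\<in>UNIV. d$i * dZ i \<omega>)) (at \<omega>)"
    and dX: "\<And>i. continuous_on (sphere 0 1) (dX i)" and dZ: "\<And>i. continuous_on (sphere 0 1) (dZ i)"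
  shows "sphere_int (\<lambda>\<omega>. X \<omega> * rot a (\<lambda>i. dZ i \<omega>) \<omega> + rot a (\<lambda>i. dX i \<omega>) \<omega> * Z \<omega>) = 0"
proof -
  have c: "continuous_on (sphere 0 1) X" "continuous_on (sphere 0 1) Z"
    using X Z by (meson continuous_at_imp_continuous_on has_derivative_continuous)+
  have "sphere_int (\<lambda>\<omega>. rot a (\<lambda>i. X \<omega> * dZ i \<omega> + dX i \<omega> * Z \<omega>) \<omega>) = 0"
  proof (rule sphere_int_rot[where k = "\<lambda>\<omega>. X \<omega> * Z \<omega>"])
    fix \<omega> :: "real^3" assume \<omega>: "\<omega> \<in> sphere 0 1"
    show "((\<lambda>\<omega>. X \<omega> * Z \<omega>) has_derivative (\<lambda>d. \<Sum>i\<in>UNIV. d$i * (X \<omega> * dZ i \<omega> + dX i \<omega> * Z \<omega>))) (at \<omega>)"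
      by (rule has_derivative_eq_rhs[OF has_derivative_mult[OF X[OF \<omega>] Z[OF \<omega>]]])
         (simp add: fun_eq_iff sum_3 algebra_simps)
  qed (intro continuous_intros c dX dZ)
  moreover have "rot a (\<lambda>i. X \<omega> * dZ i \<omega> + dX i \<omega> * Z \<omega>) \<omega>
      = X \<omega> * rot a (\<lambda>i. dZ i \<omega>) \<omega> + rot a (\<lambda>i. dX i \<omega>) \<omega> * Z \<omega>" for \<omega>
    by (auto simp: rot_def algebra_simps)
  ultimately show ?thesis by simp
qed

section \<open>Passage from the Cartesian chart to the variables (v, r, \<omega>)\<close>

definition emb :: "3 \<Rightarrow> 4" where
  "emb i = (if i = 1 then 2 else if i = 2 then 3 else 4)"

lemma emb_simps [simp]: "emb 1 = 2" "emb 2 = 3" "emb 3 = 4"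
  by (simp_all add: emb_def)

lemma pt_nth [simp]: "pt v r \<omega> $ 1 = v" "pt v r \<omega> $ 2 = r * \<omega>$1" "pt v r \<omega> $ 3 = r * \<omega>$2" "pt v r \<omega> $ 4 = r * \<omega>$3"
  by (simp_all add: pt_def)

lemma has_derivative_vec4:
  assumes "\<And>i. ((\<lambda>s. c s $ i) has_derivative (\<lambda>x. d x $ i)) (at a)"
  shows "(c has_derivative (d :: _ \<Rightarrow> real^4)) (at a)"
  using assms by (subst has_derivative_componentwise_within) (auto simp: Basis_vec_def cart_eq_inner_axis[symmetric])

lemma pt_has_derivative_angle:
  "(pt v r has_derivative (\<lambda>d. vector [0, r * d$1, r * d$2, r * d$3])) (at \<omega>)"
proof (rule has_derivative_vec4)
  fix i :: 4
  have nth: "((\<lambda>\<omega>::real^3. r * \<omega>$j) has_derivative (\<lambda>d. r * d$j)) (at \<omega>)" for j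
    by (rule has_derivative_mult_right[OF bounded_linear.has_derivative[OF bounded_linear_vec_nth has_derivative_ident]])
  show "((\<lambda>\<omega>. pt v r \<omega> $ i) has_derivative (\<lambda>d. (vector [0, r * d$1, r * d$2, r * d$3] :: real^4) $ i)) (at \<omega>)"
    using exhaust_4[of i] nth by auto
qed

lemma pt_has_vector_derivative:
  "((\<lambda>v. pt v r \<omega>) has_vector_derivative vector [1, 0, 0, 0]) (at v)"
  "((\<lambda>r. pt v r \<omega>) has_vector_derivative vector [0, \<omega>$1, \<omega>$2, \<omega>$3]) (at r)"
proof -
  show "((\<lambda>v. pt v r \<omega>) has_vector_derivative vector [1, 0, 0, 0]) (at v)"
    unfolding has_vector_derivative_def
  proof (rule has_derivative_vec4)
    fix i :: 4
    show "((\<lambda>v. pt v r \<omega> $ i) has_derivative (\<lambda>x. (x *\<^sub>R vector [1, 0, 0, 0] :: real^4) $ i)) (at v)"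
      using exhaust_4[of i] by (auto intro!: derivative_eq_intros)
  qed
  show "((\<lambda>r. pt v r \<omega>) has_vector_derivative vector [0, \<omega>$1, \<omega>$2, \<omega>$3]) (at r)"
    unfolding has_vector_derivative_def
  proof (rule has_derivative_vec4)
    fix i :: 4
    have "((\<lambda>r. r * c) has_derivative (\<lambda>x. x * c)) (at r)" for c :: real
      by (auto intro!: derivative_eq_intros)
    then show "((\<lambda>r. pt v r \<omega> $ i) has_derivative (\<lambda>x. (x *\<^sub>R vector [0, \<omega>$1, \<omega>$2, \<omega>$3] :: real^4) $ i)) (at r)"
      using exhaust_4[of i] by auto
  qed
qed

definition rad1 :: "(real^4 \<Rightarrow> real) \<Rightarrow> real \<Rightarrow> real \<Rightarrow> real^3 \<Rightarrow> real" where
  "rad1 K v r \<omega> = (\<Sum>i\<in>UNIV. \<omega>$i * partial (emb i) K (pt v r \<omega>))"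

text \<open>With x = r \<omega> these are the components of x cross grad K, the rotation derivatives
  of K. As with \<open>rad1\<close>, \<omega> ranges over all of three-space, so that the result can
  be differentiated in \<omega> again.\<close>

definition rot1 :: "3 \<Rightarrow> (real^4 \<Rightarrow> real) \<Rightarrow> real \<Rightarrow> real \<Rightarrow> real^3 \<Rightarrow> real" where
  "rot1 a K v r \<omega> = rot a (\<lambda>i. r * partial (emb i) K (pt v r \<omega>)) \<omega>"

lemma has_derivative_pt:
  assumes "K differentiable (at (pt v r \<omega>))"
  shows "((\<lambda>v. K (pt v r \<omega>)) has_real_derivative partial 1 K (pt v r \<omega>)) (at v)"
    "((\<lambda>r. K (pt v r \<omega>)) has_real_derivative rad1 K v r \<omega>) (at r)"
    "((\<lambda>\<omega>. K (pt v r \<omega>)) has_derivative (\<lambda>d. \<Sum>i\<in>UNIV. d$i * (r * partial (emb i) K (pt v r \<omega>)))) (at \<omega>)"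
proof -
  show "((\<lambda>v. K (pt v r \<omega>)) has_real_derivative partial 1 K (pt v r \<omega>)) (at v)"
    using has_derivative_along_curve[OF _ pt_has_vector_derivative(1)[of r \<omega> v], of K] assms
    by (simp add: sum_4)
  show "((\<lambda>r. K (pt v r \<omega>)) has_real_derivative rad1 K v r \<omega>) (at r)"
    using has_derivative_along_curve[OF _ pt_has_vector_derivative(2)[of v \<omega> r], of K] assms
    by (simp add: sum_4 sum_3 rad1_def)
  have "((\<lambda>\<omega>. K (pt v r \<omega>)) has_derivative
      (\<lambda>d. \<Sum>i\<in>UNIV. (vector [0, r * d$1, r * d$2, r * d$3] :: real^4) $ i * partial i K (pt v r \<omega>))) (at \<omega>)"
    by (rule has_derivative_compose[OF pt_has_derivative_angle has_derivative_partials[OF assms]])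
  then show "((\<lambda>\<omega>. K (pt v r \<omega>)) has_derivative (\<lambda>d. \<Sum>i\<in>UNIV. d$i * (r * partial (emb i) K (pt v r \<omega>)))) (at \<omega>)"
    by (rule has_derivative_eq_rhs) (simp add: fun_eq_iff sum_4 sum_3)
qed

lemma continuous_on_pt: "continuous_on A (\<lambda>(v,r,\<omega>). pt v r \<omega>)"
proof -
  have nth: "continuous_on A (\<lambda>x. pt (fst x) (fst (snd x)) (snd (snd x)) $ i)" for i
  proof -
    have "i = 1 \<or> i = 2 \<or> i = 3 \<or> i = 4" using exhaust_4 by blast
    then show ?thesis
      by (elim disjE; simp only: pt_nth; intro continuous_intros)
  qed
  have "continuous_on A (\<lambda>x. \<chi> i. pt (fst x) (fst (snd x)) (snd (snd x)) $ i)"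
    by (intro continuous_on_vec_lambda nth)
  then show ?thesis by (simp add: case_prod_unfold)
qed

text \<open>The gradient of the extension that is constant along rays is the tangential projection
  of the full gradient, and for a unit vector the squared length of this projection equals that of
  the cross product with \<omega>.\<close>

lemma ang_sq_rot1:
  assumes K: "K differentiable (at (pt v r \<omega>))" and r: "r > 0" and \<omega>: "\<omega> \<in> sphere 0 1"
  shows "ang_sq K v r \<omega> = (\<Sum>a\<in>UNIV. (rot1 a K v r \<omega>)\<^sup>2) / r\<^sup>2"
proof -
  have n: "norm \<omega> = 1" using \<omega> by simp
  have nz: "\<omega> \<noteq> 0" using n by auto
  have one: "(\<omega>$1)\<^sup>2 + (\<omega>$2)\<^sup>2 + (\<omega>$3)\<^sup>2 = 1" using norm_vec3[of \<omega>] n by simp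
  have sgn: "sgn \<omega> = \<omega>" using n by (simp add: sgn_div_norm)
  have "((\<lambda>y. inverse (norm y) *\<^sub>R y) has_derivative
      (\<lambda>d. inverse (norm \<omega>) *\<^sub>R d + (- (inverse (norm \<omega>) * (d \<bullet> sgn \<omega>) * inverse (norm \<omega>))) *\<^sub>R \<omega>)) (at \<omega>)"
    by (rule has_derivative_scaleR[OF Deriv.has_derivative_inverse[OF _ has_derivative_norm[OF nz]] has_derivative_ident])
       (use n in simp)
  then have "((\<lambda>y. y /\<^sub>R norm y) has_derivative (\<lambda>d. d - (\<omega> \<bullet> d) *\<^sub>R \<omega>)) (at \<omega>)"
    by (simp add: n sgn inner_commute)
  then have s: "(sgn has_derivative (\<lambda>d. d - (\<omega> \<bullet> d) *\<^sub>R \<omega>)) (at \<omega>)"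
    by (simp add: sgn_div_norm[abs_def])
  define D where "D i = partial (emb i) K (pt v r \<omega>)" for i
  have "((\<lambda>y. K (pt v r (sgn y))) has_derivative
     (\<lambda>d. \<Sum>i\<in>UNIV. (d - (\<omega> \<bullet> d) *\<^sub>R \<omega>)$i * (r * partial (emb i) K (pt v r (sgn \<omega>))))) (at \<omega>)"
    by (rule has_derivative_compose[OF s has_derivative_pt(3)]) (use K in \<open>simp add: sgn\<close>)
  then have P: "partial j (\<lambda>y. K (pt v r (sgn y))) \<omega> = (\<Sum>i\<in>UNIV. (axis j 1 - (\<omega> \<bullet> axis j 1) *\<^sub>R \<omega>)$i * (r * D i))" for j
    unfolding sgn D_def by (rule partial_eqI)
  have p: "partial j (\<lambda>y. K (pt v r (sgn y))) \<omega> = r * (D j - \<omega>$j * (\<Sum>i\<in>UNIV. \<omega>$i * D i))" for j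
    unfolding P sum_3 vector_minus_component vector_scaleR_component inner_axis
    using exhaust_3[of j] by (auto simp: axis_def algebra_simps)
  have "sphere_grad_sq (\<lambda>y. K (pt v r y)) \<omega> = (\<Sum>a\<in>UNIV. (rot1 a K v r \<omega>)\<^sup>2)"
    unfolding sphere_grad_sq_def p rot1_def D_def[symmetric] rot_def sum_3
    apply simp
    using one by algebra
  then show ?thesis by (simp add: ang_sq_def)
qed

text \<open>All that the energy argument uses of a solution. \<open>oa\<close> are its rotation
  derivatives, \<open>ota\<close> and \<open>ora\<close> their derivatives in v and r,
  \<open>ooa\<close> the second rotation derivatives. With L = \<partial>_r - m \<partial>_v and h =
  1 - 2M/r, the right side of \<open>wave\<close> is 2 r^2 \<partial>_v L u + 2 r \<partial>_v u + L
  (r^2 h L u) plus the spherical Laplacian. Derivatives are two-sided even at v = 0 and r =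
  \<open>r0\<close>, as the solution is regular on an open set around the region.\<close>

locale polar_wave =
  fixes M r0 :: real and m m' :: "real \<Rightarrow> real"
    and u ut ur utt utr urr f :: "real \<Rightarrow> real \<Rightarrow> real^3 \<Rightarrow> real"
    and oa ota ora ooa :: "3 \<Rightarrow> real \<Rightarrow> real \<Rightarrow> real^3 \<Rightarrow> real"
  assumes M: "M > 0" and r0: "r0 > 0"
    and m_deriv: "\<And>r. r \<ge> r0 \<Longrightarrow> (m has_real_derivative m' r) (at r)"
    and m'_cont: "continuous_on {r0..} m'"
    and D:
      "\<And>v r \<omega>. v \<ge> 0 \<Longrightarrow> r \<ge> r0 \<Longrightarrow> \<omega> \<in> sphere 0 1 \<Longrightarrow> ((\<lambda>v. u v r \<omega>) has_real_derivative ut v r \<omega>) (at v)"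
      "\<And>v r \<omega>. v \<ge> 0 \<Longrightarrow> r \<ge> r0 \<Longrightarrow> \<omega> \<in> sphere 0 1 \<Longrightarrow> ((\<lambda>r. u v r \<omega>) has_real_derivative ur v r \<omega>) (at r)"
      "\<And>v r \<omega>. v \<ge> 0 \<Longrightarrow> r \<ge> r0 \<Longrightarrow> \<omega> \<in> sphere 0 1 \<Longrightarrow> ((\<lambda>v. ut v r \<omega>) has_real_derivative utt v r \<omega>) (at v)"
      "\<And>v r \<omega>. v \<ge> 0 \<Longrightarrow> r \<ge> r0 \<Longrightarrow> \<omega> \<in> sphere 0 1 \<Longrightarrow> ((\<lambda>r. ut v r \<omega>) has_real_derivative utr v r \<omega>) (at r)"
      "\<And>v r \<omega>. v \<ge> 0 \<Longrightarrow> r \<ge> r0 \<Longrightarrow> \<omega> \<in> sphere 0 1 \<Longrightarrow> ((\<lambda>v. ur v r \<omega>) has_real_derivative utr v r \<omega>) (at v)"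
      "\<And>v r \<omega>. v \<ge> 0 \<Longrightarrow> r \<ge> r0 \<Longrightarrow> \<omega> \<in> sphere 0 1 \<Longrightarrow> ((\<lambda>r. ur v r \<omega>) has_real_derivative urr v r \<omega>) (at r)"
      "\<And>v r \<omega> a. v \<ge> 0 \<Longrightarrow> r \<ge> r0 \<Longrightarrow> \<omega> \<in> sphere 0 1 \<Longrightarrow> ((\<lambda>v. oa a v r \<omega>) has_real_derivative ota a v r \<omega>) (at v)"
      "\<And>v r \<omega> a. v \<ge> 0 \<Longrightarrow> r \<ge> r0 \<Longrightarrow> \<omega> \<in> sphere 0 1 \<Longrightarrow> ((\<lambda>r. oa a v r \<omega>) has_real_derivative ora a v r \<omega>) (at r)"
    and cont:
      "continuous_on ({0..} \<times> {r0..} \<times> sphere 0 1) (\<lambda>(v,r,\<omega>). u v r \<omega>)"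
      "continuous_on ({0..} \<times> {r0..} \<times> sphere 0 1) (\<lambda>(v,r,\<omega>). ut v r \<omega>)"
      "continuous_on ({0..} \<times> {r0..} \<times> sphere 0 1) (\<lambda>(v,r,\<omega>). ur v r \<omega>)"
      "continuous_on ({0..} \<times> {r0..} \<times> sphere 0 1) (\<lambda>(v,r,\<omega>). utt v r \<omega>)"
      "continuous_on ({0..} \<times> {r0..} \<times> sphere 0 1) (\<lambda>(v,r,\<omega>). utr v r \<omega>)"
      "continuous_on ({0..} \<times> {r0..} \<times> sphere 0 1) (\<lambda>(v,r,\<omega>). urr v r \<omega>)"
      "\<And>a. continuous_on ({0..} \<times> {r0..} \<times> sphere 0 1) (\<lambda>(v,r,\<omega>). oa a v r \<omega>)"
      "\<And>a. continuous_on ({0..} \<times> {r0..} \<times> sphere 0 1) (\<lambda>(v,r,\<omega>). ota a v r \<omega>)"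
      "\<And>a. continuous_on ({0..} \<times> {r0..} \<times> sphere 0 1) (\<lambda>(v,r,\<omega>). ora a v r \<omega>)"
      "\<And>a. continuous_on ({0..} \<times> {r0..} \<times> sphere 0 1) (\<lambda>(v,r,\<omega>). ooa a v r \<omega>)"
    and wave: "\<And>v r \<omega>. v \<ge> 0 \<Longrightarrow> r \<ge> r0 \<Longrightarrow> \<omega> \<in> sphere 0 1 \<Longrightarrow>
      r\<^sup>2 * f v r \<omega> = 2 * r\<^sup>2 * (utr v r \<omega> - m r * utt v r \<omega>) + 2 * r * ut v r \<omega>
        + (2 * r - 2 * M) * (ur v r \<omega> - m r * ut v r \<omega>)
        + r\<^sup>2 * lapse M r * (urr v r \<omega> - 2 * m r * utr v r \<omega> + (m r)\<^sup>2 * utt v r \<omega> - m' r * ut v r \<omega>)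
        + (\<Sum>a\<in>UNIV. ooa a v r \<omega>)"
    and parts:
      "\<And>v r a. v \<ge> 0 \<Longrightarrow> r \<ge> r0 \<Longrightarrow> sphere_int (\<lambda>\<omega>. u v r \<omega> * ooa a v r \<omega> + oa a v r \<omega> * oa a v r \<omega>) = 0"
      "\<And>v r a. v \<ge> 0 \<Longrightarrow> r \<ge> r0 \<Longrightarrow> sphere_int (\<lambda>\<omega>. ut v r \<omega> * ooa a v r \<omega> + ota a v r \<omega> * oa a v r \<omega>) = 0"
      "\<And>v r a. v \<ge> 0 \<Longrightarrow> r \<ge> r0 \<Longrightarrow> sphere_int (\<lambda>\<omega>. ur v r \<omega> * ooa a v r \<omega> + ora a v r \<omega> * oa a v r \<omega>) = 0"

definition rad2 :: "(real^4 \<Rightarrow> real) \<Rightarrow> real \<Rightarrow> real \<Rightarrow> real^3 \<Rightarrow> real" where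
  "rad2 K v r \<omega> = (\<Sum>i\<in>UNIV. \<Sum>j\<in>UNIV. \<omega>$i * \<omega>$j * partial (emb j) (partial (emb i) K) (pt v r \<omega>))"

text \<open>The gradient in \<omega> of \<open>rad1\<close>, as the next definition is that of
  \<open>rot1\<close>, with \<omega> varying freely in three-space. Angular integration by parts
  applied to derivatives of the solution needs these gradients on the sphere.\<close>

definition radgrad :: "(real^4 \<Rightarrow> real) \<Rightarrow> real \<Rightarrow> real \<Rightarrow> real^3 \<Rightarrow> 3 \<Rightarrow> real" where
  "radgrad K v r \<omega> i = partial (emb i) K (pt v r \<omega>)
     + r * (\<Sum>j\<in>UNIV. \<omega>$j * partial (emb i) (partial (emb j) K) (pt v r \<omega>))"

definition rotgrad :: "3 \<Rightarrow> (real^4 \<Rightarrow> real) \<Rightarrow> real \<Rightarrow> real \<Rightarrow> real^3 \<Rightarrow> 3 \<Rightarrow> real" where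
  "rotgrad a K v r \<omega> i = rot a (\<lambda>j. r * partial (emb j) K (pt v r \<omega>)) (axis i 1)
     + rot a (\<lambda>j. r * (r * partial (emb i) (partial (emb j) K) (pt v r \<omega>))) \<omega>"

lemma has_derivative_rot:
  assumes "\<And>j. ((\<lambda>\<omega>. d j \<omega>) has_derivative (\<lambda>e. \<Sum>i\<in>UNIV. e$i * d' i j)) (at \<omega>)"
  shows "((\<lambda>\<omega>. rot a (\<lambda>j. d j \<omega>) \<omega>) has_derivative
    (\<lambda>e. \<Sum>i\<in>UNIV. e$i * (rot a (\<lambda>j. d j \<omega>) (axis i 1) + rot a (\<lambda>j. d' i j) \<omega>))) (at \<omega>)"
proof -
  have nth: "((\<lambda>\<omega>::real^3. \<omega>$j) has_derivative (\<lambda>e. e$j)) (at \<omega>)" for j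
    by (rule bounded_linear.has_derivative[OF bounded_linear_vec_nth has_derivative_ident])
  have *: "((\<lambda>\<omega>. \<omega>$b * d c \<omega> - \<omega>$c * d b \<omega>) has_derivative
      (\<lambda>e. \<omega>$b * (\<Sum>i\<in>UNIV. e$i * d' i c) + e$b * d c \<omega> - (\<omega>$c * (\<Sum>i\<in>UNIV. e$i * d' i b) + e$c * d b \<omega>))) (at \<omega>)" for b c
    by (intro has_derivative_diff has_derivative_mult nth assms)
  consider "a = 1" | "a = 2" | "a = 3" using exhaust_3 by blast
  then show ?thesis
  proof cases
    case 1
    show ?thesis unfolding rot_def using 1
      by simp (rule has_derivative_eq_rhs[OF *], simp add: fun_eq_iff sum_3 axis_def algebra_simps)
  next
    case 2
    show ?thesis unfolding rot_def using 2
      by simp (rule has_derivative_eq_rhs[OF *], simp add: fun_eq_iff sum_3 axis_def algebra_simps)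
  next
    case 3
    show ?thesis unfolding rot_def using 3
      by simp (rule has_derivative_eq_rhs[OF *], simp add: fun_eq_iff sum_3 axis_def algebra_simps)
  qed
qed

lemma rot_has_real_derivative:
  assumes "\<And>j. ((\<lambda>s. d j s) has_real_derivative d' j) (at s)"
  shows "((\<lambda>s. rot a (\<lambda>j. d j s) \<omega>) has_real_derivative rot a d' \<omega>) (at s)"
proof -
  have "((\<lambda>s. \<omega>$b * d c s - \<omega>$c * d b s) has_real_derivative \<omega>$b * d' c - \<omega>$c * d' b) (at s)" for b c
    by (intro DERIV_diff DERIV_cmult assms)
  then show ?thesis unfolding rot_def by simp
qed

lemma continuous_on_rot:
  assumes "\<And>j. continuous_on A (\<lambda>x. d j x)" "continuous_on A w"
  shows "continuous_on A (\<lambda>x. rot a (\<lambda>j. d j x) (w x))"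
  unfolding rot_def using assms by (cases "a = 1"; cases "a = 2"; simp; intro continuous_intros)

text \<open>The squares of the rotation fields add up to the spherical Laplacian, which is r^2 times
  the Euclidean Laplacian minus its radial part r^2 \<partial>_r^2 + 2 r \<partial>_r.\<close>

lemma rotgrad_trace:
  assumes one: "(\<omega>$1)\<^sup>2 + (\<omega>$2)\<^sup>2 + (\<omega>$3)\<^sup>2 = 1"
    and sym: "\<And>i j. partial (emb i) (partial (emb j) K) (pt v r \<omega>) = partial (emb j) (partial (emb i) K) (pt v r \<omega>)"
  shows "(\<Sum>a\<in>UNIV. rot a (rotgrad a K v r \<omega>) \<omega>) =
    r\<^sup>2 * ((\<Sum>i\<in>UNIV. partial (emb i) (partial (emb i) K) (pt v r \<omega>)) - rad2 K v r \<omega>) - 2 * r * rad1 K v r \<omega>"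
proof -
  have s: "partial 3 (partial 2 K) (pt v r \<omega>) = partial 2 (partial 3 K) (pt v r \<omega>)"
    "partial 4 (partial 2 K) (pt v r \<omega>) = partial 2 (partial 4 K) (pt v r \<omega>)"
    "partial 4 (partial 3 K) (pt v r \<omega>) = partial 3 (partial 4 K) (pt v r \<omega>)"
    using sym[of 2 1] sym[of 3 1] sym[of 3 2] by auto
  show ?thesis
    unfolding sum_3 rotgrad_def rot_def rad2_def rad1_def
    apply (simp add: axis_def s)
    using one by algebra
qed

lemma polar_wave_of_solution:
  assumes M: "M > 0" and r0: "r0 > 0"
    and mu: "\<And>n r. r \<ge> r0 \<Longrightarrow> (deriv ^^ n) \<mu> differentiable (at r)"
    and U: "open U" "region r0 \<subseteq> U" and C2: "C2_on U \<phi>"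
    and box: "\<And>p. p \<in> region r0 \<Longrightarrow> dalembertian (schw_metric M \<mu>) \<phi> p = f p"
  shows "polar_wave M r0 (deriv \<mu>) (deriv (deriv \<mu>))
    (\<lambda>v r \<omega>. \<phi> (pt v r \<omega>)) (\<lambda>v r \<omega>. partial 1 \<phi> (pt v r \<omega>)) (rad1 \<phi>)
    (\<lambda>v r \<omega>. partial 1 (partial 1 \<phi>) (pt v r \<omega>)) (rad1 (partial 1 \<phi>)) (rad2 \<phi>)
    (\<lambda>v r \<omega>. f (pt v r \<omega>))
    (\<lambda>a. rot1 a \<phi>) (\<lambda>a. rot1 a (partial 1 \<phi>))
    (\<lambda>a v r \<omega>. rot a (radgrad \<phi> v r \<omega>) \<omega>) (\<lambda>a v r \<omega>. rot a (rotgrad a \<phi> v r \<omega>) \<omega>)"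
proof -
  let ?dom = "{0..} \<times> {r0..} \<times> (sphere 0 1 :: (real^3) set)"
  have reg: "pt v r \<omega> \<in> region r0" if "v \<ge> 0" "r \<ge> r0" "\<omega> \<in> sphere 0 1" for v r \<omega>
    using that r0 by (simp add: region_def rad_pt)
  then have inU: "pt v r \<omega> \<in> U" if "v \<ge> 0" "r \<ge> r0" "\<omega> \<in> sphere 0 1" for v r \<omega>
    using that U by blast
  have d0: "\<phi> differentiable (at (pt v r \<omega>))"
    and d1: "partial i \<phi> differentiable (at (pt v r \<omega>))"
    if "v \<ge> 0" "r \<ge> r0" "\<omega> \<in> sphere 0 1" for v r \<omega> i
    using inU[OF that] C2 unfolding C2_on_def by blast+
  have comm: "partial i (partial j \<phi>) (pt v r \<omega>) = partial j (partial i \<phi>) (pt v r \<omega>)"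
    if "v \<ge> 0" "r \<ge> r0" "\<omega> \<in> sphere 0 1" for v r \<omega> i j
    using partial_commute[OF U(1) inU[OF that] C2] .
  have cK: "continuous_on ?dom (\<lambda>x. K (pt (fst x) (fst (snd x)) (snd (snd x))))"
    if "continuous_on U K" for K :: "real^4 \<Rightarrow> real"
    by (rule continuous_on_compose2[OF that continuous_on_pt[unfolded case_prod_unfold]]) (auto intro!: inU)
  have c0: "continuous_on U \<phi>" and c1: "continuous_on U (partial i \<phi>)" for i
    using C2 unfolding C2_on_def
    by (meson continuous_at_imp_continuous_on differentiable_imp_continuous_within)+
  have c2: "continuous_on U (partial i (partial j \<phi>))" for i j
    using C2 unfolding C2_on_def by blast
  note cc = cK[OF c0] cK[OF c1] cK[OF c2]
  have cw: "continuous_on ?dom (\<lambda>x. snd (snd x))" "continuous_on ?dom (\<lambda>x. snd (snd x) $ i)"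
    "continuous_on ?dom (\<lambda>x. fst (snd x))" for i
    by (intro continuous_intros)+
  note cs = continuous_on_mult continuous_on_add continuous_on_sum continuous_on_rot continuous_on_const cc cw
  have slice: "continuous_on (sphere 0 1) (\<lambda>\<omega>. K v r \<omega>)"
    if "continuous_on ?dom (\<lambda>(v,r,\<omega>). K v r \<omega>)" "v \<ge> 0" "r \<ge> r0" for K :: "real \<Rightarrow> real \<Rightarrow> real^3 \<Rightarrow> real" and v r
  proof -
    have "continuous_on (sphere 0 1) (\<lambda>\<omega>. (v, r, \<omega>))" by (intro continuous_intros)
    from continuous_on_compose2[OF that(1) this] show ?thesis using that by auto
  qed
  have C: "continuous_on ?dom (\<lambda>(v,r,\<omega>). \<phi> (pt v r \<omega>))"
    "continuous_on ?dom (\<lambda>(v,r,\<omega>). partial 1 \<phi> (pt v r \<omega>))"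
    "continuous_on ?dom (\<lambda>(v,r,\<omega>). rad1 \<phi> v r \<omega>)"
    "continuous_on ?dom (\<lambda>(v,r,\<omega>). partial 1 (partial 1 \<phi>) (pt v r \<omega>))"
    "continuous_on ?dom (\<lambda>(v,r,\<omega>). rad1 (partial 1 \<phi>) v r \<omega>)"
    "continuous_on ?dom (\<lambda>(v,r,\<omega>). rad2 \<phi> v r \<omega>)"
    "\<And>a. continuous_on ?dom (\<lambda>(v,r,\<omega>). rot1 a \<phi> v r \<omega>)"
    "\<And>a. continuous_on ?dom (\<lambda>(v,r,\<omega>). rot1 a (partial 1 \<phi>) v r \<omega>)"
    "\<And>a. continuous_on ?dom (\<lambda>(v,r,\<omega>). rot a (radgrad \<phi> v r \<omega>) \<omega>)"
    "\<And>a. continuous_on ?dom (\<lambda>(v,r,\<omega>). rot a (rotgrad a \<phi> v r \<omega>) \<omega>)"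
    unfolding case_prod_unfold rad1_def rad2_def rot1_def radgrad_def rotgrad_def
    by (intro cs)+
  have G: "continuous_on ?dom (\<lambda>(v,r,\<omega>). r * partial (emb i) \<phi> (pt v r \<omega>))"
    "continuous_on ?dom (\<lambda>(v,r,\<omega>). r * partial (emb i) (partial 1 \<phi>) (pt v r \<omega>))"
    "continuous_on ?dom (\<lambda>(v,r,\<omega>). radgrad \<phi> v r \<omega> i)"
    "continuous_on ?dom (\<lambda>(v,r,\<omega>). rotgrad a \<phi> v r \<omega> i)" for a i
    unfolding case_prod_unfold radgrad_def rotgrad_def by (intro cs)+
  have mud: "((deriv ^^ n) \<mu> has_real_derivative (deriv ^^ Suc n) \<mu> r) (at r)" if "r \<ge> r0" for r n
    using mu[OF that, of n] by (simp add: DERIV_deriv_iff_real_differentiable)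
  have gu: "((\<lambda>\<omega>. \<phi> (pt v r \<omega>)) has_derivative (\<lambda>d. \<Sum>i\<in>UNIV. d$i * (r * partial (emb i) \<phi> (pt v r \<omega>)))) (at \<omega>)"
    and gut: "((\<lambda>\<omega>. partial 1 \<phi> (pt v r \<omega>)) has_derivative (\<lambda>d. \<Sum>i\<in>UNIV. d$i * (r * partial (emb i) (partial 1 \<phi>) (pt v r \<omega>)))) (at \<omega>)"
    and gur: "(rad1 \<phi> v r has_derivative (\<lambda>d. \<Sum>i\<in>UNIV. d$i * radgrad \<phi> v r \<omega> i)) (at \<omega>)"
    and goa: "(rot1 a \<phi> v r has_derivative (\<lambda>d. \<Sum>i\<in>UNIV. d$i * rotgrad a \<phi> v r \<omega> i)) (at \<omega>)"
    if "v \<ge> 0" "r \<ge> r0" "\<omega> \<in> sphere 0 1" for v r \<omega> a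
  proof -
    note g1 = has_derivative_pt(3)[OF d1[OF that]]
    show "((\<lambda>\<omega>. \<phi> (pt v r \<omega>)) has_derivative (\<lambda>d. \<Sum>i\<in>UNIV. d$i * (r * partial (emb i) \<phi> (pt v r \<omega>)))) (at \<omega>)"
      by (rule has_derivative_pt(3)[OF d0[OF that]])
    show "((\<lambda>\<omega>. partial 1 \<phi> (pt v r \<omega>)) has_derivative (\<lambda>d. \<Sum>i\<in>UNIV. d$i * (r * partial (emb i) (partial 1 \<phi>) (pt v r \<omega>)))) (at \<omega>)"
      by (rule g1)
    have nth: "((\<lambda>\<omega>::real^3. \<omega>$j) has_derivative (\<lambda>e. e$j)) (at \<omega>)" for j
      by (rule bounded_linear.has_derivative[OF bounded_linear_vec_nth has_derivative_ident])
    have "((\<lambda>\<omega>. \<Sum>i\<in>UNIV. \<omega>$i * partial (emb i) \<phi> (pt v r \<omega>)) has_derivative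
       (\<lambda>d. \<Sum>i\<in>UNIV. \<omega>$i * (\<Sum>j\<in>UNIV. d$j * (r * partial (emb j) (partial (emb i) \<phi>) (pt v r \<omega>))) + d$i * partial (emb i) \<phi> (pt v r \<omega>))) (at \<omega>)"
      by (intro has_derivative_sum has_derivative_mult nth g1)
    then show "(rad1 \<phi> v r has_derivative (\<lambda>d. \<Sum>i\<in>UNIV. d$i * radgrad \<phi> v r \<omega> i)) (at \<omega>)"
      unfolding rad1_def[abs_def]
      by (rule has_derivative_eq_rhs) (simp add: fun_eq_iff radgrad_def sum_3 algebra_simps)
    have "((\<lambda>\<omega>. r * partial (emb j) \<phi> (pt v r \<omega>)) has_derivative
       (\<lambda>d. \<Sum>i\<in>UNIV. d$i * (r * (r * partial (emb i) (partial (emb j) \<phi>) (pt v r \<omega>))))) (at \<omega>)" for j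
      by (rule has_derivative_eq_rhs[OF has_derivative_mult_right[OF g1]])
         (simp add: fun_eq_iff sum_3 algebra_simps)
    from has_derivative_rot[OF this, of a]
    show "(rot1 a \<phi> v r has_derivative (\<lambda>d. \<Sum>i\<in>UNIV. d$i * rotgrad a \<phi> v r \<omega> i)) (at \<omega>)"
      unfolding rot1_def[abs_def] rotgrad_def .
  qed
  have rg: "rot a (radgrad \<phi> v r \<omega>) \<omega> = rot a (\<lambda>j. 1 * partial (emb j) \<phi> (pt v r \<omega>) + rad1 (partial (emb j) \<phi>) v r \<omega> * r) \<omega>"
    if "v \<ge> 0" "r \<ge> r0" "\<omega> \<in> sphere 0 1" for v r \<omega> a
    unfolding rot_def radgrad_def rad1_def sum_3 using comm[OF that] by (simp add: algebra_simps)
  show ?thesis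
  proof (unfold_locales; (rule M r0 C)?)
    show "continuous_on {r0..} (deriv (deriv \<mu>))"
      using mud[of _ 2] by (intro continuous_at_imp_continuous_on ballI DERIV_isCont) (auto simp: numeral_2_eq_2)
    fix r assume r: "r \<ge> r0"
    then have rpos: "r > 0" using r0 by simp
    show "(deriv \<mu> has_real_derivative deriv (deriv \<mu>) r) (at r)"
      using mud[OF r, of 1] by simp
    fix v :: real assume v: "v \<ge> 0"
    {
      fix a
      show "sphere_int (\<lambda>\<omega>. \<phi> (pt v r \<omega>) * rot a (rotgrad a \<phi> v r \<omega>) \<omega> + rot1 a \<phi> v r \<omega> * rot1 a \<phi> v r \<omega>) = 0"
        using sphere_int_by_parts[OF gu[OF v r] goa[OF v r] slice[OF G(1) v r] slice[OF G(4) v r], of a a]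
        by (simp add: rot1_def)
      show "sphere_int (\<lambda>\<omega>. partial 1 \<phi> (pt v r \<omega>) * rot a (rotgrad a \<phi> v r \<omega>) \<omega> + rot1 a (partial 1 \<phi>) v r \<omega> * rot1 a \<phi> v r \<omega>) = 0"
        using sphere_int_by_parts[OF gut[OF v r] goa[OF v r] slice[OF G(2) v r] slice[OF G(4) v r], of a a]
        by (simp add: rot1_def)
      show "sphere_int (\<lambda>\<omega>. rad1 \<phi> v r \<omega> * rot a (rotgrad a \<phi> v r \<omega>) \<omega> + rot a (radgrad \<phi> v r \<omega>) \<omega> * rot1 a \<phi> v r \<omega>) = 0"
        using sphere_int_by_parts[OF gur[OF v r] goa[OF v r] slice[OF G(3) v r] slice[OF G(4) v r], of a a]
        by simp
    }
    fix \<omega> :: "real^3" assume w: "\<omega> \<in> sphere 0 1"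
    note d0 = d0[OF v r w] and d1 = d1[OF v r w] and comm = comm[OF v r w]
    show "((\<lambda>v. \<phi> (pt v r \<omega>)) has_real_derivative partial 1 \<phi> (pt v r \<omega>)) (at v)"
      "((\<lambda>r. \<phi> (pt v r \<omega>)) has_real_derivative rad1 \<phi> v r \<omega>) (at r)"
      "((\<lambda>v. partial 1 \<phi> (pt v r \<omega>)) has_real_derivative partial 1 (partial 1 \<phi>) (pt v r \<omega>)) (at v)"
      "((\<lambda>r. partial 1 \<phi> (pt v r \<omega>)) has_real_derivative rad1 (partial 1 \<phi>) v r \<omega>) (at r)"
      by (intro has_derivative_pt d0 d1)+
    show "((\<lambda>v. rad1 \<phi> v r \<omega>) has_real_derivative rad1 (partial 1 \<phi>) v r \<omega>) (at v)"
      unfolding rad1_def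
      by (intro DERIV_sum DERIV_cmult) (use has_derivative_pt(1)[OF d1] comm in metis)
    have "((\<lambda>r. rad1 \<phi> v r \<omega>) has_real_derivative (\<Sum>i\<in>UNIV. \<omega>$i * rad1 (partial (emb i) \<phi>) v r \<omega>)) (at r)"
      unfolding rad1_def[of \<phi>] by (intro DERIV_sum DERIV_cmult has_derivative_pt(2) d1)
    then show "((\<lambda>r. rad1 \<phi> v r \<omega>) has_real_derivative rad2 \<phi> v r \<omega>) (at r)"
      by (simp add: rad2_def rad1_def sum_distrib_left mult.assoc)
    fix a
    have "((\<lambda>v. rot1 a \<phi> v r \<omega>) has_real_derivative rot a (\<lambda>j. r * partial 1 (partial (emb j) \<phi>) (pt v r \<omega>)) \<omega>) (at v)"
      unfolding rot1_def by (intro rot_has_real_derivative DERIV_cmult has_derivative_pt(1) d1)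
    then show "((\<lambda>v. rot1 a \<phi> v r \<omega>) has_real_derivative rot1 a (partial 1 \<phi>) v r \<omega>) (at v)"
      by (simp add: rot1_def comm[of _ 1])
    have "((\<lambda>r. rot1 a \<phi> v r \<omega>) has_real_derivative
        rot a (\<lambda>j. 1 * partial (emb j) \<phi> (pt v r \<omega>) + rad1 (partial (emb j) \<phi>) v r \<omega> * r) \<omega>) (at r)"
      unfolding rot1_def by (intro rot_has_real_derivative DERIV_mult DERIV_ident has_derivative_pt(2) d1)
    then show "((\<lambda>r. rot1 a \<phi> v r \<omega>) has_real_derivative rot a (radgrad \<phi> v r \<omega>) \<omega>) (at r)"
      by (simp only: rg[OF v r w])
  next
    fix r v :: real and \<omega> :: "real^3" assume v: "v \<ge> 0" and r: "r \<ge> r0" and w: "\<omega> \<in> sphere 0 1"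
    then have rpos: "r > 0" using r0 by simp
    note comm = comm[OF v r w]
    have radp: "rad (pt v r \<omega>) = r" using w rpos by (simp add: rad_pt)
    have dr: "dr_cov (pt v r \<omega>) 1 = 0" "dr_cov (pt v r \<omega>) 2 = \<omega>$1" "dr_cov (pt v r \<omega>) 3 = \<omega>$2" "dr_cov (pt v r \<omega>) 4 = \<omega>$3"
      using rpos unfolding dr_cov_def radp by simp_all
    have one: "(\<omega>$1)\<^sup>2 + (\<omega>$2)\<^sup>2 + (\<omega>$3)\<^sup>2 = 1" using norm_vec3[of \<omega>] w by simp
    define h where "h = lapse M r"
    define mm where "mm = deriv \<mu> r"
    define m' where "m' = deriv (deriv \<mu>) r"
    define DD where "DD i j = partial i (partial j \<phi>) (pt v r \<omega>)" for i j
    have DDs: "DD 2 1 = DD 1 2" "DD 3 1 = DD 1 3" "DD 4 1 = DD 1 4" "DD 3 2 = DD 2 3" "DD 4 2 = DD 2 4" "DD 4 3 = DD 3 4"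
      unfolding DD_def by (rule comm)+
    have mu1: "(deriv \<mu> has_real_derivative m') (at r)"
      using mud[OF r, of 1] by (simp add: m'_def)
    have S: "(\<Sum>i\<in>UNIV. \<Sum>j\<in>UNIV. schw_inv M \<mu> (pt v r \<omega>) $ i $ j * DD i j)
      = - (2 * mm - h * mm\<^sup>2) * DD 1 1 + 2 * (1 - h * mm) * rad1 (partial 1 \<phi>) v r \<omega>
       + h * rad2 \<phi> v r \<omega> + ((\<Sum>i\<in>UNIV. DD (emb i) (emb i)) - rad2 \<phi> v r \<omega>)"
      unfolding rad1_def rad2_def sum_3 emb_simps DD_def[symmetric] sum_4
      by (simp add: schw_inv_def Let_def sphere_part_def dv_cov_def radp dr h_def[symmetric] mm_def[symmetric] DDs algebra_simps)
    have tr: "(\<Sum>a\<in>UNIV. rot a (rotgrad a \<phi> v r \<omega>) \<omega>) =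
      r\<^sup>2 * ((\<Sum>i\<in>UNIV. DD (emb i) (emb i)) - rad2 \<phi> v r \<omega>) - 2 * r * rad1 \<phi> v r \<omega>"
      unfolding DD_def by (rule rotgrad_trace[OF one comm])
    have r1: "(\<Sum>k\<in>UNIV. dr_cov (pt v r \<omega>) k * partial k \<phi> (pt v r \<omega>)) = rad1 \<phi> v r \<omega>"
      unfolding rad1_def sum_3 sum_4 dr by simp
    have F: "f (pt v r \<omega>) = (\<Sum>i\<in>UNIV. \<Sum>j\<in>UNIV. schw_inv M \<mu> (pt v r \<omega>) $ i $ j * DD i j)
     + (2 * (1 - h * mm) / r - (2*M/r\<^sup>2 * mm + h * m')) * partial 1 \<phi> (pt v r \<omega>)
     + (2*M/r\<^sup>2 + 2 * (h - 1) / r) * rad1 \<phi> v r \<omega>"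
      using dalembertian_schw[of "pt v r \<omega>" \<mu> m' M \<phi>] box[OF reg[OF v r w]] mu1 rpos
      unfolding radp r1 DD_def h_def mm_def by simp
    define c1 where "c1 = 2 * (1 - h * mm) / r - (2*M/r\<^sup>2 * mm + h * m')"
    define c2 where "c2 = 2*M/r\<^sup>2 + 2 * (h - 1) / r"
    have c: "r\<^sup>2 * c1 = 2 * r * (1 - h * mm) - (2*M * mm + r\<^sup>2 * h * m')" "r\<^sup>2 * c2 = 2*M + 2 * r * (h - 1)"
      using rpos by (simp_all add: c1_def c2_def field_simps power2_eq_square)
    have "r\<^sup>2 * f (pt v r \<omega>) = r\<^sup>2 * (- (2 * mm - h * mm\<^sup>2) * DD 1 1 + 2 * (1 - h * mm) * rad1 (partial 1 \<phi>) v r \<omega>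
       + h * rad2 \<phi> v r \<omega>) + ((\<Sum>a\<in>UNIV. rot a (rotgrad a \<phi> v r \<omega>) \<omega>) + 2 * r * rad1 \<phi> v r \<omega>)
     + (2 * r * (1 - h * mm) - (2*M * mm + r\<^sup>2 * h * m')) * partial 1 \<phi> (pt v r \<omega>)
     + (2*M + 2 * r * (h - 1)) * rad1 \<phi> v r \<omega>"
      using F[unfolded S c1_def[symmetric] c2_def[symmetric]] c tr by algebra
    \<comment> \<open>Trading the Euclidean Laplacian for the rotation fields costs 2 r
      \<partial>_r; together with 2 M + 2 r (h - 1) this gives 2 M + 2 r h = 2 r - 2 M, the
      derivative of r^2 h.\<close>
    moreover have "r * h = r - 2 * M" using rpos by (simp add: h_def lapse_def field_simps)
    ultimately show "r\<^sup>2 * f (pt v r \<omega>) =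
         2 * r\<^sup>2 * (rad1 (partial 1 \<phi>) v r \<omega> - deriv \<mu> r * partial 1 (partial 1 \<phi>) (pt v r \<omega>)) +
         2 * r * partial 1 \<phi> (pt v r \<omega>) +
         (2 * r - 2 * M) * (rad1 \<phi> v r \<omega> - deriv \<mu> r * partial 1 \<phi> (pt v r \<omega>)) +
         r\<^sup>2 * lapse M r *
         (rad2 \<phi> v r \<omega> - 2 * deriv \<mu> r * rad1 (partial 1 \<phi>) v r \<omega> +
          (deriv \<mu> r)\<^sup>2 * partial 1 (partial 1 \<phi>) (pt v r \<omega>) -
          deriv (deriv \<mu>) r * partial 1 \<phi> (pt v r \<omega>)) +
         (\<Sum>a\<in>UNIV. rot a (rotgrad a \<phi> v r \<omega>) \<omega>)"
      unfolding h_def[symmetric] mm_def[symmetric] m'_def[symmetric] DD_def[of 1 1, symmetric]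
      by algebra
  qed
qed

section \<open>Multiplier identity\<close>

text \<open>The multiplier is \<open>cY\<close> L - \<open>cB\<close> P + \<open>cq\<close>. Primed
  fields stand for r-derivatives, tied to the others by \<open>coefs_on\<close>. \<open>ca\<close>
  and \<open>cb\<close> are no part of the multiplier: they weight the product rules for
  \<partial>_v (a u^2) and L (b u^2), which hold for every function u and move zeroth order terms
  between bulk and boundary. \<open>ca\<close> is differentiated in v only and so has no primed
  companion.\<close>

record coefs =
  cB :: "real \<Rightarrow> real"
  cB' :: "real \<Rightarrow> real"
  cY :: "real \<Rightarrow> real"
  cY' :: "real \<Rightarrow> real"
  cq :: "real \<Rightarrow> real"
  cq' :: "real \<Rightarrow> real"
  cq'' :: "real \<Rightarrow> real"
  ca :: "real \<Rightarrow> real"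
  cb :: "real \<Rightarrow> real"
  cb' :: "real \<Rightarrow> real"

definition coefs_on :: "real \<Rightarrow> coefs \<Rightarrow> bool" where
  "coefs_on r1 K \<longleftrightarrow> (\<forall>r\<ge>r1. (cB K has_real_derivative cB' K r) (at r) \<and> (cY K has_real_derivative cY' K r) (at r)
      \<and> (cq K has_real_derivative cq' K r) (at r) \<and> (cq' K has_real_derivative cq'' K r) (at r)
      \<and> (cb K has_real_derivative cb' K r) (at r)) \<and>
    continuous_on {r1..} (cB' K) \<and> continuous_on {r1..} (cY' K) \<and> continuous_on {r1..} (cq'' K) \<and>
    continuous_on {r1..} (ca K) \<and> continuous_on {r1..} (cb' K)"

definition mult_dens :: "coefs \<Rightarrow> real \<Rightarrow> real \<Rightarrow> real \<Rightarrow> real \<Rightarrow> real" where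
  "mult_dens K r P L U = cY K r * L - cB K r * P + cq K r * U"

definition slice_dens :: "coefs \<Rightarrow> real \<Rightarrow> real \<Rightarrow> real \<Rightarrow> real \<Rightarrow> real \<Rightarrow> real \<Rightarrow> real \<Rightarrow> real" where
  "slice_dens K M m r P L Q U = (let h = lapse M r in
     r\<^sup>2 * (m * cB K r * P\<^sup>2 + (1 - m * h / 2) * cY K r * L\<^sup>2)
     + (cB K r * (1 - m * h / 2) + m * cY K r) / 2 * Q
     + cq K r * r\<^sup>2 * (U * ((1 - m * h / 2) * L - m * P))
     + (m * cb K r - ca K r - cq' K r * r\<^sup>2 * (1 - m * h) / 2) * U\<^sup>2)"

definition flux_dens :: "coefs \<Rightarrow> real \<Rightarrow> real \<Rightarrow> real \<Rightarrow> real \<Rightarrow> real \<Rightarrow> real \<Rightarrow> real" where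
  "flux_dens K M r P L Q U = (let h = lapse M r in
     r\<^sup>2 * (h * cY K r / 2 * L\<^sup>2 - cB K r * P\<^sup>2) - (cY K r - cB K r * h / 2) / 2 * Q
     + cq K r * r\<^sup>2 * (U * (P + h / 2 * L)) - (cb K r + cq' K r * r\<^sup>2 * h / 2) * U\<^sup>2)"

text \<open>The flux through a level set of v + \<mu>(r). Such a set is null and ruled by L, so
  neither P nor m survives in the combination of \<open>slice_dens\<close> and
  \<open>flux_dens\<close>. It is what meets the derivative of a cut-off depending on v +
  \<mu>(r).\<close>

definition long_dens :: "coefs \<Rightarrow> real \<Rightarrow> real \<Rightarrow> real \<Rightarrow> real \<Rightarrow> real" where
  "long_dens K r L Q U = r\<^sup>2 * cY K r * L\<^sup>2 + cB K r / 2 * Q + cq K r * r\<^sup>2 * (U * L)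
     - (ca K r + cq' K r * r\<^sup>2 / 2) * U\<^sup>2"

text \<open>Free of m, since L, the Killing direction and r do not depend on the choice of \<mu>.
  The last terms with \<open>cb\<close>, \<open>cb'\<close> and \<open>ca\<close> cancel the
  derivatives of the boundary terms that carry the same coefficients.\<close>

definition bulk_dens :: "coefs \<Rightarrow> real \<Rightarrow> real \<Rightarrow> real \<Rightarrow> real \<Rightarrow> real \<Rightarrow> real \<Rightarrow> real" where
  "bulk_dens K M r P L Q U = (let h = lapse M r in
     r\<^sup>2 * cB' K r * P\<^sup>2 + (M * cY K r - r\<^sup>2 * h / 2 * cY' K r) * L\<^sup>2
     + 2 * (r * (cY K r - cB K r * h / 2) - cq K r * r\<^sup>2) * (P * L)
     + ((cY' K r - (cB' K r * h + cB K r * (2*M/r\<^sup>2)) / 2) / 2 - cq K r) * Q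
     + ((cq'' K r * r\<^sup>2 * h + cq' K r * (2 * r - 2 * M)) / 2 + cb' K r) * U\<^sup>2
     + 2 * cb K r * (U * L) + 2 * ca K r * (U * (P - h / 2 * L)))"

definition slice_v :: "coefs \<Rightarrow> real \<Rightarrow> real \<Rightarrow> real \<Rightarrow> real \<Rightarrow> real \<Rightarrow> real \<Rightarrow> real \<Rightarrow> real \<Rightarrow> real \<Rightarrow> real \<Rightarrow> real" where
  "slice_v K M m r P L U Pv Lv Qv Uv = (let h = lapse M r in
     r\<^sup>2 * (m * cB K r * (2 * P * Pv) + (1 - m * h / 2) * cY K r * (2 * L * Lv))
     + (cB K r * (1 - m * h / 2) + m * cY K r) / 2 * Qv
     + cq K r * r\<^sup>2 * (Uv * ((1 - m * h / 2) * L - m * P) + U * ((1 - m * h / 2) * Lv - m * Pv))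
     + (m * cb K r - ca K r - cq' K r * r\<^sup>2 * (1 - m * h) / 2) * (2 * U * Uv))"

definition flux_r :: "coefs \<Rightarrow> real \<Rightarrow> real \<Rightarrow> real \<Rightarrow> real \<Rightarrow> real \<Rightarrow> real \<Rightarrow> real \<Rightarrow> real \<Rightarrow> real \<Rightarrow> real \<Rightarrow> real" where
  "flux_r K M r P L Q U Pr Lr Qr Ur = (let h = lapse M r; h' = 2*M/r\<^sup>2 in
     2 * r * (h * cY K r / 2 * L\<^sup>2 - cB K r * P\<^sup>2)
     + r\<^sup>2 * ((h' * cY K r + h * cY' K r) / 2 * L\<^sup>2 + h * cY K r * (L * Lr) - cB' K r * P\<^sup>2 - cB K r * (2 * P * Pr))
     - (cY' K r - (cB' K r * h + cB K r * h') / 2) / 2 * Q - (cY K r - cB K r * h / 2) / 2 * Qr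
     + (cq' K r * r\<^sup>2 + 2 * r * cq K r) * (U * (P + h / 2 * L))
     + cq K r * r\<^sup>2 * (Ur * (P + h / 2 * L) + U * (Pr + h' / 2 * L + h / 2 * Lr))
     - (cb' K r + (cq'' K r * r\<^sup>2 * h + cq' K r * (2 * r - 2 * M)) / 2) * U\<^sup>2
     - (cb K r + cq' K r * r\<^sup>2 * h / 2) * (2 * U * Ur))"

lemma long_dens_eq: "long_dens K r L Q U = slice_dens K M m r P L Q U + m * flux_dens K M r P L Q U"
  unfolding long_dens_def slice_dens_def flux_dens_def Let_def by (simp add: field_simps power2_eq_square)

text \<open>Expressed through u_r and u_t, the field Y L - B P has the coefficients Y - B h/2 and -
  (B + (Y - B h/2) m). With these the angular part of the equation turns into brackets whose sphere
  averages vanish after integration by parts; everything else is an identity of polynomials.\<close>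

lemma divergence_identity:
  fixes r M m m' ut utt utr ur urr U f :: real and o1 o1v o1r o2 :: "3 \<Rightarrow> real" and K :: coefs
  assumes r: "r > 0"
    and wave: "r\<^sup>2 * f = 2 * r\<^sup>2 * (utr - m * utt) + 2 * r * ut + (2 * r - 2 * M) * (ur - m * ut)
        + r\<^sup>2 * lapse M r * (urr - 2 * m * utr + m\<^sup>2 * utt - m' * ut) + (\<Sum>a\<in>UNIV. o2 a)"
  defines "h \<equiv> lapse M r" and "h' \<equiv> 2*M/r\<^sup>2" and "L \<equiv> ur - m * ut"
    and "Lv \<equiv> utr - m * utt" and "Lr \<equiv> urr - m' * ut - m * utr"
  defines "P \<equiv> ut + h / 2 * L" and "Pv \<equiv> utt + h / 2 * Lv" and "Pr \<equiv> utr + h' / 2 * L + h / 2 * Lr"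
    and "Q \<equiv> (\<Sum>a\<in>UNIV. (o1 a)\<^sup>2)" and "Qv \<equiv> (\<Sum>a\<in>UNIV. 2 * o1 a * o1v a)" and "Qr \<equiv> (\<Sum>a\<in>UNIV. 2 * o1 a * o1r a)"
  shows "slice_v K M m r P L U Pv Lv Qv ut + flux_r K M r P L Q U Pr Lr Qr ur + bulk_dens K M r P L Q U
     + (\<Sum>a\<in>UNIV. (cY K r - cB K r * h / 2) * (ur * o2 a + o1r a * o1 a)
         - (cB K r + (cY K r - cB K r * h / 2) * m) * (ut * o2 a + o1v a * o1 a) + cq K r * (U * o2 a + o1 a * o1 a))
     = r\<^sup>2 * f * mult_dens K r P L U"
proof -
  have h': "h' * r\<^sup>2 = 2 * M" using r by (simp add: h'_def)
  \<comment> \<open>Expressing h and M through h' removes all denominators from the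
    identity.\<close>
  have h: "h = 1 - h' * r" using r by (simp add: h_def lapse_def h'_def power2_eq_square)
  have M: "M = h' * r\<^sup>2 / 2" using h' by simp
  have utr: "utr = Lv + m * utt" and ur: "ur = L + m * ut" by (simp_all add: Lv_def L_def)
  have wave': "r\<^sup>2 * f = 2 * r\<^sup>2 * Lv + 2 * r * ut + (2 * r - 2 * M) * L + r\<^sup>2 * h * (Lr - m * Lv) + (o2 1 + o2 2 + o2 3)"
    unfolding wave h_def[symmetric] Lv_def Lr_def L_def sum_3 by (simp add: algebra_simps power2_eq_square)
  have Q: "Q = (o1 1)\<^sup>2 + (o1 2)\<^sup>2 + (o1 3)\<^sup>2"
    "Qv = 2 * (o1 1 * o1v 1 + o1 2 * o1v 2 + o1 3 * o1v 3)" "Qr = 2 * (o1 1 * o1r 1 + o1 2 * o1r 2 + o1 3 * o1r 3)"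
    by (simp_all add: Q_def Qv_def Qr_def sum_3)
  define z1 where "z1 = o2 1 + o2 2 + o2 3"
  define B where "B = cB K r"
  define B' where "B' = cB' K r"
  define Y where "Y = cY K r"
  define Y' where "Y' = cY' K r"
  define q where "q = cq K r"
  define q' where "q' = cq' K r"
  define q'' where "q'' = cq'' K r"
  define a where "a = ca K r"
  define b where "b = cb K r"
  define b' where "b' = cb' K r"
  note defs = B_def[symmetric] B'_def[symmetric] Y_def[symmetric] Y'_def[symmetric] q_def[symmetric] q'_def[symmetric]
    q''_def[symmetric] a_def[symmetric] b_def[symmetric] b'_def[symmetric]
  have S: "(\<Sum>a\<in>UNIV. (Y - B * h / 2) * (ur * o2 a + o1r a * o1 a)
         - (B + (Y - B * h / 2) * m) * (ut * o2 a + o1v a * o1 a) + q * (U * o2 a + o1 a * o1 a))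
     = (Y - B * h / 2) * (L * z1 + Qr / 2 - m * Qv / 2) - B * (ut * z1 + Qv / 2) + q * (U * z1 + Q)"
    unfolding sum_3 ur Q z1_def by (simp add: field_simps power2_eq_square)
  show ?thesis
    unfolding slice_v_def flux_r_def bulk_dens_def mult_dens_def Let_def h_def[symmetric] h'_def[symmetric] wave' defs S z1_def[symmetric]
    unfolding P_def Pv_def Pr_def ur utr M h
    by (simp add: field_simps power2_eq_square)
qed

lemma coefs_on_continuous:
  assumes "coefs_on r1 K"
  shows "continuous_on {r1..} (cB K)" "continuous_on {r1..} (cB' K)" "continuous_on {r1..} (cY K)"
    "continuous_on {r1..} (cY' K)" "continuous_on {r1..} (cq K)" "continuous_on {r1..} (cq' K)"
    "continuous_on {r1..} (cq'' K)" "continuous_on {r1..} (ca K)" "continuous_on {r1..} (cb K)" "continuous_on {r1..} (cb' K)"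
  using assms unfolding coefs_on_def
  by (blast intro: continuous_at_imp_continuous_on DERIV_isCont)+

lemma continuous_on_dens:
  fixes R mm P L Q U :: "'a::topological_space \<Rightarrow> real"
  assumes K: "coefs_on r1 K" and r1: "r1 > 0"
    and c: "continuous_on A R" "continuous_on A mm" "continuous_on A P" "continuous_on A L" "continuous_on A Q" "continuous_on A U"
    and R: "\<And>x. x \<in> A \<Longrightarrow> R x \<ge> r1"
  shows "continuous_on A (\<lambda>x. slice_dens K M (mm x) (R x) (P x) (L x) (Q x) (U x))"
    "continuous_on A (\<lambda>x. flux_dens K M (R x) (P x) (L x) (Q x) (U x))"
    "continuous_on A (\<lambda>x. long_dens K (R x) (L x) (Q x) (U x))"
    "continuous_on A (\<lambda>x. bulk_dens K M (R x) (P x) (L x) (Q x) (U x))"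
    "continuous_on A (\<lambda>x. mult_dens K (R x) (P x) (L x) (U x))"
    "\<And>Pv Lv Qv Uv. continuous_on A Pv \<Longrightarrow> continuous_on A Lv \<Longrightarrow> continuous_on A Qv \<Longrightarrow> continuous_on A Uv \<Longrightarrow>
      continuous_on A (\<lambda>x. slice_v K M (mm x) (R x) (P x) (L x) (U x) (Pv x) (Lv x) (Qv x) (Uv x))"
    "\<And>Pv Lv Qv Uv. continuous_on A Pv \<Longrightarrow> continuous_on A Lv \<Longrightarrow> continuous_on A Qv \<Longrightarrow> continuous_on A Uv \<Longrightarrow>
      continuous_on A (\<lambda>x. flux_r K M (R x) (P x) (L x) (Q x) (U x) (Pv x) (Lv x) (Qv x) (Uv x))"
proof -
  have nz: "R x \<noteq> 0" if "x \<in> A" for x using R[OF that] r1 by auto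
  have k: "continuous_on A (\<lambda>x. g (R x))" if "continuous_on {r1..} g" for g :: "real \<Rightarrow> real"
    by (rule continuous_on_compose2[OF that c(1)]) (use R in auto)
  have l: "continuous_on A (\<lambda>x. lapse M (R x))"
    unfolding lapse_def by (intro continuous_on_diff continuous_on_divide continuous_on_const c(1)) (use nz in auto)
  have d: "continuous_on A (\<lambda>x. 2 * M / (R x)\<^sup>2)"
    by (intro continuous_on_divide continuous_on_const continuous_on_power c(1)) (use nz in auto)
  have half: "continuous_on A (\<lambda>x. g x / 2)" if "continuous_on A g" for g :: "'a \<Rightarrow> real"
    by (intro continuous_on_divide that continuous_on_const) simp
  note ks = coefs_on_continuous[OF K, THEN k]
  note ci = continuous_on_add continuous_on_diff continuous_on_mult d half continuous_on_power continuous_on_const l ks c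
  show "continuous_on A (\<lambda>x. slice_dens K M (mm x) (R x) (P x) (L x) (Q x) (U x))"
    unfolding slice_dens_def Let_def by (intro ci)
  show "continuous_on A (\<lambda>x. flux_dens K M (R x) (P x) (L x) (Q x) (U x))"
    unfolding flux_dens_def Let_def by (intro ci)
  show "continuous_on A (\<lambda>x. long_dens K (R x) (L x) (Q x) (U x))"
    unfolding long_dens_def Let_def by (intro ci)
  show "continuous_on A (\<lambda>x. bulk_dens K M (R x) (P x) (L x) (Q x) (U x))"
    unfolding bulk_dens_def Let_def by (intro ci)
  show "continuous_on A (\<lambda>x. mult_dens K (R x) (P x) (L x) (U x))"
    unfolding mult_dens_def by (intro ci)
  fix Pv Lv Qv Uv :: "'a \<Rightarrow> real"
  assume c': "continuous_on A Pv" "continuous_on A Lv" "continuous_on A Qv" "continuous_on A Uv"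
  show "continuous_on A (\<lambda>x. slice_v K M (mm x) (R x) (P x) (L x) (U x) (Pv x) (Lv x) (Qv x) (Uv x))"
    unfolding slice_v_def Let_def by (intro ci c')
  show "continuous_on A (\<lambda>x. flux_r K M (R x) (P x) (L x) (Q x) (U x) (Pv x) (Lv x) (Qv x) (Uv x))"
    unfolding flux_r_def Let_def by (intro ci c')
qed

context polar_wave
begin

definition LL where "LL v r \<omega> = ur v r \<omega> - m r * ut v r \<omega>"
definition PP where "PP v r \<omega> = ut v r \<omega> + lapse M r / 2 * LL v r \<omega>"
definition QQ where "QQ v r \<omega> = (\<Sum>a\<in>UNIV. (oa a v r \<omega>)\<^sup>2)"
definition LLv where "LLv v r \<omega> = utr v r \<omega> - m r * utt v r \<omega>"
definition PPv where "PPv v r \<omega> = utt v r \<omega> + lapse M r / 2 * LLv v r \<omega>"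
definition QQv where "QQv v r \<omega> = (\<Sum>a\<in>UNIV. 2 * oa a v r \<omega> * ota a v r \<omega>)"
definition LLr where "LLr v r \<omega> = urr v r \<omega> - m' r * ut v r \<omega> - m r * utr v r \<omega>"
definition PPr where "PPr v r \<omega> = utr v r \<omega> + (2*M/r\<^sup>2) / 2 * LL v r \<omega> + lapse M r / 2 * LLr v r \<omega>"
definition QQr where "QQr v r \<omega> = (\<Sum>a\<in>UNIV. 2 * oa a v r \<omega> * ora a v r \<omega>)"

definition "slice K v r \<omega> = slice_dens K M (m r) r (PP v r \<omega>) (LL v r \<omega>) (QQ v r \<omega>) (u v r \<omega>)"
definition "flux K v r \<omega> = flux_dens K M r (PP v r \<omega>) (LL v r \<omega>) (QQ v r \<omega>) (u v r \<omega>)"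
definition "long K v r \<omega> = long_dens K r (LL v r \<omega>) (QQ v r \<omega>) (u v r \<omega>)"
definition "bulk K v r \<omega> = bulk_dens K M r (PP v r \<omega>) (LL v r \<omega>) (QQ v r \<omega>) (u v r \<omega>)"
definition "source K v r \<omega> = r\<^sup>2 * f v r \<omega> * mult_dens K r (PP v r \<omega>) (LL v r \<omega>) (u v r \<omega>)"
definition "dslice K v r \<omega> = slice_v K M (m r) r (PP v r \<omega>) (LL v r \<omega>) (u v r \<omega>)
  (PPv v r \<omega>) (LLv v r \<omega>) (QQv v r \<omega>) (ut v r \<omega>)"
definition "dflux K v r \<omega> = flux_r K M r (PP v r \<omega>) (LL v r \<omega>) (QQ v r \<omega>) (u v r \<omega>)
  (PPr v r \<omega>) (LLr v r \<omega>) (QQr v r \<omega>) (ur v r \<omega>)"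

abbreviation "dom1 r1 \<equiv> {0..} \<times> {r1..} \<times> (sphere 0 1 :: (real^3) set)"

abbreviation "cdom r1 F \<equiv> continuous_on (dom1 r1) (\<lambda>x. F (fst x) (fst (snd x)) (snd (snd x)))"

lemma cdom_subset: "cdom r0 F \<Longrightarrow> r0 \<le> r1 \<Longrightarrow> cdom r1 F"
  by (erule continuous_on_subset) auto

lemma cdom_r: "continuous_on {r0..} g \<Longrightarrow> cdom r0 (\<lambda>v r \<omega>. g r)"
  by (erule continuous_on_compose2[where f = "\<lambda>x. fst (snd x)"]) (auto intro!: continuous_on_fst continuous_on_snd continuous_on_id)

lemma m_cont: "continuous_on {r0..} m"
  using m_deriv by (auto intro!: continuous_at_imp_continuous_on DERIV_isCont)

lemma cdom_base:
  "cdom r0 u" "cdom r0 ut" "cdom r0 ur" "cdom r0 utt" "cdom r0 utr" "cdom r0 urr"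
  "cdom r0 (oa a)" "cdom r0 (ota a)" "cdom r0 (ora a)" "cdom r0 (ooa a)"
  "cdom r0 (\<lambda>v r \<omega>. r)" "cdom r0 (\<lambda>v r \<omega>. m r)" "cdom r0 (\<lambda>v r \<omega>. m' r)" "cdom r0 (\<lambda>v r \<omega>. lapse M r)"
  "cdom r0 (\<lambda>v r \<omega>. 2*M/r\<^sup>2)"
proof -
  show "cdom r0 u" "cdom r0 ut" "cdom r0 ur" "cdom r0 utt" "cdom r0 utr" "cdom r0 urr"
    "cdom r0 (oa a)" "cdom r0 (ota a)" "cdom r0 (ora a)" "cdom r0 (ooa a)"
    using cont by (simp_all add: case_prod_unfold)
  show "cdom r0 (\<lambda>v r \<omega>. r)" by (intro continuous_on_fst continuous_on_snd continuous_on_id)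
  show "cdom r0 (\<lambda>v r \<omega>. m r)" by (rule cdom_r[OF m_cont])
  show "cdom r0 (\<lambda>v r \<omega>. m' r)" by (rule cdom_r[OF m'_cont])
  have "continuous_on {r0..} (lapse M)" unfolding lapse_def[abs_def]
    by (intro continuous_on_diff continuous_on_divide continuous_on_const continuous_on_id) (use r0 in auto)
  then show "cdom r0 (\<lambda>v r \<omega>. lapse M r)" by (rule cdom_r)
  have "continuous_on {r0..} (\<lambda>r. 2*M/r\<^sup>2)"
    by (intro continuous_on_power continuous_on_divide continuous_on_const continuous_on_id) (use r0 in auto)
  then show "cdom r0 (\<lambda>v r \<omega>. 2*M/r\<^sup>2)" by (rule cdom_r)
qed

lemma cdom_derived:
  "cdom r0 LL" "cdom r0 PP" "cdom r0 QQ" "cdom r0 LLv" "cdom r0 PPv" "cdom r0 QQv" "cdom r0 LLr" "cdom r0 PPr" "cdom r0 QQr"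
proof -
  have half: "cdom r0 (\<lambda>v r \<omega>. g v r \<omega> / 2)" if "cdom r0 g" for g :: "real \<Rightarrow> real \<Rightarrow> real^3 \<Rightarrow> real"
    by (intro continuous_on_divide that continuous_on_const) simp
  note ci = continuous_on_add continuous_on_diff continuous_on_mult half cdom_base continuous_on_sum continuous_on_power continuous_on_const
  show LL: "cdom r0 LL" unfolding LL_def by (intro ci)
  show LLv: "cdom r0 LLv" unfolding LLv_def by (intro ci)
  show LLr: "cdom r0 LLr" unfolding LLr_def by (intro ci)
  show "cdom r0 PP" unfolding PP_def by (intro ci LL)
  show "cdom r0 PPv" unfolding PPv_def by (intro ci LLv)
  show "cdom r0 PPr" unfolding PPr_def by (intro ci LL LLr)
  show "cdom r0 QQ" unfolding QQ_def by (intro ci)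
  show "cdom r0 QQv" unfolding QQv_def by (intro ci)
  show "cdom r0 QQr" unfolding QQr_def by (intro ci)
qed

text \<open>The theorem puts no regularity on the source; its continuity on the region is read off
  from the equation for a twice continuously differentiable solution.\<close>

lemma cdom_f: "cdom r0 f"
proof -
  have half: "cdom r0 (\<lambda>v r \<omega>. g v r \<omega> / r\<^sup>2)" if "cdom r0 g" for g :: "real \<Rightarrow> real \<Rightarrow> real^3 \<Rightarrow> real"
    by (intro continuous_on_divide that continuous_on_power cdom_base) (use r0 in auto)
  note ci = continuous_on_add continuous_on_diff continuous_on_mult half cdom_base continuous_on_sum continuous_on_power continuous_on_const
  have "cdom r0 (\<lambda>v r \<omega>. (2 * r\<^sup>2 * (utr v r \<omega> - m r * utt v r \<omega>) + 2 * r * ut v r \<omega>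
        + (2 * r - 2 * M) * (ur v r \<omega> - m r * ut v r \<omega>)
        + r\<^sup>2 * lapse M r * (urr v r \<omega> - 2 * m r * utr v r \<omega> + (m r)\<^sup>2 * utt v r \<omega> - m' r * ut v r \<omega>)
        + (\<Sum>a\<in>UNIV. ooa a v r \<omega>)) / r\<^sup>2)"
    by (intro ci)
  then show ?thesis
    by (rule continuous_on_eq) (use wave[symmetric] r0 in auto)
qed

lemma cdom_dens:
  assumes K: "coefs_on r1 K" and r1: "r0 \<le> r1"
  shows "cdom r1 (slice K)" "cdom r1 (flux K)" "cdom r1 (long K)" "cdom r1 (bulk K)" "cdom r1 (source K)"
    "cdom r1 (dslice K)" "cdom r1 (dflux K)"
proof -
  note c = cdom_base(1,2,3,11,12)[THEN cdom_subset[OF _ r1]] cdom_derived[THEN cdom_subset[OF _ r1]]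
    cdom_f[THEN cdom_subset[OF _ r1]]
  have r1p: "r1 > 0" using r1 r0 by simp
  have R: "fst (snd x) \<ge> r1" if "x \<in> dom1 r1" for x using that by auto
  note d = continuous_on_dens[OF K r1p c(4,5) _ _ _ _ R]
  show "cdom r1 (slice K)" unfolding slice_def by (rule d; (rule c | assumption))
  show "cdom r1 (flux K)" unfolding flux_def by (rule d; (rule c | assumption))
  show "cdom r1 (long K)" unfolding long_def
    by (rule continuous_on_dens(3)[OF K r1p c(4,5) c(7) _ _ _ R]; (rule c | assumption))
  show "cdom r1 (bulk K)" unfolding bulk_def by (rule d; (rule c | assumption))
  have "cdom r1 (\<lambda>v r \<omega>. mult_dens K r (PP v r \<omega>) (LL v r \<omega>) (u v r \<omega>))"
    by (rule continuous_on_dens(5)[OF K r1p c(4,5) _ _ c(8) _ R]; (rule c | assumption))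
  then show "cdom r1 (source K)" unfolding source_def
    by (intro continuous_on_mult continuous_on_power c)
  show "cdom r1 (dslice K)" unfolding dslice_def
    by (rule continuous_on_dens(6)[OF K r1p c(4,5) _ _ c(8) _ R]; (rule c | assumption))
  show "cdom r1 (dflux K)" unfolding dflux_def by (rule d; (rule c | assumption))
qed

end

section \<open>Sphere averages and the weighted identity on a box\<close>

context polar_wave
begin

definition av :: "(real \<Rightarrow> real \<Rightarrow> real^3 \<Rightarrow> real) \<Rightarrow> real \<Rightarrow> real \<Rightarrow> real" where
  "av F v r = sphere_int (F v r)"

lemma cdom_slice:
  assumes "cdom r1 F" "v \<ge> 0" "r \<ge> r1"
  shows "continuous_on (sphere 0 1) (F v r)"
proof -
  have "continuous_on (sphere 0 1) (\<lambda>\<omega>. (v, r, \<omega>))"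
    by (intro continuous_on_Pair continuous_on_const continuous_on_id)
  from continuous_on_compose2[OF assms(1) this] show ?thesis using assms by auto
qed

lemma av_continuous:
  assumes "cdom r1 F"
  shows "continuous_on ({0..} \<times> {r1..}) (\<lambda>x. av F (fst x) (snd x))"
  unfolding av_def
proof (rule continuous_on_sphere_int)
  have c: "continuous_on (({0..} \<times> {r1..}) \<times> (sphere 0 1 :: (real^3) set)) (\<lambda>y. (fst (fst y), snd (fst y), snd y))"
    by (intro continuous_on_Pair continuous_on_fst continuous_on_snd continuous_on_id)
  have sub: "(\<lambda>y. (fst (fst y), snd (fst y), snd y)) ` (({0..} \<times> {r1..}) \<times> (sphere 0 1 :: (real^3) set)) \<subseteq> dom1 r1"
    by auto
  from continuous_on_compose2[OF assms c sub] have "continuous_on (({0..} \<times> {r1..}) \<times> (sphere 0 1 :: (real^3) set)) (\<lambda>x. F (fst (fst x)) (snd (fst x)) (snd x))"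
    by (simp only: fst_conv snd_conv)
  then show "continuous_on (({0..} \<times> {r1..}) \<times> sphere 0 1) (\<lambda>(x,\<omega>). F (fst x) (snd x) \<omega>)"
    by (simp add: case_prod_unfold)
qed

lemma av_deriv_v:
  assumes F: "cdom r1 F" "cdom r1 F'" and r: "r \<ge> r1" and v: "v \<ge> 0"
    and D: "\<And>v \<omega>. v \<ge> 0 \<Longrightarrow> \<omega> \<in> sphere 0 1 \<Longrightarrow> ((\<lambda>v. F v r \<omega>) has_real_derivative F' v r \<omega>) (at v)"
  shows "((\<lambda>v. av F v r) has_real_derivative av F' v r) (at v within {0..})"
  unfolding av_def
proof (rule sphere_int_has_derivative)
  have c: "continuous_on ({0..} \<times> (sphere 0 1 :: (real^3) set)) (\<lambda>y. (fst y, r, snd y))"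
    by (intro continuous_on_Pair continuous_on_fst continuous_on_snd continuous_on_id continuous_on_const)
  have sub: "(\<lambda>y. (fst y, r, snd y)) ` ({0..} \<times> (sphere 0 1 :: (real^3) set)) \<subseteq> dom1 r1"
    using r by auto
  from continuous_on_compose2[OF F(2) c sub] have "continuous_on ({0..} \<times> (sphere 0 1 :: (real^3) set)) (\<lambda>x. F' (fst x) r (snd x))"
    by (simp only: fst_conv snd_conv)
  then show "continuous_on ({0..} \<times> sphere 0 1) (\<lambda>(v, \<omega>). F' v r \<omega>)"
    by (simp add: case_prod_unfold)
qed (use v r D cdom_slice[OF F(1)] in \<open>auto intro: has_field_derivative_at_within\<close>)

lemma av_deriv_r:
  assumes F: "cdom r1 F" "cdom r1 F'" and r: "r \<ge> r1" and v: "v \<ge> 0"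
    and D: "\<And>r \<omega>. r \<ge> r1 \<Longrightarrow> \<omega> \<in> sphere 0 1 \<Longrightarrow> ((\<lambda>r. F v r \<omega>) has_real_derivative F' v r \<omega>) (at r)"
  shows "((\<lambda>r. av F v r) has_real_derivative av F' v r) (at r within {r1..})"
  unfolding av_def
proof (rule sphere_int_has_derivative)
  have c: "continuous_on ({r1..} \<times> (sphere 0 1 :: (real^3) set)) (\<lambda>y. (v, fst y, snd y))"
    by (intro continuous_on_Pair continuous_on_fst continuous_on_snd continuous_on_id continuous_on_const)
  have sub: "(\<lambda>y. (v, fst y, snd y)) ` ({r1..} \<times> (sphere 0 1 :: (real^3) set)) \<subseteq> dom1 r1"
    using v by auto
  from continuous_on_compose2[OF F(2) c sub] have "continuous_on ({r1..} \<times> (sphere 0 1 :: (real^3) set)) (\<lambda>x. F' v (fst x) (snd x))"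
    by (simp only: fst_conv snd_conv)
  then show "continuous_on ({r1..} \<times> sphere 0 1) (\<lambda>(r, \<omega>). F' v r \<omega>)"
    by (simp add: case_prod_unfold)
qed (use v r D cdom_slice[OF F(1)] in \<open>auto intro: has_field_derivative_at_within\<close>)

lemma D_derived:
  assumes "v \<ge> 0" "r \<ge> r0" "\<omega> \<in> sphere 0 1"
  shows "((\<lambda>v. LL v r \<omega>) has_real_derivative LLv v r \<omega>) (at v)"
    "((\<lambda>v. PP v r \<omega>) has_real_derivative PPv v r \<omega>) (at v)"
    "((\<lambda>v. QQ v r \<omega>) has_real_derivative QQv v r \<omega>) (at v)"
    "((\<lambda>r. LL v r \<omega>) has_real_derivative LLr v r \<omega>) (at r)"
    "((\<lambda>r. PP v r \<omega>) has_real_derivative PPr v r \<omega>) (at r)"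
    "((\<lambda>r. QQ v r \<omega>) has_real_derivative QQr v r \<omega>) (at r)"
proof -
  note D = D[OF assms]
  have r: "r \<noteq> 0" using assms r0 by auto
  note lap = lapse_has_real_derivative[OF r, of M]
  show Lv: "((\<lambda>v. LL v r \<omega>) has_real_derivative LLv v r \<omega>) (at v)"
    unfolding LL_def LLv_def by (intro DERIV_diff DERIV_cmult D)
  show "((\<lambda>v. PP v r \<omega>) has_real_derivative PPv v r \<omega>) (at v)"
    unfolding PP_def PPv_def by (intro DERIV_add DERIV_cmult D Lv)
  show "((\<lambda>v. QQ v r \<omega>) has_real_derivative QQv v r \<omega>) (at v)"
    unfolding QQ_def QQv_def
    by (intro DERIV_sum) (rule derivative_eq_intros D refl | simp)+
  show Lr: "((\<lambda>r. LL v r \<omega>) has_real_derivative LLr v r \<omega>) (at r)"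
    unfolding LL_def LLr_def
    by (rule derivative_eq_intros D m_deriv[OF assms(2)] refl | simp)+
  show "((\<lambda>r. PP v r \<omega>) has_real_derivative PPr v r \<omega>) (at r)"
    unfolding PP_def PPr_def
    by (rule derivative_eq_intros D lap Lr refl | simp)+
  show "((\<lambda>r. QQ v r \<omega>) has_real_derivative QQr v r \<omega>) (at r)"
    unfolding QQ_def QQr_def
    by (intro DERIV_sum) (rule derivative_eq_intros D refl | simp)+
qed

lemma slice_deriv:
  assumes "v \<ge> 0" "r \<ge> r0" "\<omega> \<in> sphere 0 1"
  shows "((\<lambda>v. slice K v r \<omega>) has_real_derivative dslice K v r \<omega>) (at v)"
  unfolding slice_def dslice_def slice_dens_def slice_v_def Let_def
  by (rule derivative_eq_intros D_derived[OF assms] D[OF assms] refl)+ (simp add: algebra_simps)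

lemma flux_deriv:
  assumes K: "coefs_on r1 K" and r1: "r0 \<le> r1" and as: "v \<ge> 0" "r \<ge> r1" "\<omega> \<in> sphere 0 1"
  shows "((\<lambda>r. flux K v r \<omega>) has_real_derivative dflux K v r \<omega>) (at r)"
proof -
  have r: "r \<noteq> 0" "r \<ge> r0" using as r1 r0 by auto
  note lap = lapse_has_real_derivative[OF r(1), of M]
  have k: "(cB K has_real_derivative cB' K r) (at r)" "(cY K has_real_derivative cY' K r) (at r)"
      "(cq K has_real_derivative cq' K r) (at r)" "(cq' K has_real_derivative cq'' K r) (at r)"
      "(cb K has_real_derivative cb' K r) (at r)"
    using K as(2) unfolding coefs_on_def by auto
  have rh: "r * lapse M r = r - 2 * M" using r(1) by (simp add: lapse_def field_simps)
  define h' where "h' = 2 * M / r\<^sup>2"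
  have h: "r * r * h' = 2 * M" using r(1) by (simp add: h'_def power2_eq_square)
  note lap = lap[folded h'_def] and Dd = D_derived[OF as(1) r(2) as(3)] and Du = D(2)[OF as(1) r(2) as(3)]
  have hY: "((\<lambda>r. lapse M r * cY K r / 2) has_real_derivative (h' * cY K r + lapse M r * cY' K r) / 2) (at r)"
    by (rule DERIV_cong[OF DERIV_cdivide[OF DERIV_mult[OF lap k(2)]]]) (simp add: algebra_simps)
  have hB: "((\<lambda>r. cB K r * lapse M r / 2) has_real_derivative (cB' K r * lapse M r + cB K r * h') / 2) (at r)"
    by (rule DERIV_cong[OF DERIV_cdivide[OF DERIV_mult[OF k(1) lap]]]) (simp add: algebra_simps)
  have Y2: "((\<lambda>r. (cY K r - cB K r * lapse M r / 2) / 2) has_real_derivative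
      (cY' K r - (cB' K r * lapse M r + cB K r * h') / 2) / 2) (at r)"
    by (rule DERIV_cdivide[OF DERIV_diff[OF k(2) hB]])
  have sq: "((\<lambda>r. r\<^sup>2) has_real_derivative 2 * r) (at r)"
    by (rule DERIV_cong[OF DERIV_power[OF DERIV_ident]]) simp
  have qr: "((\<lambda>r. cq K r * r\<^sup>2) has_real_derivative cq' K r * r\<^sup>2 + 2 * r * cq K r) (at r)"
    by (rule DERIV_cong[OF DERIV_mult[OF k(3) sq]]) (simp add: algebra_simps)
  have q'r: "((\<lambda>r. cq' K r * r\<^sup>2 * lapse M r / 2) has_real_derivative
      (cq'' K r * r\<^sup>2 * lapse M r + cq' K r * (2 * r - 2 * M)) / 2) (at r)"
    by (rule DERIV_cong[OF DERIV_cdivide[OF DERIV_mult[OF DERIV_mult[OF k(4) sq] lap]]]) (use rh h in algebra)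
  have pw: "((\<lambda>r. (g r)\<^sup>2) has_real_derivative 2 * g r * g') (at r)" if "(g has_real_derivative g') (at r)" for g g'
    by (rule DERIV_cong[OF DERIV_power[OF that]]) simp
  have Pp: "((\<lambda>r. PP v r \<omega> + lapse M r / 2 * LL v r \<omega>) has_real_derivative
      PPr v r \<omega> + h' / 2 * LL v r \<omega> + lapse M r / 2 * LLr v r \<omega>) (at r)"
    by (rule DERIV_cong[OF DERIV_add[OF Dd(5) DERIV_mult[OF DERIV_cdivide[OF lap] Dd(4)]]]) (simp add: algebra_simps)
  show ?thesis
    unfolding flux_def dflux_def flux_dens_def flux_r_def Let_def h'_def[symmetric]
    by (rule DERIV_cong[OF DERIV_diff[OF DERIV_add[OF DERIV_diff[OF
            DERIV_mult[OF sq DERIV_diff[OF DERIV_mult[OF hY pw[OF Dd(4)]] DERIV_mult[OF k(1) pw[OF Dd(5)]]]]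
            DERIV_mult[OF Y2 Dd(6)]] DERIV_mult[OF qr DERIV_mult[OF Du Pp]]]
            DERIV_mult[OF DERIV_add[OF k(5) q'r] pw[OF Du]]]])
       (simp add: field_simps)
qed

lemma pointwise_identity:
  assumes as: "v \<ge> 0" "r \<ge> r0" "\<omega> \<in> sphere 0 1"
  shows "dslice K v r \<omega> + dflux K v r \<omega> + bulk K v r \<omega>
     + (\<Sum>a\<in>UNIV. (cY K r - cB K r * lapse M r / 2) * (ur v r \<omega> * ooa a v r \<omega> + ora a v r \<omega> * oa a v r \<omega>)
         - (cB K r + (cY K r - cB K r * lapse M r / 2) * m r) * (ut v r \<omega> * ooa a v r \<omega> + ota a v r \<omega> * oa a v r \<omega>)
         + cq K r * (u v r \<omega> * ooa a v r \<omega> + oa a v r \<omega> * oa a v r \<omega>))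
     = source K v r \<omega>"
  unfolding dslice_def dflux_def bulk_def source_def LL_def PP_def QQ_def LLv_def PPv_def QQv_def LLr_def PPr_def QQr_def
  by (rule divergence_identity[OF _ wave[OF as]]) (use as r0 in auto)

text \<open>Grouped by u_r, u_t and u, the angular brackets of \<open>pointwise_identity\<close> are
  those of \<open>parts\<close>, so they disappear in the average.\<close>

lemma av_identity:
  assumes K: "coefs_on r1 K" and r1: "r0 \<le> r1" and as: "v \<ge> 0" "r \<ge> r1"
  shows "av (dslice K) v r + av (dflux K) v r + av (bulk K) v r = av (source K) v r"
proof -
  have r: "r \<ge> r0" using as r1 by simp
  note s = cdom_dens[OF K r1, THEN cdom_slice[OF _ as]] and c = cdom_base[THEN cdom_slice[OF _ as(1) r]]
  define c1 where "c1 = cY K r - cB K r * lapse M r / 2"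
  define c2 where "c2 = cB K r + c1 * m r"
  define X where "X a \<omega> = c1 * (ur v r \<omega> * ooa a v r \<omega> + ora a v r \<omega> * oa a v r \<omega>)
         - c2 * (ut v r \<omega> * ooa a v r \<omega> + ota a v r \<omega> * oa a v r \<omega>)
         + cq K r * (u v r \<omega> * ooa a v r \<omega> + oa a v r \<omega> * oa a v r \<omega>)" for a \<omega>
  note ci = continuous_on_add continuous_on_diff continuous_on_mult continuous_on_const c
  have cX: "continuous_on (sphere 0 1) (X a)" for a
    unfolding X_def by (intro ci)
  have X0: "sphere_int (X a) = 0" for a
  proof -
    have 1: "sphere_int (\<lambda>\<omega>. c1 * (ur v r \<omega> * ooa a v r \<omega> + ora a v r \<omega> * oa a v r \<omega>)) = 0"
      "sphere_int (\<lambda>\<omega>. c2 * (ut v r \<omega> * ooa a v r \<omega> + ota a v r \<omega> * oa a v r \<omega>)) = 0"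
      "sphere_int (\<lambda>\<omega>. cq K r * (u v r \<omega> * ooa a v r \<omega> + oa a v r \<omega> * oa a v r \<omega>)) = 0"
      unfolding sphere_int_cmult parts[OF as(1) r] by simp_all
    show ?thesis
      unfolding X_def[abs_def]
      by (subst sphere_int_add; (intro ci)?) (subst sphere_int_diff; (intro ci)?; simp only: 1)
  qed
  have "av (source K) v r = sphere_int (\<lambda>\<omega>. dslice K v r \<omega> + dflux K v r \<omega> + bulk K v r \<omega> + (X 1 \<omega> + X 2 \<omega> + X 3 \<omega>))"
    unfolding av_def
    by (rule sphere_int_cong) (use pointwise_identity[OF as(1) r, of _ K] in \<open>simp add: X_def c1_def c2_def sum_3\<close>)
  also have "\<dots> = av (dslice K) v r + av (dflux K) v r + av (bulk K) v r + (sphere_int (X 1) + sphere_int (X 2) + sphere_int (X 3))"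
    unfolding av_def using s cX by (simp add: sphere_int_add continuous_on_add)
  finally show ?thesis by (simp add: X0)
qed

lemma av_long:
  assumes K: "coefs_on r1 K" and r1: "r0 \<le> r1" and as: "v \<ge> 0" "r \<ge> r1"
  shows "av (long K) v r = av (slice K) v r + m r * av (flux K) v r"
proof -
  note s = cdom_dens[OF K r1, THEN cdom_slice[OF _ as]]
  have "av (long K) v r = sphere_int (\<lambda>\<omega>. slice K v r \<omega> + m r * flux K v r \<omega>)"
    unfolding av_def long_def slice_def flux_def
    by (rule sphere_int_cong) (rule long_dens_eq)
  also have "\<dots> = sphere_int (slice K v r) + m r * sphere_int (flux K v r)"
    using s by (subst sphere_int_add) (auto simp: sphere_int_cmult continuous_on_mult_left)
  finally show ?thesis by (simp add: av_def)
qed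

text \<open>The hypotheses on \<open>X\<close> say that its r-derivative is m times its
  v-derivative, as for a function of v + \<mu>(r). Differentiating the weight then produces slice
  plus m times flux, which is \<open>long\<close> alone.\<close>

lemma box_identity:
  fixes X Xv :: "real \<Rightarrow> real \<Rightarrow> real"
  assumes K: "coefs_on r1 K" and r1: "r0 \<le> r1" and T: "0 \<le> T" and R: "r1 \<le> R"
    and Xd: "\<And>v r. v \<in> {0..T} \<Longrightarrow> r \<in> {r1..R} \<Longrightarrow> ((\<lambda>v. X v r) has_real_derivative Xv v r) (at v)"
      "\<And>v r. v \<in> {0..T} \<Longrightarrow> r \<in> {r1..R} \<Longrightarrow> ((\<lambda>r. X v r) has_real_derivative m r * Xv v r) (at r)"
    and Xc: "continuous_on ({0..T} \<times> {r1..R}) (\<lambda>x. X (fst x) (snd x))"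
      "continuous_on ({0..T} \<times> {r1..R}) (\<lambda>x. Xv (fst x) (snd x))"
  shows "integral {r1..R} (\<lambda>r. X T r * av (slice K) T r - X 0 r * av (slice K) 0 r)
      + integral {0..T} (\<lambda>v. X v R * av (flux K) v R - X v r1 * av (flux K) v r1)
      + integral (cbox (0,r1) (T,R)) (\<lambda>x. X (fst x) (snd x) * av (bulk K) (fst x) (snd x))
    = integral (cbox (0,r1) (T,R)) (\<lambda>x. X (fst x) (snd x) * av (source K) (fst x) (snd x))
      + integral (cbox (0,r1) (T,R)) (\<lambda>x. Xv (fst x) (snd x) * av (long K) (fst x) (snd x))"
proof -
  let ?C = "cbox (0,r1) (T,R)"
  have C: "?C = {0..T} \<times> {r1..R}" by (auto simp: cbox_Pair_eq)
  have sub: "?C \<subseteq> {0..} \<times> {r1..}" unfolding C by auto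
  note cs = cdom_dens[OF K r1]
  note c = cs[THEN av_continuous, THEN continuous_on_subset[OF _ sub]]
  note Xc' = Xc[folded C]
  have cm: "continuous_on ?C (\<lambda>x. m (snd x))"
    by (rule continuous_on_compose2[OF m_cont continuous_on_snd[OF continuous_on_id]]) (use r1 in \<open>auto simp: C\<close>)
  note ci = continuous_on_add continuous_on_diff continuous_on_mult c Xc' cm
  define G where "G v r = Xv v r * av (slice K) v r + X v r * av (dslice K) v r" for v r
  define H where "H v r = (m r * Xv v r) * av (flux K) v r + X v r * av (dflux K) v r" for v r
  have cG: "continuous_on ?C (\<lambda>(v,r). G v r)" and cH: "continuous_on ?C (\<lambda>(v,r). H v r)"
    unfolding G_def H_def case_prod_unfold by (intro ci)+
  have 1: "integral ?C (\<lambda>(v,r). G v r) = integral {r1..R} (\<lambda>r. X T r * av (slice K) T r - X 0 r * av (slice K) 0 r)"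
  proof (rule box_integral_deriv_fst[OF T cG])
    fix v r assume vr: "v \<in> {0..T}" "r \<in> {r1..R}"
    have S: "((\<lambda>v. av (slice K) v r) has_real_derivative av (dslice K) v r) (at v within {0..T})"
      by (rule DERIV_subset[OF av_deriv_v[OF cs(1) cs(6)]]) (use vr r1 in \<open>auto intro: slice_deriv\<close>)
    show "((\<lambda>v. X v r * av (slice K) v r) has_real_derivative G v r) (at v within {0..T})"
      unfolding G_def
      by (rule DERIV_cong[OF DERIV_mult[OF has_field_derivative_at_within[OF Xd(1)[OF vr]] S]]) (simp add: algebra_simps)
  qed
  have 2: "integral ?C (\<lambda>(v,r). H v r) = integral {0..T} (\<lambda>v. X v R * av (flux K) v R - X v r1 * av (flux K) v r1)"
  proof (rule box_integral_deriv_snd[OF R cH])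
    fix v r assume vr: "v \<in> {0..T}" "r \<in> {r1..R}"
    have S: "((\<lambda>r. av (flux K) v r) has_real_derivative av (dflux K) v r) (at r within {r1..R})"
      by (rule DERIV_subset[OF av_deriv_r[OF cs(2) cs(7)]]) (use vr r1 in \<open>auto intro: flux_deriv[OF K r1]\<close>)
    show "((\<lambda>r. X v r * av (flux K) v r) has_real_derivative H v r) (at r within {r1..R})"
      unfolding H_def
      by (rule DERIV_cong[OF DERIV_mult[OF has_field_derivative_at_within[OF Xd(2)[OF vr]] S]]) (simp add: algebra_simps)
  qed
  let ?b = "\<lambda>x. X (fst x) (snd x) * av (bulk K) (fst x) (snd x)"
  let ?s = "\<lambda>x. X (fst x) (snd x) * av (source K) (fst x) (snd x)"
  let ?l = "\<lambda>x. Xv (fst x) (snd x) * av (long K) (fst x) (snd x)"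
  have i: "?b integrable_on ?C" "?s integrable_on ?C" "?l integrable_on ?C" "(\<lambda>(v,r). G v r) integrable_on ?C" "(\<lambda>(v,r). H v r) integrable_on ?C"
    by (intro integrable_continuous ci cG cH)+
  have "integral ?C (\<lambda>(v,r). G v r) + integral ?C (\<lambda>(v,r). H v r) + integral ?C ?b
     = integral ?C (\<lambda>x. (\<lambda>(v,r). G v r) x + (\<lambda>(v,r). H v r) x + ?b x)"
    using i by (simp add: integral_add integrable_add)
  also have "\<dots> = integral ?C (\<lambda>x. ?s x + ?l x)"
  proof (rule integral_cong)
    fix x assume "x \<in> ?C"
    then obtain v r where x: "x = (v,r)" and v: "v \<ge> 0" and r: "r \<ge> r1"
      unfolding C by (cases x) auto
    show "(\<lambda>(v,r). G v r) x + (\<lambda>(v,r). H v r) x + ?b x = ?s x + ?l x"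
      unfolding x prod.case fst_conv snd_conv G_def H_def av_identity[OF K r1 v r, symmetric] av_long[OF K r1 v r]
      by (simp add: algebra_simps)
  qed
  also have "\<dots> = integral ?C ?s + integral ?C ?l"
    using i by (simp add: integral_add)
  finally show ?thesis unfolding 1 2 .
qed

end

section \<open>Cut-offs and the crude energy bound\<close>

text \<open>The square makes the truncated linear function continuously differentiable, which is all
  that \<open>box_identity\<close> asks of a cut-off, and the bounds on its values and its
  derivative are explicit in \<open>n\<close>.\<close>

definition chi :: "real \<Rightarrow> real \<Rightarrow> real" where
  "chi n w = (max 0 (1 - w / n))\<^sup>2"

definition chi' :: "real \<Rightarrow> real \<Rightarrow> real" where
  "chi' n w = - 2 / n * max 0 (1 - w / n)"

lemma chi_deriv:
  assumes "n > 0"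
  shows "(chi n has_real_derivative chi' n w) (at w)"
proof -
  have pos: "((\<lambda>x. (max 0 x)\<^sup>2) has_real_derivative 2 * max 0 x) (at x)" for x :: real
  proof (cases "x = 0")
    case False
    have sq: "((\<lambda>x. x\<^sup>2) has_real_derivative 2 * x) (at x)"
      by (rule DERIV_cong[OF DERIV_power[OF DERIV_ident]]) simp
    show ?thesis
    proof (cases "x > 0")
      case True
      have "((\<lambda>x. (max 0 x)\<^sup>2) has_real_derivative 2 * x) (at x)"
        by (rule has_field_derivative_transform_within_open[OF sq, of "{0<..}"]) (use True in auto)
      then show ?thesis using True by simp
    next
      case False
      with \<open>x \<noteq> 0\<close> have x: "x < 0" by simp
      have "((\<lambda>x. (max 0 x)\<^sup>2) has_real_derivative 0) (at x)"
        by (rule has_field_derivative_transform_within_open[OF DERIV_const[of 0], of "{..<0}"]) (use x in auto)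
      then show ?thesis using x by simp
    qed
  next
    case True
    have "(\<lambda>h. ((max 0 (0 + h))\<^sup>2 - (max 0 0)\<^sup>2) / h) \<midarrow>0\<rightarrow> (0::real)"
    proof (rule Lim_null_comparison)
      show "\<forall>\<^sub>F h in at 0. norm (((max 0 (0 + h))\<^sup>2 - (max 0 0)\<^sup>2) / h) \<le> \<bar>h\<bar>"
        by (rule always_eventually) (auto simp: power2_eq_square max_def)
      show "(\<lambda>h. \<bar>h\<bar>) \<midarrow>0\<rightarrow> (0::real)" by (intro tendsto_rabs_zero tendsto_ident_at)
    qed
    then show ?thesis using True by (simp add: DERIV_def)
  qed
  have "((\<lambda>w. 1 - w / n) has_real_derivative - 1 / n) (at w)"
    using assms by (auto intro!: derivative_eq_intros)
  from DERIV_chain2[OF pos this] show ?thesis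
    unfolding chi_def chi'_def by (rule DERIV_cong) simp
qed

lemma chi_bounds:
  assumes "n > 0" "w \<ge> 0"
  shows "0 \<le> chi n w" "chi n w \<le> 1" "chi' n w \<le> 0" "w \<ge> n \<Longrightarrow> chi n w = 0" "w \<le> n / 2 \<Longrightarrow> chi n w \<ge> 1/4"
proof -
  have z: "0 \<le> w / n" using assms by simp
  show "0 \<le> chi n w" by (simp add: chi_def)
  have "max 0 (1 - w / n) \<le> 1" using z by simp
  then show "chi n w \<le> 1" unfolding chi_def by (intro power_le_one) auto
  show "chi' n w \<le> 0" using assms by (simp add: chi'_def mult_nonpos_nonneg)
  show "w \<ge> n \<Longrightarrow> chi n w = 0" using assms by (simp add: chi_def)
  assume "w \<le> n / 2"
  then have "1 - w / n \<ge> 1/2" using assms by (simp add: field_simps)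
  then have "1/2 \<le> max 0 (1 - w / n)" by (rule max.coboundedI2)
  then have "(1/2)\<^sup>2 \<le> (max 0 (1 - w / n))\<^sup>2" by (rule power_mono) simp
  moreover have "(1/2)\<^sup>2 = (1/4 :: real)" by (simp add: power2_eq_square)
  ultimately show "chi n w \<ge> 1/4" by (simp only: chi_def)
qed

lemma chi_continuous: "n > 0 \<Longrightarrow> continuous_on A g \<Longrightarrow> continuous_on A (\<lambda>x. chi n (g x))"
  "n > 0 \<Longrightarrow> continuous_on A g \<Longrightarrow> continuous_on A (\<lambda>x. chi' n (g x))"
  unfolding chi_def chi'_def
  by (intro continuous_on_power continuous_on_max continuous_on_mult continuous_on_diff continuous_on_divide continuous_on_const; simp)+

section \<open>The Killing field outside r = 3M and a bound on finite time intervals\<close>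

locale schw_wave = polar_wave +
  fixes \<mu> :: "real \<Rightarrow> real"
  assumes mu_deriv: "\<And>r. r \<ge> r0 \<Longrightarrow> (\<mu> has_real_derivative m r) (at r)"
    and m_pos: "\<And>r. r \<ge> r0 \<Longrightarrow> m r > 0"
    and spacelike: "\<And>r. r \<ge> r0 \<Longrightarrow> 2 - lapse M r * m r > 0"
    and mu_far: "\<And>r. r > 5*M/2 \<Longrightarrow> \<mu> r = tortoise M r"
    and r0_less: "r0 < 2 * M"
    and decay: "\<And>v \<omega>. v \<ge> 0 \<Longrightarrow> \<omega> \<in> sphere 0 1 \<Longrightarrow> ((\<lambda>r. u v r \<omega>) \<longlongrightarrow> 0) at_top"
begin

lemma lapse_pos: "r > 2 * M \<Longrightarrow> lapse M r > 0"
  using M by (simp add: lapse_def field_simps)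

lemma m_far:
  assumes "r > 5*M/2"
  shows "m r = 1 / lapse M r"
proof -
  have r: "r > 2*M" "r > 0" "r \<ge> r0" using assms M r0_less by auto
  have "(tortoise M has_real_derivative 1 + 2 * M * (1 / (r - 2 * M))) (at r)"
    unfolding tortoise_def[abs_def] using r
    by (auto intro!: derivative_eq_intros)
  then have "(\<mu> has_real_derivative 1 + 2 * M * (1 / (r - 2 * M))) (at r)"
    by (rule has_field_derivative_transform_within_open[of _ _ _ "{5*M/2<..}"]) (use assms mu_far in auto)
  then have "m r = 1 + 2 * M * (1 / (r - 2 * M))"
    using DERIV_unique mu_deriv[OF r(3)] by blast
  also have "\<dots> = 1 / lapse M r"
    using r by (simp add: lapse_def field_simps)
  finally show ?thesis .
qed

lemma mu_cont: "continuous_on {r0..} \<mu>"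
  using mu_deriv by (auto intro!: continuous_at_imp_continuous_on DERIV_isCont)

lemma mu_mono: "r0 \<le> r \<Longrightarrow> r \<le> s \<Longrightarrow> \<mu> r \<le> \<mu> s"
  by (rule DERIV_nonneg_imp_nondecreasing) (use mu_deriv m_pos in \<open>auto intro: less_imp_le exI\<close>, meson dual_order.trans less_imp_le)

lemma mu_3M: "\<mu> (3 * M) = 0"
  using mu_far[of "3*M"] M by (simp add: tortoise_def)

text \<open>Makes every cut-off in v + \<mu>(r) vanish beyond some radius when v \<ge> 0, so that no
  boundary term at large r appears.\<close>

lemma mu_large: "\<exists>R\<ge>a. \<forall>r\<ge>R. \<mu> r \<ge> n"
proof -
  define R where "R = max a (max (3*M) (n + 3*M))"
  have "\<mu> r \<ge> n" if "r \<ge> R" for r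
  proof -
    have r: "r \<ge> 3*M" "r \<ge> n + 3*M" using that by (auto simp: R_def)
    have "ln M \<le> ln (r - 2*M)" using r M by simp
    then have A: "2*M * ln M \<le> 2*M * ln (r - 2*M)" using M by simp
    have "\<mu> r = tortoise M r" using mu_far[of r] r M by simp
    then show ?thesis unfolding tortoise_def using A r by linarith
  qed
  then show ?thesis by (intro exI[of _ R]) (auto simp: R_def)
qed

definition ee where "ee v r \<omega> = r\<^sup>2 * ((ur v r \<omega>)\<^sup>2 + (ut v r \<omega>)\<^sup>2) + QQ v r \<omega>"

lemma cdom_ee: "cdom r0 ee"
  unfolding ee_def
  by (intro continuous_on_add continuous_on_mult continuous_on_power cdom_base cdom_derived)

lemma QQ_nonneg: "QQ v r \<omega> \<ge> 0"
  unfolding QQ_def by (simp add: sum_nonneg)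

lemma ee_nonneg: "ee v r \<omega> \<ge> 0"
  unfolding ee_def using QQ_nonneg by simp

lemma av_mono:
  assumes "cdom r1 F" "cdom r1 G" "v \<ge> 0" "r \<ge> r1" "\<And>\<omega>. \<omega> \<in> sphere 0 1 \<Longrightarrow> F v r \<omega> \<le> G v r \<omega>"
  shows "av F v r \<le> av G v r"
  unfolding av_def using assms by (intro sphere_int_mono cdom_slice)

lemma av_nonneg:
  assumes "cdom r1 F" "v \<ge> 0" "r \<ge> r1" "\<And>\<omega>. \<omega> \<in> sphere 0 1 \<Longrightarrow> 0 \<le> F v r \<omega>"
  shows "0 \<le> av F v r"
  unfolding av_def using assms by (intro sphere_int_nonneg cdom_slice)

lemma av_cmult: "av (\<lambda>v r \<omega>. g v r * F v r \<omega>) v r = g v r * av F v r"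
  unfolding av_def by (rule sphere_int_cmult)

lemma av_add:
  assumes "cdom r1 F" "cdom r1 G" "v \<ge> 0" "r \<ge> r1"
  shows "av (\<lambda>v r \<omega>. F v r \<omega> + G v r \<omega>) v r = av F v r + av G v r"
  unfolding av_def using assms by (intro sphere_int_add cdom_slice)

text \<open>The multiplier (h/2) L - P is minus the time derivative, whose flow preserves the
  metric; the bulk is therefore zero.\<close>

definition "killing = \<lparr>cB = \<lambda>_. 1, cB' = \<lambda>_. 0, cY = \<lambda>r. lapse M r / 2, cY' = \<lambda>r. M / r\<^sup>2,
  cq = \<lambda>_. 0, cq' = \<lambda>_. 0, cq'' = \<lambda>_. 0, ca = \<lambda>_. 0, cb = \<lambda>_. 0, cb' = \<lambda>_. 0\<rparr>"

lemma coefs_killing: "coefs_on (3*M) killing"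
proof -
  have "((\<lambda>r. lapse M r / 2) has_real_derivative M / r\<^sup>2) (at r)" if "r \<ge> 3 * M" for r
    using DERIV_cdivide[OF lapse_has_real_derivative[of r M], of 2] that M by simp
  moreover have "continuous_on {3*M..} (\<lambda>r. M / r\<^sup>2)"
    by (intro continuous_on_divide continuous_on_power continuous_on_const continuous_on_id) (use M in auto)
  ultimately show ?thesis
    unfolding coefs_on_def killing_def by simp
qed

lemma killing_dens:
  assumes "r \<ge> 3 * M"
  shows "slice killing v r \<omega> = (r\<^sup>2 * (lapse M r * (ur v r \<omega>)\<^sup>2 + (ut v r \<omega>)\<^sup>2 / lapse M r) + QQ v r \<omega>) / 2"
    "bulk killing v r \<omega> = 0"
    "source killing v r \<omega> = - (r\<^sup>2 * f v r \<omega> * ut v r \<omega>)"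
    "long killing v r \<omega> \<ge> 0"
proof -
  define h where "h = lapse M r"
  have h: "h > 0" using assms M lapse_pos[of r] by (simp add: h_def)
  have m: "m r = 1 / h" using m_far[of r] assms M by (simp add: h_def)
  have r: "r > 0" using assms M by simp
  show "slice killing v r \<omega> = (r\<^sup>2 * (lapse M r * (ur v r \<omega>)\<^sup>2 + (ut v r \<omega>)\<^sup>2 / lapse M r) + QQ v r \<omega>) / 2"
    unfolding slice_def slice_dens_def killing_def Let_def PP_def LL_def m coefs.select_convs h_def[symmetric]
    using h by (simp add: field_simps power2_eq_square)
  show "bulk killing v r \<omega> = 0"
    unfolding bulk_def bulk_dens_def killing_def Let_def using r by (simp add: field_simps)
  show "source killing v r \<omega> = - (r\<^sup>2 * f v r \<omega> * ut v r \<omega>)"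
    unfolding source_def mult_dens_def killing_def PP_def by simp
  show "long killing v r \<omega> \<ge> 0"
    unfolding long_def long_dens_def killing_def using h QQ_nonneg by (simp add: h_def)
qed

text \<open>For r \<ge> 3M the function h lies between 1/3 and 1, so the Killing energy, with
  weights h and 1/h on the two derivatives, is comparable with the full energy.\<close>

lemma killing_slice_bounds:
  assumes "r \<ge> 3 * M"
  shows "ee v r \<omega> \<le> 6 * slice killing v r \<omega>" "slice killing v r \<omega> \<le> 2 * ee v r \<omega>"
proof -
  define h where "h = lapse M r"
  have h: "1/3 \<le> h" "h \<le> 1" using assms M by (auto simp: h_def lapse_def field_simps)
  have 1: "(ur v r \<omega>)\<^sup>2 / 3 \<le> h * (ur v r \<omega>)\<^sup>2" "h * (ur v r \<omega>)\<^sup>2 \<le> (ur v r \<omega>)\<^sup>2"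
    using mult_right_mono[OF h(1), of "(ur v r \<omega>)\<^sup>2"] mult_right_mono[OF h(2), of "(ur v r \<omega>)\<^sup>2"] by auto
  have "1 \<le> 1 / h" "1 / h \<le> 3" using h by (auto simp: field_simps)
  then have 2: "(ut v r \<omega>)\<^sup>2 \<le> (ut v r \<omega>)\<^sup>2 / h" "(ut v r \<omega>)\<^sup>2 / h \<le> 3 * (ut v r \<omega>)\<^sup>2"
    using mult_right_mono[of 1 "1/h" "(ut v r \<omega>)\<^sup>2"] mult_right_mono[of "1/h" 3 "(ut v r \<omega>)\<^sup>2"] by auto
  have 3: "r\<^sup>2 * ((ur v r \<omega>)\<^sup>2 / 3 + (ut v r \<omega>)\<^sup>2) \<le> r\<^sup>2 * (h * (ur v r \<omega>)\<^sup>2 + (ut v r \<omega>)\<^sup>2 / h)"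
    "r\<^sup>2 * (h * (ur v r \<omega>)\<^sup>2 + (ut v r \<omega>)\<^sup>2 / h) \<le> r\<^sup>2 * ((ur v r \<omega>)\<^sup>2 + 3 * (ut v r \<omega>)\<^sup>2)"
    by (rule mult_left_mono; use 1 2 in auto)+
  have 4: "0 \<le> r\<^sup>2 * (ut v r \<omega>)\<^sup>2" "0 \<le> r\<^sup>2 * (ur v r \<omega>)\<^sup>2" by auto
  have 5: "r\<^sup>2 * ((ur v r \<omega>)\<^sup>2 / 3 + (ut v r \<omega>)\<^sup>2) = r\<^sup>2 * (ur v r \<omega>)\<^sup>2 / 3 + r\<^sup>2 * (ut v r \<omega>)\<^sup>2"
    "r\<^sup>2 * ((ur v r \<omega>)\<^sup>2 + 3 * (ut v r \<omega>)\<^sup>2) = r\<^sup>2 * (ur v r \<omega>)\<^sup>2 + 3 * (r\<^sup>2 * (ut v r \<omega>)\<^sup>2)"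
    by (simp_all add: algebra_simps)
  have 6: "ee v r \<omega> = r\<^sup>2 * (ur v r \<omega>)\<^sup>2 + r\<^sup>2 * (ut v r \<omega>)\<^sup>2 + QQ v r \<omega>"
    by (simp add: ee_def algebra_simps)
  define Z where "Z = r\<^sup>2 * (h * (ur v r \<omega>)\<^sup>2 + (ut v r \<omega>)\<^sup>2 / h)"
  define x where "x = r\<^sup>2 * (ur v r \<omega>)\<^sup>2"
  define y where "y = r\<^sup>2 * (ut v r \<omega>)\<^sup>2"
  note 7 = killing_dens(1)[OF assms, of v \<omega>, folded h_def, folded Z_def]
  note 8 = 3[unfolded 5, folded Z_def x_def y_def] 4[folded x_def y_def]
  have 9: "x + 3 * y \<le> 3 * Z" using 8(1) by simp
  show "ee v r \<omega> \<le> 6 * slice killing v r \<omega>"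
    unfolding 6 7 x_def[symmetric] y_def[symmetric] using 8(2-4) 9 QQ_nonneg[of v r \<omega>] by simp
  show "slice killing v r \<omega> \<le> 2 * ee v r \<omega>"
    unfolding 6 7 x_def[symmetric] y_def[symmetric] using 8(2-4) 9 QQ_nonneg[of v r \<omega>] by simp
qed

text \<open>Purely qualitative: \<open>C\<close> may depend on \<open>T\<close> and on the solution.
  Pointwise decay alone does not make the energy of a later slice finite; the Killing identity with
  a cut-off does, because the derivative of the cut-off is nonpositive and meets a nonnegative
  density.\<close>

lemma crude_energy_bound:
  assumes T: "T > 0"
    and E0: "\<And>R. R \<ge> 3*M \<Longrightarrow> integral {3*M..R} (av ee 0) \<le> A"
    and F: "\<And>R. R \<ge> 3*M \<Longrightarrow> integral (cbox (0,3*M) (T,R)) (\<lambda>x. av (\<lambda>v r \<omega>. r\<^sup>2 * (f v r \<omega>)\<^sup>2) (fst x) (snd x)) \<le> A"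
  shows "\<exists>C. \<forall>v\<in>{0..T}. \<forall>R\<ge>3*M. integral {3*M..R} (av ee v) \<le> C"
proof -
  let ?r1 = "3 * M"
  have r1: "r0 \<le> ?r1" using r0_less M by simp
  note cs = cdom_dens[OF coefs_killing r1]
  note ce = cdom_subset[OF cdom_ee r1]
  have cf: "cdom ?r1 (\<lambda>v r \<omega>. r\<^sup>2 * (f v r \<omega>)\<^sup>2)"
    by (intro continuous_on_mult continuous_on_power cdom_subset[OF cdom_f r1] cdom_subset[OF cdom_base(11) r1])
  have slice_cont: "continuous_on {a..b} (\<lambda>r. G v r)"
    if "continuous_on ({0..} \<times> {?r1..}) (\<lambda>x. G (fst x) (snd x))" "v \<ge> 0" "a \<ge> ?r1" for G :: "real \<Rightarrow> real \<Rightarrow> real" and v a b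
    by (rule continuous_on_compose2[OF that(1), of _ "\<lambda>r. (v, r)", unfolded fst_conv snd_conv])
       (use that in \<open>auto intro!: continuous_on_Pair continuous_on_const continuous_on_id\<close>)
  have ci: "continuous_on (cbox (0,?r1) (T',R)) (\<lambda>x. G (fst x) (snd x))"
    if "continuous_on ({0..} \<times> {?r1..}) (\<lambda>x. G (fst x) (snd x))" for G :: "real \<Rightarrow> real \<Rightarrow> real" and T' R
    by (rule continuous_on_subset[OF that]) (auto simp: cbox_Pair_eq)
  have "continuous_on {0..T} (\<lambda>v. av (flux killing) v ?r1)"
    by (rule continuous_on_compose2[OF av_continuous[OF cs(2)], of _ "\<lambda>v. (v, ?r1)", unfolded fst_conv snd_conv])
       (auto intro!: continuous_on_Pair continuous_on_const continuous_on_id)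
  then have "bounded ((\<lambda>v. av (flux killing) v ?r1) ` {0..T})"
    by (intro compact_imp_bounded compact_continuous_image) auto
  then obtain Fm where "\<forall>x\<in>(\<lambda>v. av (flux killing) v ?r1) ` {0..T}. norm x \<le> Fm"
    unfolding bounded_iff by blast
  then have Fm: "\<And>v. v \<in> {0..T} \<Longrightarrow> \<bar>av (flux killing) v ?r1\<bar> \<le> Fm" by auto
  have Fm0: "Fm \<ge> 0" using Fm[of 0] T by auto
  \<comment> \<open>The summands pay for the initial energy, for the flux through r = 3M, bounded by
    compactness of the time interval, and for the source.\<close>
  define K0 where "K0 = 2 * A + T * Fm + 3 * T * A"
  have A0: "A \<ge> 0" using E0[of ?r1] by simp
  have key: "integral {?r1..R} (\<lambda>r. chi n (v + \<mu> r) * av (slice killing) v r) \<le> 2 * K0"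
    if n: "n > 0" and R: "R \<ge> ?r1" and Rn: "\<And>r. r \<ge> R \<Longrightarrow> \<mu> r \<ge> n" and v: "v \<in> {0..T}" for n R v
  proof -
    define X where "X v r = chi n (v + \<mu> r)" for v r
    define Xv where "Xv v r = chi' n (v + \<mu> r)" for v r
    define s where "s v = integral {?r1..R} (\<lambda>r. X v r * av (slice killing) v r)" for v
    have w0: "v + \<mu> r \<ge> 0" if "v \<ge> 0" "r \<ge> ?r1" for v r
      using mu_mono[OF r1 that(2)] mu_3M that by simp
    have X01: "0 \<le> X v r" "X v r \<le> 1" "Xv v r \<le> 0" if "v \<ge> 0" "r \<ge> ?r1" for v r
      using chi_bounds[OF n w0[OF that]] by (auto simp: X_def Xv_def)
    have XR: "X v R = 0" if "v \<ge> 0" for v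
      using chi_bounds(4)[OF n w0[OF that R]] Rn[of R] that by (auto simp: X_def)
    have Xd: "((\<lambda>v. X v r) has_real_derivative Xv v r) (at v)" for v r
      unfolding X_def Xv_def by (rule DERIV_cong[OF DERIV_chain2[OF chi_deriv[OF n]]]) (auto intro!: derivative_eq_intros)
    have Xdr: "((\<lambda>r. X v r) has_real_derivative m r * Xv v r) (at r)" if "r \<ge> ?r1" for v r
    proof -
      have "((\<lambda>r. v + \<mu> r) has_real_derivative m r) (at r)"
        using DERIV_add[OF DERIV_const mu_deriv[of r]] that r1 by simp
      from DERIV_chain2[OF chi_deriv[OF n] this] show ?thesis
        unfolding X_def Xv_def by (simp add: mult.commute)
    qed
    have cw: "continuous_on ({0..} \<times> {?r1..}) (\<lambda>x. fst x + \<mu> (snd x))"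
      by (intro continuous_on_add continuous_on_fst continuous_on_id continuous_on_compose2[OF mu_cont continuous_on_snd[OF continuous_on_id]])
         (use r1 in auto)
    have cX: "continuous_on ({0..} \<times> {?r1..}) (\<lambda>x. X (fst x) (snd x))" "continuous_on ({0..} \<times> {?r1..}) (\<lambda>x. Xv (fst x) (snd x))"
      unfolding X_def Xv_def by (intro chi_continuous n cw)+
    note cXS = continuous_on_mult[OF cX(1) av_continuous[OF cs(1)]]
    have s_cont: "continuous_on {0..T} s"
      unfolding s_def
      by (rule integral_continuous_on_param[where a = ?r1 and b = R, unfolded cbox_interval])
         (unfold case_prod_unfold, rule continuous_on_subset[OF cXS], auto)
    \<comment> \<open>The cut-off energy \<open>s\<close> is continuous and so attains its maximum.
      Bounding \<open>s\<close> everywhere by \<open>K0\<close> plus half this maximum replaces a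
      Gronwall argument.\<close>
    obtain v0 where v0: "v0 \<in> {0..T}" "\<And>v. v \<in> {0..T} \<Longrightarrow> s v \<le> s v0"
      using continuous_attains_sup[OF compact_Icc _ s_cont] T by auto
    have s_nonneg: "X v r * av (slice killing) v r \<ge> 0" if "v \<ge> 0" "r \<ge> ?r1" for v r
    proof -
      have "av (slice killing) v r \<ge> 0"
        by (rule av_nonneg[OF cs(1) that]) (use killing_slice_bounds(1)[OF that(2)] ee_nonneg in \<open>smt (verit)\<close>)
      then show ?thesis using X01[OF that] by simp
    qed
    have bound: "s T' \<le> K0 + s v0 / 2" if T': "T' \<in> {0..T}" for T'
    proof -
      let ?C = "cbox (0,?r1) (T',R)"
      have id: "integral {?r1..R} (\<lambda>r. X T' r * av (slice killing) T' r - X 0 r * av (slice killing) 0 r)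
          + integral {0..T'} (\<lambda>v. X v R * av (flux killing) v R - X v ?r1 * av (flux killing) v ?r1)
          + integral ?C (\<lambda>x. X (fst x) (snd x) * av (bulk killing) (fst x) (snd x))
        = integral ?C (\<lambda>x. X (fst x) (snd x) * av (source killing) (fst x) (snd x))
          + integral ?C (\<lambda>x. Xv (fst x) (snd x) * av (long killing) (fst x) (snd x))"
        by (rule box_identity[OF coefs_killing r1]) (use T' R Xd Xdr in \<open>auto intro: continuous_on_subset[OF cX(1)] continuous_on_subset[OF cX(2)]\<close>)
      have i1: "integral {?r1..R} (\<lambda>r. X T' r * av (slice killing) T' r - X 0 r * av (slice killing) 0 r) = s T' - s 0"
        unfolding s_def
        by (rule integral_diff) (use T' in \<open>auto intro!: integrable_continuous_real slice_cont[OF cXS]\<close>)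
      have i0: "s 0 \<le> 2 * A"
      proof -
        have "s 0 \<le> integral {?r1..R} (\<lambda>r. 2 * av ee 0 r)"
          unfolding s_def
        proof (rule integral_le)
          fix r assume r: "r \<in> {?r1..R}"
          have "X 0 r * av (slice killing) 0 r \<le> 1 * av (slice killing) 0 r"
            by (rule mult_right_mono) (use X01[of 0 r] r av_nonneg[OF cs(1), of 0 r] killing_slice_bounds(1)[of r 0] ee_nonneg[of 0 r] in \<open>auto, smt (verit)\<close>)
          also have "\<dots> \<le> av (\<lambda>v r \<omega>. 2 * ee v r \<omega>) 0 r"
            unfolding mult_1 by (rule av_mono[OF cs(1)]) (use r killing_slice_bounds(2) in \<open>auto intro!: continuous_on_mult continuous_on_const ce\<close>)
          finally show "X 0 r * av (slice killing) 0 r \<le> 2 * av ee 0 r"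
            using av_cmult[of "\<lambda>_ _. 2" ee] by simp
        qed (auto intro!: integrable_continuous_real slice_cont[OF cXS] continuous_on_mult_left slice_cont[OF av_continuous[OF ce]])
        also have "\<dots> \<le> 2 * A" using E0[OF R] by simp
        finally show ?thesis .
      qed
      have i2: "\<bar>integral {0..T'} (\<lambda>v. X v R * av (flux killing) v R - X v ?r1 * av (flux killing) v ?r1)\<bar> \<le> T * Fm"
      proof -
        have cc: "continuous_on {0..T'} (\<lambda>v. X v ?r1 * av (flux killing) v ?r1)"
          by (rule continuous_on_compose2[OF continuous_on_mult[OF cX(1) av_continuous[OF cs(2)]], of _ "\<lambda>v. (v, ?r1)", unfolded fst_conv snd_conv])
             (auto intro!: continuous_on_Pair continuous_on_const continuous_on_id)
        have "integral {0..T'} (\<lambda>v. X v R * av (flux killing) v R - X v ?r1 * av (flux killing) v ?r1)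
           = integral {0..T'} (\<lambda>v. - (X v ?r1 * av (flux killing) v ?r1))"
          by (rule integral_cong) (use XR in auto)
        moreover have "norm (integral {0..T'} (\<lambda>v. - (X v ?r1 * av (flux killing) v ?r1))) \<le> Fm * (T' - 0)"
        proof (rule integral_bound)
          fix v assume v: "v \<in> {0..T'}"
          have "\<bar>X v ?r1\<bar> * \<bar>av (flux killing) v ?r1\<bar> \<le> 1 * Fm"
            by (rule mult_mono) (use v T' X01[of v ?r1] Fm in auto)
          then show "norm (- (X v ?r1 * av (flux killing) v ?r1)) \<le> Fm" by (simp add: abs_mult)
        qed (use T' cc in \<open>auto intro: continuous_on_minus\<close>)
        moreover have "Fm * (T' - 0) \<le> T * Fm"
          using mult_left_mono[of T' T Fm] T' Fm0 by (simp add: mult.commute)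
        ultimately show ?thesis by (simp only: real_norm_def)
      qed
      have i3: "integral ?C (\<lambda>x. X (fst x) (snd x) * av (bulk killing) (fst x) (snd x)) = 0"
      proof -
        have "X (fst x) (snd x) * av (bulk killing) (fst x) (snd x) = 0" if "x \<in> ?C" for x
        proof -
          have "snd x \<ge> ?r1" using that by (cases x) (auto simp: cbox_Pair_eq)
          then have "av (bulk killing) (fst x) (snd x) = sphere_int (\<lambda>_. 0)"
            unfolding av_def by (intro sphere_int_cong) (simp add: killing_dens)
          then show ?thesis by simp
        qed
        then have "integral ?C (\<lambda>x. X (fst x) (snd x) * av (bulk killing) (fst x) (snd x)) = integral ?C (\<lambda>x. 0)"
          by (intro integral_cong) auto
        then show ?thesis by simp
      qed
      have i4: "integral ?C (\<lambda>x. Xv (fst x) (snd x) * av (long killing) (fst x) (snd x)) \<le> 0"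
      proof -
        have "integral ?C (\<lambda>x. Xv (fst x) (snd x) * av (long killing) (fst x) (snd x)) \<le> integral ?C (\<lambda>x. 0)"
        proof (rule integral_le)
          fix x assume "x \<in> ?C"
          then have x: "fst x \<ge> 0" "snd x \<ge> ?r1" by (cases x, auto simp: cbox_Pair_eq)+
          have "av (long killing) (fst x) (snd x) \<ge> 0"
            by (rule av_nonneg[OF cs(3) x]) (use killing_dens(4) x in auto)
          then show "Xv (fst x) (snd x) * av (long killing) (fst x) (snd x) \<le> 0"
            using X01(3)[OF x] by (simp add: mult_nonpos_nonneg)
        qed (auto intro!: integrable_continuous ci continuous_on_mult cX av_continuous cs)
        then show ?thesis by simp
      qed
      let ?g = "\<lambda>v r. 3 * T * av (\<lambda>v r \<omega>. r\<^sup>2 * (f v r \<omega>)\<^sup>2) v r"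
      let ?k = "\<lambda>v r. (1 / (2*T)) * (X v r * av (slice killing) v r)"
      have cg: "continuous_on ({0..} \<times> {?r1..}) (\<lambda>x. ?g (fst x) (snd x))" "continuous_on ({0..} \<times> {?r1..}) (\<lambda>x. ?k (fst x) (snd x))"
        by (intro continuous_on_mult continuous_on_const av_continuous cf cs cX)+
      have i5: "integral ?C (\<lambda>x. X (fst x) (snd x) * av (source killing) (fst x) (snd x)) \<le> 3 * T * A + s v0 / 2"
      proof -
        have "integral ?C (\<lambda>x. X (fst x) (snd x) * av (source killing) (fst x) (snd x))
           \<le> integral ?C (\<lambda>x. ?g (fst x) (snd x) + ?k (fst x) (snd x))"
        proof (rule integral_le)
          fix x assume "x \<in> ?C"
          then have x: "fst x \<ge> 0" "snd x \<ge> ?r1" by (cases x, auto simp: cbox_Pair_eq)+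
          have "av (source killing) (fst x) (snd x)
             \<le> av (\<lambda>v r \<omega>. 3 * T * (r\<^sup>2 * (f v r \<omega>)\<^sup>2) + (1/(2*T)) * slice killing v r \<omega>) (fst x) (snd x)"
          proof (rule av_mono[OF cs(5) _ x])
            show "cdom ?r1 (\<lambda>v r \<omega>. 3 * T * (r\<^sup>2 * (f v r \<omega>)\<^sup>2) + (1/(2*T)) * slice killing v r \<omega>)"
              by (intro continuous_on_add continuous_on_mult continuous_on_const cs cdom_subset[OF cdom_f r1] cdom_subset[OF cdom_base(11) r1] continuous_on_power)
            fix \<omega> :: "real^3"
            let ?r = "snd x" and ?f = "f (fst x) (snd x) \<omega>" and ?u = "ut (fst x) (snd x) \<omega>"
            \<comment> \<open>The weight 6 T leaves exactly 1/(2 T) of the slice density, whose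
              integral over a time interval of length at most \<open>T\<close> is at most half of
              the maximum.\<close>
            have "0 \<le> (?r * (6 * T * ?f + ?u))\<^sup>2" by simp
            then have "- (12 * T * (?r\<^sup>2 * ?f * ?u)) \<le> 36 * T\<^sup>2 * (?r\<^sup>2 * ?f\<^sup>2) + ?r\<^sup>2 * ?u\<^sup>2"
              by (simp add: power2_eq_square algebra_simps)
            also have "?r\<^sup>2 * ?u\<^sup>2 \<le> ee (fst x) (snd x) \<omega>"
              unfolding ee_def using QQ_nonneg[of "fst x" "snd x" \<omega>] by (simp add: distrib_left)
            also have "\<dots> \<le> 6 * slice killing (fst x) (snd x) \<omega>" by (rule killing_slice_bounds(1)[OF x(2)])
            finally have fin: "- (12 * T * (?r\<^sup>2 * ?f * ?u)) \<le> 36 * T\<^sup>2 * (?r\<^sup>2 * ?f\<^sup>2) + 6 * slice killing (fst x) (snd x) \<omega>"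
              by simp
            have eq: "(12 * T) * (3 * T * a + (1/(2*T)) * s) = 36 * T\<^sup>2 * a + 6 * s" for a s
              using T by (simp add: field_simps power2_eq_square)
            have "(12 * T) * (- (?r\<^sup>2 * ?f * ?u)) \<le> (12 * T) * (3 * T * (?r\<^sup>2 * ?f\<^sup>2) + (1/(2*T)) * slice killing (fst x) (snd x) \<omega>)"
              unfolding eq using fin by simp
            then show "source killing (fst x) (snd x) \<omega> \<le> 3 * T * (?r\<^sup>2 * ?f\<^sup>2) + (1/(2*T)) * slice killing (fst x) (snd x) \<omega>"
              unfolding killing_dens(3)[OF x(2)] using T by (simp only: mult_le_cancel_left_pos)
          qed
          also have "\<dots> = ?g (fst x) (snd x) + (1/(2*T)) * av (slice killing) (fst x) (snd x)"
            unfolding av_add[OF continuous_on_mult[OF continuous_on_const cf] continuous_on_mult[OF continuous_on_const cs(1)] x]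
            by (simp only: av_cmult)
          finally have le: "av (source killing) (fst x) (snd x) \<le> \<dots>" .
          have g0: "?g (fst x) (snd x) \<ge> 0"
            using T by (intro mult_nonneg_nonneg av_nonneg[OF cf x]) auto
          have "X (fst x) (snd x) * av (source killing) (fst x) (snd x)
             \<le> X (fst x) (snd x) * ?g (fst x) (snd x) + X (fst x) (snd x) * ((1/(2*T)) * av (slice killing) (fst x) (snd x))"
            using mult_left_mono[OF le X01(1)[OF x]] by (simp only: distrib_left)
          also have "X (fst x) (snd x) * ?g (fst x) (snd x) \<le> ?g (fst x) (snd x)"
            using mult_right_mono[OF X01(2)[OF x] g0] by simp
          finally show "X (fst x) (snd x) * av (source killing) (fst x) (snd x) \<le> ?g (fst x) (snd x) + ?k (fst x) (snd x)"
            by (simp add: mult.left_commute mult.assoc)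
        qed (rule integrable_continuous[OF ci[OF continuous_on_mult[OF cX(1) av_continuous[OF cs(5)]]]]
             integrable_continuous[OF ci[OF continuous_on_add[OF cg]]])+
        also have "\<dots> = integral ?C (\<lambda>x. ?g (fst x) (snd x)) + integral ?C (\<lambda>x. ?k (fst x) (snd x))"
          by (rule integral_add) (intro integrable_continuous ci cg)+
        also have "integral ?C (\<lambda>x. ?g (fst x) (snd x)) \<le> 3 * T * A"
        proof -
          have "integral ?C (\<lambda>x. av (\<lambda>v r \<omega>. r\<^sup>2 * (f v r \<omega>)\<^sup>2) (fst x) (snd x))
            \<le> integral (cbox (0,?r1) (T,R)) (\<lambda>x. av (\<lambda>v r \<omega>. r\<^sup>2 * (f v r \<omega>)\<^sup>2) (fst x) (snd x))"
          proof (rule integral_subset_le)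
            show "?C \<subseteq> cbox (0,?r1) (T,R)" using T' by (auto simp: cbox_Pair_eq)
            show "\<forall>x\<in>cbox (0,?r1) (T,R). 0 \<le> av (\<lambda>v r \<omega>. r\<^sup>2 * (f v r \<omega>)\<^sup>2) (fst x) (snd x)"
              by (intro ballI av_nonneg[OF cf]) (auto simp: cbox_Pair_eq)
          qed (intro integrable_continuous ci av_continuous cf)+
          with F[OF R] have "integral ?C (\<lambda>x. av (\<lambda>v r \<omega>. r\<^sup>2 * (f v r \<omega>)\<^sup>2) (fst x) (snd x)) \<le> A" by linarith
          from mult_left_mono[OF this, of "3 * T"] T show ?thesis by simp
        qed
        also have "integral ?C (\<lambda>x. ?k (fst x) (snd x)) \<le> s v0 / 2"
        proof -
          have "integral ?C (\<lambda>x. ?k (fst x) (snd x)) = integral {0..T'} (\<lambda>v. integral {?r1..R} (\<lambda>r. ?k v r))"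
            using integral_prod_continuous[OF ci[OF cg(2)]] by simp
          also have "\<dots> = integral {0..T'} (\<lambda>v. (1/(2*T)) * s v)"
            unfolding s_def by simp
          also have "\<dots> \<le> integral {0..T'} (\<lambda>v. (1/(2*T)) * s v0)"
          proof (rule integral_le)
            show "(\<lambda>v. (1/(2*T)) * s v) integrable_on {0..T'}"
              by (intro integrable_continuous_real continuous_on_mult continuous_on_const continuous_on_subset[OF s_cont]) (use T' in auto)
          qed (use v0 T T' in \<open>auto intro!: mult_left_mono divide_right_mono\<close>)
          also have "\<dots> = T' * ((1/(2*T)) * s v0)" using T' by simp
          also have "\<dots> \<le> T * ((1/(2*T)) * s v0)"
          proof (rule mult_right_mono)
            have "s v0 \<ge> 0" unfolding s_def
              by (rule integral_nonneg) (use v0 s_nonneg in \<open>auto intro!: integrable_continuous_real slice_cont[OF cXS]\<close>)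
            then show "0 \<le> (1/(2*T)) * s v0" using T by simp
          qed (use T' in auto)
          also have "\<dots> = s v0 / 2" using T by simp
          finally show ?thesis .
        qed
        finally show ?thesis by simp
      qed
      show ?thesis using id i0 i2 i4 i5 unfolding i1 i3 K0_def by linarith
    qed
    from bound[OF v0(1)] have "s v0 \<le> 2 * K0" by linarith
    with v0(2)[OF v] show ?thesis by (simp add: s_def X_def)
  qed
  have "integral {?r1..R} (av ee v) \<le> 48 * K0" if v: "v \<in> {0..T}" and R: "R \<ge> ?r1" for v R
  proof -
    \<comment> \<open>Up to time \<open>T\<close> and radius \<open>R\<close> the argument v +
      \<mu>(r) stays below n/2, where the cut-off is at least 1/4. With the factor 6 between
      \<open>ee\<close> and the slice density this gives the factor 24.\<close>
    define n where "n = 2 * (T + \<mu> R) + 1"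
    have muR: "\<mu> R \<ge> 0" using mu_mono[OF r1 R] mu_3M by simp
    have n: "n > 0" using muR T by (simp add: n_def)
    obtain R' where R': "R' \<ge> R" "\<And>r. r \<ge> R' \<Longrightarrow> \<mu> r \<ge> n" using mu_large[of R n] by blast
    have c1: "continuous_on {?r1..R'} (\<lambda>r. chi n (v + \<mu> r) * av (slice killing) v r)"
      by (intro continuous_on_mult chi_continuous n continuous_on_add continuous_on_const slice_cont[OF av_continuous[OF cs(1)]] continuous_on_subset[OF mu_cont])
         (use v r1 in auto)
    have sn: "0 \<le> av (slice killing) v r" if "r \<ge> ?r1" for r
      by (rule av_nonneg[OF cs(1)]) (use v that killing_slice_bounds(1)[OF that] ee_nonneg in \<open>auto, smt (verit)\<close>)
    have "integral {?r1..R} (av ee v) \<le> integral {?r1..R} (\<lambda>r. 24 * (chi n (v + \<mu> r) * av (slice killing) v r))"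
    proof (rule integral_le)
      fix r assume r: "r \<in> {?r1..R}"
      have mu: "0 \<le> \<mu> r" "\<mu> r \<le> \<mu> R" using mu_mono[OF r1, of r] mu_mono[of r R] r r1 mu_3M by auto
      have "chi n (v + \<mu> r) \<ge> 1/4" by (rule chi_bounds(5)[OF n]) (use mu v in \<open>auto simp: n_def\<close>)
      from mult_right_mono[OF this sn[of r]] r have "av (slice killing) v r \<le> 4 * (chi n (v + \<mu> r) * av (slice killing) v r)" by simp
      moreover have "av ee v r \<le> av (\<lambda>v r \<omega>. 6 * slice killing v r \<omega>) v r"
        by (rule av_mono[OF ce]) (use v r killing_slice_bounds(1) in \<open>auto intro!: continuous_on_mult_left cs\<close>)
      ultimately show "av ee v r \<le> 24 * (chi n (v + \<mu> r) * av (slice killing) v r)"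
        using av_cmult[of "\<lambda>_ _. 6" "slice killing" v r] by simp
    qed (use v R' in \<open>auto intro!: integrable_continuous_real slice_cont[OF av_continuous[OF ce]] continuous_on_mult_left continuous_on_subset[OF c1]\<close>)
    also have "\<dots> \<le> 24 * integral {?r1..R'} (\<lambda>r. chi n (v + \<mu> r) * av (slice killing) v r)"
    proof -
      have "integral {?r1..R} (\<lambda>r. chi n (v + \<mu> r) * av (slice killing) v r) \<le> integral {?r1..R'} (\<lambda>r. chi n (v + \<mu> r) * av (slice killing) v r)"
      proof (rule integral_subset_le)
        show "(\<lambda>r. chi n (v + \<mu> r) * av (slice killing) v r) integrable_on {?r1..R}"
          using R' by (auto intro!: integrable_continuous_real continuous_on_subset[OF c1])
        show "\<forall>r\<in>{?r1..R'}. 0 \<le> chi n (v + \<mu> r) * av (slice killing) v r"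
          using sn by (simp add: chi_def)
      qed (use R' c1 in \<open>auto intro: integrable_continuous_real\<close>)
      then show ?thesis by simp
    qed
    also have "\<dots> \<le> 24 * (2 * K0)"
      using key[OF n _ R'(2) v] R R' by (intro mult_left_mono) auto
    finally show ?thesis by simp
  qed
  then show ?thesis by blast
qed

end

section \<open>Morawetz multiplier\<close>

lemma quad_form_nonneg:
  fixes a b c p z :: real
  assumes "a > 0" "c\<^sup>2 \<le> a * b"
  shows "0 \<le> a * p\<^sup>2 + 2 * c * p * z + b * z\<^sup>2"
proof -
  have "0 \<le> (a * p + c * z)\<^sup>2 + (a * b - c\<^sup>2) * z\<^sup>2"
    using assms by simp
  also have "\<dots> = a * (a * p\<^sup>2 + 2 * c * p * z + b * z\<^sup>2)"
    by (simp add: power2_eq_square algebra_simps)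
  finally show ?thesis using assms by (simp add: zero_le_mult_iff)
qed

lemma young: "2 * a * b \<le> d * a\<^sup>2 + b\<^sup>2 / d" if "d > 0" for a b d :: real
proof -
  have "0 \<le> (d * a - b)\<^sup>2 / d" using that by simp
  also have "\<dots> = d * a\<^sup>2 + b\<^sup>2 / d - 2 * a * b"
    using that by (simp add: power2_eq_square field_simps)
  finally show ?thesis by simp
qed

text \<open>The determinant condition of the quadratic form in p and z, after 1/20 of each square
  has been set aside to absorb the small corrections.\<close>

lemma morawetz_discriminant:
  assumes "0 \<le> x" "x \<le> 4/7"
  shows "1 \<le> (19/20 + 12 * x) * (49/20 - 9 * x + 9 * x\<^sup>2 :: real)"
proof -
  \<comment> \<open>The cubic has its local minimum near x = 0.48, so after this shift the linear
    term is small against the others.\<close>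
  define t where "t = x - 46/100"
  have x: "x = t + 46/100" by (simp add: t_def)
  have eq: "(19/20 + 12 * x) * (49/20 - 9 * x + 9 * x\<^sup>2) - 1
     = (108 * t + 4959/100) * t\<^sup>2 - (2607/1250) * t + 12099/31250"
    unfolding x by (simp add: power2_eq_square algebra_simps)
  have "0 \<le> (108 * t + 4959/100) * t\<^sup>2 - (2607/1250) * t + 12099/31250"
  proof (cases "t \<ge> 0")
    case True
    then have "0 \<le> t * t\<^sup>2" by simp
    moreover have "0 \<le> (t - 1/40)\<^sup>2" by simp
    then have "0 \<le> t\<^sup>2 - t / 20 + 1/1600" by (simp add: power2_eq_square algebra_simps)
    moreover have "0 \<le> t\<^sup>2" by simp
    moreover have "(108 * t + 4959/100) * t\<^sup>2 = 108 * (t * t\<^sup>2) + 4959/100 * t\<^sup>2"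
      by (simp add: algebra_simps)
    ultimately show ?thesis using True by linarith
  next
    case False
    have "0 \<le> x * t\<^sup>2" using assms by simp
    moreover have "t\<^sup>2 \<le> 1" using False assms by (auto simp: t_def abs_square_le_1)
    moreover have "(108 * t + 4959/100) * t\<^sup>2 = 108 * (x * t\<^sup>2) - 9/100 * t\<^sup>2"
      unfolding x by (simp add: algebra_simps)
    ultimately show ?thesis using False by linarith
  qed
  then show ?thesis using eq by linarith
qed

text \<open>x^2 times this is the zeroth order bulk term produced by the correction x^2 (1 - 2x) (1
  - 3x)^2 in \<open>pq\<close>.\<close>

definition quart :: "real \<Rightarrow> real" where
  "quart x = 1 - 28 * x + 198 * x^2 - 516 * x^3 + 450 * x^4"

lemma quart_bound: "0 \<le> x \<Longrightarrow> x \<le> 1 \<Longrightarrow> \<bar>quart x\<bar> \<le> 1200"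
proof -
  assume x: "0 \<le> x" "x \<le> 1"
  then have "0 \<le> x^2" "x^2 \<le> 1" "0 \<le> x^3" "x^3 \<le> 1" "0 \<le> x^4" "x^4 \<le> 1"
    by (auto intro: power_le_one)
  then show ?thesis using x unfolding quart_def by linarith
qed

text \<open>With x = M/r, only the p, z form has coefficients of size one. \<open>c1\<close> buys
  the square of w at the expense of p and z. \<epsilon> buys the square of L where \<tau> is
  positive, that is for r < 5M/2, and its cross terms go into that square and the reserve of
  \<open>morawetz_discriminant\<close>. \<sigma> is kept at a quarter of \<epsilon>, so that its
  cross term is harmless too.\<close>

lemma morawetz_positive:
  fixes x \<tau> p z w L Q :: real
  defines "c1 \<equiv> 1/100000" and "\<epsilon> \<equiv> 1/1000" and "\<sigma> \<equiv> 1/4000"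
  assumes x: "0 < x" "x \<le> 4/7" and tau: "\<tau> = max 0 (5/2 - 1/x)" and Q: "Q \<ge> 0"
  shows "p\<^sup>2/100 + z\<^sup>2/100 + c1 * (1 - 3*x)\<^sup>2 * w\<^sup>2 + \<epsilon> * \<tau> * L\<^sup>2 / 5 + x * (1 - 3*x)\<^sup>2 * Q / 4
    \<le> (1 + 12*x - c1 * (1 - 3*x)\<^sup>2) * p\<^sup>2 + 2 * z * p
      + (5/2 - 9*x + 9*x\<^sup>2 + c1 * quart x - 2 * \<sigma> * \<tau> / x\<^sup>2) * z\<^sup>2
      + c1 * (1 - 3*x)\<^sup>2 * w\<^sup>2 + \<epsilon> * (\<tau>\<^sup>2 * (3 - 1/x) + 1/x * (1/x - 2) * \<tau>) * L\<^sup>2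
      + 2 * \<epsilon> * \<tau>\<^sup>2 / x * p * L + 2 * \<sigma> * \<tau>\<^sup>2 / x * z * L
      + (x * (1 - 3*x)\<^sup>2 * (1 + 2*x - c1 * x * (1 - 2*x)) - \<epsilon> * \<tau>) * Q"
proof -
  define \<rho> where "\<rho> = 1 / x"
  have rho: "\<rho> \<ge> 7/4" using x by (simp add: \<rho>_def field_simps)
  have tau0: "0 \<le> \<tau>" and tau1: "\<tau> \<le> 3/4" using tau rho by (auto simp: \<rho>_def max_def)
  have rt: "\<rho> * \<tau> \<le> 15/8" "0 \<le> \<rho> * \<tau>"
  proof -
    show "0 \<le> \<rho> * \<tau>" using rho tau0 by simp
    show "\<rho> * \<tau> \<le> 15/8"
    proof (cases "\<tau> = 0")
      case False
      then have "\<rho> \<le> 5/2" using tau by (auto simp: \<rho>_def max_def split: if_splits)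
      then have "\<rho> * \<tau> \<le> (5/2) * (3/4)" using tau0 tau1 rho by (intro mult_mono) auto
      then show ?thesis by simp
    qed simp
  qed
  have rrt: "\<rho>\<^sup>2 * \<tau> \<le> 5"
  proof (cases "\<tau> = 0")
    case False
    then have "\<rho> \<le> 5/2" using tau by (auto simp: \<rho>_def max_def split: if_splits)
    then have "\<rho> * (\<rho> * \<tau>) \<le> (5/2) * (15/8)" using rt rho by (intro mult_mono) auto
    then show ?thesis by (simp add: power2_eq_square mult.assoc)
  qed simp
  have rt2: "(\<rho> * \<tau>)\<^sup>2 \<le> 4"
    using power_mono[OF rt(1) rt(2), of 2] by (simp add: power2_eq_square)
  have rt2t: "\<tau> * (\<rho> * \<tau>)\<^sup>2 \<le> 3"
    using mult_mono[OF tau1 rt2] tau0 by simp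
  have sq1: "(1 - 3*x)\<^sup>2 \<le> 1"
  proof -
    have "\<bar>1 - 3*x\<bar> \<le> 1" using x by auto
    then show ?thesis by (simp add: abs_square_le_1)
  qed
  have p2: "0 \<le> p\<^sup>2" and z2: "0 \<le> z\<^sup>2" and L2: "0 \<le> L\<^sup>2" by auto
  \<comment> \<open>The reserve of 1/20 in p^2 has to cover 1/1000 + 3/100 and leave 1/100; that in
    z^2 has to cover 12/1000 + 1/400 + 3/1000 and leave 1/100.\<close>
  have core: "0 \<le> (19/20 + 12*x) * p\<^sup>2 + 2 * 1 * p * z + (49/20 - 9*x + 9*x\<^sup>2) * z\<^sup>2"
    by (rule quad_form_nonneg) (use x morawetz_discriminant[of x] in auto)
  have a1: "c1 * (1 - 3*x)\<^sup>2 * p\<^sup>2 \<le> (1/1000) * p\<^sup>2"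
  proof -
    have "(1 - 3*x)\<^sup>2 * p\<^sup>2 \<le> p\<^sup>2" using mult_right_mono[OF sq1 p2] by simp
    moreover have "c1 * (1 - 3*x)\<^sup>2 * p\<^sup>2 = ((1 - 3*x)\<^sup>2 * p\<^sup>2) / 100000" by (simp add: c1_def)
    ultimately show ?thesis using p2 by linarith
  qed
  have a2: "- (12/1000) * z\<^sup>2 \<le> c1 * quart x * z\<^sup>2"
  proof (rule mult_right_mono)
    show "- (12/1000) \<le> c1 * quart x" using quart_bound[of x] x by (auto simp: c1_def abs_le_iff)
  qed simp
  have a3: "2 * \<sigma> * \<tau> / x\<^sup>2 * z\<^sup>2 \<le> (1/400) * z\<^sup>2"
  proof (rule mult_right_mono)
    have "2 * \<sigma> * \<tau> / x\<^sup>2 = 2 * \<sigma> * (\<rho>\<^sup>2 * \<tau>)" by (simp add: \<rho>_def power_divide)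
    also have "\<dots> \<le> 1/400" using rrt by (simp add: \<sigma>_def mult.commute)
    finally show "2 * \<sigma> * \<tau> / x\<^sup>2 \<le> 1/400" .
  qed simp
  have a4: "- (2 * \<epsilon> * \<tau>\<^sup>2 / x * p * L) \<le> \<epsilon> * \<tau> / 10 * L\<^sup>2 + (3/100) * p\<^sup>2"
  proof -
    have "2 * L * (- (\<rho> * \<tau> * p)) \<le> (1/10) * L\<^sup>2 + (- (\<rho> * \<tau> * p))\<^sup>2 / (1/10)"
      by (rule young) simp
    then have "- (2 * (\<rho> * \<tau>) * p * L) \<le> L\<^sup>2 / 10 + 10 * ((\<rho> * \<tau>)\<^sup>2 * p\<^sup>2)"
      by (simp add: power_mult_distrib algebra_simps)
    from mult_left_mono[OF this, of "\<epsilon> * \<tau>"] tau0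
    have "- (2 * \<epsilon> * \<tau>\<^sup>2 / x * p * L) \<le> \<epsilon> * \<tau> / 10 * L\<^sup>2 + 10 * \<epsilon> * ((\<tau> * (\<rho> * \<tau>)\<^sup>2) * p\<^sup>2)"
      by (simp add: \<epsilon>_def \<rho>_def power2_eq_square algebra_simps)
    moreover have "(\<tau> * (\<rho> * \<tau>)\<^sup>2) * p\<^sup>2 \<le> 3 * p\<^sup>2" by (rule mult_right_mono[OF rt2t p2])
    ultimately show ?thesis by (simp add: \<epsilon>_def)
  qed
  have a5: "- (2 * \<sigma> * \<tau>\<^sup>2 / x * z * L) \<le> \<epsilon> * \<tau> / 10 * L\<^sup>2 + (3/1000) * z\<^sup>2"
  proof -
    have "2 * L * (- (\<rho> * \<tau> * z / 4)) \<le> (1/10) * L\<^sup>2 + (- (\<rho> * \<tau> * z / 4))\<^sup>2 / (1/10)"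
      by (rule young) simp
    then have "- (2 * (\<rho> * \<tau>) * z * L) / 4 \<le> L\<^sup>2 / 10 + 10 * ((\<rho> * \<tau>)\<^sup>2 * z\<^sup>2) / 16"
      by (simp add: power_mult_distrib power_divide algebra_simps)
    from mult_left_mono[OF this, of "\<epsilon> * \<tau>"] tau0
    have "- (2 * \<sigma> * \<tau>\<^sup>2 / x * z * L) \<le> \<epsilon> * \<tau> / 10 * L\<^sup>2 + 10 * \<epsilon> * ((\<tau> * (\<rho> * \<tau>)\<^sup>2) * z\<^sup>2) / 16"
      by (simp add: \<epsilon>_def \<sigma>_def \<rho>_def power2_eq_square algebra_simps)
    moreover have "(\<tau> * (\<rho> * \<tau>)\<^sup>2) * z\<^sup>2 \<le> 3 * z\<^sup>2" by (rule mult_right_mono[OF rt2t z2])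
    ultimately show ?thesis using z2 unfolding \<epsilon>_def by linarith
  qed
  \<comment> \<open>Where \<tau> = 5/2 - \<rho> is positive, the bracket is 2 (\<rho> - 15/8)^2 +
    15/32 and so stays above 2/5. Half of this is spent on the two cross terms with L.\<close>
  have a6: "\<epsilon> * \<tau> * (2/5) * L\<^sup>2 \<le> \<epsilon> * (\<tau>\<^sup>2 * (3 - 1/x) + 1/x * (1/x - 2) * \<tau>) * L\<^sup>2"
  proof (rule mult_right_mono[OF _ L2])
    have "\<tau> * (2/5) \<le> \<tau> * (\<tau> * (3 - \<rho>) + \<rho> * (\<rho> - 2))"
    proof (cases "\<tau> = 0")
      case False
      then have t: "\<tau> = 5/2 - \<rho>" using tau by (auto simp: \<rho>_def max_def split: if_splits)
      have "\<tau> * (3 - \<rho>) + \<rho> * (\<rho> - 2) = 2 * (\<rho> - 15/8)\<^sup>2 + 15/32"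
        unfolding t by (simp add: power2_eq_square field_simps)
      moreover have "0 \<le> (\<rho> - 15/8)\<^sup>2" by simp
      ultimately have "2/5 \<le> \<tau> * (3 - \<rho>) + \<rho> * (\<rho> - 2)" by linarith
      then show ?thesis using tau0 by (intro mult_left_mono)
    qed simp
    from mult_left_mono[OF this, of \<epsilon>]
    show "\<epsilon> * \<tau> * (2/5) \<le> \<epsilon> * (\<tau>\<^sup>2 * (3 - 1/x) + 1/x * (1/x - 2) * \<tau>)"
      by (simp add: \<epsilon>_def \<rho>_def power2_eq_square algebra_simps)
  qed
  have a7: "x * (1 - 3*x)\<^sup>2 * Q / 4 \<le> (x * (1 - 3*x)\<^sup>2 * (1 + 2*x - c1 * x * (1 - 2*x)) - \<epsilon> * \<tau>) * Q"
  proof -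
    have xx: "0 \<le> x * (1 - 3*x)\<^sup>2" using x by simp
    have c: "c1 * x * (1 - 2*x) \<le> 1/4"
    proof -
      have "x * (1 - 2*x) \<le> 1 * 1" using x by (cases "1 - 2*x \<ge> 0", intro mult_mono) (auto intro: order_trans[OF mult_nonneg_nonpos])
      then show ?thesis by (simp add: c1_def)
    qed
    have "x * (1 - 3*x)\<^sup>2 * (3/4) \<le> x * (1 - 3*x)\<^sup>2 * (1 + 2*x - c1 * x * (1 - 2*x))"
      using c x by (intro mult_left_mono[OF _ xx]) auto
    \<comment> \<open>The angular loss of the red-shift term sits at x \<ge> 2/5, away from the
      trapped value x = 1/3, where the degenerate angular term is bounded below.\<close>
    moreover have "\<epsilon> * \<tau> \<le> x * (1 - 3*x)\<^sup>2 / 2"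
    proof (cases "\<tau> = 0")
      case True then show ?thesis using xx by simp
    next
      case False
      then have "1/x \<le> 5/2" using tau by (auto simp: max_def split: if_splits)
      then have x25: "x \<ge> 2/5" using x by (simp add: field_simps)
      then have "(1/5)\<^sup>2 \<le> (3*x - 1)\<^sup>2" by (intro power_mono) auto
      moreover have "(3*x - 1)\<^sup>2 = (1 - 3*x)\<^sup>2" by (rule power2_commute)
      moreover have "(1/5)\<^sup>2 = (1/25 :: real)" by (simp add: power2_eq_square)
      ultimately have "(1/25) \<le> (1 - 3*x)\<^sup>2" by linarith
      then have "(2/5) * (1/25) \<le> x * (1 - 3*x)\<^sup>2" using x25 by (intro mult_mono) auto
      then show ?thesis using tau1 by (simp add: \<epsilon>_def)
    qed
    ultimately have "x * (1 - 3*x)\<^sup>2 / 4 \<le> x * (1 - 3*x)\<^sup>2 * (1 + 2*x - c1 * x * (1 - 2*x)) - \<epsilon> * \<tau>" by linarith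
    from mult_right_mono[OF this Q] show ?thesis by simp
  qed
  define X1 where "X1 = x * p\<^sup>2"
  define X2 where "X2 = x * z\<^sup>2"
  define X3 where "X3 = x\<^sup>2 * z\<^sup>2"
  define X4 where "X4 = c1 * (1 - 3*x)\<^sup>2 * p\<^sup>2"
  define X5 where "X5 = c1 * quart x * z\<^sup>2"
  define X6 where "X6 = 2 * \<sigma> * \<tau> / x\<^sup>2 * z\<^sup>2"
  have e1: "(1 + 12*x - c1 * (1 - 3*x)\<^sup>2) * p\<^sup>2 = p\<^sup>2 + 12 * X1 - X4"
    by (simp add: X1_def X4_def algebra_simps)
  have e2: "(5/2 - 9*x + 9*x\<^sup>2 + c1 * quart x - 2 * \<sigma> * \<tau> / x\<^sup>2) * z\<^sup>2 = 5/2 * z\<^sup>2 - 9 * X2 + 9 * X3 + X5 - X6"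
    by (simp add: X2_def X3_def X5_def X6_def algebra_simps)
  have e3: "(19/20 + 12*x) * p\<^sup>2 + 2 * 1 * p * z + (49/20 - 9*x + 9*x\<^sup>2) * z\<^sup>2
    = 19/20 * p\<^sup>2 + 12 * X1 + 2 * z * p + (49/20 * z\<^sup>2 - 9 * X2 + 9 * X3)"
    by (simp add: X1_def X2_def X3_def algebra_simps)
  define E1 where "E1 = \<epsilon> * \<tau> * L\<^sup>2"
  define X7 where "X7 = \<epsilon> * (\<tau>\<^sup>2 * (3 - 1/x) + 1/x * (1/x - 2) * \<tau>) * L\<^sup>2"
  define X8 where "X8 = 2 * \<epsilon> * \<tau>\<^sup>2 / x * p * L"
  define X9 where "X9 = 2 * \<sigma> * \<tau>\<^sup>2 / x * z * L"
  define X10 where "X10 = (x * (1 - 3*x)\<^sup>2 * (1 + 2*x - c1 * x * (1 - 2*x)) - \<epsilon> * \<tau>) * Q"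
  define X11 where "X11 = x * (1 - 3*x)\<^sup>2 * Q"
  define X12 where "X12 = c1 * (1 - 3*x)\<^sup>2 * w\<^sup>2"
  have b4: "- X8 \<le> E1 / 10 + (3/100) * p\<^sup>2" using a4 unfolding X8_def E1_def by simp
  have b5: "- X9 \<le> E1 / 10 + (3/1000) * z\<^sup>2" using a5 unfolding X9_def E1_def by simp
  have b6: "E1 * (2/5) \<le> X7" using a6 unfolding X7_def E1_def by (simp add: mult.commute mult.left_commute)
  show ?thesis
    unfolding e1 e2 E1_def[symmetric] X7_def[symmetric] X8_def[symmetric] X9_def[symmetric] X10_def[symmetric]
      X11_def[symmetric] X12_def[symmetric]
    using core[unfolded e3] a1[folded X4_def] a2[folded X5_def] a3[folded X6_def] b4 b5 b6
      a7[folded X10_def X11_def] p2 z2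
    by linarith
qed

text \<open>The profile of M \<open>cq\<close> in x = M/r. The first bracket is x (1 - 2x) (1 -
  x/2), forced by the requirement that the P and L terms of the Morawetz bulk combine to (1 + 12x)
  (P + h L/2)^2. The second is x^2 (1 - 2x) (1 - 3x)^2, times a small constant: as 2 h P L is the
  square of the tortoise derivative minus that of the time derivative, it turns a little of the
  former into the latter, with the factor (1 - 3x)^2 that trapping leaves room for.\<close>

definition pq :: "real \<Rightarrow> real" where
  "pq x = - (x - 5/2 * x^2 + x^3) + (x^2 - 8 * x^3 + 21 * x^4 - 18 * x^5) / 100000"

definition pq' :: "real \<Rightarrow> real" where
  "pq' x = - (1 - 5 * x + 3 * x^2) + (2 * x - 24 * x^2 + 84 * x^3 - 90 * x^4) / 100000"

definition pq'' :: "real \<Rightarrow> real" where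
  "pq'' x = - (6 * x - 5) + (2 - 48 * x + 252 * x^2 - 360 * x^3) / 100000"

text \<open>Supported in r \<le> 5M/2, hence off the trapped radius, and squared to be continuously
  differentiable. It enters \<open>cY\<close>, where it keeps the L energy alive at the horizon, and
  \<open>cb\<close>, where it provides the square of the solution in the flux just inside.\<close>

definition redshift :: "real \<Rightarrow> real \<Rightarrow> real" where
  "redshift M r = (max 0 (5/2 - r/M))\<^sup>2"

definition redshift' :: "real \<Rightarrow> real \<Rightarrow> real" where
  "redshift' M r = - 2 / M * max 0 (5/2 - r/M)"

text \<open>The Morawetz part has \<open>F = (1 - 3M/r)(1 + 2M/r)\<close>; the remaining summands are \<open>\<Lambda>\<close> times the Killing
  field, a small red-shift term near the horizon, a small Lagrangian correction recovering the time
  derivative, and the lower order terms.\<close>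

definition exterior_coefs :: "real \<Rightarrow> real \<Rightarrow> coefs" where
  "exterior_coefs M \<Lambda> = \<lparr>
     cB = \<lambda>r. \<Lambda> + (1 - M/r - 6 * (M/r)^2),
     cB' = \<lambda>r. (1 + 12 * (M/r)) * (M/r^2),
     cY = \<lambda>r. (\<Lambda> - (1 - M/r - 6 * (M/r)^2)) * (lapse M r / 2) + redshift M r / 1000,
     cY' = \<lambda>r. - (1 + 12 * (M/r)) * (M/r^2) * (lapse M r / 2) + (\<Lambda> - (1 - M/r - 6 * (M/r)^2)) * (M/r^2) + redshift' M r / 1000,
     cq = \<lambda>r. pq (M/r) / M,
     cq' = \<lambda>r. - pq' (M/r) / r^2,
     cq'' = \<lambda>r. (2 * (M/r) * pq' (M/r) + (M/r)^2 * pq'' (M/r)) / (M * r^2),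
     ca = \<lambda>r. M/r,
     cb = \<lambda>r. lapse M r * (M/r) + redshift M r / 4000,
     cb' = \<lambda>r. - (1 - 4 * (M/r)) * (M/r^2) + redshift' M r / 4000\<rparr>"

lemma redshift_deriv:
  assumes "M > 0"
  shows "(redshift M has_real_derivative redshift' M r) (at r)"
proof -
  have mx: "max 0 (5/2 * z) = 5/2 * max 0 z" for z :: real
    by (cases "z \<ge> 0") (auto simp: max_def)
  \<comment> \<open>In this form the function is 25/4 times the cut-off \<open>chi\<close> with
    parameter 5M/2, so its derivative is already known.\<close>
  have e: "5/2 - r/M = 5/2 * (1 - r / (5*M/2))" for r using assms by (simp add: field_simps)
  have r1: "redshift M = (\<lambda>r. 25/4 * chi (5*M/2) r)"
    unfolding redshift_def[abs_def] chi_def e mx power_mult_distrib by (simp add: power2_eq_square)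
  have r2: "redshift' M r = 25/4 * chi' (5*M/2) r"
    unfolding redshift'_def chi'_def e mx using assms by (simp add: field_simps)
  show ?thesis
    unfolding r1 r2 by (intro DERIV_cmult chi_deriv) (use assms in simp)
qed

lemma redshift'_cont: "continuous_on A (redshift' M)"
  unfolding redshift'_def[abs_def] divide_inverse
  by (intro continuous_on_mult continuous_on_max continuous_on_diff continuous_on_const continuous_on_id)

lemma exterior_coefs_on:
  assumes M: "M > 0" and r1: "r1 > 0"
  shows "coefs_on r1 (exterior_coefs M \<Lambda>)"
proof -
  have nz: "r \<noteq> 0" if "r \<ge> r1" for r using that r1 by auto
  have x: "((\<lambda>r. M/r) has_real_derivative - (M/r^2)) (at r)" if "r \<ge> r1" for r
    using nz[OF that] by (auto intro!: derivative_eq_intros simp: power2_eq_square)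
  have pw: "((\<lambda>r. (M/r)^n) has_real_derivative real n * (M/r)^(n-1) * - (M/r^2)) (at r)" if "r \<ge> r1" for r n
    by (rule DERIV_cong[OF DERIV_power[OF x[OF that]]]) simp
  have F: "((\<lambda>r. 1 - M/r - 6 * (M/r)^2) has_real_derivative (1 + 12 * (M/r)) * (M/r^2)) (at r)" if "r \<ge> r1" for r
    by (rule DERIV_cong[OF DERIV_diff[OF DERIV_diff[OF DERIV_const x[OF that]] DERIV_cmult[OF pw[OF that, of 2]]]])
       (simp add: algebra_simps)
  have h: "((\<lambda>r. lapse M r / 2) has_real_derivative M/r^2) (at r)" if "r \<ge> r1" for r
    using DERIV_cdivide[OF lapse_has_real_derivative[OF nz[OF that], of M], of 2] by simp
  have p: "(pq has_real_derivative pq' x) (at x)" "(pq' has_real_derivative pq'' x) (at x)" for x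
    unfolding pq_def[abs_def] pq'_def[abs_def] pq''_def
    by (auto intro!: derivative_eq_intros simp: field_simps)
  note px = DERIV_chain2[OF p(1) x] DERIV_chain2[OF p(2) x]
  have B: "(cB (exterior_coefs M \<Lambda>) has_real_derivative cB' (exterior_coefs M \<Lambda>) r) (at r)" if "r \<ge> r1" for r
    unfolding exterior_coefs_def coefs.select_convs
    using DERIV_add[OF DERIV_const F[OF that]] by simp
  have Y: "(cY (exterior_coefs M \<Lambda>) has_real_derivative cY' (exterior_coefs M \<Lambda>) r) (at r)" if "r \<ge> r1" for r
    unfolding exterior_coefs_def coefs.select_convs
    by (rule DERIV_cong[OF DERIV_add[OF DERIV_mult[OF DERIV_diff[OF DERIV_const F[OF that]] h[OF that]]
          DERIV_cdivide[OF redshift_deriv[OF M]]]]) (simp add: algebra_simps)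
  have q: "(cq (exterior_coefs M \<Lambda>) has_real_derivative cq' (exterior_coefs M \<Lambda>) r) (at r)" if "r \<ge> r1" for r
    unfolding exterior_coefs_def coefs.select_convs
    by (rule DERIV_cong[OF DERIV_cdivide[OF px(1)[OF that]]]) (use M in simp)
  have q': "(cq' (exterior_coefs M \<Lambda>) has_real_derivative cq'' (exterior_coefs M \<Lambda>) r) (at r)" if "r \<ge> r1" for r
  proof -
    have "((\<lambda>r. - pq' (M/r) / r^2) has_real_derivative
      (- (pq'' (M/r) * - (M/r^2)) * r^2 - (- pq' (M/r)) * (2 * r)) / (r^2 * r^2)) (at r)"
      by (rule DERIV_divide[OF DERIV_minus[OF px(2)[OF that]] DERIV_cong[OF DERIV_power[OF DERIV_ident]]])
         (use nz[OF that] in auto)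
    then show ?thesis
      unfolding exterior_coefs_def coefs.select_convs
      by (rule DERIV_cong) (use nz[OF that] M in \<open>simp add: field_simps power2_eq_square\<close>)
  qed
  have b: "(cb (exterior_coefs M \<Lambda>) has_real_derivative cb' (exterior_coefs M \<Lambda>) r) (at r)" if "r \<ge> r1" for r
    unfolding exterior_coefs_def coefs.select_convs
    by (rule DERIV_cong[OF DERIV_add[OF DERIV_mult[OF lapse_has_real_derivative[OF nz[OF that]] x[OF that]] DERIV_cdivide[OF redshift_deriv[OF M]]]])
       (use nz[OF that] in \<open>simp add: lapse_def field_simps power2_eq_square\<close>)
  have cx: "continuous_on {r1..} (\<lambda>r. M/r)" "continuous_on {r1..} (\<lambda>r. M/r^2)" "continuous_on {r1..} (\<lambda>r. lapse M r / 2)"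
  proof -
    show "continuous_on {r1..} (\<lambda>r. M/r)" "continuous_on {r1..} (\<lambda>r. M/r^2)"
      by (intro continuous_on_divide continuous_on_power continuous_on_const continuous_on_id; use nz in auto)+
    show "continuous_on {r1..} (\<lambda>r. lapse M r / 2)"
      by (intro continuous_at_imp_continuous_on ballI DERIV_isCont[OF h]) simp
  qed
  have cp: "continuous_on {r1..} (\<lambda>r. pq' (M/r))" "continuous_on {r1..} (\<lambda>r. pq'' (M/r))"
    unfolding pq'_def pq''_def by (auto intro!: continuous_intros dest: nz)
  show ?thesis
    unfolding coefs_on_def
  proof (intro conjI allI impI)
    show "continuous_on {r1..} (cB' (exterior_coefs M \<Lambda>))" "continuous_on {r1..} (ca (exterior_coefs M \<Lambda>))"
      "continuous_on {r1..} (cY' (exterior_coefs M \<Lambda>))"  "continuous_on {r1..} (cb' (exterior_coefs M \<Lambda>))"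
      unfolding exterior_coefs_def coefs.select_convs divide_inverse[of _ 1000] divide_inverse[of _ 4000]
      by (intro continuous_on_add continuous_on_diff continuous_on_minus continuous_on_mult continuous_on_power continuous_on_const cx redshift'_cont)+
    show "continuous_on {r1..} (cq'' (exterior_coefs M \<Lambda>))"
      unfolding exterior_coefs_def coefs.select_convs
      by (intro continuous_on_divide continuous_on_add continuous_on_mult continuous_on_power continuous_on_const continuous_on_id cx cp)
         (use M nz in auto)
  qed (use B Y q q' b in auto)
qed

text \<open>Here p is the derivative along the tortoise coordinate and w the one along the Killing
  field, both in static coordinates. The Killing field has no bulk, so \<Lambda> drops out and can
  later be taken large at no cost in the interior of the region.\<close>

lemma exterior_bulk:
  fixes M r P L Q U \<Lambda> :: real
  assumes M: "M > 0" and r: "r > 0"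
  defines "x \<equiv> M/r" and "\<tau> \<equiv> max 0 (5/2 - r/M)" and "h \<equiv> lapse M r"
  defines "p \<equiv> P + h / 2 * L" and "w \<equiv> P - h / 2 * L" and "z \<equiv> U / r"
  shows "bulk_dens (exterior_coefs M \<Lambda>) M r P L Q U = M * (
      (1 + 12*x - 1/100000 * (1 - 3*x)\<^sup>2) * p\<^sup>2 + 2 * z * p
      + (5/2 - 9*x + 9*x\<^sup>2 + 1/100000 * quart x - 2 * (1/4000) * \<tau> / x\<^sup>2) * z\<^sup>2
      + 1/100000 * (1 - 3*x)\<^sup>2 * w\<^sup>2 + 1/1000 * (\<tau>\<^sup>2 * (3 - 1/x) + 1/x * (1/x - 2) * \<tau>) * L\<^sup>2
      + 2 * (1/1000) * \<tau>\<^sup>2 / x * p * L + 2 * (1/4000) * \<tau>\<^sup>2 / x * z * L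
      + (x * (1 - 3*x)\<^sup>2 * (1 + 2*x - 1/100000 * x * (1 - 2*x)) - 1/1000 * \<tau>) * (Q / M\<^sup>2))"
proof -
  have x: "x > 0" and Mx: "M = x * r" and hx: "h = 1 - 2 * x"
    using M r by (auto simp: x_def h_def lapse_def)
  have U: "U = z * r" using r by (simp add: z_def)
  have P: "P = p - h / 2 * L" by (simp add: p_def)
  have w: "w = p - h * L" by (simp add: p_def w_def)
  have r': "r = M / x" using x Mx by simp
  define f where "f = 1 - x - 6 * x^2"
  define c where "c = (1/100000 :: real)"
  define C3 where "C3 = (1 + 12*x) * h / 2 - c * (1 - 3*x)\<^sup>2 * h + \<tau>\<^sup>2 / (1000 * x)"
  let ?K = "exterior_coefs M \<Lambda>"
  \<comment> \<open>The choice of the main part of \<open>pq\<close>: the cross term of P and L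
    completes the square (1 + 12x) p^2 up to the Lagrangian correction.\<close>
  have K3: "(- f * h) / x - pq x / x^2 = (1 + 12*x) * h / 2 - c * (1 - 3*x)\<^sup>2 * h"
    using x unfolding pq_def hx f_def c_def by (simp add: field_simps) (simp add: algebra_simps eval_nat_numeral)
  \<comment> \<open>The angular coefficient. Its double zero at x = 1/3 is the trapping at the
    photon sphere.\<close>
  have K4: "x^2 * (- (1 + 12*x) * h / 2 - f) - pq x = x * (1 - 3*x)\<^sup>2 * (1 + 2*x - c * x * (1 - 2*x))"
    unfolding pq_def hx f_def c_def by (simp add: field_simps eval_nat_numeral)
  \<comment> \<open>The term - (1 - 4x) x^2 stems from \<open>cb'\<close>. Without it the main part
    would be 7/2 - 13x + 9x^2, negative for x > 0.36; with it 5/2 - 9x + 9x^2 has no real zero. The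
    price is the cross term 2 z p, which \<open>ca\<close> and \<open>cb\<close> produce
    together.\<close>
  have K5: "((2 * x * pq' x + x^2 * pq'' x) * h / 2 - pq' x * (x - x^2) - (1 - 4*x) * x^2) = x^2 * (5/2 - 9*x + 9*x\<^sup>2 + c * quart x)"
    unfolding pq'_def pq''_def quart_def hx c_def by (simp add: field_simps eval_nat_numeral)
  note sel = exterior_coefs_def coefs.select_convs redshift_def redshift'_def x_def[symmetric] \<tau>_def[symmetric] h_def[symmetric] f_def[symmetric]
  have Mr: "M / r\<^sup>2 = x\<^sup>2 / M" using x M unfolding r' by (simp add: field_simps power2_eq_square)
  have T1: "r\<^sup>2 * cB' ?K r = M * (1 + 12*x)"
    unfolding sel using r M by (simp add: field_simps)
  have T2: "M * cY ?K r - r\<^sup>2 * h / 2 * cY' ?K r = M * ((1 + 12*x) * h\<^sup>2 / 4 + (\<tau>\<^sup>2 + \<tau> * h / x\<^sup>2) / 1000)"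
  proof -
    have "r\<^sup>2 * h / 2 * cY' ?K r = h / 2 * (- (1 + 12*x) * h / 2 * (r\<^sup>2 * (M / r\<^sup>2)) + (\<Lambda> - f) * (r\<^sup>2 * (M / r\<^sup>2)) - (r\<^sup>2 / M) * (2 * \<tau> / 1000))"
      unfolding sel using r M by (simp add: field_simps)
    moreover have m: "r\<^sup>2 * (M / r\<^sup>2) = M" "r\<^sup>2 / M = M / x\<^sup>2" using r M x unfolding r' by (simp_all add: field_simps power2_eq_square)
    ultimately have eq: "r\<^sup>2 * h / 2 * cY' ?K r = M * (h / 2 * (- (1 + 12*x) * h / 2 + (\<Lambda> - f) - 2 * \<tau> / 1000 / x\<^sup>2))"
      unfolding m by (simp add: algebra_simps)
    show ?thesis unfolding eq unfolding sel by (simp add: field_simps power2_eq_square)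
  qed
  have T3: "r * (cY ?K r - cB ?K r * h / 2) - cq ?K r * r\<^sup>2 = M * C3"
  proof -
    have "r * (cY ?K r - cB ?K r * h / 2) - cq ?K r * r\<^sup>2 = M * ((- f * h) / x - pq x / x^2 + \<tau>\<^sup>2 / (1000 * x))"
      unfolding sel unfolding r' using x M by (simp add: field_simps) (simp add: algebra_simps power2_eq_square)
    then show ?thesis unfolding K3 C3_def .
  qed
  have T4: "(cY' ?K r - (cB' ?K r * h + cB ?K r * (2 * M / r\<^sup>2)) / 2) / 2 - cq ?K r
     = (x * (1 - 3*x)\<^sup>2 * (1 + 2*x - c * x * (1 - 2*x)) - \<tau> / 1000) / M"
  proof -
    have e: "2 * M / r\<^sup>2 = 2 * (x\<^sup>2 / M)" using Mr by simp
    have "(cY' ?K r - (cB' ?K r * h + cB ?K r * (2 * M / r\<^sup>2)) / 2) / 2 - cq ?K r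
       = (x^2 * (- (1 + 12*x) * h / 2 - f) - pq x - \<tau> / 1000) / M"
      unfolding e sel Mr using M by (simp add: field_simps)
    then show ?thesis unfolding K4 .
  qed
  have T5: "(cq'' ?K r * r\<^sup>2 * h + cq' ?K r * (2 * r - 2 * M)) / 2 + cb' ?K r
     = x\<^sup>2 / M * (5/2 - 9*x + 9*x\<^sup>2 + c * quart x - 2 * (1/4000) * \<tau> / x\<^sup>2)"
  proof -
    have qs: "cq'' ?K r * r\<^sup>2 = (2 * x * pq' x + x^2 * pq'' x) / M" "cq' ?K r * (2 * r - 2 * M) = - 2 * pq' x * (x - x^2) / M"
      unfolding sel unfolding Mx using r x by (simp_all add: field_simps power2_eq_square)
    have "(cq'' ?K r * r\<^sup>2 * h + cq' ?K r * (2 * r - 2 * M)) / 2 + cb' ?K r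
      = ((2 * x * pq' x + x^2 * pq'' x) * h / 2 - pq' x * (x - x^2) - (1 - 4*x) * x^2 - 2 * \<tau> / 4000) / M"
      unfolding qs unfolding sel Mr using M by (simp add: field_simps)
    moreover have "(x^2 * k - 2 * \<tau> / 4000) / M = x\<^sup>2 / M * (k - 2 * (1/4000) * \<tau> / x\<^sup>2)" for k
      using x M by (simp add: field_simps)
    ultimately show ?thesis unfolding K5 by simp
  qed
  have T6: "cb ?K r = h * x + \<tau>\<^sup>2 / 4000" "ca ?K r = x" unfolding sel by simp_all
  have "bulk_dens ?K M r P L Q U = M * (1 + 12*x) * P\<^sup>2
     + M * ((1 + 12*x) * h\<^sup>2 / 4 + (\<tau>\<^sup>2 + \<tau> * h / x\<^sup>2) / 1000) * L\<^sup>2 + 2 * (M * C3) * (P * L)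
     + (x * (1 - 3*x)\<^sup>2 * (1 + 2*x - c * x * (1 - 2*x)) - \<tau> / 1000) / M * Q
     + x\<^sup>2 / M * (5/2 - 9*x + 9*x\<^sup>2 + c * quart x - 2 * (1/4000) * \<tau> / x\<^sup>2) * U\<^sup>2
     + 2 * (h * x + \<tau>\<^sup>2 / 4000) * (U * L) + 2 * x * (U * (P - h / 2 * L))"
    unfolding bulk_dens_def Let_def h_def[symmetric] T1 T2 T3 T4 T5 T6 ..
  also have "\<dots> = M * ((1 + 12*x) * P\<^sup>2
     + ((1 + 12*x) * h\<^sup>2 / 4 + (\<tau>\<^sup>2 + \<tau> * h / x\<^sup>2) / 1000) * L\<^sup>2 + 2 * C3 * (P * L)
     + (x * (1 - 3*x)\<^sup>2 * (1 + 2*x - c * x * (1 - 2*x)) - \<tau> / 1000) * (Q / M\<^sup>2)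
     + (5/2 - 9*x + 9*x\<^sup>2 + c * quart x - 2 * (1/4000) * \<tau> / x\<^sup>2) * z\<^sup>2
     + 2 * (h + \<tau>\<^sup>2 / (4000 * x)) * (z * L) + 2 * (z * (P - h / 2 * L)))"
  proof -
    have u: "x\<^sup>2 / M * k * U\<^sup>2 = M * (k * z\<^sup>2)" "x * U = M * z" for k
      unfolding U r' using x M by (simp_all add: field_simps power2_eq_square)
    have u2: "2 * (h * x + \<tau>\<^sup>2 / 4000) * (U * L) = 2 * (h + \<tau>\<^sup>2 / (4000 * x)) * ((x * U) * L)"
      "2 * x * (U * (P - h / 2 * L)) = 2 * ((x * U) * (P - h / 2 * L))"
      using x by (simp_all add: field_simps)
    have q: "k / M * Q = M * (k * (Q / M\<^sup>2))" for k using M by (simp add: field_simps power2_eq_square)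
    show ?thesis unfolding u2 unfolding u q by (simp add: algebra_simps)
  qed
  also have "\<dots> = M * (
      (1 + 12*x - c * (1 - 3*x)\<^sup>2) * p\<^sup>2 + 2 * z * p
      + (5/2 - 9*x + 9*x\<^sup>2 + c * quart x - 2 * (1/4000) * \<tau> / x\<^sup>2) * z\<^sup>2
      + c * (1 - 3*x)\<^sup>2 * w\<^sup>2 + 1/1000 * (\<tau>\<^sup>2 * (3 - 1/x) + 1/x * (1/x - 2) * \<tau>) * L\<^sup>2
      + 2 * (1/1000) * \<tau>\<^sup>2 / x * p * L + 2 * (1/4000) * \<tau>\<^sup>2 / x * z * L
      + (x * (1 - 3*x)\<^sup>2 * (1 + 2*x - c * x * (1 - 2*x)) - 1/1000 * \<tau>) * (Q / M\<^sup>2))"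
  proof -
    define k where "k = 5/2 - 9*x + 9*x\<^sup>2 + c * quart x - 2 * (1/4000) * \<tau> / x\<^sup>2"
    define cc where "cc = c * (1 - 3*x)\<^sup>2"
    define a where "a = (1 + 12*x)"
    define q where "q = (x * (1 - 3*x)\<^sup>2 * (1 + 2*x - c * x * (1 - 2*x)) - \<tau> / 1000) * (Q / M\<^sup>2)"
    have q': "(x * (1 - 3*x)\<^sup>2 * (1 + 2*x - c * x * (1 - 2*x)) - 1/1000 * \<tau>) * (Q / M\<^sup>2) = q" by (simp add: q_def)
    define \<rho> where "\<rho> = 1 / x"
    have hr: "h * \<rho> = \<rho> - 2" using x by (simp add: hx \<rho>_def field_simps)
    define G where "G = \<tau>\<^sup>2 * \<rho>"
    have hG: "h * G = G - 2 * \<tau>\<^sup>2"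
      using hr unfolding G_def by algebra
    have eqs: "\<tau>\<^sup>2 / (1000 * x) = G / 1000" "\<tau>\<^sup>2 / (4000 * x) = G / 4000"
      "2 * (1/1000) * \<tau>\<^sup>2 / x = 2 * (1/1000) * G" "2 * (1/4000) * \<tau>\<^sup>2 / x = 2 * (1/4000) * G"
      by (simp_all add: G_def \<rho>_def)
    have r3: "\<tau>\<^sup>2 * (3 - 1/x) + 1/x * (1/x - 2) * \<tau> = 3 * \<tau>\<^sup>2 - G + \<tau> * h / x\<^sup>2"
      unfolding G_def hx \<rho>_def using x by (simp add: field_simps power2_eq_square)
    have C3': "C3 = a * h / 2 - cc * h + G / 1000"
      unfolding C3_def a_def cc_def eqs ..
    have "a * P\<^sup>2 + (a * h\<^sup>2 / 4 + (\<tau>\<^sup>2 + \<tau> * h / x\<^sup>2) / 1000) * L\<^sup>2 + 2 * C3 * (P * L) + q + k * z\<^sup>2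
        + 2 * (h + G / 4000) * (z * L) + 2 * (z * (P - h / 2 * L))
      = (a - cc) * p\<^sup>2 + 2 * z * p + k * z\<^sup>2 + cc * (p - h * L)\<^sup>2 + (\<tau>\<^sup>2 + \<tau> * h / x\<^sup>2 - h * G) / 1000 * L\<^sup>2
        + 2 * (1/1000) * G * p * L + 2 * (1/4000) * G * z * L + q"
      unfolding C3' P by (simp add: power2_eq_square field_simps)
    moreover have "\<tau>\<^sup>2 + \<tau> * h / x\<^sup>2 - h * G = 3 * \<tau>\<^sup>2 - G + \<tau> * h / x\<^sup>2"
      unfolding hG by simp
    ultimately show ?thesis
      unfolding q' q_def[symmetric] k_def[symmetric] cc_def[symmetric] a_def[symmetric] eqs r3 w by simp
  qed
  finally show ?thesis unfolding c_def .
qed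

section \<open>Slices and fluxes of the exterior multiplier down to just inside the horizon\<close>

lemma young_abs: "\<bar>2 * a * b\<bar> \<le> d * a\<^sup>2 + b\<^sup>2 / d" if "d > 0" for a b d :: real
  using young[OF that, of a b] young[OF that, of "-a" b] by (simp add: abs_le_iff)

text \<open>The factor 1 - 2x is h. Hence every product of the solution with a first derivative on a
  slice carries h and can be absorbed by the Killing energy, whose L part is itself proportional to
  h.\<close>

lemma pq_factor: "pq x = x * (1 - 2*x) * (- 1 + x/2 + x * (1 - 3*x)\<^sup>2 / 100000)"
  unfolding pq_def by (simp add: field_simps eval_nat_numeral)

lemma poly_bounds:
  fixes x :: real
  assumes "0 \<le> x" "x \<le> 4/7"
  shows "\<bar>- 1 + x/2 + x * (1 - 3*x)\<^sup>2 / 100000\<bar> \<le> 2" "\<bar>pq' x\<bar> \<le> 10" "\<bar>pq'' x\<bar> \<le> 20"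
    "-2 \<le> 1 - x - 6 * x\<^sup>2" "1 - x - 6 * x\<^sup>2 \<le> 1" "(1 - 3*x)\<^sup>2 \<le> 1"
proof -
  have b: "0 \<le> x^2" "x^2 \<le> 16/49" "0 \<le> x^3" "x^3 \<le> 1" "0 \<le> x^4" "x^4 \<le> 1"
    using power_mono[OF assms(2,1), of 2] assms by (auto intro: power_le_one simp: power_divide)
  show sq: "(1 - 3*x)\<^sup>2 \<le> 1"
  proof -
    have "\<bar>1 - 3*x\<bar> \<le> 1" using assms by auto
    then show ?thesis by (simp add: abs_square_le_1)
  qed
  define X where "X = x * (1 - 3*x)\<^sup>2"
  have "X \<le> 1 * 1" unfolding X_def using assms sq by (intro mult_mono) auto
  moreover have "0 \<le> X" using assms by (simp add: X_def)
  ultimately show "\<bar>- 1 + x/2 + x * (1 - 3*x)\<^sup>2 / 100000\<bar> \<le> 2"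
    unfolding X_def[symmetric] abs_le_iff using assms by linarith
  show "\<bar>pq' x\<bar> \<le> 10" unfolding pq'_def abs_le_iff add_divide_distrib diff_divide_distrib using assms b by (intro conjI) linarith+
  show "\<bar>pq'' x\<bar> \<le> 20" unfolding pq''_def abs_le_iff add_divide_distrib diff_divide_distrib using assms b by (intro conjI) linarith+
  show "-2 \<le> 1 - x - 6 * x\<^sup>2" using assms b by linarith
  show "1 - x - 6 * x\<^sup>2 \<le> 1" using assms b by linarith
qed

lemma redshift_bounds:
  assumes M: "M > 0" and r: "r \<ge> 7*M/4"
  shows "0 \<le> redshift M r" "redshift M r \<le> 1" "\<bar>redshift' M r\<bar> \<le> 2 / M"
    "r < 2*M \<Longrightarrow> 1/4 \<le> redshift M r" "r < 9*M/4 \<Longrightarrow> 1/16 \<le> redshift M r"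
proof -
  define \<tau> where "\<tau> = max 0 (5/2 - r/M)"
  have rM: "r / M \<ge> 7/4" using M r by (simp add: field_simps)
  have t: "0 \<le> \<tau>" "\<tau> \<le> 1" using rM by (auto simp: \<tau>_def max_def)
  have e: "redshift M r = \<tau>\<^sup>2" "redshift' M r = - (2/M) * \<tau>" by (simp_all add: redshift_def redshift'_def \<tau>_def)
  show "0 \<le> redshift M r" "redshift M r \<le> 1" unfolding e using t by (auto intro: power_le_one)
  show "\<bar>redshift' M r\<bar> \<le> 2 / M" unfolding e abs_mult using t M mult_left_mono[of \<tau> 1 "2/M"] by simp
  show "1/4 \<le> redshift M r" if "r < 2*M"
  proof -
    have "r / M < 2" using that M by (simp add: field_simps)
    then have "1/2 \<le> \<tau>" unfolding \<tau>_def by (intro max.coboundedI2) linarith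
    then have "(1/2)^2 \<le> \<tau>^2" by (rule power_mono) simp
    then show ?thesis unfolding e by (simp add: power_divide)
  qed
  show "1/16 \<le> redshift M r" if "r < 9*M/4"
  proof -
    have "r / M < 9/4" using that M by (simp add: field_simps)
    then have "1/4 \<le> \<tau>" unfolding \<tau>_def by (intro max.coboundedI2) linarith
    then have "(1/4)^2 \<le> \<tau>^2" by (rule power_mono) simp
    then show ?thesis unfolding e by (simp add: power_divide)
  qed
qed

text \<open>In the null frame u_r = n L + m P with n = 1 - m h/2, and u_t = P - (h/2) L. The
  space-like condition on the slices is what makes n positive.\<close>

lemma energy_null_frame:
  fixes m h P L :: real
  assumes m: "0 \<le> m" "m \<le> m1" and n: "0 \<le> 1 - m * h / 2" "1 - m * h / 2 \<le> n1" and h: "\<bar>h\<bar> \<le> 1"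
  shows "((1 - m * h / 2) * L + m * P)\<^sup>2 \<le> 2 * (1 - m * h / 2)\<^sup>2 * L\<^sup>2 + 2 * m\<^sup>2 * P\<^sup>2"
    "((1 - m * h / 2) * L + m * P)\<^sup>2 + (P - h / 2 * L)\<^sup>2 \<le> (2 * n1\<^sup>2 + 1) * L\<^sup>2 + (2 * m1\<^sup>2 + 2) * P\<^sup>2"
proof -
  have sq: "(a + b)\<^sup>2 \<le> 2 * a\<^sup>2 + 2 * b\<^sup>2" for a b :: real
    using zero_le_power2[of "a - b"] by (simp add: power2_eq_square algebra_simps)
  show 1: "((1 - m * h / 2) * L + m * P)\<^sup>2 \<le> 2 * (1 - m * h / 2)\<^sup>2 * L\<^sup>2 + 2 * m\<^sup>2 * P\<^sup>2"
    using sq[of "(1 - m * h / 2) * L" "m * P"] by (simp add: power_mult_distrib)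
  have "(P - h / 2 * L)\<^sup>2 \<le> 2 * P\<^sup>2 + 2 * (h / 2 * L)\<^sup>2"
    using sq[of P "- (h / 2 * L)"] by simp
  also have "2 * (h / 2 * L)\<^sup>2 \<le> L\<^sup>2"
  proof -
    have "h\<^sup>2 \<le> 1" using h by (simp add: abs_square_le_1)
    from mult_right_mono[OF this, of "L\<^sup>2"] have "h\<^sup>2 * L\<^sup>2 \<le> L\<^sup>2" by simp
    moreover have "2 * (h / 2 * L)\<^sup>2 = h\<^sup>2 * L\<^sup>2 / 2" by (simp add: power_mult_distrib power_divide)
    ultimately show ?thesis using zero_le_power2[of L] by linarith
  qed
  finally have 2: "(P - h / 2 * L)\<^sup>2 \<le> 2 * P\<^sup>2 + L\<^sup>2" by simp
  have "(1 - m * h / 2)\<^sup>2 \<le> n1\<^sup>2" "m\<^sup>2 \<le> m1\<^sup>2" using m n by (auto intro: power_mono)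
  then have "2 * (1 - m * h / 2)\<^sup>2 * L\<^sup>2 \<le> 2 * n1\<^sup>2 * L\<^sup>2" "2 * m\<^sup>2 * P\<^sup>2 \<le> 2 * m1\<^sup>2 * P\<^sup>2"
    by (auto intro!: mult_right_mono)
  with 1 2 show "((1 - m * h / 2) * L + m * P)\<^sup>2 + (P - h / 2 * L)\<^sup>2 \<le> (2 * n1\<^sup>2 + 1) * L\<^sup>2 + (2 * m1\<^sup>2 + 2) * P\<^sup>2"
    by (simp add: algebra_simps)
qed

text \<open>\<open>C\<close> absorbs the zeroth order terms on a time slice, \<open>8 * C * n1\<close> is what the Hardy inequality costs.\<close>

locale exterior_constants =
  fixes M m0 m1 n0 n1 :: real
  assumes M: "M > 0" and m0: "m0 > 0" and n0: "n0 > 0" and m01: "m0 \<le> m1" and n01: "n0 \<le> n1"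
begin

definition "C = 2 * m1 + 1 + 5 * (1 + m1) + m1 + 4 * n1"
definition "D = 8 * C * n1"
text \<open>72 (D + 1) serves r \<ge> 9M/4, where h \<ge> 1/9 and an eighth of \<Lambda> h must
  exceed D + 1. 32 C m1 + 4 makes \<Lambda>/4 at least 8 C m1 + 1, the Hardy cost plus the energy in
  the P direction. The leading 4 helps keep \<Lambda> well above the size of the Morawetz factor,
  which lies between -2 and 1.\<close>

definition "\<Lambda> = 4 + 72 * (D + 1) + 32 * C * m1 + 4"
text \<open>The depth, in units of M, to which the exterior multiplier is continued inside the
  horizon. There h is negative but at most \<open>d\<close> in size, so that \<Lambda> times it is
  at most 1/256000, well below the red-shift term, which is at least 1/4000.\<close>

definition "d = 1 / (256000 * (\<Lambda> + D + 1))"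

lemma cpos: "C \<ge> 1" "D \<ge> 0" "\<Lambda> \<ge> 8" "d > 0" "d \<le> 1/256000" "\<Lambda> * d \<le> 1/256000" "D * d \<le> 1/256000"
proof -
  have m1: "m1 > 0" and n1: "n1 > 0" using m0 n0 m01 n01 by auto
  show C: "C \<ge> 1" using m1 n1 by (simp add: C_def)
  show D: "D \<ge> 0" using C n1 by (simp add: D_def)
  show L: "\<Lambda> \<ge> 8" using C D m1 by (simp add: \<Lambda>_def)
  show "d > 0" using L D by (simp add: d_def)
  show "d \<le> 1/256000" "\<Lambda> * d \<le> 1/256000" "D * d \<le> 1/256000"
    using L D by (simp_all add: d_def field_simps)
qed

context
  fixes r1 :: real
  assumes r1: "2*M - M * d \<le> r1" "r1 < 2*M"
begin

lemma r1_lower: "r1 \<ge> 7*M/4"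
proof -
  have "M * d \<le> M * (1/256000)" using cpos M by (intro mult_left_mono) auto
  then show ?thesis using r1 M by linarith
qed

text \<open>The coefficient of L^2 on a slice must exceed the Hardy cost D (r - r1)^2 / r^2 and the
  cross term share, with a margin. Inside the horizon the red-shift term does this alone, as the
  cost is tiny near \<open>r1\<close>. Outside, \<Lambda> h helps. It is essential that the Hardy
  weight vanishes at \<open>r1\<close>: a cost of fixed size at the horizon could not be met by the
  small red-shift term.\<close>

lemma exterior_setup:
  assumes r: "r \<ge> r1"
  defines "h \<equiv> lapse M r" and "x \<equiv> M/r" and "y \<equiv> redshift M r"
  defines "B \<equiv> \<Lambda> + (1 - x - 6 * x\<^sup>2)" and "Y \<equiv> (\<Lambda> - (1 - x - 6 * x\<^sup>2)) * (h / 2) + y / 1000"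
  shows "r > 0" "0 < x" "x \<le> 4/7" "\<bar>h\<bar> \<le> 1" "h < 0 \<Longrightarrow> \<bar>h\<bar> \<le> d" "B \<ge> \<Lambda>/2"
    "Y - \<bar>h\<bar> * (\<Lambda>/16) \<ge> D * ((r - r1)\<^sup>2 / r\<^sup>2) + 1/32000" "Y \<ge> 1/32000"
    "r < 2*M \<Longrightarrow> Y \<ge> 1/8000"
proof -
  have r7: "r \<ge> 7*M/4" using r r1_lower by simp
  then show rp: "r > 0" using M by linarith
  show x0: "0 < x" using M rp by (simp add: x_def)
  show x: "x \<le> 4/7" using r7 rp M by (simp add: x_def field_simps)
  have hx: "h = 1 - 2 * x" by (simp add: h_def lapse_def x_def)
  show h1: "\<bar>h\<bar> \<le> 1" using x x0 by (simp add: hx)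
  have hneg: "\<bar>h\<bar> \<le> d" if "h < 0"
  proof -
    have "r < 2*M" using that rp by (simp add: h_def lapse_def field_simps)
    have "\<bar>h\<bar> = (2*M - r) / r" using that rp by (simp add: h_def lapse_def field_simps)
    also have "\<dots> \<le> (M * d) / r" using r r1 rp by (intro divide_right_mono) auto
    also have "\<dots> = x * d" by (simp add: x_def)
    also have "\<dots> \<le> d" using x x0 cpos by (intro mult_left_le_one_le) auto
    finally show ?thesis .
  qed
  then show "h < 0 \<Longrightarrow> \<bar>h\<bar> \<le> d" .
  define F where "F = 1 - x - 6 * x\<^sup>2"
  have F: "-2 \<le> F" "F \<le> 1" using poly_bounds[of x] x x0 by (auto simp: F_def)
  show "B \<ge> \<Lambda>/2" unfolding B_def F_def[symmetric] using F cpos by linarith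
  have y: "0 \<le> y" "r < 2*M \<Longrightarrow> 1/4 \<le> y" "r < 9*M/4 \<Longrightarrow> 1/16 \<le> y"
    using redshift_bounds[OF M r7] by (auto simp: y_def)
  define W where "W = (r - r1)\<^sup>2 / r\<^sup>2"
  have W: "W = ((r - r1) / r)\<^sup>2" by (simp add: W_def power_divide)
  have Y: "Y = (\<Lambda> - F) * (h / 2) + y / 1000" by (simp add: Y_def F_def)
  have neg: "D * W + 1/32000 \<le> Y - \<bar>h\<bar> * (\<Lambda>/16) \<and> Y \<ge> 1/8000" if "r < 2*M"
  proof -
    have h: "h < 0" using that rp by (simp add: h_def lapse_def field_simps)
    have hd: "\<bar>h\<bar> \<le> d" by (rule hneg[OF h])
    have "\<Lambda> * \<bar>h\<bar> \<le> 1/256000" using mult_left_mono[OF hd, of \<Lambda>] cpos by linarith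
    moreover have "(\<Lambda> - F) * (h / 2) \<ge> - (\<Lambda> * \<bar>h\<bar>)"
    proof -
      have "(\<Lambda> - F) * \<bar>h\<bar> \<le> (2 * \<Lambda>) * \<bar>h\<bar>" using F cpos by (intro mult_right_mono) auto
      then show ?thesis using h by (simp add: algebra_simps)
    qed
    moreover have "D * W \<le> 1/256000"
    proof -
      have "(r - r1) / r \<le> d"
      proof -
        have "(r - r1) / r \<le> (M * d) / r" using that r r1 rp by (intro divide_right_mono) auto
        also have "\<dots> = x * d" by (simp add: x_def)
        also have "\<dots> \<le> d" using x x0 cpos by (intro mult_left_le_one_le) auto
        finally show ?thesis .
      qed
      then have "W \<le> d\<^sup>2" unfolding W using r rp by (intro power_mono) auto
      also have "d\<^sup>2 \<le> d" using cpos by (simp add: power2_eq_square mult_left_le_one_le)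
      finally have "D * W \<le> D * d" using cpos by (intro mult_left_mono) auto
      then show ?thesis using cpos by linarith
    qed
    moreover have "y / 1000 \<ge> 1/4000" using y that by simp
    moreover define G where "G = (\<Lambda> - F) * (h / 2)"
    moreover define H where "H = \<Lambda> * \<bar>h\<bar>"
    moreover define k where "k = y / 1000"
    ultimately have "H \<le> 1/256000" "- H \<le> G" "D * W \<le> 1/256000" "1/4000 \<le> k" "Y = G + k" "\<bar>h\<bar> * (\<Lambda>/16) = H / 16"
      by (simp_all add: Y)
    then show ?thesis by (intro conjI) linarith+
  qed
  have pos: "D * W + 1/32000 \<le> Y - \<bar>h\<bar> * (\<Lambda>/16)" if r2: "r \<ge> 2*M"
  proof -
    have h: "h \<ge> 0" using r2 rp by (simp add: h_def lapse_def field_simps)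
    have "(\<Lambda>/2) * (h/2) \<le> (\<Lambda> - F) * (h/2)" using F h cpos by (intro mult_right_mono) auto
    moreover define H where "H = \<Lambda> * h"
    moreover have "(\<Lambda>/2) * (h/2) = H / 4" "\<bar>h\<bar> * (\<Lambda>/16) = H / 16" "0 \<le> H" using h cpos by (simp_all add: H_def)
    ultimately have Z: "Y - \<bar>h\<bar> * (\<Lambda>/16) \<ge> H / 8 + y / 1000"
      unfolding Y by linarith
    show ?thesis
    \<comment> \<open>Near the horizon W \<le> 2 h + 2 d: the part with h is taken by \<Lambda> h /
      8 because 16 D \<le> \<Lambda>, the part with d by the red-shift term, which is at least
      1/16000. Further out h \<ge> 1/9, W \<le> 1, and \<Lambda> suffices.\<close>
    proof (cases "r < 9*M/4")
      case True
      have "(r - r1) / r \<le> h + d"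
      proof -
        have "(r - r1) / r \<le> (r - 2*M + M * d) / r" using r1 rp by (intro divide_right_mono) auto
        also have "\<dots> = h + x * d" using rp by (simp add: h_def lapse_def x_def field_simps)
        also have "\<dots> \<le> h + d" using mult_left_le_one_le[of d x] x x0 cpos by auto
        finally show ?thesis .
      qed
      then have "W \<le> (h + d)\<^sup>2" unfolding W using r rp by (intro power_mono) auto
      also have "\<dots> \<le> 2 * h\<^sup>2 + 2 * d\<^sup>2"
        using zero_le_power2[of "h - d"] by (simp add: power2_eq_square algebra_simps)
      also have "\<dots> \<le> 2 * h + 2 * d"
      proof -
        have "h * h \<le> 1 * h" "d * d \<le> 1 * d" using h h1 cpos by (intro mult_right_mono; simp)+
        then show ?thesis unfolding power2_eq_square by linarith
      qed
      finally have W2: "W \<le> 2 * h + 2 * d" .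
      have "D * W \<le> 2 * (D * h) + 2 * (D * d)"
      proof -
        have "D * W \<le> D * (2 * h + 2 * d)" using W2 cpos by (intro mult_left_mono) auto
        then show ?thesis by (simp only: distrib_left mult.left_commute)
      qed
      moreover have "16 * (D * h) \<le> H"
      proof -
        have "16 * D \<le> \<Lambda>" using cpos m0 m01 by (simp add: \<Lambda>_def)
        from mult_right_mono[OF this h] show ?thesis by (simp add: H_def)
      qed
      moreover define S where "S = \<bar>h\<bar> * (\<Lambda>/16)"
      moreover have "H / 8 + y / 1000 \<le> Y - S" using Z by (simp add: S_def)
      ultimately have "D * W + 1/32000 \<le> Y - S" using y(3)[OF True] cpos by linarith
      then show ?thesis by (simp add: S_def)
    next
      case False
      then have "h \<ge> 1/9" using rp M by (simp add: h_def lapse_def field_simps)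
      then have "\<Lambda> * (1/9) \<le> H" unfolding H_def using cpos by (intro mult_left_mono) auto
      moreover have "72 * (D + 1) \<le> \<Lambda>" using cpos m0 m01 by (simp add: \<Lambda>_def)
      ultimately have "D + 1 \<le> H / 8" by simp
      moreover have "D * W \<le> D"
      proof -
        have "(r - r1) / r \<le> 1" using rp r1_lower M by simp
        then have "W \<le> 1" unfolding W using r rp by (intro power_le_one) auto
        then show ?thesis using mult_left_mono[of W 1 D] cpos by simp
      qed
      ultimately have "D * W + 1/32000 \<le> H / 8 + y / 1000" using y(1) by simp
      then show ?thesis using Z by (rule order_trans)
    qed
  qed
  show Z: "Y - \<bar>h\<bar> * (\<Lambda>/16) \<ge> D * ((r - r1)\<^sup>2 / r\<^sup>2) + 1/32000"
    using neg pos by (cases "r < 2*M") (auto simp: W_def)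
  have "0 \<le> D * ((r - r1)\<^sup>2 / r\<^sup>2)" "0 \<le> \<bar>h\<bar> * (\<Lambda>/16)" using cpos by auto
  then show "Y \<ge> 1/32000" using Z by linarith
  show "r < 2*M \<Longrightarrow> Y \<ge> 1/8000" using neg by simp
qed

lemma exterior_q:
  assumes "r \<ge> r1"
  shows "\<exists>ph. \<bar>ph\<bar> \<le> 2 \<and> cq (exterior_coefs M \<Lambda>) r * r\<^sup>2 = r * lapse M r * ph"
    "\<bar>cq' (exterior_coefs M \<Lambda>) r * r\<^sup>2\<bar> \<le> 10"
proof -
  note s = exterior_setup[OF assms]
  define x where "x = M/r"
  have x: "0 \<le> x" "x \<le> 4/7" "M = x * r" using s by (auto simp: x_def)
  have "cq (exterior_coefs M \<Lambda>) r * r\<^sup>2 = r * lapse M r * (- 1 + x/2 + x * (1 - 3*x)\<^sup>2 / 100000)"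
    unfolding exterior_coefs_def coefs.select_convs pq_factor x_def[symmetric] lapse_def
    using s(1) M by (simp add: x_def field_simps power2_eq_square)
  then show "\<exists>ph. \<bar>ph\<bar> \<le> 2 \<and> cq (exterior_coefs M \<Lambda>) r * r\<^sup>2 = r * lapse M r * ph"
    using poly_bounds(1)[OF x(1,2)] by blast
  show "\<bar>cq' (exterior_coefs M \<Lambda>) r * r\<^sup>2\<bar> \<le> 10"
    using poly_bounds(2)[OF x(1,2)] s(1) by (simp add: exterior_coefs_def x_def)
qed

text \<open>The second summand on the left has the shape of the Hardy defect: integrated over a
  slice of a decaying function, 4 (r - r1)^2 u_r^2 outweighs u^2, so the slice integral controls the
  energy although the density itself is not positive.\<close>

lemma exterior_slice:
  fixes P L Q U m :: real
  assumes r: "r \<ge> r1" and m: "m0 \<le> m" "m \<le> m1" and n: "n0 \<le> 1 - m * lapse M r / 2" "1 - m * lapse M r / 2 \<le> n1" and Q: "Q \<ge> 0"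
  defines "ur \<equiv> (1 - m * lapse M r / 2) * L + m * P" and "ut \<equiv> P - lapse M r / 2 * L"
  shows "min n0 (min (m0 / (2 * m1\<^sup>2 + 2)) (n0 / 32000 / (2 * n1\<^sup>2 + 1))) * (r\<^sup>2 * (ur\<^sup>2 + ut\<^sup>2) + Q)
     + C * (4 * (r - r1)\<^sup>2 * ur\<^sup>2 - U\<^sup>2) \<le> slice_dens (exterior_coefs M \<Lambda>) M m r P L Q U"
proof -
  define h where "h = lapse M r"
  define n where "n = 1 - m * h / 2"
  define x where "x = M/r"
  define B where "B = \<Lambda> + (1 - x - 6 * x\<^sup>2)"
  define Y where "Y = (\<Lambda> - (1 - x - 6 * x\<^sup>2)) * (h / 2) + redshift M r / 1000"
  note s = exterior_setup[OF r, folded h_def x_def, folded B_def Y_def]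
  have nn: "n0 \<le> n" "n \<le> n1" using n by (simp_all add: n_def h_def)
  have n0': "n > 0" "m > 0" using nn n0 m m0 by auto
  obtain ph where ph: "\<bar>ph\<bar> \<le> 2" "cq (exterior_coefs M \<Lambda>) r * r\<^sup>2 = r * h * ph"
    using exterior_q(1)[OF r] by (auto simp: h_def)
  define q1 where "q1 = cq' (exterior_coefs M \<Lambda>) r * r\<^sup>2"
  have q1: "\<bar>q1\<bar> \<le> 10" using exterior_q(2)[OF r] by (simp add: q1_def)
  define b where "b = h * x + redshift M r / 4000"
  define z0 where "z0 = m * b - x - q1 * (1 - m * h) / 2"
  have sl: "slice_dens (exterior_coefs M \<Lambda>) M m r P L Q U = r\<^sup>2 * (m * B * P\<^sup>2 + n * Y * L\<^sup>2) + (B * n + m * Y) / 2 * Q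
     + r * h * ph * (U * (n * L - m * P)) + z0 * U\<^sup>2"
    unfolding slice_dens_def Let_def ph(2)[unfolded h_def] q1_def[symmetric] n_def[symmetric] h_def[symmetric]
    by (simp add: exterior_coefs_def B_def Y_def x_def h_def n_def z0_def b_def)
  have mh: "\<bar>m * h\<bar> \<le> m1" using mult_mono[of m m1 "\<bar>h\<bar>" 1] m m0 s(4) by (simp add: abs_mult)
  have r7: "r \<ge> 7*M/4" using r r1_lower by simp
  have z0: "z0 \<ge> - (2 * m1 + 1 + 5 * (1 + m1))"
  proof -
    have "\<bar>h * x\<bar> \<le> 1 * 1" unfolding abs_mult using s by (intro mult_mono) auto
    then have "\<bar>b\<bar> \<le> 2" using redshift_bounds(1,2)[OF M r7] unfolding b_def abs_le_iff by (intro conjI) linarith+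
    then have "\<bar>m * b\<bar> \<le> m1 * 2" unfolding abs_mult using m m0 by (intro mult_mono) auto
    moreover have "\<bar>q1 * (1 - m * h)\<bar> \<le> 10 * (1 + m1)" unfolding abs_mult using q1 mh by (intro mult_mono) auto
    moreover define k where "k = q1 * (1 - m * h)"
    moreover define l where "l = m * b"
    ultimately have "\<bar>l\<bar> \<le> m1 * 2" "\<bar>k\<bar> \<le> 10 * (1 + m1)" "z0 = l - x - k / 2" by (simp_all add: z0_def)
    then show ?thesis using s(3) unfolding abs_le_iff by linarith
  qed
  have cP: "r * h * ph * (U * (m * P)) \<le> m * (\<Lambda>/4) * (r\<^sup>2 * P\<^sup>2) + m1 * U\<^sup>2"
  proof -
    have "\<bar>h * ph\<bar> \<le> 1 * 2" unfolding abs_mult using s(4) ph by (intro mult_mono) auto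
    then have "\<bar>h * ph * (r * P * U)\<bar> \<le> 2 * \<bar>r * P * U\<bar>"
      unfolding abs_mult[of "h * ph"] by (intro mult_right_mono) auto
    also have "\<dots> = \<bar>2 * (r * P) * U\<bar>" by (simp add: abs_mult)
    also have "\<dots> \<le> (\<Lambda>/4) * (r * P)\<^sup>2 + U\<^sup>2 / (\<Lambda>/4)" by (rule young_abs) (use cpos in simp)
    also have "U\<^sup>2 / (\<Lambda>/4) \<le> U\<^sup>2 / 1" using cpos by (intro divide_left_mono) auto
    finally have "m * (h * ph * (r * P * U)) \<le> m * ((\<Lambda>/4) * (r * P)\<^sup>2 + U\<^sup>2)" using n0' by (intro mult_left_mono) auto
    moreover have "m * U\<^sup>2 \<le> m1 * U\<^sup>2" using m by (intro mult_right_mono) auto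
    ultimately show ?thesis by (simp add: power_mult_distrib algebra_simps)
  qed
  have cL: "- (r * h * ph * (U * (n * L))) \<le> n * (\<bar>h\<bar> * (\<Lambda>/16)) * (r\<^sup>2 * L\<^sup>2) + 4 * n1 * U\<^sup>2"
  proof -
    have "\<bar>ph * (r * L * U)\<bar> \<le> 2 * \<bar>r * L * U\<bar>" unfolding abs_mult[of ph] using ph by (intro mult_right_mono) auto
    also have "\<dots> = \<bar>2 * (r * L) * U\<bar>" by (simp add: abs_mult)
    also have "\<dots> \<le> (\<Lambda>/16) * (r * L)\<^sup>2 + U\<^sup>2 / (\<Lambda>/16)" by (rule young_abs) (use cpos in simp)
    also have "U\<^sup>2 / (\<Lambda>/16) \<le> U\<^sup>2 / (1/4)" using cpos by (intro divide_left_mono) auto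
    finally have "\<bar>h\<bar> * \<bar>ph * (r * L * U)\<bar> \<le> \<bar>h\<bar> * ((\<Lambda>/16) * (r * L)\<^sup>2 + 4 * U\<^sup>2)" by (intro mult_left_mono) auto
    also have "\<dots> \<le> \<bar>h\<bar> * ((\<Lambda>/16) * (r * L)\<^sup>2) + 4 * U\<^sup>2"
      using mult_right_mono[OF s(4), of "4 * U\<^sup>2"] by (simp add: distrib_left)
    finally have "\<bar>h * (ph * (r * L * U))\<bar> \<le> \<bar>h\<bar> * ((\<Lambda>/16) * (r * L)\<^sup>2) + 4 * U\<^sup>2" by (simp add: abs_mult)
    then have "- (h * (ph * (r * L * U))) \<le> \<bar>h\<bar> * ((\<Lambda>/16) * (r * L)\<^sup>2) + 4 * U\<^sup>2" by linarith
    then have "n * - (h * (ph * (r * L * U))) \<le> n * (\<bar>h\<bar> * ((\<Lambda>/16) * (r * L)\<^sup>2) + 4 * U\<^sup>2)" using n0' by (intro mult_left_mono) auto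
    moreover have "n * (4 * U\<^sup>2) \<le> n1 * (4 * U\<^sup>2)" using nn by (intro mult_right_mono) auto
    ultimately show ?thesis by (simp add: power_mult_distrib algebra_simps)
  qed
  have z: "- (2 * m1 + 1 + 5 * (1 + m1)) * U\<^sup>2 \<le> z0 * U\<^sup>2" using z0 by (intro mult_right_mono) auto
  have BP: "m * (\<Lambda>/2) * (r\<^sup>2 * P\<^sup>2) \<le> m * B * (r\<^sup>2 * P\<^sup>2)" using s(6) n0' by (intro mult_right_mono mult_left_mono) auto
  have QQ: "n0 * Q \<le> (B * n + m * Y) / 2 * Q"
  proof (rule mult_right_mono[OF _ Q])
    have "4 * n0 \<le> B * n" using s(6) cpos nn n0 by (intro mult_mono) auto
    moreover have "0 \<le> m * Y" using n0' s(8) by simp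
    ultimately have "2 * n0 \<le> B * n + m * Y" using n0 by linarith
    then show "n0 \<le> (B * n + m * Y) / 2" by simp
  qed
  define Z where "Z = Y - \<bar>h\<bar> * (\<Lambda>/16)"
  have low: "m * (\<Lambda>/4) * (r\<^sup>2 * P\<^sup>2) + n * Z * (r\<^sup>2 * L\<^sup>2) + n0 * Q - C * U\<^sup>2 \<le> slice_dens (exterior_coefs M \<Lambda>) M m r P L Q U"
  proof -
    have "m * (\<Lambda>/4) * (r\<^sup>2 * P\<^sup>2) = m * (\<Lambda>/2) * (r\<^sup>2 * P\<^sup>2) - m * (\<Lambda>/4) * (r\<^sup>2 * P\<^sup>2)" by simp
    moreover have "n * Z * (r\<^sup>2 * L\<^sup>2) = n * Y * (r\<^sup>2 * L\<^sup>2) - n * (\<bar>h\<bar> * (\<Lambda>/16)) * (r\<^sup>2 * L\<^sup>2)" by (simp add: Z_def algebra_simps)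
    moreover have "C * U\<^sup>2 = (2 * m1 + 1 + 5 * (1 + m1)) * U\<^sup>2 + m1 * U\<^sup>2 + 4 * n1 * U\<^sup>2" by (simp add: C_def algebra_simps)
    moreover have "r\<^sup>2 * (m * B * P\<^sup>2 + n * Y * L\<^sup>2) = m * B * (r\<^sup>2 * P\<^sup>2) + n * Y * (r\<^sup>2 * L\<^sup>2)" by (simp add: algebra_simps)
    moreover have "r * h * ph * (U * (n * L - m * P)) = r * h * ph * (U * (n * L)) - r * h * ph * (U * (m * P))" by (simp add: algebra_simps)
    moreover have "- (2 * m1 + 1 + 5 * (1 + m1)) * U\<^sup>2 = - ((2 * m1 + 1 + 5 * (1 + m1)) * U\<^sup>2)" by (rule minus_mult_left[symmetric])
    ultimately show ?thesis unfolding sl using cP cL z BP QQ by linarith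
  qed
  define \<kappa> where "\<kappa> = min n0 (min (m0 / (2 * m1\<^sup>2 + 2)) (n0 / 32000 / (2 * n1\<^sup>2 + 1)))"
  have pos: "2 * m1\<^sup>2 + 2 > 0" "2 * n1\<^sup>2 + 1 > 0" by (simp_all add: add_nonneg_pos)
  have \<kappa>0: "\<kappa> > 0" unfolding \<kappa>_def using m0 n0 pos by simp
  have k1: "\<kappa> \<le> n0" unfolding \<kappa>_def by (rule min.cobounded1)
  have "\<kappa> \<le> m0 / (2 * m1\<^sup>2 + 2)" unfolding \<kappa>_def by (rule min.coboundedI2[OF min.cobounded1])
  then have k2: "\<kappa> * (2 * m1\<^sup>2 + 2) \<le> m0" by (simp only: pos_le_divide_eq[OF pos(1)])
  have "\<kappa> \<le> n0 / 32000 / (2 * n1\<^sup>2 + 1)" unfolding \<kappa>_def by (rule min.coboundedI2[OF min.cobounded2])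
  then have k3: "\<kappa> * (2 * n1\<^sup>2 + 1) \<le> n0 / 32000" by (simp only: pos_le_divide_eq[OF pos(2)])
  define W where "W = (r - r1)\<^sup>2 / r\<^sup>2"
  have W: "(r - r1)\<^sup>2 = W * r\<^sup>2" "0 \<le> W" using s(1) by (simp_all add: W_def)
  have W1: "W \<le> 1"
  proof -
    have "(r - r1)\<^sup>2 \<le> r\<^sup>2" using r r1_lower M by (intro power_mono) auto
    then show ?thesis using s(1) by (simp add: W_def)
  qed
  note en = energy_null_frame[of m m1 h n1 L P, folded n_def]
  have e1: "(n * L + m * P)\<^sup>2 \<le> 2 * n\<^sup>2 * L\<^sup>2 + 2 * m\<^sup>2 * P\<^sup>2"
    and e2: "(n * L + m * P)\<^sup>2 + (P - h / 2 * L)\<^sup>2 \<le> (2 * n1\<^sup>2 + 1) * L\<^sup>2 + (2 * m1\<^sup>2 + 2) * P\<^sup>2"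
    using en m m0 nn n0' s(4) by auto
  have ee: "\<kappa> * (r\<^sup>2 * ((n * L + m * P)\<^sup>2 + (P - h / 2 * L)\<^sup>2)) \<le> (n0 / 32000) * (r\<^sup>2 * L\<^sup>2) + m0 * (r\<^sup>2 * P\<^sup>2)"
  proof -
    have "\<kappa> * (r\<^sup>2 * ((n * L + m * P)\<^sup>2 + (P - h / 2 * L)\<^sup>2)) \<le> \<kappa> * (r\<^sup>2 * ((2 * n1\<^sup>2 + 1) * L\<^sup>2 + (2 * m1\<^sup>2 + 2) * P\<^sup>2))"
      using e2 \<kappa>0 by (intro mult_left_mono) auto
    also have "\<dots> = \<kappa> * (2 * n1\<^sup>2 + 1) * (r\<^sup>2 * L\<^sup>2) + \<kappa> * (2 * m1\<^sup>2 + 2) * (r\<^sup>2 * P\<^sup>2)" by (simp add: algebra_simps)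
    also have "\<dots> \<le> (n0 / 32000) * (r\<^sup>2 * L\<^sup>2) + m0 * (r\<^sup>2 * P\<^sup>2)" using k2 k3 by (intro add_mono mult_right_mono) auto
    finally show ?thesis .
  qed
  \<comment> \<open>Here 8 is 4 from the Hardy inequality times 2 from the square of n L + m P. One
    factor n is kept for comparison with n Y L^2 and the other is bounded by \<open>n1\<close>,
    which gives \<open>D\<close>.\<close>
  have hardy: "C * (4 * (r - r1)\<^sup>2 * (n * L + m * P)\<^sup>2) \<le> n * (D * W) * (r\<^sup>2 * L\<^sup>2) + m * (8 * C * m1) * (r\<^sup>2 * P\<^sup>2)"
  proof -
    have "C * (4 * (r - r1)\<^sup>2 * (n * L + m * P)\<^sup>2) \<le> C * (4 * (W * r\<^sup>2) * (2 * n\<^sup>2 * L\<^sup>2 + 2 * m\<^sup>2 * P\<^sup>2))"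
      unfolding W(1) using e1 cpos W by (intro mult_left_mono) auto
    also have "\<dots> = n * (8 * C * n * W) * (r\<^sup>2 * L\<^sup>2) + m * (8 * C * m * W) * (r\<^sup>2 * P\<^sup>2)"
      by (simp add: power2_eq_square algebra_simps)
    also have "\<dots> \<le> n * (8 * C * n1 * W) * (r\<^sup>2 * L\<^sup>2) + m * (8 * C * m1 * 1) * (r\<^sup>2 * P\<^sup>2)"
      using n0' nn m W W1 cpos by (intro add_mono mult_right_mono mult_left_mono mult_mono) auto
    finally show ?thesis by (simp add: D_def mult_ac)
  qed
  have fP: "m * (8 * C * m1) * (r\<^sup>2 * P\<^sup>2) + m0 * (r\<^sup>2 * P\<^sup>2) \<le> m * (\<Lambda>/4) * (r\<^sup>2 * P\<^sup>2)"
  proof -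
    have "m * (8 * C * m1 + 1) \<le> m * (\<Lambda>/4)" using n0' cpos by (intro mult_left_mono) (auto simp: \<Lambda>_def)
    then have "m * (8 * C * m1) + m0 \<le> m * (\<Lambda>/4)" using m by (simp add: algebra_simps)
    from mult_right_mono[OF this, of "r\<^sup>2 * P\<^sup>2"] show ?thesis by (simp add: algebra_simps)
  qed
  have fL: "n * (D * W) * (r\<^sup>2 * L\<^sup>2) + (n0 / 32000) * (r\<^sup>2 * L\<^sup>2) \<le> n * Z * (r\<^sup>2 * L\<^sup>2)"
  proof -
    have "D * W + 1/32000 \<le> Z" using s(7) by (simp add: Z_def W_def)
    then have "n * (D * W + 1/32000) \<le> n * Z" using n0' by (intro mult_left_mono) auto
    then have "n * (D * W) + n0 / 32000 \<le> n * Z" using nn by (simp add: algebra_simps)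
    from mult_right_mono[OF this, of "r\<^sup>2 * L\<^sup>2"] show ?thesis by (simp add: algebra_simps)
  qed
  have kQ: "\<kappa> * Q \<le> n0 * Q" using k1 Q by (rule mult_right_mono)
  have u: "ur = n * L + m * P" "ut = P - h / 2 * L" by (simp_all add: ur_def ut_def n_def h_def)
  have "\<kappa> * (r\<^sup>2 * (ur\<^sup>2 + ut\<^sup>2) + Q) + C * (4 * (r - r1)\<^sup>2 * ur\<^sup>2 - U\<^sup>2)
    = \<kappa> * (r\<^sup>2 * ((n * L + m * P)\<^sup>2 + (P - h / 2 * L)\<^sup>2)) + \<kappa> * Q + C * (4 * (r - r1)\<^sup>2 * (n * L + m * P)\<^sup>2) - C * U\<^sup>2"
    unfolding u by (simp add: algebra_simps)
  then show ?thesis using low ee hardy fP fL kQ unfolding \<kappa>_def[symmetric] by linarith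
qed

text \<open>Inside the horizon the surface r = r1 is space-like, so its flux is definite, with an
  L^2 coefficient proportional to \<eta> that degenerates as \<open>r1\<close> approaches 2M. The
  control of U^2 is included since the interior estimate starts from this surface.\<close>

lemma exterior_flux:
  fixes P L Q U m :: real
  assumes m: "m0 \<le> m" "m \<le> m1" and n: "n0 \<le> 1 - m * lapse M r1 / 2" "1 - m * lapse M r1 / 2 \<le> n1" and Q: "Q \<ge> 0"
  defines "\<eta> \<equiv> - lapse M r1"
  defines "ur \<equiv> (1 - m * lapse M r1 / 2) * L + m * P" and "ut \<equiv> P - lapse M r1 / 2 * L"
  shows "min (1/32000) (min (1 / (2 * m1\<^sup>2 + 2)) (\<eta> / 32000 / (2 * n1\<^sup>2 + 1))) * (r1\<^sup>2 * (ur\<^sup>2 + ut\<^sup>2) + Q + U\<^sup>2)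
     \<le> - flux_dens (exterior_coefs M \<Lambda>) M r1 P L Q U" and "\<eta> > 0"
proof -
  define h where "h = lapse M r1"
  define n where "n = 1 - m * h / 2"
  define x where "x = M/r1"
  define B where "B = \<Lambda> + (1 - x - 6 * x\<^sup>2)"
  define Y where "Y = (\<Lambda> - (1 - x - 6 * x\<^sup>2)) * (h / 2) + redshift M r1 / 1000"
  note s = exterior_setup[OF order_refl, folded h_def x_def, folded B_def Y_def]
  have h: "h = - \<eta>" by (simp add: \<eta>_def h_def)
  show \<eta>0: "\<eta> > 0" using r1 s(1) by (simp add: \<eta>_def lapse_def field_simps)
  have \<eta>d: "\<eta> \<le> 1/256000" using s(5) \<eta>0 h cpos by auto
  have Y: "Y \<ge> 1/8000" using s(9) r1 by simp
  obtain ph where ph: "\<bar>ph\<bar> \<le> 2" "cq (exterior_coefs M \<Lambda>) r1 * r1\<^sup>2 = r1 * h * ph"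
    using exterior_q(1)[OF order_refl] by (auto simp: h_def)
  define q1 where "q1 = cq' (exterior_coefs M \<Lambda>) r1 * r1\<^sup>2"
  have q1: "\<bar>q1\<bar> \<le> 10" using exterior_q(2)[OF order_refl] by (simp add: q1_def)
  define b where "b = h * x + redshift M r1 / 4000"
  have fl: "flux_dens (exterior_coefs M \<Lambda>) M r1 P L Q U = r1\<^sup>2 * (h * Y / 2 * L\<^sup>2 - B * P\<^sup>2) - (Y - B * h / 2) / 2 * Q
     + r1 * h * ph * (U * (P + h / 2 * L)) - (b + q1 * h / 2) * U\<^sup>2"
    unfolding flux_dens_def Let_def ph(2)[unfolded h_def] q1_def[symmetric] h_def[symmetric]
    by (simp add: exterior_coefs_def B_def Y_def x_def h_def b_def)
  have r7: "r1 \<ge> 7*M/4" by (rule r1_lower)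
  \<comment> \<open>h M/r has the wrong sign here; the red-shift part of \<open>cb\<close> is at
    least 16/256000, from which \<eta> x and the \<open>cq'\<close> term take at most
    6/256000.\<close>
  have bU: "10/256000 \<le> b + q1 * h / 2"
  proof -
    have "\<eta> * x \<le> \<eta> * 1" using s \<eta>0 by (intro mult_left_mono) auto
    moreover have "\<bar>q1 * \<eta>\<bar> \<le> 10 * \<eta>" unfolding abs_mult using q1 \<eta>0 by (intro mult_mono) auto
    then have "q1 * \<eta> \<le> 10 * \<eta>" by (rule abs_le_D1)
    moreover have "redshift M r1 \<ge> 1/4" using redshift_bounds(4)[OF M r7] r1 by simp
    moreover have "b + q1 * h / 2 = redshift M r1 / 4000 - \<eta> * x - (q1 * \<eta>) / 2"
      by (simp add: b_def h)
    ultimately show ?thesis using \<eta>d by linarith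
  qed
  have c1: "r1 * h * ph * (U * P) \<le> \<eta> * (r1\<^sup>2 * P\<^sup>2) + \<eta> * U\<^sup>2"
  proof -
    have "\<bar>ph * (r1 * P * U)\<bar> \<le> 2 * \<bar>r1 * P * U\<bar>" unfolding abs_mult[of ph] using ph by (intro mult_right_mono) auto
    also have "\<dots> = \<bar>2 * (r1 * P) * U\<bar>" by (simp add: abs_mult)
    also have "\<dots> \<le> 1 * (r1 * P)\<^sup>2 + U\<^sup>2 / 1" by (rule young_abs) simp
    finally have "- (ph * (r1 * P * U)) \<le> (r1 * P)\<^sup>2 + U\<^sup>2" by simp
    from mult_left_mono[OF this, of \<eta>] \<eta>0 show ?thesis by (simp add: h power_mult_distrib algebra_simps)
  qed
  have c2: "r1 * h * ph * (U * (h / 2 * L)) \<le> \<eta> * (1/16000) / 2 * (r1\<^sup>2 * L\<^sup>2) + \<eta> * U\<^sup>2"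
  proof -
    have "\<bar>ph * (r1 * L * U)\<bar> \<le> 2 * \<bar>r1 * L * U\<bar>" unfolding abs_mult[of ph] using ph by (intro mult_right_mono) auto
    also have "\<dots> = \<bar>2 * (r1 * L) * U\<bar>" by (simp add: abs_mult)
    also have "\<dots> \<le> 1 * (r1 * L)\<^sup>2 + U\<^sup>2 / 1" by (rule young_abs) simp
    finally have "ph * (r1 * L * U) \<le> (r1 * L)\<^sup>2 + U\<^sup>2" by simp
    then have "\<eta> * \<eta> / 2 * (ph * (r1 * L * U)) \<le> \<eta> * \<eta> / 2 * ((r1 * L)\<^sup>2 + U\<^sup>2)" using \<eta>0 by (intro mult_left_mono) auto
    also have "\<dots> \<le> \<eta> * (1/16000) / 2 * ((r1 * L)\<^sup>2 + U\<^sup>2)" using \<eta>0 \<eta>d by (intro mult_right_mono divide_right_mono mult_left_mono) auto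
    also have "\<dots> \<le> \<eta> * (1/16000) / 2 * (r1 * L)\<^sup>2 + \<eta> * U\<^sup>2" using \<eta>0 by (simp add: distrib_left)
    finally show ?thesis by (simp add: h power_mult_distrib algebra_simps)
  qed
  have low: "r1\<^sup>2 * P\<^sup>2 + \<eta> / 32000 * (r1\<^sup>2 * L\<^sup>2) + Q / 32000 + U\<^sup>2 / 32000 \<le> - flux_dens (exterior_coefs M \<Lambda>) M r1 P L Q U"
  proof -
    have "2 * (r1\<^sup>2 * P\<^sup>2) \<le> B * (r1\<^sup>2 * P\<^sup>2)" using s(6) cpos by (intro mult_right_mono) auto
    moreover have "\<eta> * (1/8000) / 2 * (r1\<^sup>2 * L\<^sup>2) \<le> \<eta> * Y / 2 * (r1\<^sup>2 * L\<^sup>2)" using Y \<eta>0 by (intro mult_right_mono divide_right_mono mult_left_mono) auto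
    moreover have "(1/16000) * Q \<le> (Y + B * \<eta> / 2) / 2 * Q"
    proof (rule mult_right_mono[OF _ Q])
      have "0 \<le> B * \<eta>" using s(6) cpos \<eta>0 by simp
      then show "1/16000 \<le> (Y + B * \<eta> / 2) / 2" using Y by simp
    qed
    moreover have "(10/256000) * U\<^sup>2 \<le> (b + q1 * h / 2) * U\<^sup>2" using bU by (intro mult_right_mono) auto
    moreover have "\<eta> * (r1\<^sup>2 * P\<^sup>2) \<le> 1 * (r1\<^sup>2 * P\<^sup>2)" "\<eta> * U\<^sup>2 \<le> (1/256000) * U\<^sup>2" using \<eta>d by (intro mult_right_mono; simp)+
    moreover have "- flux_dens (exterior_coefs M \<Lambda>) M r1 P L Q U = \<eta> * Y / 2 * (r1\<^sup>2 * L\<^sup>2) + B * (r1\<^sup>2 * P\<^sup>2) + (Y + B * \<eta> / 2) / 2 * Q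
      - r1 * h * ph * (U * P) - r1 * h * ph * (U * (h / 2 * L)) + (b + q1 * h / 2) * U\<^sup>2"
      unfolding fl by (simp add: h algebra_simps)
    moreover have "0 \<le> \<eta> * (r1\<^sup>2 * L\<^sup>2)" using \<eta>0 by simp
    ultimately show ?thesis using c1 c2 Q zero_le_power2[of U] by linarith
  qed
  define \<kappa> where "\<kappa> = min (1/32000) (min (1 / (2 * m1\<^sup>2 + 2)) (\<eta> / 32000 / (2 * n1\<^sup>2 + 1)))"
  have pos: "2 * m1\<^sup>2 + 2 > 0" "2 * n1\<^sup>2 + 1 > 0" by (simp_all add: add_nonneg_pos)
  have \<kappa>0: "\<kappa> > 0" unfolding \<kappa>_def using \<eta>0 pos by simp
  have k1: "\<kappa> \<le> 1/32000" unfolding \<kappa>_def by (rule min.cobounded1)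
  have "\<kappa> \<le> 1 / (2 * m1\<^sup>2 + 2)" unfolding \<kappa>_def by (rule min.coboundedI2[OF min.cobounded1])
  then have k2: "\<kappa> * (2 * m1\<^sup>2 + 2) \<le> 1" by (simp only: pos_le_divide_eq[OF pos(1)])
  have "\<kappa> \<le> \<eta> / 32000 / (2 * n1\<^sup>2 + 1)" unfolding \<kappa>_def by (rule min.coboundedI2[OF min.cobounded2])
  then have k3: "\<kappa> * (2 * n1\<^sup>2 + 1) \<le> \<eta> / 32000" by (simp only: pos_le_divide_eq[OF pos(2)])
  have nn: "n0 \<le> n" "n \<le> n1" using n by (simp_all add: n_def h_def)
  have e2: "(n * L + m * P)\<^sup>2 + (P - h / 2 * L)\<^sup>2 \<le> (2 * n1\<^sup>2 + 1) * L\<^sup>2 + (2 * m1\<^sup>2 + 2) * P\<^sup>2"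
    using energy_null_frame(2)[of m m1 h n1 L P, folded n_def] m m0 nn n0 s(4) by auto
  have u: "ur = n * L + m * P" "ut = P - h / 2 * L" by (simp_all add: ur_def ut_def n_def h_def)
  have "\<kappa> * (r1\<^sup>2 * (ur\<^sup>2 + ut\<^sup>2)) \<le> \<kappa> * (r1\<^sup>2 * ((2 * n1\<^sup>2 + 1) * L\<^sup>2 + (2 * m1\<^sup>2 + 2) * P\<^sup>2))"
    unfolding u using e2 \<kappa>0 by (intro mult_left_mono) auto
  also have "\<dots> = \<kappa> * (2 * n1\<^sup>2 + 1) * (r1\<^sup>2 * L\<^sup>2) + \<kappa> * (2 * m1\<^sup>2 + 2) * (r1\<^sup>2 * P\<^sup>2)" by (simp add: algebra_simps)
  also have "\<dots> \<le> (\<eta> / 32000) * (r1\<^sup>2 * L\<^sup>2) + 1 * (r1\<^sup>2 * P\<^sup>2)" using k2 k3 by (intro add_mono mult_right_mono) auto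
  finally have "\<kappa> * (r1\<^sup>2 * (ur\<^sup>2 + ut\<^sup>2)) \<le> (\<eta> / 32000) * (r1\<^sup>2 * L\<^sup>2) + r1\<^sup>2 * P\<^sup>2" by simp
  moreover have "\<kappa> * Q \<le> (1/32000) * Q" by (rule mult_right_mono[OF k1 Q])
  moreover have "\<kappa> * U\<^sup>2 \<le> (1/32000) * U\<^sup>2" by (rule mult_right_mono[OF k1 zero_le_power2])
  ultimately have "\<kappa> * (r1\<^sup>2 * (ur\<^sup>2 + ut\<^sup>2)) + \<kappa> * Q + \<kappa> * U\<^sup>2 \<le> - flux_dens (exterior_coefs M \<Lambda>) M r1 P L Q U"
    using low by linarith
  then show "min (1/32000) (min (1 / (2 * m1\<^sup>2 + 2)) (\<eta> / 32000 / (2 * n1\<^sup>2 + 1))) * (r1\<^sup>2 * (ur\<^sup>2 + ut\<^sup>2) + Q + U\<^sup>2)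
     \<le> - flux_dens (exterior_coefs M \<Lambda>) M r1 P L Q U" unfolding \<kappa>_def[symmetric] by (simp add: distrib_left)
qed

end

end

section \<open>Hardy inequality\<close>

lemma cut_lower:
  fixes X g :: "'a::euclidean_space \<Rightarrow> real"
  assumes "S \<subseteq> S'" "g integrable_on S" "(\<lambda>x. X x * g x) integrable_on S" "(\<lambda>x. X x * g x) integrable_on S'"
    and "\<And>x. x \<in> S' \<Longrightarrow> 0 \<le> X x" "\<And>x. x \<in> S' \<Longrightarrow> 0 \<le> g x" "\<And>x. x \<in> S \<Longrightarrow> \<theta> \<le> X x"
  shows "\<theta> * integral S g \<le> integral S' (\<lambda>x. X x * g x)"
proof -
  have "\<theta> * integral S g = integral S (\<lambda>x. \<theta> * g x)" by simp
  also have "\<dots> \<le> integral S (\<lambda>x. X x * g x)"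
    by (rule integral_le[OF integrable_on_mult_right assms(3)]) (use assms in \<open>auto intro!: mult_right_mono\<close>)
  also have "\<dots> \<le> integral S' (\<lambda>x. X x * g x)"
    by (rule integral_subset_le[OF assms(1,3,4)]) (use assms in auto)
  finally show ?thesis .
qed

text \<open>Removes the cut-off: \<open>n\<close> is its scale, 1 - 2 W/n its lower bound on a fixed
  region, and B/n the error caused by its derivative.\<close>

lemma le_of_scaled_le:
  fixes S Z B W :: real
  assumes "\<And>n. n > 0 \<Longrightarrow> (1 - 2 * W / n) * S \<le> Z + B / n"
  shows "S \<le> Z"
proof (rule field_le_epsilon)
  fix e :: real assume e: "e > 0"
  define A where "A = \<bar>B + 2 * W * S\<bar>"
  have A: "A \<ge> 0" by (simp add: A_def)
  define n where "n = (A + 1) / e"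
  have n: "n > 0" using A e by (simp add: n_def)
  have "S \<le> Z + (B + 2 * W * S) / n" using assms[OF n] by (simp add: algebra_simps add_divide_distrib)
  moreover have "(B + 2 * W * S) / n \<le> A / n" using n by (intro divide_right_mono) (auto simp: A_def)
  moreover have "A / n \<le> e"
  proof -
    have "A / n = A * e / (A + 1)" by (simp add: n_def)
    also have "\<dots> \<le> e" using A e by (simp add: field_simps)
    finally show ?thesis .
  qed
  ultimately show "S \<le> Z + e" by linarith
qed

context schw_wave
begin

abbreviation "ctd b G \<equiv> continuous_on ({0..} \<times> {b..}) (\<lambda>x::real\<times>real. (G (fst x) (snd x)::real))"

lemma ctd_slice:
  assumes "ctd b G" "v \<ge> 0" "x \<ge> b"
  shows "continuous_on {x..y} (G v)"
  by (rule continuous_on_compose2[OF assms(1), of _ "\<lambda>r. (v, r)", unfolded fst_conv snd_conv])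
     (use assms in \<open>auto intro!: continuous_on_Pair continuous_on_const continuous_on_id\<close>)

lemma ctd_col:
  assumes "ctd b G" "r \<ge> b"
  shows "continuous_on {0..T} (\<lambda>v. G v r)"
  by (rule continuous_on_compose2[OF assms(1), of _ "\<lambda>v. (v, r)", unfolded fst_conv snd_conv])
     (use assms in \<open>auto intro!: continuous_on_Pair continuous_on_const continuous_on_id\<close>)

lemma ctd_box: "ctd b G \<Longrightarrow> a \<ge> b \<Longrightarrow> continuous_on (cbox (0,a) (T,R)) (\<lambda>x. G (fst x) (snd x))"
  by (erule continuous_on_subset) (auto simp: cbox_Pair_eq)

text \<open>Transfers a pointwise linear inequality between at most four fields to their averages;
  shorter inequalities are stated with coefficient 0.\<close>

lemma av_lin:
  assumes c: "cdom b F" "cdom b G" "cdom b H" "cdom b Z" and as: "v \<ge> 0" "r \<ge> b"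
    and le: "\<And>\<omega>. \<omega> \<in> sphere 0 1 \<Longrightarrow> p * F v r \<omega> + q * G v r \<omega> + s * H v r \<omega> + t * Z v r \<omega> \<le> 0"
  shows "p * av F v r + q * av G v r + s * av H v r + t * av Z v r \<le> 0"
proof -
  note cs = c[THEN cdom_slice[OF _ as]]
  have "sphere_int (\<lambda>\<omega>. p * F v r \<omega> + q * G v r \<omega> + s * H v r \<omega> + t * Z v r \<omega>) \<le> sphere_int (\<lambda>_. 0)"
    by (intro sphere_int_mono continuous_on_add continuous_on_mult_left cs continuous_on_const le)
  moreover have "sphere_int (\<lambda>\<omega>. p * F v r \<omega> + q * G v r \<omega> + s * H v r \<omega> + t * Z v r \<omega>)
     = p * av F v r + q * av G v r + s * av H v r + t * av Z v r"
    unfolding av_def by (simp add: sphere_int_add sphere_int_cmult continuous_on_add continuous_on_mult_left cs)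
  ultimately show ?thesis by simp
qed

definition "u2 v r \<omega> = (u v r \<omega>)\<^sup>2"
definition "ur2 v r \<omega> = (ur v r \<omega>)\<^sup>2"
definition "f2 v r \<omega> = (f v r \<omega>)\<^sup>2"
definition "ww v r \<omega> = ee v r \<omega> + (u v r \<omega>)\<^sup>2"
text \<open>r^2 times the bracket of the local energy norm. \<open>ww\<close> adds the square of the
  solution to the energy density; unlike \<open>lee\<close> it has neither decay nor
  degeneracy.\<close>

definition "lee v r \<omega> = (ur v r \<omega>)\<^sup>2 + (1 - 3*(M/r))\<^sup>2 * ((ut v r \<omega>)\<^sup>2 + QQ v r \<omega> / r) + (u v r \<omega> / r)\<^sup>2"
definition "wt r = inverse ((1 - 3*M/r)\<^sup>2) * r\<^sup>2 * r\<^sup>2"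

definition "dual_bound T LS \<longleftrightarrow> (\<forall>a R g. r0 \<le> a \<longrightarrow> continuous_on (cbox (0,a) (T,R)) g \<longrightarrow>
  (\<forall>x\<in>cbox (0,a) (T,R). 0 \<le> g x \<and> (snd x \<noteq> 3*M \<longrightarrow> g x \<le> wt (snd x) * av f2 (fst x) (snd x))) \<longrightarrow>
  integral (cbox (0,a) (T,R)) g \<le> LS)"

lemma cdom_sq: "cdom r0 u2" "cdom r0 ur2" "cdom r0 f2" "cdom r0 ww" "cdom r0 lee"
proof -
  have rr: "cdom r0 (\<lambda>v r \<omega>. g v r \<omega> / r)" if "cdom r0 g" for g :: "real \<Rightarrow> real \<Rightarrow> real^3 \<Rightarrow> real"
    by (intro continuous_on_divide that cdom_base) (use r0 in auto)
  show "cdom r0 u2" "cdom r0 ur2" "cdom r0 f2" "cdom r0 ww"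
    unfolding u2_def ur2_def f2_def ww_def by (intro continuous_on_power continuous_on_add cdom_base cdom_f cdom_ee)+
  show "cdom r0 lee" unfolding lee_def
    by (intro continuous_on_power continuous_on_add continuous_on_diff continuous_on_mult continuous_on_const rr cdom_base cdom_derived)
qed

lemma ww_nonneg: "ww v r \<omega> \<ge> 0" using ee_nonneg by (simp add: ww_def)

lemma lee_nonneg: "r > 0 \<Longrightarrow> lee v r \<omega> \<ge> 0"
  unfolding lee_def by (intro add_nonneg_nonneg mult_nonneg_nonneg divide_nonneg_pos QQ_nonneg) auto

lemma av_sq_nonneg:
  assumes "v \<ge> 0" "r \<ge> r0"
  shows "av u2 v r \<ge> 0" "av ur2 v r \<ge> 0" "av f2 v r \<ge> 0" "av ww v r \<ge> 0" "av lee v r \<ge> 0" "av ee v r \<ge> 0"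
  using assms r0 by (auto intro!: av_nonneg[OF cdom_sq(1)] av_nonneg[OF cdom_sq(2)] av_nonneg[OF cdom_sq(3)] av_nonneg[OF cdom_sq(4)]
     av_nonneg[OF cdom_sq(5)] av_nonneg[OF cdom_ee] ww_nonneg lee_nonneg ee_nonneg simp: u2_def ur2_def f2_def)

lemma av_ww: "v \<ge> 0 \<Longrightarrow> r \<ge> r0 \<Longrightarrow> av ww v r = av ee v r + av u2 v r"
  unfolding ww_def[abs_def] u2_def[symmetric] by (rule av_add[OF cdom_ee cdom_sq(1)])

section \<open>Zeroth order control from pointwise decay\<close>

lemma sq_combine: "- D\<^sup>2 + (a - r) * (2 * D * p) \<le> (r - a)\<^sup>2 * p\<^sup>2" for a r D p :: real
proof -
  have "0 \<le> (D + (r - a) * p)\<^sup>2" by simp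
  then show ?thesis by (simp add: power2_eq_square algebra_simps)
qed

text \<open>With D the increment up to R', the function (a - r) D^2 vanishes at R' and has
  derivative at most (r - a)^2 u_r^2, by completing a square. Integration gives the bound.\<close>

lemma increment_bound:
  assumes v: "v \<ge> 0" and a: "a \<ge> r0" and R: "a \<le> R" "R \<le> R'"
  shows "(R - a) * av (\<lambda>v r \<omega>. (u v r \<omega> - u v R' \<omega>)\<^sup>2) v R \<le> integral {R..R'} (\<lambda>r. (r - a)\<^sup>2 * av ur2 v r)"
proof -
  have cR: "cdom r0 (\<lambda>v r \<omega>. u v R' \<omega>)"
    by (rule continuous_on_compose2[OF cdom_base(1), of _ "\<lambda>x. (fst x, R', snd (snd x))", unfolded fst_conv snd_conv])
       (use R a in \<open>auto intro!: continuous_on_Pair continuous_on_fst continuous_on_snd continuous_on_id continuous_on_const\<close>)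
  define D where "D v r \<omega> = u v r \<omega> - u v R' \<omega>" for v r \<omega>
  have cD: "cdom r0 D" unfolding D_def by (intro continuous_on_diff cR cdom_base)
  define F where "F v r \<omega> = (a - r) * (D v r \<omega>)\<^sup>2" for v r \<omega>
  define F' where "F' v r \<omega> = - (D v r \<omega>)\<^sup>2 + (a - r) * (2 * D v r \<omega> * ur v r \<omega>)" for v r \<omega>
  have cF: "cdom r0 F" unfolding F_def
    by (intro continuous_on_mult continuous_on_diff continuous_on_power cD continuous_on_const cdom_base)
  have cF': "cdom r0 F'" unfolding F'_def
    by (intro continuous_on_add continuous_on_minus continuous_on_mult continuous_on_diff continuous_on_power cD continuous_on_const cdom_base)
  have d: "((\<lambda>r. F v r \<omega>) has_real_derivative F' v r \<omega>) (at r)" if "r \<ge> r0" "\<omega> \<in> sphere 0 1" for r \<omega>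
  proof -
    have "((\<lambda>r. D v r \<omega>) has_real_derivative ur v r \<omega>) (at r)"
      unfolding D_def using DERIV_diff[OF D(2)[OF v that] DERIV_const] by simp
    from DERIV_power[OF this, of 2] have sq: "((\<lambda>r. (D v r \<omega>)\<^sup>2) has_real_derivative 2 * D v r \<omega> * ur v r \<omega>) (at r)"
      by (rule DERIV_cong) simp
    show ?thesis unfolding F_def F'_def
      by (rule DERIV_cong[OF DERIV_mult[OF DERIV_diff[OF DERIV_const DERIV_ident] sq]]) (simp add: algebra_simps)
  qed
  have "(av F' v has_integral av F v R' - av F v R) {R..R'}"
  proof (rule fundamental_theorem_of_calculus[OF R(2)])
    fix r assume r: "r \<in> {R..R'}"
    have "((\<lambda>r. av F v r) has_real_derivative av F' v r) (at r within {r0..})"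
      by (rule av_deriv_r[OF cF cF' _ v d]) (use r R a in auto)
    then show "(av F v has_vector_derivative av F' v r) (at r within {R..R'})"
      by (rule has_vector_derivative_within_subset[OF has_real_derivative_iff_has_vector_derivative[THEN iffD1]]) (use R a in auto)
  qed
  moreover have "av F v R' = 0" unfolding av_def F_def D_def by simp
  moreover have "av F v R = (a - R) * av (\<lambda>v r \<omega>. (D v r \<omega>)\<^sup>2) v R"
    unfolding F_def[abs_def] by (rule av_cmult)
  ultimately have e: "(R - a) * av (\<lambda>v r \<omega>. (D v r \<omega>)\<^sup>2) v R = integral {R..R'} (av F' v)"
    by (simp add: integral_unique algebra_simps)
  also have "\<dots> \<le> integral {R..R'} (\<lambda>r. (r - a)\<^sup>2 * av ur2 v r)"
  proof (rule integral_le)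
    show "av F' v integrable_on {R..R'}"
      by (intro integrable_continuous_real ctd_slice[OF av_continuous[OF cF']] v) (use R a in auto)
    show "(\<lambda>r. (r - a)\<^sup>2 * av ur2 v r) integrable_on {R..R'}"
      by (intro integrable_continuous_real continuous_on_mult continuous_on_power continuous_on_diff continuous_on_id continuous_on_const ctd_slice[OF av_continuous[OF cdom_sq(2)]] v) (use R a in auto)
    fix r assume r: "r \<in> {R..R'}"
    have "1 * av F' v r + (- ((r - a)\<^sup>2)) * av ur2 v r + 0 * av F v r + 0 * av F v r \<le> 0"
      by (rule av_lin[OF cF' cdom_sq(2) cF cF v]) (use r R a sq_combine in \<open>auto simp: F'_def ur2_def\<close>)
    then show "av F' v r \<le> (r - a)\<^sup>2 * av ur2 v r" by simp
  qed
  finally show ?thesis by (simp add: D_def)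
qed

text \<open>Decay holds along each ray separately, without uniformity in the angle. The limit of
  \<open>increment_bound\<close> as the outer radius goes to infinity is therefore taken under the
  sphere integral by Fatou's lemma.\<close>

lemma tail_bound:
  assumes v: "v \<ge> 0" and a: "a \<ge> r0" and R: "a < R"
    and J: "\<And>R'. R' \<ge> R \<Longrightarrow> integral {R..R'} (\<lambda>r. (r - a)\<^sup>2 * av ur2 v r) \<le> \<delta>"
  shows "(R - a) * av u2 v R \<le> \<delta>"
proof -
  have Rr: "R \<ge> r0" using R a by simp
  have [simp]: "sets sphere_measure = sets borel" by (simp add: sphere_measure_def)
  define g where "g n \<omega> = (u v R \<omega> - u v (R + real n) \<omega>)\<^sup>2" for n :: nat and \<omega>
  have cu: "continuous_on (sphere 0 1) (\<lambda>\<omega>. u v r \<omega>)" if "r \<ge> r0" for r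
    using cdom_slice[OF cdom_base(1) v that] by simp
  have cg: "continuous_on (sphere 0 1) (g n)" for n
    unfolding g_def by (intro continuous_on_power continuous_on_diff cu) (use Rr in auto)
  have meas: "(\<lambda>\<omega>. ennreal (indicator (sphere 0 1) \<omega> *\<^sub>R g n \<omega>)) \<in> borel_measurable sphere_measure" for n
  proof -
    have "(\<lambda>\<omega>. indicator (sphere 0 1) \<omega> *\<^sub>R g n \<omega>) \<in> borel_measurable borel"
      by (intro borel_measurable_continuous_on_indicator cg) auto
    then show ?thesis by (simp cong: measurable_cong_sets)
  qed
  have int_g: "(\<integral>\<^sup>+\<omega>. ennreal (indicator (sphere 0 1) \<omega> *\<^sub>R g n \<omega>) \<partial>sphere_measure) \<le> ennreal (\<delta> / (R - a))" for n
  proof -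
    have "(\<integral>\<^sup>+\<omega>. ennreal (indicator (sphere 0 1) \<omega> *\<^sub>R g n \<omega>) \<partial>sphere_measure) = (\<integral>\<^sup>+\<omega>. ennreal (g n \<omega>) \<partial>sphere_measure)"
      by (rule nn_integral_cong_AE) (use AE_sphere_measure in \<open>eventually_elim, auto\<close>)
    also have "\<dots> = ennreal (sphere_int (g n))"
      by (rule nn_integral_sphere_int[OF cg]) (simp add: g_def)
    also have "sphere_int (g n) = av (\<lambda>v r \<omega>. (u v r \<omega> - u v (R + real n) \<omega>)\<^sup>2) v R"
      by (simp add: av_def g_def[abs_def])
    also have "ennreal \<dots> \<le> ennreal (\<delta> / (R - a))"
    proof (rule ennreal_leI)
      have "(R - a) * av (\<lambda>v r \<omega>. (u v r \<omega> - u v (R + real n) \<omega>)\<^sup>2) v R \<le> \<delta>"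
        using increment_bound[OF v a less_imp_le[OF R], of "R + real n"] J[of "R + real n"] by simp
      then show "av (\<lambda>v r \<omega>. (u v r \<omega> - u v (R + real n) \<omega>)\<^sup>2) v R \<le> \<delta> / (R - a)"
        using R by (simp add: pos_le_divide_eq mult.commute)
    qed
    finally show ?thesis .
  qed
  have lim: "(\<lambda>n. ennreal (indicator (sphere 0 1) \<omega> *\<^sub>R g n \<omega>)) \<longlonglongrightarrow> ennreal ((u v R \<omega>)\<^sup>2)" if "\<omega> \<in> sphere 0 1" for \<omega>
  proof -
    have "filterlim (\<lambda>n. R + real n) at_top sequentially"
      by (rule filterlim_tendsto_add_at_top[OF tendsto_const filterlim_real_sequentially])
    from filterlim_compose[OF decay[OF v that] this]
    have "(\<lambda>n. u v (R + real n) \<omega>) \<longlonglongrightarrow> 0" .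
    then have "(\<lambda>n. g n \<omega>) \<longlonglongrightarrow> (u v R \<omega> - 0)\<^sup>2" unfolding g_def by (intro tendsto_power tendsto_diff tendsto_const)
    then have "(\<lambda>n. ennreal (g n \<omega>)) \<longlonglongrightarrow> ennreal ((u v R \<omega>)\<^sup>2)" by (intro tendsto_ennrealI) simp
    then show ?thesis using that by simp
  qed
  have "ennreal (av u2 v R) = (\<integral>\<^sup>+\<omega>. ennreal (u2 v R \<omega>) \<partial>sphere_measure)"
    unfolding av_def by (rule nn_integral_sphere_int[symmetric, OF cdom_slice[OF cdom_sq(1) v Rr]]) (simp add: u2_def)
  also have "\<dots> = (\<integral>\<^sup>+\<omega>. liminf (\<lambda>n. ennreal (indicator (sphere 0 1) \<omega> *\<^sub>R g n \<omega>)) \<partial>sphere_measure)"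
  proof (rule nn_integral_cong_AE)
    show "AE \<omega> in sphere_measure. ennreal (u2 v R \<omega>) = liminf (\<lambda>n. ennreal (indicator (sphere 0 1) \<omega> *\<^sub>R g n \<omega>))"
      using AE_sphere_measure
    proof eventually_elim
      case (elim \<omega>)
      show ?case using lim_imp_Liminf[OF trivial_limit_sequentially lim[OF elim]] by (simp add: u2_def)
    qed
  qed
  also have "\<dots> \<le> liminf (\<lambda>n. \<integral>\<^sup>+\<omega>. ennreal (indicator (sphere 0 1) \<omega> *\<^sub>R g n \<omega>) \<partial>sphere_measure)"
    by (rule nn_integral_liminf[OF meas])
  also have "\<dots> \<le> limsup (\<lambda>n. \<integral>\<^sup>+\<omega>. ennreal (indicator (sphere 0 1) \<omega> *\<^sub>R g n \<omega>) \<partial>sphere_measure)"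
    by (rule Liminf_le_Limsup) simp
  also have "\<dots> \<le> ennreal (\<delta> / (R - a))"
    by (rule Limsup_bounded) (use int_g in simp)
  finally have "ennreal (av u2 v R) \<le> ennreal (\<delta> / (R - a))" .
  moreover have "0 \<le> \<delta>" using J[of R] by simp
  then have "0 \<le> \<delta> / (R - a)" using R by simp
  ultimately have "av u2 v R \<le> \<delta> / (R - a)" by (simp only: ennreal_le_iff)
  then show ?thesis using R by (simp add: pos_le_divide_eq mult.commute)
qed

text \<open>The derivative of (r - a) u^2 is at least u^2 / 2 - 2 (r - a)^2 u_r^2. The boundary term
  vanishes at \<open>a\<close>; at the outer end it is small by \<open>tail_bound\<close>, once the
  weighted integral of u_r^2 has nearly reached its supremum.\<close>

lemma hardy:
  assumes v: "v \<ge> 0" and a: "a \<ge> r0"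
    and J: "\<And>R. R \<ge> a \<Longrightarrow> integral {a..R} (\<lambda>r. (r - a)\<^sup>2 * av ur2 v r) \<le> B"
    and R: "R \<ge> a"
  shows "integral {a..R} (av u2 v) \<le> 4 * B"
proof (rule field_le_epsilon)
  fix e :: real assume e: "e > 0"
  define J' where "J' R = integral {a..R} (\<lambda>r. (r - a)\<^sup>2 * av ur2 v r)" for R
  have ci: "(\<lambda>r. (r - a)\<^sup>2 * av ur2 v r) integrable_on {x..y}" if "x \<ge> a" for x y
    by (intro integrable_continuous_real continuous_on_mult continuous_on_power continuous_on_diff continuous_on_id continuous_on_const ctd_slice[OF av_continuous[OF cdom_sq(2)]] v) (use that a in auto)
  have cu: "av u2 v integrable_on {x..y}" if "x \<ge> a" for x y
    by (intro integrable_continuous_real ctd_slice[OF av_continuous[OF cdom_sq(1)]] v) (use that a in auto)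
  have nn: "0 \<le> (r - a)\<^sup>2 * av ur2 v r" if "r \<ge> a" for r using av_sq_nonneg(2)[OF v, of r] that a by simp
  have Jmono: "J' x \<le> J' y" if "x \<le> y" "a \<le> x" for x y
    unfolding J'_def by (rule integral_subset_le) (use that ci nn in auto)
  have bdd: "bdd_above (J' ` {a..})" by (rule bdd_aboveI[of _ B]) (use J in \<open>auto simp: J'_def\<close>)
  define S where "S = (SUP R\<in>{a..}. J' R)"
  have SB: "S \<le> B" unfolding S_def by (rule cSUP_least) (use J in \<open>auto simp: J'_def\<close>)
  have JS: "J' R \<le> S" if "R \<ge> a" for R unfolding S_def by (rule cSUP_upper[OF _ bdd]) (use that in auto)
  have "S - e/4 < S" using e by simp
  then obtain R1 where R1: "R1 \<ge> a" "S - e/4 < J' R1"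
    unfolding S_def by (subst (asm) less_cSUP_iff[OF _ bdd]) auto
  \<comment> \<open>Beyond this radius less than e/4 of the weighted integral remains, so the
    boundary term at \<open>R'\<close> is at most e/4.\<close>
  define R' where "R' = max (max R R1) (a + 1)"
  have R': "R' \<ge> R" "R' \<ge> R1" "R' > a" by (auto simp: R'_def)
  have JR': "S - e/4 < J' R'" using Jmono[OF R'(2) R1(1)] R1(2) by simp
  have tail: "(R' - a) * av u2 v R' \<le> e/4"
  proof (rule tail_bound[OF v a R'(3)])
    fix y assume y: "y \<ge> R'"
    have "integral {a..R'} (\<lambda>r. (r - a)\<^sup>2 * av ur2 v r) + integral {R'..y} (\<lambda>r. (r - a)\<^sup>2 * av ur2 v r) = J' y"
      unfolding J'_def by (rule Henstock_Kurzweil_Integration.integral_combine) (use R' y ci in auto)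
    then show "integral {R'..y} (\<lambda>r. (r - a)\<^sup>2 * av ur2 v r) \<le> e/4"
      using JS[of y] JR' y R' unfolding J'_def[symmetric] by simp
  qed
  define F where "F v r \<omega> = (r - a) * u2 v r \<omega>" for v r \<omega>
  define F' where "F' v r \<omega> = u2 v r \<omega> + (r - a) * (2 * u v r \<omega> * ur v r \<omega>)" for v r \<omega>
  have cF: "cdom r0 F" unfolding F_def
    by (intro continuous_on_mult continuous_on_diff continuous_on_const cdom_base cdom_sq)
  have cF': "cdom r0 F'" unfolding F'_def
    by (intro continuous_on_add continuous_on_mult continuous_on_diff continuous_on_const cdom_base cdom_sq)
  have d: "((\<lambda>r. F v r \<omega>) has_real_derivative F' v r \<omega>) (at r)" if "r \<ge> r0" "\<omega> \<in> sphere 0 1" for r \<omega>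
  proof -
    have sq: "((\<lambda>r. u2 v r \<omega>) has_real_derivative 2 * u v r \<omega> * ur v r \<omega>) (at r)"
      unfolding u2_def by (rule DERIV_cong[OF DERIV_power[OF D(2)[OF v that], of 2]]) simp
    show ?thesis unfolding F_def F'_def
      by (rule DERIV_cong[OF DERIV_mult[OF DERIV_diff[OF DERIV_ident DERIV_const] sq]]) (simp add: algebra_simps)
  qed
  have "(av F' v has_integral av F v R' - av F v a) {a..R'}"
  proof (rule fundamental_theorem_of_calculus)
    fix r assume r: "r \<in> {a..R'}"
    have "((\<lambda>r. av F v r) has_real_derivative av F' v r) (at r within {r0..})"
      by (rule av_deriv_r[OF cF cF' _ v d]) (use r a in auto)
    then show "(av F v has_vector_derivative av F' v r) (at r within {a..R'})"
      by (rule has_vector_derivative_within_subset[OF has_real_derivative_iff_has_vector_derivative[THEN iffD1]]) (use a in auto)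
  qed (use R' in auto)
  moreover have "av F v r = (r - a) * av u2 v r" for r unfolding F_def[abs_def] by (rule av_cmult)
  ultimately have I: "(av F' v has_integral (R' - a) * av u2 v R') {a..R'}" by simp
  have "integral {a..R'} (\<lambda>r. (1/2) * av u2 v r - 2 * ((r - a)\<^sup>2 * av ur2 v r)) \<le> integral {a..R'} (av F' v)"
  proof (rule integral_le)
    show "(\<lambda>r. (1/2) * av u2 v r - 2 * ((r - a)\<^sup>2 * av ur2 v r)) integrable_on {a..R'}"
      by (intro integrable_diff integrable_on_mult_right cu ci) auto
    show "av F' v integrable_on {a..R'}" using I by blast
    fix r assume r: "r \<in> {a..R'}"
    have "(1/2) * av u2 v r + (- 2 * (r - a)\<^sup>2) * av ur2 v r + (-1) * av F' v r + 0 * av F v r \<le> 0"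
    proof (rule av_lin[OF cdom_sq(1,2) cF' cF v])
      fix \<omega>
      have "0 \<le> (u v r \<omega> + 2 * (r - a) * ur v r \<omega>)\<^sup>2" by simp
      then show "1/2 * u2 v r \<omega> + - 2 * (r - a)\<^sup>2 * ur2 v r \<omega> + - 1 * F' v r \<omega> + 0 * F v r \<omega> \<le> 0"
        by (simp add: F'_def u2_def ur2_def power2_eq_square algebra_simps)
    qed (use r a in auto)
    then show "(1/2) * av u2 v r - 2 * ((r - a)\<^sup>2 * av ur2 v r) \<le> av F' v r" by simp
  qed
  also have "integral {a..R'} (\<lambda>r. (1/2) * av u2 v r - 2 * ((r - a)\<^sup>2 * av ur2 v r)) = (1/2) * integral {a..R'} (av u2 v) - 2 * J' R'"
    unfolding J'_def by (subst integral_diff) (auto intro!: integrable_on_mult_right cu ci)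
  also have "integral {a..R'} (av F' v) = (R' - a) * av u2 v R'" by (rule integral_unique[OF I])
  finally have "integral {a..R'} (av u2 v) \<le> 2 * ((R' - a) * av u2 v R') + 4 * J' R'" by simp
  moreover have "integral {a..R} (av u2 v) \<le> integral {a..R'} (av u2 v)"
    by (rule integral_subset_le) (use R' cu av_sq_nonneg(1)[OF v] a in auto)
  moreover have "J' R' \<le> S" using JS R' by simp
  ultimately show "integral {a..R} (av u2 v) \<le> 4 * B + e" using tail SB e by linarith
qed

lemma weighted_radial_le:
  assumes "v \<ge> 0" "a \<ge> r0" "r \<ge> a"
  shows "(r - a)\<^sup>2 * av ur2 v r \<le> av ee v r"
proof -
  have "(r - a)\<^sup>2 * av ur2 v r + (-1) * av ee v r + 0 * av u2 v r + 0 * av u2 v r \<le> 0"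
  proof (rule av_lin[OF cdom_sq(2) cdom_ee cdom_sq(1) cdom_sq(1) assms(1)])
    fix \<omega>
    have "(r - a)\<^sup>2 \<le> r\<^sup>2" using assms r0 by (intro power_mono) auto
    then have "(r - a)\<^sup>2 * ur2 v r \<omega> \<le> r\<^sup>2 * (ur v r \<omega>)\<^sup>2" unfolding ur2_def by (intro mult_right_mono) auto
    then show "(r - a)\<^sup>2 * ur2 v r \<omega> + - 1 * ee v r \<omega> + 0 * u2 v r \<omega> + 0 * u2 v r \<omega> \<le> 0"
      using QQ_nonneg[of v r \<omega>] by (simp add: ee_def distrib_left add_nonneg_nonneg)
         (smt (verit) mult_nonneg_nonneg zero_le_power2)
  qed (use assms in auto)
  then show ?thesis by simp
qed

text \<open>On slices (r - a)^2 u_r^2 is part of the energy density, so Hardy bounds the added u^2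
  by four times the energy.\<close>

lemma energy_controls_ww:
  assumes v: "v \<ge> 0" and a: "a \<ge> r0" and E: "\<And>R. R \<ge> a \<Longrightarrow> integral {a..R} (av ee v) \<le> E" and R: "R \<ge> a"
  shows "integral {a..R} (av ww v) \<le> 5 * E"
proof -
  have ce: "av ee v integrable_on {x..y}" if "x \<ge> a" for x y
    by (intro integrable_continuous_real ctd_slice[OF av_continuous[OF cdom_ee]] v) (use that a in auto)
  have cu: "av u2 v integrable_on {x..y}" if "x \<ge> a" for x y
    by (intro integrable_continuous_real ctd_slice[OF av_continuous[OF cdom_sq(1)]] v) (use that a in auto)
  have J: "integral {a..R} (\<lambda>r. (r - a)\<^sup>2 * av ur2 v r) \<le> E" if "R \<ge> a" for R
  proof -
    have "integral {a..R} (\<lambda>r. (r - a)\<^sup>2 * av ur2 v r) \<le> integral {a..R} (av ee v)"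
    proof (rule integral_le)
      show "(\<lambda>r. (r - a)\<^sup>2 * av ur2 v r) integrable_on {a..R}"
        by (intro integrable_continuous_real continuous_on_mult continuous_on_power continuous_on_diff continuous_on_id continuous_on_const ctd_slice[OF av_continuous[OF cdom_sq(2)]] v) (use that a in auto)
    qed (use ce weighted_radial_le[OF v a] in auto)
    then show ?thesis using E[OF that] by simp
  qed
  have "integral {a..R} (av ww v) = integral {a..R} (\<lambda>r. av ee v r + av u2 v r)"
    by (rule integral_cong) (use v a in \<open>auto simp: av_ww\<close>)
  also have "\<dots> = integral {a..R} (av ee v) + integral {a..R} (av u2 v)"
    by (rule integral_add) (use ce cu in auto)
  also have "\<dots> \<le> E + 4 * E" using E[OF R] hardy[OF v a J R] by simp
  finally show ?thesis by simp
qed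

text \<open>Again qualitative. Beyond 3M it is the crude bound, whose source hypothesis follows from
  \<open>dual_bound\<close> since the dual weight there is at least 9 M^2 r^2; between
  \<open>a\<close> and 3M it is compactness. The constant enters later only divided by the cut-off
  scale.\<close>

lemma energy_bounded:
  assumes a: "r0 \<le> a" "a < 3*M" and T: "T > 0"
    and E0: "\<And>R. R \<ge> a \<Longrightarrow> integral {a..R} (av ee 0) \<le> E" and DB: "dual_bound T LS"
  shows "\<exists>C\<ge>0. \<forall>v\<in>{0..T}. \<forall>R\<ge>a. integral {a..R} (av ee v) \<le> C"
proof -
  have ce: "av ee v integrable_on {x..y}" if "x \<ge> a" "v \<ge> 0" for v x y
    by (intro integrable_continuous_real ctd_slice[OF av_continuous[OF cdom_ee]]) (use that a in auto)
  have en: "av ee v r \<ge> 0" if "r \<ge> a" "v \<ge> 0" for v r using av_sq_nonneg(6)[of v r] that a by simp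
  have M3: "3*M \<ge> r0" using a by simp
  have e1: "integral {3*M..R} (av ee 0) \<le> max E (LS / (9*M\<^sup>2))" if "R \<ge> 3*M" for R
  proof -
    have "integral {3*M..R} (av ee 0) \<le> integral {a..R} (av ee 0)"
      by (rule integral_subset_le) (use a ce en in auto)
    then show ?thesis using E0[of R] that a by linarith
  qed
  have cf: "cdom r0 (\<lambda>v r \<omega>. r\<^sup>2 * (f v r \<omega>)\<^sup>2)"
    by (intro continuous_on_mult continuous_on_power cdom_f cdom_base)
  have e2: "integral (cbox (0,3*M) (T,R)) (\<lambda>x. av (\<lambda>v r \<omega>. r\<^sup>2 * (f v r \<omega>)\<^sup>2) (fst x) (snd x)) \<le> max E (LS / (9*M\<^sup>2))" if "R \<ge> 3*M" for R
  proof -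
    define g where "g x = 9*M\<^sup>2 * av (\<lambda>v r \<omega>. r\<^sup>2 * (f v r \<omega>)\<^sup>2) (fst x) (snd x)" for x
    have "integral (cbox (0,3*M) (T,R)) g \<le> LS"
    proof (rule DB[unfolded dual_bound_def, rule_format, OF M3])
      show "continuous_on (cbox (0,3*M) (T,R)) g" unfolding g_def
        by (intro continuous_on_mult continuous_on_const ctd_box[OF av_continuous[OF cf]] M3)
      fix x assume "x \<in> cbox (0,3*M) (T,R)"
      then have x: "fst x \<ge> 0" "snd x \<ge> 3*M" by (cases x, auto simp: cbox_Pair_eq)+
      define r where "r = snd x"
      have r: "r > 0" "r \<ge> 3*M" using x M by (auto simp: r_def)
      have eq: "av (\<lambda>v r \<omega>. r\<^sup>2 * (f v r \<omega>)\<^sup>2) (fst x) (snd x) = r\<^sup>2 * av f2 (fst x) r"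
        unfolding r_def f2_def[symmetric] by (rule av_cmult)
      have f2: "av f2 (fst x) r \<ge> 0" unfolding r_def by (rule av_sq_nonneg) (use x M3 in auto)
      show "0 \<le> g x \<and> (snd x \<noteq> 3*M \<longrightarrow> g x \<le> wt (snd x) * av f2 (fst x) (snd x))"
      proof (intro conjI impI)
        show "0 \<le> g x" unfolding g_def eq using f2 by simp
        assume "snd x \<noteq> 3*M"
        then have r3: "r > 3*M" using x by (simp add: r_def)
        have "0 < 1 - 3*M/r" "1 - 3*M/r \<le> 1" using r3 r M by (auto simp: field_simps)
        then have "(1 - 3*M/r)\<^sup>2 > 0" "(1 - 3*M/r)\<^sup>2 \<le> 1" by (auto intro: power_le_one)
        then have i: "1 \<le> inverse ((1 - 3*M/r)\<^sup>2)" by (simp add: one_le_inverse_iff)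
        have "(3*M)\<^sup>2 \<le> r\<^sup>2" using r M by (intro power_mono) auto
        then have "9*M\<^sup>2 * r\<^sup>2 \<le> 1 * r\<^sup>2 * r\<^sup>2" using mult_right_mono[of "(3*M)\<^sup>2" "r\<^sup>2" "r\<^sup>2"] by (simp add: power_mult_distrib)
        also have "\<dots> \<le> wt r" unfolding wt_def using i by (intro mult_right_mono) auto
        finally have "9*M\<^sup>2 * r\<^sup>2 * av f2 (fst x) r \<le> wt r * av f2 (fst x) r" using f2 by (intro mult_right_mono)
        then show "g x \<le> wt (snd x) * av f2 (fst x) (snd x)" unfolding g_def eq by (simp add: r_def mult.assoc)
      qed
    qed
    then have "9*M\<^sup>2 * integral (cbox (0,3*M) (T,R)) (\<lambda>x. av (\<lambda>v r \<omega>. r\<^sup>2 * (f v r \<omega>)\<^sup>2) (fst x) (snd x)) \<le> LS"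
      unfolding g_def by simp
    then have "integral (cbox (0,3*M) (T,R)) (\<lambda>x. av (\<lambda>v r \<omega>. r\<^sup>2 * (f v r \<omega>)\<^sup>2) (fst x) (snd x)) \<le> LS / (9*M\<^sup>2)"
      using M by (simp add: pos_le_divide_eq mult.commute)
    then show ?thesis by simp
  qed
  obtain C1 where C1: "\<And>v R. v \<in> {0..T} \<Longrightarrow> R \<ge> 3*M \<Longrightarrow> integral {3*M..R} (av ee v) \<le> C1"
    using crude_energy_bound[OF T e1 e2] by blast
  have "bounded ((\<lambda>x. av ee (fst x) (snd x)) ` cbox (0,a) (T,3*M))"
    by (intro compact_imp_bounded compact_continuous_image ctd_box[OF av_continuous[OF cdom_ee]] a compact_cbox)
  then obtain B where B: "\<And>x. x \<in> cbox (0,a) (T,3*M) \<Longrightarrow> \<bar>av ee (fst x) (snd x)\<bar> \<le> B"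
    unfolding bounded_iff by (auto simp: real_norm_def)
  have B': "av ee v r \<le> B" if "v \<in> {0..T}" "r \<in> {a..3*M}" for v r
    using B[of "(v,r)"] that by (simp add: cbox_Pair_eq)
  have "integral {a..R} (av ee v) \<le> \<bar>B\<bar> * (3*M - a) + \<bar>C1\<bar>" if v: "v \<in> {0..T}" and R: "R \<ge> a" for v R
  proof -
    define R' where "R' = max R (3*M)"
    have v0: "v \<ge> 0" using v by simp
    have "integral {a..R} (av ee v) \<le> integral {a..R'} (av ee v)"
      by (rule integral_subset_le) (use ce en v0 in \<open>auto simp: R'_def\<close>)
    also have "\<dots> = integral {a..3*M} (av ee v) + integral {3*M..R'} (av ee v)"
      by (rule Henstock_Kurzweil_Integration.integral_combine[symmetric]) (use a ce v0 in \<open>auto simp: R'_def\<close>)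
    also have "integral {a..3*M} (av ee v) \<le> integral {a..3*M} (\<lambda>_. B)"
      by (rule integral_le) (use ce v0 B' v in auto)
    also have "integral {a..3*M} (\<lambda>_. B) = B * (3*M - a)" using a by simp
    also have "B * (3*M - a) \<le> \<bar>B\<bar> * (3*M - a)" using a by (intro mult_right_mono) auto
    finally show ?thesis using C1[OF v, of R'] by (simp add: R'_def)
  qed
  moreover have "0 \<le> \<bar>B\<bar> * (3*M - a) + \<bar>C1\<bar>" using a by simp
  ultimately show ?thesis by blast
qed

end

section \<open>Exterior and interior estimates\<close>

lemma chi_lower:
  assumes "n > 0"
  shows "1 - 2 * w / n \<le> chi n w"
proof -
  define y where "y = 1 - w / n"
  have "2 * y - 1 \<le> (max 0 y)\<^sup>2"
    using zero_le_power2[of "y - 1"] by (cases "y \<ge> 0") (simp_all add: power2_eq_square algebra_simps)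
  then show ?thesis by (simp add: chi_def y_def)
qed

lemma chi'_abs:
  assumes "n > 0" "w \<ge> 0"
  shows "\<bar>chi' n w\<bar> \<le> 2 / n"
proof -
  have w: "0 \<le> w / n" using assms by simp
  have "max 0 (1 - w / n) \<le> 1" using w by simp
  then have "2 / n * max 0 (1 - w / n) \<le> 2 / n * 1" using assms by (intro mult_left_mono) auto
  then show ?thesis using assms by (simp add: chi'_def abs_mult)
qed

section \<open>Integrated estimates outside and inside\<close>

context schw_wave
begin

text \<open>The weight is a cut-off at scale n in v + \<mu>(r). Its derivative is of size 2/n and
  meets a density bounded by \<open>ww\<close>, whose integral is finite by
  \<open>energy_bounded\<close>. The term - C u^2 of \<open>H1\<close> at time T is replaced, by
  Hardy, by - 4 C S, with S the limit of the weighted integrals J; it cancels against 4 C J, but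
  only after both the cut-off and the radius have gone to infinity.\<close>

lemma stage1:
  fixes a \<kappa> C k C2 G T R E LS :: real
  assumes K: "coefs_on a K" and a: "r0 \<le> a" "a < 3*M" and T: "T > 0"
    and pos: "\<kappa> > 0" "C \<ge> 0" "k > 0" "C2 > 0" "G \<ge> 0"
    and H1: "\<And>v r \<omega>. v \<ge> 0 \<Longrightarrow> r \<ge> a \<Longrightarrow> \<omega> \<in> sphere 0 1 \<Longrightarrow>
       \<kappa> * ee v r \<omega> + C * (4 * (r - a)\<^sup>2 * (ur v r \<omega>)\<^sup>2 - (u v r \<omega>)\<^sup>2) \<le> slice K v r \<omega>"
    and H2: "\<And>v \<omega>. v \<ge> 0 \<Longrightarrow> \<omega> \<in> sphere 0 1 \<Longrightarrow> \<kappa> * ww v a \<omega> \<le> - flux K v a \<omega>"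
    and H3: "\<And>v r \<omega>. v \<ge> 0 \<Longrightarrow> r \<ge> a \<Longrightarrow> \<omega> \<in> sphere 0 1 \<Longrightarrow> k * lee v r \<omega> \<le> bulk K v r \<omega>"
    and H4: "\<And>v r \<omega>. v \<ge> 0 \<Longrightarrow> r \<ge> a \<Longrightarrow> r \<noteq> 3*M \<Longrightarrow> \<omega> \<in> sphere 0 1 \<Longrightarrow>
       source K v r \<omega> \<le> k/2 * lee v r \<omega> + C2 * (wt r * f2 v r \<omega>)"
    and H5: "\<And>v r \<omega>. v \<ge> 0 \<Longrightarrow> r \<ge> a \<Longrightarrow> \<omega> \<in> sphere 0 1 \<Longrightarrow> \<bar>slice K v r \<omega>\<bar> \<le> G * ww v r \<omega>"
      "\<And>v r \<omega>. v \<ge> 0 \<Longrightarrow> r \<ge> a \<Longrightarrow> \<omega> \<in> sphere 0 1 \<Longrightarrow> \<bar>long K v r \<omega>\<bar> \<le> G * ww v r \<omega>"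
    and E0: "\<And>R. R \<ge> a \<Longrightarrow> integral {a..R} (av ee 0) \<le> E" and DB: "dual_bound T LS"
    and R: "R \<ge> a"
  shows "\<kappa> * integral {a..R} (av ee T) + \<kappa> * integral {0..T} (\<lambda>v. av ww v a)
     + k/2 * integral (cbox (0,a) (T,R)) (\<lambda>x. av lee (fst x) (snd x)) \<le> 5 * G * E + C2 * LS"
proof -
  note cs = cdom_dens[OF K a(1)]
  note sq = cdom_sq[THEN cdom_subset[OF _ a(1)]]
  note ce = cdom_subset[OF cdom_ee a(1)]
  note ac = av_continuous[OF ce] sq[THEN av_continuous] cs(1-5)[THEN av_continuous]
  have T0: "T \<ge> 0" "(0::real) \<ge> 0" using T by auto
  have nn: "av u2 v r \<ge> 0" "av ur2 v r \<ge> 0" "av f2 v r \<ge> 0" "av ww v r \<ge> 0" "av lee v r \<ge> 0" "av ee v r \<ge> 0"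
    if "v \<ge> 0" "r \<ge> a" for v r using av_sq_nonneg[of v r] that a by auto
  have i1: "(g v) integrable_on {x..y}" if "ctd a g" "v \<ge> 0" "x \<ge> a" for g :: "real \<Rightarrow> real \<Rightarrow> real" and v x y
    by (rule integrable_continuous_real[OF ctd_slice[OF that]])
  have ib: "(\<lambda>x. g (fst x) (snd x)) integrable_on (cbox (0,a) (T,y))" if "ctd a g" for g :: "real \<Rightarrow> real \<Rightarrow> real" and y
    by (rule integrable_continuous[OF ctd_box[OF that order_refl]])
  have h1: "\<kappa> * av ee v r + (4 * C * (r - a)\<^sup>2) * av ur2 v r - C * av u2 v r \<le> av (slice K) v r" if "v \<ge> 0" "r \<ge> a" for v r
  proof -
    have "\<kappa> * av ee v r + (4 * C * (r - a)\<^sup>2) * av ur2 v r + (- C) * av u2 v r + (- 1) * av (slice K) v r \<le> 0"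
    proof (rule av_lin[OF ce sq(2) sq(1) cs(1) that])
      fix \<omega> :: "real^3" assume w: "\<omega> \<in> sphere 0 1"
      show "\<kappa> * ee v r \<omega> + (4 * C * (r - a)\<^sup>2) * ur2 v r \<omega> + (- C) * u2 v r \<omega> + (- 1) * slice K v r \<omega> \<le> 0"
        using H1[OF that w] unfolding ur2_def u2_def right_diff_distrib by (simp add: mult_ac)
    qed
    then show ?thesis by simp
  qed
  have h2: "\<kappa> * av ww v a \<le> - av (flux K) v a" if "v \<ge> 0" for v
  proof -
    have "\<kappa> * av ww v a + 1 * av (flux K) v a + 0 * av ww v a + 0 * av ww v a \<le> 0"
      by (rule av_lin[OF sq(4) cs(2) sq(4) sq(4) that order_refl]) (use H2[OF that] in force)
    then show ?thesis by simp
  qed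
  have h3: "k * av lee v r \<le> av (bulk K) v r" if "v \<ge> 0" "r \<ge> a" for v r
  proof -
    have "k * av lee v r + (- 1) * av (bulk K) v r + 0 * av ww v r + 0 * av ww v r \<le> 0"
      by (rule av_lin[OF sq(5) cs(4) sq(4) sq(4) that]) (use H3[OF that] in force)
    then show ?thesis by simp
  qed
  have h4: "av (source K) v r - k/2 * av lee v r \<le> C2 * (wt r * av f2 v r)" if "v \<ge> 0" "r \<ge> a" "r \<noteq> 3*M" for v r
  proof -
    have "1 * av (source K) v r + (- (k/2)) * av lee v r + (- (C2 * wt r)) * av f2 v r + 0 * av ww v r \<le> 0"
    proof (rule av_lin[OF cs(5) sq(5) sq(3) sq(4) that(1,2)])
      fix \<omega> :: "real^3" assume w: "\<omega> \<in> sphere 0 1"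
      show "1 * source K v r \<omega> + (- (k/2)) * lee v r \<omega> + (- (C2 * wt r)) * f2 v r \<omega> + 0 * ww v r \<omega> \<le> 0"
        using H4[OF that w] by (simp add: mult.assoc)
    qed
    then show ?thesis by (simp add: mult.assoc)
  qed
  have h5: "av (slice K) v r \<le> G * av ww v r" "\<bar>av (long K) v r\<bar> \<le> G * av ww v r" if "v \<ge> 0" "r \<ge> a" for v r
  proof -
    have 1: "\<And>\<omega>. \<omega> \<in> sphere 0 1 \<Longrightarrow> slice K v r \<omega> \<le> G * ww v r \<omega>" "\<And>\<omega>. \<omega> \<in> sphere 0 1 \<Longrightarrow> long K v r \<omega> \<le> G * ww v r \<omega>"
      "\<And>\<omega>. \<omega> \<in> sphere 0 1 \<Longrightarrow> - long K v r \<omega> \<le> G * ww v r \<omega>"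
      using H5(1)[OF that] H5(2)[OF that] by (meson abs_le_D1 abs_le_D2)+
    have "1 * av (slice K) v r + (- G) * av ww v r + 0 * av ww v r + 0 * av ww v r \<le> 0"
      by (rule av_lin[OF cs(1) sq(4) sq(4) sq(4) that]) (use 1 in force)
    moreover have "1 * av (long K) v r + (- G) * av ww v r + 0 * av ww v r + 0 * av ww v r \<le> 0"
      by (rule av_lin[OF cs(3) sq(4) sq(4) sq(4) that]) (use 1 in force)
    moreover have "(- 1) * av (long K) v r + (- G) * av ww v r + 0 * av ww v r + 0 * av ww v r \<le> 0"
      by (rule av_lin[OF cs(3) sq(4) sq(4) sq(4) that]) (use 1(3) in force)
    ultimately show "av (slice K) v r \<le> G * av ww v r" "\<bar>av (long K) v r\<bar> \<le> G * av ww v r" by auto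
  qed
  obtain Cb where Cb: "Cb \<ge> 0" "\<And>v R. v \<in> {0..T} \<Longrightarrow> R \<ge> a \<Longrightarrow> integral {a..R} (av ee v) \<le> Cb"
    using energy_bounded[OF a T E0 DB] by blast
  have wwb: "integral {a..R} (av ww v) \<le> 5 * Cb" if "v \<in> {0..T}" "R \<ge> a" for v R
    by (rule energy_controls_ww[OF _ a(1) Cb(2) that(2)]) (use that in auto)
  have ww0: "integral {a..R} (av ww 0) \<le> 5 * E" if "R \<ge> a" for R
    by (rule energy_controls_ww[OF _ a(1) E0 that]) auto
  have c2: "ctd a (\<lambda>v r. (r - a)\<^sup>2 * av ur2 v r)"
    by (intro continuous_on_mult continuous_on_power continuous_on_diff continuous_on_snd continuous_on_id continuous_on_const ac)
  define J where "J R = integral {a..R} (\<lambda>r. (r - a)\<^sup>2 * av ur2 T r)" for R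
  have Jmono: "J x \<le> J y" if "x \<le> y" "a \<le> x" for x y
    unfolding J_def by (rule integral_subset_le) (use that i1[OF c2 T0(1)] nn(2)[OF T0(1)] in auto)
  have JB: "J R \<le> Cb" if "R \<ge> a" for R
  proof -
    have "J R \<le> integral {a..R} (av ee T)" unfolding J_def
      by (rule integral_le[OF i1[OF c2 T0(1)] i1[OF ac(1) T0(1)]]) (use weighted_radial_le[OF T0(1) a(1)] in auto)
    then show ?thesis using Cb(2)[of T R] that T by auto
  qed
  have bdd: "bdd_above (J ` {a..})" by (rule bdd_aboveI[of _ Cb]) (use JB in auto)
  \<comment> \<open>Finite because J is dominated by the energy at time T. Without this the Hardy
    terms on the two sides could not be subtracted from each other.\<close>
  define S where "S = (SUP R\<in>{a..}. J R)"
  have JS: "J R \<le> S" if "R \<ge> a" for R unfolding S_def by (rule cSUP_upper[OF _ bdd]) (use that in auto)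
  have u2S: "integral {a..R} (av u2 T) \<le> 4 * S" if "R \<ge> a" for R
    by (rule hardy[OF T0(1) a(1) _ that]) (use JS in \<open>auto simp: J_def\<close>)
  define tot where "tot R = \<kappa> * integral {a..R} (av ee T) + 4 * C * J R + \<kappa> * integral {0..T} (\<lambda>v. av ww v a)
     + k/2 * integral (cbox (0,a) (T,R)) (\<lambda>x. av lee (fst x) (snd x))" for R
  define Z where "Z = 5 * G * E + C2 * LS"
  \<comment> \<open>T + \<mu>(R0) - \<mu>(a) is the largest value of the argument of the cut-off on
    the region to be kept; the factor on the left is the lower bound of the cut-off there.\<close>
  have key: "(1 - 2 * (T + \<mu> R0 - \<mu> a) / n) * tot R0 \<le> (4 * C * S + Z) + (2 * G * (T * (5 * Cb))) / n" if n: "n > 0" and R0: "R0 \<ge> a" for n R0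
  proof -
    define W where "W = T + \<mu> R0 - \<mu> a"
    define \<theta> where "\<theta> = 1 - 2 * W / n"
    obtain R where R: "R \<ge> R0" "\<And>r. r \<ge> R \<Longrightarrow> \<mu> r \<ge> n + \<mu> a" using mu_large[of R0 "n + \<mu> a"] by blast
    have aR: "a \<le> R" using R R0 by simp
    define X where "X v r = chi n (v + (\<mu> r - \<mu> a))" for v r
    define Xv where "Xv v r = chi' n (v + (\<mu> r - \<mu> a))" for v r
    have w0: "v + (\<mu> r - \<mu> a) \<ge> 0" if "v \<ge> 0" "r \<ge> a" for v r
      using mu_mono[OF a(1) that(2)] that by simp
    have X0: "0 \<le> X v r" and X1: "X v r \<le> 1" and Xv1: "\<bar>Xv v r\<bar> \<le> 2 / n" if "v \<ge> 0" "r \<ge> a" for v r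
      using chi_bounds[OF n w0[OF that]] chi'_abs[OF n w0[OF that]] by (auto simp: X_def Xv_def)
    have XR: "X v R = 0" if "v \<ge> 0" for v
      using chi_bounds(4)[OF n w0[OF that aR]] R(2)[of R] that by (auto simp: X_def)
    have Xt: "\<theta> \<le> X v r" if "v \<in> {0..T}" "r \<in> {a..R0}" for v r
    proof -
      have "\<mu> r \<le> \<mu> R0" using mu_mono[of r R0] that a by simp
      then have "v + (\<mu> r - \<mu> a) \<le> W" using that by (simp add: W_def)
      then have "2 * (v + (\<mu> r - \<mu> a)) / n \<le> 2 * W / n" using n by (intro divide_right_mono) auto
      then have "\<theta> \<le> 1 - 2 * (v + (\<mu> r - \<mu> a)) / n" unfolding \<theta>_def by linarith
      also have "\<dots> \<le> X v r" unfolding X_def by (rule chi_lower[OF n])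
      finally show ?thesis .
    qed
    have Xd: "((\<lambda>v. X v r) has_real_derivative Xv v r) (at v)" for v r
      unfolding X_def Xv_def by (rule DERIV_cong[OF DERIV_chain2[OF chi_deriv[OF n]]]) (auto intro!: derivative_eq_intros)
    have Xdr: "((\<lambda>r. X v r) has_real_derivative m r * Xv v r) (at r)" if "r \<ge> a" for v r
    proof -
      have "((\<lambda>r. v + (\<mu> r - \<mu> a)) has_real_derivative m r) (at r)"
        using DERIV_add[OF DERIV_const DERIV_diff[OF mu_deriv[of r] DERIV_const]] that a by simp
      from DERIV_chain2[OF chi_deriv[OF n] this] show ?thesis
        unfolding X_def Xv_def by (simp add: mult.commute)
    qed
    have cw: "ctd a (\<lambda>v r. v + (\<mu> r - \<mu> a))"
      by (intro continuous_on_add continuous_on_diff continuous_on_const continuous_on_fst continuous_on_id continuous_on_compose2[OF mu_cont continuous_on_snd[OF continuous_on_id]])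
         (use a in auto)
    have cX: "ctd a X" "ctd a Xv" unfolding X_def Xv_def by (intro chi_continuous n cw)+
    let ?C = "cbox (0,a) (T,R)" and ?D = "cbox (0,a) (T,R0)"
    have Cx: "fst x \<ge> 0" "snd x \<ge> a" if "x \<in> cbox (0,a) (T,y)" for x y using that by (cases x, auto simp: cbox_Pair_eq)+
    define I1 where "I1 = integral {a..R} (\<lambda>r. X T r * av (slice K) T r - X 0 r * av (slice K) 0 r)"
    define I2 where "I2 = integral {0..T} (\<lambda>v. X v R * av (flux K) v R - X v a * av (flux K) v a)"
    define I3 where "I3 = integral ?C (\<lambda>x. X (fst x) (snd x) * av (bulk K) (fst x) (snd x))"
    define I4 where "I4 = integral ?C (\<lambda>x. X (fst x) (snd x) * av (source K) (fst x) (snd x))"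
    define I5 where "I5 = integral ?C (\<lambda>x. Xv (fst x) (snd x) * av (long K) (fst x) (snd x))"
    have id: "I1 + I2 + I3 = I4 + I5" unfolding I1_def I2_def I3_def I4_def I5_def
      by (rule box_identity[OF K a(1)]) (use T aR Xd Xdr in \<open>auto intro: continuous_on_subset[OF cX(1)] continuous_on_subset[OF cX(2)]\<close>)
    define g where "g v r = \<kappa> * av ee v r + 4 * C * ((r - a)\<^sup>2 * av ur2 v r)" for v r
    have cg: "ctd a g" unfolding g_def by (intro continuous_on_add continuous_on_mult_left ac c2)
    have g0: "g v r \<ge> 0" if "v \<ge> 0" "r \<ge> a" for v r using nn[OF that] pos by (simp add: g_def)
    have cXg: "ctd a (\<lambda>v r. X v r * g v r)" by (intro continuous_on_mult cX cg)
    have cut1: "\<theta> * integral {a..R0} (g T) \<le> integral {a..R} (\<lambda>r. X T r * g T r)"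
      by (rule cut_lower[OF _ i1[OF cg T0(1)] i1[OF cXg T0(1)] i1[OF cXg T0(1)]]) (use R T X0 g0 Xt in auto)
    have ig: "integral {a..R0} (g T) = \<kappa> * integral {a..R0} (av ee T) + 4 * C * J R0"
      unfolding g_def J_def
      by (subst integral_add) (use i1[OF ac(1) T0(1)] i1[OF c2 T0(1)] in \<open>auto intro!: integrable_on_mult_right\<close>)
    have s1: "integral {a..R} (\<lambda>r. X T r * g T r) - C * integral {a..R} (av u2 T) - G * integral {a..R} (av ww 0) \<le> I1"
    proof -
      have "integral {a..R} (\<lambda>r. X T r * g T r) - C * integral {a..R} (av u2 T) - G * integral {a..R} (av ww 0)
        = integral {a..R} (\<lambda>r. X T r * g T r - C * av u2 T r - G * av ww 0 r)"
        by (subst integral_diff; (subst integral_diff)?)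
           (use i1[OF cXg T0(1)] i1[OF ac(2) T0(1)] i1[OF ac(5), of 0] in \<open>auto intro!: integrable_on_mult_right integrable_diff\<close>)
      also have "\<dots> \<le> I1" unfolding I1_def
      proof (rule integral_le)
        show "(\<lambda>r. X T r * g T r - C * av u2 T r - G * av ww 0 r) integrable_on {a..R}"
          by (intro integrable_diff integrable_on_mult_right i1[OF cXg T0(1)] i1[OF ac(2) T0(1)] i1[OF ac(5)]) auto
        show "(\<lambda>r. X T r * av (slice K) T r - X 0 r * av (slice K) 0 r) integrable_on {a..R}"
          by (intro integrable_diff i1[OF continuous_on_mult[OF cX(1) ac(7)]] T0 order_refl)
        fix r assume r: "r \<in> {a..R}"
        then have ra: "r \<ge> a" by simp
        have "X T r * (g T r - C * av u2 T r) \<le> X T r * av (slice K) T r"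
          using h1[OF T0(1) ra] X0[OF T0(1) ra] by (intro mult_left_mono) (auto simp: g_def mult_ac)
        moreover have "X T r * (C * av u2 T r) \<le> 1 * (C * av u2 T r)"
          using X1[OF T0(1) ra] nn(1)[OF T0(1) ra] pos by (intro mult_right_mono) auto
        moreover have "X 0 r * av (slice K) 0 r \<le> X 0 r * (G * av ww 0 r)"
          using h5(1)[OF order_refl ra] X0[OF order_refl ra] by (intro mult_left_mono)
        moreover have "X 0 r * (G * av ww 0 r) \<le> 1 * (G * av ww 0 r)"
          using X1[OF order_refl ra] nn(4)[OF order_refl ra] pos by (intro mult_right_mono) auto
        ultimately show "X T r * g T r - C * av u2 T r - G * av ww 0 r \<le> X T r * av (slice K) T r - X 0 r * av (slice K) 0 r"
          unfolding right_diff_distrib by linarith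
      qed
      finally show ?thesis .
    qed
    have "C * integral {a..R} (av u2 T) \<le> C * (4 * S)" using u2S[OF aR] pos by (intro mult_left_mono) auto
    moreover have "G * integral {a..R} (av ww 0) \<le> G * (5 * E)" using ww0[OF aR] pos by (intro mult_left_mono) auto
    ultimately have t1: "\<theta> * (\<kappa> * integral {a..R0} (av ee T) + 4 * C * J R0) - 4 * C * S - 5 * G * E \<le> I1"
      using s1 cut1 unfolding ig by simp
    have cc: "ctd a (\<lambda>v r. \<kappa> * av ww v r)" "ctd a (\<lambda>v r. X v r * (\<kappa> * av ww v r))"
      by (intro continuous_on_mult continuous_on_const cX ac)+
    have "\<theta> * integral {0..T} (\<lambda>v. \<kappa> * av ww v a) \<le> integral {0..T} (\<lambda>v. X v a * (\<kappa> * av ww v a))"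
      by (rule cut_lower[OF order_refl]; (intro integrable_continuous_real ctd_col[OF cc(1)] ctd_col[OF cc(2)] order_refl)?)
         (use X0 Xt R0 nn(4) pos in auto)
    also have "\<dots> \<le> I2" unfolding I2_def
    proof (rule integral_le)
      show "(\<lambda>v. X v a * (\<kappa> * av ww v a)) integrable_on {0..T}"
        by (intro integrable_continuous_real ctd_col[OF cc(2)] order_refl)
      show "(\<lambda>v. X v R * av (flux K) v R - X v a * av (flux K) v a) integrable_on {0..T}"
        by (intro integrable_diff integrable_continuous_real ctd_col[OF continuous_on_mult[OF cX(1) ac(8)]] order_refl aR)
      fix v assume v: "v \<in> {0..T}"
      then have v0: "v \<ge> 0" by simp
      have "X v a * (\<kappa> * av ww v a) \<le> X v a * (- av (flux K) v a)"
        using h2[OF v0] X0[OF v0 order_refl] by (intro mult_left_mono)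
      then show "X v a * (\<kappa> * av ww v a) \<le> X v R * av (flux K) v R - X v a * av (flux K) v a" using XR[OF v0] by simp
    qed
    finally have t2: "\<theta> * (\<kappa> * integral {0..T} (\<lambda>v. av ww v a)) \<le> I2" by simp
    \<comment> \<open>What remains of the source after half of the bulk has been used. It is
      continuous and nonnegative and lies below C2 times the dual weight off r = 3M, which is the
      form that \<open>dual_bound\<close> accepts.\<close>
    define \<sigma> where "\<sigma> v r = max 0 (av (source K) v r - k/2 * av lee v r)" for v r
    have c\<sigma>: "ctd a \<sigma>" unfolding \<sigma>_def by (intro continuous_on_max continuous_on_diff continuous_on_mult continuous_on_const ac)
    have cl: "ctd a (\<lambda>v r. X v r * av lee v r)" by (intro continuous_on_mult cX ac)
    have i\<sigma>: "integral ?C (\<lambda>x. \<sigma> (fst x) (snd x)) \<le> C2 * LS"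
    proof -
      have "integral ?C (\<lambda>x. (1/C2) * \<sigma> (fst x) (snd x)) \<le> LS"
      proof (rule DB[unfolded dual_bound_def, rule_format, OF a(1)])
        show "continuous_on ?C (\<lambda>x. (1/C2) * \<sigma> (fst x) (snd x))"
          by (intro continuous_on_mult continuous_on_const ctd_box[OF c\<sigma>] order_refl)
        fix x assume x: "x \<in> ?C"
        have f0: "wt (snd x) * av f2 (fst x) (snd x) \<ge> 0" using nn(3)[OF Cx[OF x]] by (simp add: wt_def)
        show "0 \<le> (1/C2) * \<sigma> (fst x) (snd x) \<and> (snd x \<noteq> 3*M \<longrightarrow> (1/C2) * \<sigma> (fst x) (snd x) \<le> wt (snd x) * av f2 (fst x) (snd x))"
        proof (intro conjI impI)
          show "0 \<le> (1/C2) * \<sigma> (fst x) (snd x)" using pos by (simp add: \<sigma>_def)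
          assume "snd x \<noteq> 3*M"
          from h4[OF Cx[OF x] this] have "\<sigma> (fst x) (snd x) \<le> C2 * (wt (snd x) * av f2 (fst x) (snd x))"
            using f0 pos by (simp add: \<sigma>_def)
          then show "(1/C2) * \<sigma> (fst x) (snd x) \<le> wt (snd x) * av f2 (fst x) (snd x)"
            using pos by (simp add: pos_divide_le_eq mult.commute)
        qed
      qed
      then have "(1/C2) * integral ?C (\<lambda>x. \<sigma> (fst x) (snd x)) \<le> LS" by simp
      then show ?thesis using pos by (simp add: pos_divide_le_eq mult.commute)
    qed
    have s3: "k/2 * integral ?C (\<lambda>x. X (fst x) (snd x) * av lee (fst x) (snd x)) - C2 * LS \<le> I3 - I4"
    proof -
      have "k * integral ?C (\<lambda>x. X (fst x) (snd x) * av lee (fst x) (snd x)) = integral ?C (\<lambda>x. k * (X (fst x) (snd x) * av lee (fst x) (snd x)))" by simp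
      also have "\<dots> \<le> I3" unfolding I3_def
      proof (rule integral_le)
        show "(\<lambda>x. k * (X (fst x) (snd x) * av lee (fst x) (snd x))) integrable_on ?C" by (intro integrable_on_mult_right ib[OF cl])
        show "(\<lambda>x. X (fst x) (snd x) * av (bulk K) (fst x) (snd x)) integrable_on ?C" by (rule ib[OF continuous_on_mult[OF cX(1) ac(10)]])
        fix x assume x: "x \<in> ?C"
        show "k * (X (fst x) (snd x) * av lee (fst x) (snd x)) \<le> X (fst x) (snd x) * av (bulk K) (fst x) (snd x)"
          using mult_left_mono[OF h3[OF Cx[OF x]] X0[OF Cx[OF x]]] by (simp add: mult_ac)
      qed
      finally have A: "k * integral ?C (\<lambda>x. X (fst x) (snd x) * av lee (fst x) (snd x)) \<le> I3" .
      have "I4 \<le> integral ?C (\<lambda>x. k/2 * (X (fst x) (snd x) * av lee (fst x) (snd x)) + \<sigma> (fst x) (snd x))" unfolding I4_def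
      proof (rule integral_le)
        show "(\<lambda>x. k/2 * (X (fst x) (snd x) * av lee (fst x) (snd x)) + \<sigma> (fst x) (snd x)) integrable_on ?C"
          by (intro integrable_add integrable_on_mult_right ib[OF cl] ib[OF c\<sigma>])
        show "(\<lambda>x. X (fst x) (snd x) * av (source K) (fst x) (snd x)) integrable_on ?C" by (rule ib[OF continuous_on_mult[OF cX(1) ac(11)]])
        fix x assume x: "x \<in> ?C"
        have "av (source K) (fst x) (snd x) \<le> k/2 * av lee (fst x) (snd x) + \<sigma> (fst x) (snd x)" by (simp add: \<sigma>_def)
        from mult_left_mono[OF this X0[OF Cx[OF x]]]
        have "X (fst x) (snd x) * av (source K) (fst x) (snd x) \<le> k/2 * (X (fst x) (snd x) * av lee (fst x) (snd x)) + X (fst x) (snd x) * \<sigma> (fst x) (snd x)"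
          by (simp add: distrib_left mult_ac)
        moreover have "X (fst x) (snd x) * \<sigma> (fst x) (snd x) \<le> 1 * \<sigma> (fst x) (snd x)"
          using X1[OF Cx[OF x]] by (intro mult_right_mono) (auto simp: \<sigma>_def)
        ultimately show "X (fst x) (snd x) * av (source K) (fst x) (snd x) \<le> k/2 * (X (fst x) (snd x) * av lee (fst x) (snd x)) + \<sigma> (fst x) (snd x)"
          by linarith
      qed
      also have "\<dots> = k/2 * integral ?C (\<lambda>x. X (fst x) (snd x) * av lee (fst x) (snd x)) + integral ?C (\<lambda>x. \<sigma> (fst x) (snd x))"
        by (subst integral_add) (use ib[OF cl] ib[OF c\<sigma>] in \<open>auto intro!: integrable_on_mult_right\<close>)
      finally show ?thesis using A i\<sigma> by linarith
    qed
    have "\<theta> * integral ?D (\<lambda>x. av lee (fst x) (snd x)) \<le> integral ?C (\<lambda>x. X (fst x) (snd x) * av lee (fst x) (snd x))"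
    proof (rule cut_lower[OF _ ib[OF ac(6)] ib[OF cl] ib[OF cl]])
      show "?D \<subseteq> ?C" using R by (auto simp: cbox_Pair_eq)
      show "\<theta> \<le> X (fst x) (snd x)" if "x \<in> ?D" for x using that by (cases x) (auto simp: cbox_Pair_eq intro!: Xt)
    qed (use X0 nn(5) Cx in blast)+
    then have "k/2 * (\<theta> * integral ?D (\<lambda>x. av lee (fst x) (snd x))) \<le> k/2 * integral ?C (\<lambda>x. X (fst x) (snd x) * av lee (fst x) (snd x))"
      by (rule mult_left_mono) (use pos in simp)
    then have t3: "\<theta> * (k/2 * integral ?D (\<lambda>x. av lee (fst x) (snd x))) - C2 * LS \<le> I3 - I4"
      using s3 by (simp only: mult.left_commute[of \<theta>])
    \<comment> \<open>\<open>long\<close> has no sign for a general multiplier, so here the cut-off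
      error is bounded in absolute value by the a priori constant \<open>Cb\<close>, over n.\<close>
    have t5: "I5 \<le> (2 * G * (T * (5 * Cb))) / n"
    proof -
      have "I5 \<le> integral ?C (\<lambda>x. (2/n * G) * av ww (fst x) (snd x))" unfolding I5_def
      proof (rule integral_le)
        show "(\<lambda>x. (2/n * G) * av ww (fst x) (snd x)) integrable_on ?C" by (intro integrable_on_mult_right ib[OF ac(5)])
        show "(\<lambda>x. Xv (fst x) (snd x) * av (long K) (fst x) (snd x)) integrable_on ?C" by (rule ib[OF continuous_on_mult[OF cX(2) ac(9)]])
        fix x assume x: "x \<in> ?C"
        have "\<bar>Xv (fst x) (snd x)\<bar> * \<bar>av (long K) (fst x) (snd x)\<bar> \<le> (2/n) * (G * av ww (fst x) (snd x))"
          using Xv1[OF Cx[OF x]] h5(2)[OF Cx[OF x]] n by (intro mult_mono) auto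
        then show "Xv (fst x) (snd x) * av (long K) (fst x) (snd x) \<le> (2/n * G) * av ww (fst x) (snd x)"
          unfolding abs_mult[symmetric] by (simp only: mult.assoc abs_le_D1)
      qed
      also have "\<dots> = (2/n * G) * integral ?C (\<lambda>x. av ww (fst x) (snd x))" by simp
      also have "\<dots> \<le> (2/n * G) * (T * (5 * Cb))"
      proof (rule mult_left_mono)
        have "integral ?C (\<lambda>x. av ww (fst x) (snd x)) = integral {0..T} (\<lambda>v. integral {a..R} (\<lambda>r. av ww v r))"
          using integral_prod_continuous[OF ctd_box[OF ac(5) order_refl]] by simp
        also have "\<dots> \<le> integral {0..T} (\<lambda>v. 5 * Cb)"
        proof (rule integral_le)
          have "continuous_on {0..T} (\<lambda>v. integral {a..R} (\<lambda>r. av ww v r))"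
            by (rule integral_continuous_on_param[where a = a and b = R, unfolded cbox_interval])
               (unfold case_prod_unfold, rule continuous_on_subset[OF ac(5)], auto)
          then show "(\<lambda>v. integral {a..R} (\<lambda>r. av ww v r)) integrable_on {0..T}" by (rule integrable_continuous_real)
        qed (use wwb aR in auto)
        also have "\<dots> = T * (5 * Cb)" using T by simp
        finally show "integral ?C (\<lambda>x. av ww (fst x) (snd x)) \<le> T * (5 * Cb)" .
      qed (use n pos in auto)
      finally show ?thesis by simp
    qed
    have "\<theta> * tot R0 = \<theta> * (\<kappa> * integral {a..R0} (av ee T) + 4 * C * J R0) + \<theta> * (\<kappa> * integral {0..T} (\<lambda>v. av ww v a))
       + \<theta> * (k/2 * integral ?D (\<lambda>x. av lee (fst x) (snd x)))"
      unfolding tot_def by (simp only: distrib_left)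
    then show ?thesis unfolding W_def[symmetric] \<theta>_def[symmetric] Z_def using t1 t2 t3 t5 id by linarith
  qed
  have tot: "tot R \<le> 4 * C * S + Z" if "R \<ge> a" for R
    by (rule le_of_scaled_le[OF key[OF _ that]])
  have "\<kappa> * integral {a..R} (av ee T) + \<kappa> * integral {0..T} (\<lambda>v. av ww v a)
     + k/2 * integral (cbox (0,a) (T,R)) (\<lambda>x. av lee (fst x) (snd x)) \<le> Z"
  proof (rule field_le_epsilon)
    fix e :: real assume e: "e > 0"
    \<comment> \<open>The denominator 4 C + 1 makes 4 C \<delta> \<le> e and also covers C =
      0.\<close>
    define \<delta> where "\<delta> = e / (4 * C + 1)"
    have \<delta>: "\<delta> > 0" "4 * C * \<delta> \<le> e" using e pos by (auto simp: \<delta>_def field_simps)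
    have "S - \<delta> < S" using \<delta> by simp
    then obtain R1 where R1: "R1 \<ge> a" "S - \<delta> < J R1"
      unfolding S_def by (subst (asm) less_cSUP_iff[OF _ bdd]) auto
    define R0 where "R0 = max R R1"
    have R0: "R0 \<ge> R" "R0 \<ge> R1" "R0 \<ge> a" using R by (auto simp: R0_def)
    have "C * (S - J R0) \<le> C * \<delta>" using Jmono[OF R0(2) R1(1)] R1(2) pos by (intro mult_left_mono) auto
    then have jj: "4 * C * S - 4 * C * J R0 \<le> e" using \<delta>(2) by (simp add: algebra_simps)
    have m1: "\<kappa> * integral {a..R} (av ee T) \<le> \<kappa> * integral {a..R0} (av ee T)"
      by (intro mult_left_mono integral_subset_le i1[OF ac(1)] T0 ballI nn(6)) (use R0 pos in auto)
    have m2: "k/2 * integral (cbox (0,a) (T,R)) (\<lambda>x. av lee (fst x) (snd x)) \<le> k/2 * integral (cbox (0,a) (T,R0)) (\<lambda>x. av lee (fst x) (snd x))"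
    proof (intro mult_left_mono integral_subset_le ib[OF ac(6)] ballI)
      show "cbox (0,a) (T,R) \<subseteq> cbox (0,a) (T,R0)" using R0 by (auto simp: cbox_Pair_eq)
      fix x assume "x \<in> cbox (0,a) (T,R0)"
      then show "0 \<le> av lee (fst x) (snd x)" by (cases x) (auto simp: cbox_Pair_eq intro!: nn(5))
    qed (use pos in auto)
    show "\<kappa> * integral {a..R} (av ee T) + \<kappa> * integral {0..T} (\<lambda>v. av ww v a)
     + k/2 * integral (cbox (0,a) (T,R)) (\<lambda>x. av lee (fst x) (snd x)) \<le> Z + e"
      using tot[OF R0(3)] jj m1 m2 unfolding tot_def by linarith
  qed
  then show ?thesis by (simp only: Z_def)
qed

text \<open>The only incoming fluxes are through the initial slice and through r = b; the second is
  controlled by the outgoing boundary term of \<open>stage1\<close>. Here \<open>ww\<close> is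
  controlled without degeneration, as the region lies away from r = 3M.\<close>

lemma stage2:
  fixes b \<kappa> k C2 G T LS :: real
  assumes K: "coefs_on r0 K" and b: "r0 \<le> b" and T: "T > 0"
    and pos: "\<kappa> > 0" "k > 0" "C2 > 0" "G \<ge> 0"
    and H1: "\<And>v r \<omega>. v \<ge> 0 \<Longrightarrow> r \<in> {r0..b} \<Longrightarrow> \<omega> \<in> sphere 0 1 \<Longrightarrow> \<kappa> * ee v r \<omega> \<le> slice K v r \<omega>"
      "\<And>v r \<omega>. v \<ge> 0 \<Longrightarrow> r \<in> {r0..b} \<Longrightarrow> \<omega> \<in> sphere 0 1 \<Longrightarrow> \<bar>slice K v r \<omega>\<bar> \<le> G * ww v r \<omega>"
    and H2: "\<And>v \<omega>. v \<ge> 0 \<Longrightarrow> \<omega> \<in> sphere 0 1 \<Longrightarrow> \<kappa> * ee v r0 \<omega> \<le> - flux K v r0 \<omega>"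
      "\<And>v \<omega>. v \<ge> 0 \<Longrightarrow> \<omega> \<in> sphere 0 1 \<Longrightarrow> \<bar>flux K v b \<omega>\<bar> \<le> G * ww v b \<omega>"
    and H3: "\<And>v r \<omega>. v \<ge> 0 \<Longrightarrow> r \<in> {r0..b} \<Longrightarrow> \<omega> \<in> sphere 0 1 \<Longrightarrow> k * ww v r \<omega> \<le> bulk K v r \<omega>"
    and H4: "\<And>v r \<omega>. v \<ge> 0 \<Longrightarrow> r \<in> {r0..b} \<Longrightarrow> \<omega> \<in> sphere 0 1 \<Longrightarrow>
       source K v r \<omega> \<le> k/2 * ww v r \<omega> + C2 * (wt r * f2 v r \<omega>)"
    and DB: "dual_bound T LS"
  shows "\<kappa> * integral {r0..b} (av ee T) + \<kappa> * integral {0..T} (\<lambda>v. av ee v r0)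
     + k/2 * integral (cbox (0,r0) (T,b)) (\<lambda>x. av ww (fst x) (snd x))
     \<le> G * integral {r0..b} (av ww 0) + G * integral {0..T} (\<lambda>v. av ww v b) + C2 * LS"
proof -
  note cs = cdom_dens[OF K order_refl]
  note sq = cdom_sq
  note ac = av_continuous[OF cdom_ee] sq[THEN av_continuous] cs(1-5)[THEN av_continuous]
  have T0: "T \<ge> 0" "(0::real) \<ge> 0" using T by auto
  note nn = av_sq_nonneg
  let ?C = "cbox (0,r0) (T,b)"
  have i1: "(g v) integrable_on {x..y}" if "ctd r0 g" "v \<ge> 0" "x \<ge> r0" for g :: "real \<Rightarrow> real \<Rightarrow> real" and v x y
    by (rule integrable_continuous_real[OF ctd_slice[OF that]])
  have ic: "(\<lambda>v. g v r) integrable_on {0..T}" if "ctd r0 g" "r \<ge> r0" for g :: "real \<Rightarrow> real \<Rightarrow> real" and r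
    by (rule integrable_continuous_real[OF ctd_col[OF that]])
  have ib: "(\<lambda>x. g (fst x) (snd x)) integrable_on ?C" if "ctd r0 g" for g :: "real \<Rightarrow> real \<Rightarrow> real"
    by (rule integrable_continuous[OF ctd_box[OF that order_refl]])
  have Cx: "fst x \<ge> 0" "snd x \<in> {r0..b}" "snd x \<ge> r0" if "x \<in> ?C" for x using that by (cases x, auto simp: cbox_Pair_eq)+
  have h1: "\<kappa> * av ee v r \<le> av (slice K) v r" "av (slice K) v r \<le> G * av ww v r" if v: "v \<ge> 0" and r: "r \<in> {r0..b}" for v r
  proof -
    have r': "r \<ge> r0" using r by simp
    have 1: "\<And>\<omega>. \<omega> \<in> sphere 0 1 \<Longrightarrow> slice K v r \<omega> \<le> G * ww v r \<omega>" using H1(2)[OF v r] by (meson abs_le_D1)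
    have "\<kappa> * av ee v r + (- 1) * av (slice K) v r + 0 * av ww v r + 0 * av ww v r \<le> 0"
      by (rule av_lin[OF cdom_ee cs(1) sq(4) sq(4) v r']) (use H1(1)[OF v r] in force)
    moreover have "1 * av (slice K) v r + (- G) * av ww v r + 0 * av ww v r + 0 * av ww v r \<le> 0"
      by (rule av_lin[OF cs(1) sq(4) sq(4) sq(4) v r']) (use 1 in force)
    ultimately show "\<kappa> * av ee v r \<le> av (slice K) v r" "av (slice K) v r \<le> G * av ww v r" by auto
  qed
  have h2: "\<kappa> * av ee v r0 \<le> - av (flux K) v r0" "- av (flux K) v b \<le> G * av ww v b" if v: "v \<ge> 0" for v
  proof -
    have 1: "\<And>\<omega>. \<omega> \<in> sphere 0 1 \<Longrightarrow> - flux K v b \<omega> \<le> G * ww v b \<omega>" using H2(2)[OF v] by (meson abs_le_D2)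
    have "\<kappa> * av ee v r0 + 1 * av (flux K) v r0 + 0 * av ww v r0 + 0 * av ww v r0 \<le> 0"
      by (rule av_lin[OF cdom_ee cs(2) sq(4) sq(4) v order_refl]) (use H2(1)[OF v] in force)
    moreover have "(- 1) * av (flux K) v b + (- G) * av ww v b + 0 * av ww v b + 0 * av ww v b \<le> 0"
      by (rule av_lin[OF cs(2) sq(4) sq(4) sq(4) v b]) (use 1 in force)
    ultimately show "\<kappa> * av ee v r0 \<le> - av (flux K) v r0" "- av (flux K) v b \<le> G * av ww v b" by auto
  qed
  have h3: "k * av ww v r \<le> av (bulk K) v r" if v: "v \<ge> 0" and r: "r \<in> {r0..b}" for v r
  proof -
    have r': "r \<ge> r0" using r by simp
    have "k * av ww v r + (- 1) * av (bulk K) v r + 0 * av ww v r + 0 * av ww v r \<le> 0"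
      by (rule av_lin[OF sq(4) cs(4) sq(4) sq(4) v r']) (use H3[OF v r] in force)
    then show ?thesis by simp
  qed
  have h4: "av (source K) v r - k/2 * av ww v r \<le> C2 * (wt r * av f2 v r)" if v: "v \<ge> 0" and r: "r \<in> {r0..b}" for v r
  proof -
    have r': "r \<ge> r0" using r by simp
    have "1 * av (source K) v r + (- (k/2)) * av ww v r + (- (C2 * wt r)) * av f2 v r + 0 * av ww v r \<le> 0"
    proof (rule av_lin[OF cs(5) sq(4) sq(3) sq(4) v r'])
      fix \<omega> :: "real^3" assume w: "\<omega> \<in> sphere 0 1"
      show "1 * source K v r \<omega> + (- (k/2)) * ww v r \<omega> + (- (C2 * wt r)) * f2 v r \<omega> + 0 * ww v r \<omega> \<le> 0"
        using H4[OF v r w] by (simp add: mult.assoc)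
    qed
    then show ?thesis by (simp add: mult.assoc)
  qed
  \<comment> \<open>The radial range is bounded, so the weight is the constant 1 and its derivative
    term is zero.\<close>
  have one: "((\<lambda>v. 1) has_real_derivative 0) (at x)" "((\<lambda>r. 1) has_real_derivative m y * 0) (at x)" for x y :: real
    by auto
  have id: "integral {r0..b} (\<lambda>r. 1 * av (slice K) T r - 1 * av (slice K) 0 r)
      + integral {0..T} (\<lambda>v. 1 * av (flux K) v b - 1 * av (flux K) v r0)
      + integral ?C (\<lambda>x. 1 * av (bulk K) (fst x) (snd x))
    = integral ?C (\<lambda>x. 1 * av (source K) (fst x) (snd x)) + integral ?C (\<lambda>x. 0 * av (long K) (fst x) (snd x))"
    by (rule box_identity[OF K order_refl T0(1) b, where X = "\<lambda>_ _. 1" and Xv = "\<lambda>_ _. 0"]) (rule one continuous_on_const)+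
  have e1: "\<kappa> * integral {r0..b} (av ee T) - G * integral {r0..b} (av ww 0) \<le> integral {r0..b} (\<lambda>r. 1 * av (slice K) T r - 1 * av (slice K) 0 r)"
  proof -
    have "\<kappa> * integral {r0..b} (av ee T) - G * integral {r0..b} (av ww 0) = integral {r0..b} (\<lambda>r. \<kappa> * av ee T r - G * av ww 0 r)"
      by (subst integral_diff) (use i1[OF ac(1) T0(1)] i1[OF ac(5) T0(2)] in \<open>auto intro!: integrable_on_mult_right\<close>)
    also have "\<dots> \<le> integral {r0..b} (\<lambda>r. 1 * av (slice K) T r - 1 * av (slice K) 0 r)"
    proof (rule integral_le)
      show "(\<lambda>r. \<kappa> * av ee T r - G * av ww 0 r) integrable_on {r0..b}"
        by (intro integrable_diff integrable_on_mult_right i1[OF ac(1)] i1[OF ac(5)] T0 order_refl)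
      show "(\<lambda>r. 1 * av (slice K) T r - 1 * av (slice K) 0 r) integrable_on {r0..b}"
        by (intro integrable_diff integrable_on_mult_right i1[OF ac(7)] T0 order_refl)
      fix r assume r: "r \<in> {r0..b}"
      show "\<kappa> * av ee T r - G * av ww 0 r \<le> 1 * av (slice K) T r - 1 * av (slice K) 0 r"
        using h1(1)[OF T0(1) r] h1(2)[OF T0(2) r] by linarith
    qed
    finally show ?thesis .
  qed
  have e2: "\<kappa> * integral {0..T} (\<lambda>v. av ee v r0) - G * integral {0..T} (\<lambda>v. av ww v b) \<le> integral {0..T} (\<lambda>v. 1 * av (flux K) v b - 1 * av (flux K) v r0)"
  proof -
    have "\<kappa> * integral {0..T} (\<lambda>v. av ee v r0) - G * integral {0..T} (\<lambda>v. av ww v b) = integral {0..T} (\<lambda>v. \<kappa> * av ee v r0 - G * av ww v b)"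
      by (subst integral_diff) (use ic[OF ac(1) order_refl] ic[OF ac(5) b] in \<open>auto intro!: integrable_on_mult_right\<close>)
    also have "\<dots> \<le> integral {0..T} (\<lambda>v. 1 * av (flux K) v b - 1 * av (flux K) v r0)"
    proof (rule integral_le)
      show "(\<lambda>v. \<kappa> * av ee v r0 - G * av ww v b) integrable_on {0..T}"
        by (intro integrable_diff integrable_on_mult_right ic[OF ac(1)] ic[OF ac(5)] b order_refl)
      show "(\<lambda>v. 1 * av (flux K) v b - 1 * av (flux K) v r0) integrable_on {0..T}"
        by (intro integrable_diff integrable_on_mult_right ic[OF ac(8)] b order_refl)
      fix v assume "v \<in> {0..T}"
      then have v: "v \<ge> 0" by simp
      show "\<kappa> * av ee v r0 - G * av ww v b \<le> 1 * av (flux K) v b - 1 * av (flux K) v r0" using h2[OF v] by linarith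
    qed
    finally show ?thesis .
  qed
  define \<sigma> where "\<sigma> v r = max 0 (av (source K) v r - k/2 * av ww v r)" for v r
  have c\<sigma>: "ctd r0 \<sigma>" unfolding \<sigma>_def by (intro continuous_on_max continuous_on_diff continuous_on_mult continuous_on_const ac)
  have i\<sigma>: "integral ?C (\<lambda>x. \<sigma> (fst x) (snd x)) \<le> C2 * LS"
  proof -
    have "integral ?C (\<lambda>x. (1/C2) * \<sigma> (fst x) (snd x)) \<le> LS"
    proof (rule DB[unfolded dual_bound_def, rule_format, OF order_refl])
      show "continuous_on ?C (\<lambda>x. (1/C2) * \<sigma> (fst x) (snd x))"
        by (intro continuous_on_mult continuous_on_const ctd_box[OF c\<sigma>] order_refl)
      fix x assume x: "x \<in> ?C"
      have f0: "wt (snd x) * av f2 (fst x) (snd x) \<ge> 0" using nn(3)[OF Cx(1,3)[OF x]] by (simp add: wt_def)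
      have "\<sigma> (fst x) (snd x) \<le> C2 * (wt (snd x) * av f2 (fst x) (snd x))"
        using h4[OF Cx(1,2)[OF x]] f0 pos by (simp add: \<sigma>_def)
      then have "(1/C2) * \<sigma> (fst x) (snd x) \<le> wt (snd x) * av f2 (fst x) (snd x)"
        using pos by (simp add: pos_divide_le_eq mult.commute)
      moreover have "0 \<le> (1/C2) * \<sigma> (fst x) (snd x)" using pos by (simp add: \<sigma>_def)
      ultimately show "0 \<le> (1/C2) * \<sigma> (fst x) (snd x) \<and> (snd x \<noteq> 3*M \<longrightarrow> (1/C2) * \<sigma> (fst x) (snd x) \<le> wt (snd x) * av f2 (fst x) (snd x))"
        by blast
    qed
    then have "(1/C2) * integral ?C (\<lambda>x. \<sigma> (fst x) (snd x)) \<le> LS" by simp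
    then show ?thesis using pos by (simp add: pos_divide_le_eq mult.commute)
  qed
  have e3: "k * integral ?C (\<lambda>x. av ww (fst x) (snd x)) \<le> integral ?C (\<lambda>x. 1 * av (bulk K) (fst x) (snd x))"
    unfolding integral_mult_right[symmetric]
    by (rule integral_le; (intro integrable_on_mult_right ib[OF ac(5)] ib[OF ac(10)])?) (use h3 Cx in auto)
  have "integral ?C (\<lambda>x. 1 * av (source K) (fst x) (snd x)) \<le> integral ?C (\<lambda>x. k/2 * av ww (fst x) (snd x) + \<sigma> (fst x) (snd x))"
    by (rule integral_le; (intro integrable_add integrable_on_mult_right ib[OF ac(5)] ib[OF ac(11)] ib[OF c\<sigma>])?) (simp add: \<sigma>_def)
  also have "\<dots> = k/2 * integral ?C (\<lambda>x. av ww (fst x) (snd x)) + integral ?C (\<lambda>x. \<sigma> (fst x) (snd x))"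
    by (subst integral_add) (use ib[OF ac(5)] ib[OF c\<sigma>] in \<open>auto intro!: integrable_on_mult_right\<close>)
  finally have "integral ?C (\<lambda>x. 1 * av (source K) (fst x) (snd x)) \<le> k/2 * integral ?C (\<lambda>x. av ww (fst x) (snd x)) + C2 * LS"
    using i\<sigma> by linarith
  moreover have "integral ?C (\<lambda>x. 0 * av (long K) (fst x) (snd x)) = 0" by simp
  ultimately show ?thesis using id e1 e2 e3 by linarith
qed

end

section \<open>Coercivity stated for real numbers in place of a solution\<close>

text \<open>What is used of \<mu>' at one radius: two-sided bounds for it and for 1 - m h/2, and its
  exact value beyond 5M/2, where v is static time.\<close>

definition m_ok :: "real \<Rightarrow> real \<Rightarrow> real \<Rightarrow> real \<Rightarrow> real \<Rightarrow> real \<Rightarrow> real \<Rightarrow> bool" where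
  "m_ok M m0 m1 n0 n1 r m \<longleftrightarrow> m0 \<le> m \<and> m \<le> m1 \<and> n0 \<le> 1 - m * lapse M r / 2 \<and> 1 - m * lapse M r / 2 \<le> n1
     \<and> (r > 5*M/2 \<longrightarrow> m = 1 / lapse M r)"

text \<open>The inverse change of frame: the time and radial derivative recovered from arbitrary
  values of P and L. \<open>en_of\<close> and \<open>le_of\<close> are \<open>ee\<close> and
  \<open>lee\<close> in these values.\<close>

definition ut_of where "ut_of M r P L = P - lapse M r / 2 * L"
definition ur_of where "ur_of M r m P L = L + m * ut_of M r P L"
definition en_of where "en_of M r m P L Q = r\<^sup>2 * ((ur_of M r m P L)\<^sup>2 + (ut_of M r P L)\<^sup>2) + Q"
definition le_of where "le_of M r m P L Q U =
  (ur_of M r m P L)\<^sup>2 + (1 - 3*(M/r))\<^sup>2 * ((ut_of M r P L)\<^sup>2 + Q / r) + (U / r)\<^sup>2"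

text \<open>The hypotheses of \<open>stage1\<close> with the solution, its derivatives, the source
  and \<mu>' replaced by free real numbers. The constants found for it are thereby independent of
  the solution. \<open>int_ok\<close> does the same for \<open>stage2\<close>.\<close>

definition ext_ok where "ext_ok M a m0 m1 n0 n1 K \<kappa> C k C2 G \<longleftrightarrow> (\<kappa>::real) > 0 \<and> (C::real) \<ge> 0 \<and> (k::real) > 0 \<and> (C2::real) > 0 \<and> (G::real) \<ge> 0 \<and>
  (\<forall>r m P L Q U f. r \<ge> a \<longrightarrow> m_ok M m0 m1 n0 n1 r m \<longrightarrow> Q \<ge> 0 \<longrightarrow>
    \<kappa> * en_of M r m P L Q + C * (4 * (r - a)\<^sup>2 * (ur_of M r m P L)\<^sup>2 - U\<^sup>2) \<le> slice_dens K M m r P L Q U \<and>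
    (r = a \<longrightarrow> \<kappa> * (en_of M r m P L Q + U\<^sup>2) \<le> - flux_dens K M r P L Q U) \<and>
    k * le_of M r m P L Q U \<le> bulk_dens K M r P L Q U \<and>
    (r \<noteq> 3*M \<longrightarrow> r\<^sup>2 * f * mult_dens K r P L U \<le> k/2 * le_of M r m P L Q U + C2 * (inverse ((1 - 3*M/r)\<^sup>2) * r\<^sup>2 * r\<^sup>2 * f\<^sup>2)) \<and>
    \<bar>slice_dens K M m r P L Q U\<bar> \<le> G * (en_of M r m P L Q + U\<^sup>2) \<and>
    \<bar>long_dens K r L Q U\<bar> \<le> G * (en_of M r m P L Q + U\<^sup>2))"

definition int_ok where "int_ok M r0 b m0 m1 n0 n1 K \<kappa> k C2 G \<longleftrightarrow> (\<kappa>::real) > 0 \<and> (k::real) > 0 \<and> (C2::real) > 0 \<and> (G::real) \<ge> 0 \<and>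
  (\<forall>r m P L Q U f. r0 \<le> r \<longrightarrow> r \<le> b \<longrightarrow> m_ok M m0 m1 n0 n1 r m \<longrightarrow> Q \<ge> 0 \<longrightarrow>
    \<kappa> * en_of M r m P L Q \<le> slice_dens K M m r P L Q U \<and>
    \<kappa> * en_of M r m P L Q \<le> - flux_dens K M r P L Q U \<and>
    k * (en_of M r m P L Q + U\<^sup>2) \<le> bulk_dens K M r P L Q U \<and>
    r\<^sup>2 * f * mult_dens K r P L U \<le> k/2 * (en_of M r m P L Q + U\<^sup>2) + C2 * (inverse ((1 - 3*M/r)\<^sup>2) * r\<^sup>2 * r\<^sup>2 * f\<^sup>2) \<and>
    \<bar>slice_dens K M m r P L Q U\<bar> \<le> G * (en_of M r m P L Q + U\<^sup>2) \<and>
    \<bar>flux_dens K M r P L Q U\<bar> \<le> G * (en_of M r m P L Q + U\<^sup>2))"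

section \<open>Coercivity of the multipliers\<close>

lemma abs_two_mult_le: "2 * \<bar>a * b\<bar> \<le> a\<^sup>2 + b\<^sup>2" for a b :: real
  using zero_le_power2[of "\<bar>a\<bar> - \<bar>b\<bar>"] by (simp add: power2_eq_square algebra_simps abs_mult)

lemma sq_sum_le: "(a + b)\<^sup>2 \<le> 2 * a\<^sup>2 + 2 * b\<^sup>2" for a b :: real
  using zero_le_power2[of "a - b"] by (simp add: power2_eq_square algebra_simps)

lemma frame_equiv:
  fixes m h P L ur w :: real
  assumes m: "0 \<le> m" "m \<le> m1" and h: "\<bar>h\<bar> \<le> h1" and L: "L = ur - m * w" and P: "P = w + h / 2 * L"
  defines "K \<equiv> 2 + (2 + h1\<^sup>2) * (1 + 2 * m1\<^sup>2)"
  shows "P\<^sup>2 + L\<^sup>2 \<le> K * (ur\<^sup>2 + w\<^sup>2)" "ur\<^sup>2 + w\<^sup>2 \<le> K * (P\<^sup>2 + L\<^sup>2)"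
proof -
  have m2: "m\<^sup>2 \<le> m1\<^sup>2" using m by (intro power_mono)
  have h2: "h\<^sup>2 \<le> h1\<^sup>2" using h by (metis abs_ge_zero power2_abs power_mono)
  have mw: "2 * (m * x)\<^sup>2 \<le> 2 * m1\<^sup>2 * x\<^sup>2" for x using mult_right_mono[OF m2, of "x\<^sup>2"] by (simp add: power_mult_distrib)
  have hw: "2 * (h / 2 * x)\<^sup>2 \<le> h1\<^sup>2 / 2 * x\<^sup>2" for x using mult_right_mono[OF h2, of "x\<^sup>2"] by (simp add: power_mult_distrib power_divide)
  have a: "L\<^sup>2 \<le> 2 * ur\<^sup>2 + 2 * m1\<^sup>2 * w\<^sup>2" using sq_sum_le[of ur "- (m * w)"] mw[of w] by (simp add: L)
  have b: "P\<^sup>2 \<le> 2 * w\<^sup>2 + h1\<^sup>2 / 2 * L\<^sup>2" using sq_sum_le[of w "h / 2 * L"] hw[of L] by (simp add: P)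
  have c: "w\<^sup>2 \<le> 2 * P\<^sup>2 + h1\<^sup>2 / 2 * L\<^sup>2" using sq_sum_le[of P "- (h / 2 * L)"] hw[of L] by (simp add: P)
  have d: "ur\<^sup>2 \<le> 2 * L\<^sup>2 + 2 * m1\<^sup>2 * w\<^sup>2" using sq_sum_le[of L "m * w"] mw[of w] by (simp add: L)
  have n: "0 \<le> ur\<^sup>2" "0 \<le> w\<^sup>2" "0 \<le> P\<^sup>2" "0 \<le> L\<^sup>2" "0 \<le> m1\<^sup>2" "0 \<le> h1\<^sup>2" by auto
  have "P\<^sup>2 + L\<^sup>2 \<le> 2 * w\<^sup>2 + (1 + h1\<^sup>2 / 2) * L\<^sup>2" using b by (simp add: algebra_simps)
  also have "\<dots> \<le> 2 * w\<^sup>2 + (1 + h1\<^sup>2 / 2) * (2 * ur\<^sup>2 + 2 * m1\<^sup>2 * w\<^sup>2)" using a n by (intro add_left_mono mult_left_mono) auto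
  also have "\<dots> = 2 * w\<^sup>2 + (2 + h1\<^sup>2) * (ur\<^sup>2 + m1\<^sup>2 * w\<^sup>2)" by (simp add: field_simps)
  also have "\<dots> \<le> 2 * (ur\<^sup>2 + w\<^sup>2) + (2 + h1\<^sup>2) * ((1 + 2 * m1\<^sup>2) * (ur\<^sup>2 + w\<^sup>2))"
  proof (intro add_mono mult_left_mono)
    have "0 \<le> m1\<^sup>2 * ur\<^sup>2" "0 \<le> m1\<^sup>2 * w\<^sup>2" by auto
    then show "ur\<^sup>2 + m1\<^sup>2 * w\<^sup>2 \<le> (1 + 2 * m1\<^sup>2) * (ur\<^sup>2 + w\<^sup>2)" using n by (simp add: algebra_simps)
  qed (use n in auto)
  finally show "P\<^sup>2 + L\<^sup>2 \<le> K * (ur\<^sup>2 + w\<^sup>2)" by (simp add: K_def algebra_simps)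
  have "ur\<^sup>2 + w\<^sup>2 \<le> 2 * L\<^sup>2 + (1 + 2 * m1\<^sup>2) * w\<^sup>2" using d by (simp add: algebra_simps)
  also have "\<dots> \<le> 2 * L\<^sup>2 + (1 + 2 * m1\<^sup>2) * (2 * P\<^sup>2 + h1\<^sup>2 / 2 * L\<^sup>2)" using c n by (intro add_left_mono mult_left_mono) auto
  also have "\<dots> \<le> 2 * (P\<^sup>2 + L\<^sup>2) + (1 + 2 * m1\<^sup>2) * ((2 + h1\<^sup>2) * (P\<^sup>2 + L\<^sup>2))"
  proof (intro add_mono mult_left_mono)
    have "0 \<le> h1\<^sup>2 * P\<^sup>2" "0 \<le> h1\<^sup>2 * L\<^sup>2" by auto
    then show "2 * P\<^sup>2 + h1\<^sup>2 / 2 * L\<^sup>2 \<le> (2 + h1\<^sup>2) * (P\<^sup>2 + L\<^sup>2)" using n by (simp add: algebra_simps)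
  qed (use n in auto)
  finally show "ur\<^sup>2 + w\<^sup>2 \<le> K * (P\<^sup>2 + L\<^sup>2)" by (simp add: K_def algebra_simps)
qed

text \<open>Each density is a sum of at most ten monomials, and each monomial is a frame factor
  bounded by g, a multiplier coefficient bounded by k, and one of the four squares or a product
  estimated by two of them.\<close>

lemma dens_growth:
  fixes r m P L Q U :: real
  assumes r: "r > 0" and m: "0 \<le> m" "m \<le> m1" and h: "\<bar>lapse M r\<bar> \<le> h1" and Q: "Q \<ge> 0"
    and k: "\<bar>cB K r\<bar> \<le> k" "\<bar>cY K r\<bar> \<le> k" "\<bar>cq K r * r\<^sup>2\<bar> \<le> k * r" "\<bar>cq' K r * r\<^sup>2\<bar> \<le> k" "\<bar>ca K r\<bar> \<le> k" "\<bar>cb K r\<bar> \<le> k"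
  defines "G \<equiv> 10 * (1 + h1) * (1 + m1) * (1 + m1 * h1) * k" and "N \<equiv> r\<^sup>2 * (P\<^sup>2 + L\<^sup>2) + Q + U\<^sup>2"
  shows "\<bar>slice_dens K M m r P L Q U\<bar> \<le> G * N" "\<bar>flux_dens K M r P L Q U\<bar> \<le> G * N" "\<bar>long_dens K r L Q U\<bar> \<le> G * N"
proof -
  define h where "h = lapse M r"
  define B where "B = cB K r"
  define Y where "Y = cY K r"
  define q where "q = cq K r * r\<^sup>2"
  define q1 where "q1 = cq' K r * r\<^sup>2"
  define a where "a = ca K r"
  define b where "b = cb K r"
  note defs = h_def[symmetric] B_def[symmetric] Y_def[symmetric] q_def[symmetric] q1_def[symmetric] a_def[symmetric] b_def[symmetric]
  note k = k[unfolded defs]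
  have h: "\<bar>h\<bar> \<le> h1" using h by (simp add: h_def)
  have k0: "0 \<le> k" and h10: "0 \<le> h1" and m10: "0 \<le> m1" using k(1) h m by linarith+
  define g where "g = (1 + h1) * (1 + m1) * (1 + m1 * h1)"
  have g: "1 \<le> g" "h1 \<le> g" "m1 \<le> g" "m1 * h1 \<le> g" "m1 + m1 * h1 \<le> g" "1 + m1 * h1 \<le> g"
  proof -
    have e: "g = 1 + h1 + m1 + m1 * h1 + (1 + h1 + m1 + m1 * h1) * (m1 * h1)" by (simp add: g_def algebra_simps)
    have "0 \<le> m1 * h1" "0 \<le> (1 + h1 + m1 + m1 * h1) * (m1 * h1)" using m10 h10 by auto
    then show "1 \<le> g" "h1 \<le> g" "m1 \<le> g" "m1 * h1 \<le> g" "m1 + m1 * h1 \<le> g" "1 + m1 * h1 \<le> g" unfolding e using m10 h10 by auto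
  qed
  have G: "G = 10 * (g * k)" by (simp add: G_def g_def)
  have mh: "\<bar>m * h\<bar> \<le> m1 * h1" unfolding abs_mult using m h m10 by (intro mult_mono) auto
  define n where "n = 1 - m * h / 2"
  have n: "\<bar>n\<bar> \<le> g"
  proof -
    have "0 \<le> m1 * h1" using m10 h10 by simp
    then have "\<bar>n\<bar> \<le> 1 + m1 * h1" using mh unfolding n_def abs_le_iff by (intro conjI; linarith)
    then show ?thesis using g by linarith
  qed
  have mg: "\<bar>m\<bar> \<le> g" using m g(3) by simp
  have og: "\<bar>1::real\<bar> \<le> g" "\<bar>m * h\<bar> \<le> g" "\<bar>h\<bar> \<le> g" using g(1,2,4) mh h by simp_all
  have "g * 1 \<le> g * g" using g by (intro mult_left_mono) auto
  have p2: "0 \<le> r\<^sup>2 * P\<^sup>2" "0 \<le> r\<^sup>2 * L\<^sup>2" "0 \<le> U\<^sup>2" by auto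
  have ab: "\<bar>x * y * z\<bar> \<le> g * k * z" if "\<bar>x\<bar> \<le> g" "\<bar>y\<bar> \<le> k" "0 \<le> z" for x y z
    unfolding abs_mult using that g k0 by (intro mult_mono) auto
  have UX: "\<bar>x * q * (U * X)\<bar> \<le> g * k * (U\<^sup>2 + r\<^sup>2 * X\<^sup>2)" if "\<bar>x\<bar> \<le> g" for x X
  proof -
    have "\<bar>q * (U * X)\<bar> \<le> (k * r) * \<bar>U * X\<bar>" unfolding abs_mult[of q] using k(3) by (intro mult_right_mono) auto
    also have "\<dots> = k * \<bar>U * (r * X)\<bar>" using r by (simp add: abs_mult)
    also have "\<dots> \<le> k * (U\<^sup>2 + (r * X)\<^sup>2)" using abs_two_mult_le[of U "r * X"] k0 by (intro mult_left_mono) auto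
    finally have "\<bar>q * (U * X)\<bar> \<le> k * (U\<^sup>2 + r\<^sup>2 * X\<^sup>2)" by (simp add: power_mult_distrib)
    then have "\<bar>x\<bar> * \<bar>q * (U * X)\<bar> \<le> g * (k * (U\<^sup>2 + r\<^sup>2 * X\<^sup>2))" using that g by (intro mult_mono) auto
    then show ?thesis by (simp add: abs_mult mult.assoc)
  qed
  have z1: "\<bar>m * b * U\<^sup>2\<bar> \<le> g * k * U\<^sup>2" "\<bar>1 * a * U\<^sup>2\<bar> \<le> g * k * U\<^sup>2" "\<bar>1 * b * U\<^sup>2\<bar> \<le> g * k * U\<^sup>2"
    "\<bar>1 * q1 * U\<^sup>2\<bar> \<le> g * k * U\<^sup>2" "\<bar>(m * h) * q1 * U\<^sup>2\<bar> \<le> g * k * U\<^sup>2" "\<bar>h * q1 * U\<^sup>2\<bar> \<le> g * k * U\<^sup>2"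
    by (intro ab mg og n k zero_le_power2)+
  have z2: "\<bar>m * B * (r\<^sup>2 * P\<^sup>2)\<bar> \<le> g * k * (r\<^sup>2 * P\<^sup>2)" "\<bar>n * Y * (r\<^sup>2 * L\<^sup>2)\<bar> \<le> g * k * (r\<^sup>2 * L\<^sup>2)"
    "\<bar>1 * B * (r\<^sup>2 * P\<^sup>2)\<bar> \<le> g * k * (r\<^sup>2 * P\<^sup>2)" "\<bar>1 * Y * (r\<^sup>2 * L\<^sup>2)\<bar> \<le> g * k * (r\<^sup>2 * L\<^sup>2)" "\<bar>h * Y * (r\<^sup>2 * L\<^sup>2)\<bar> \<le> g * k * (r\<^sup>2 * L\<^sup>2)"
    by (intro ab mg og n k p2)+
  have z3: "\<bar>n * B * Q\<bar> \<le> g * k * Q" "\<bar>m * Y * Q\<bar> \<le> g * k * Q" "\<bar>1 * B * Q\<bar> \<le> g * k * Q" "\<bar>1 * Y * Q\<bar> \<le> g * k * Q" "\<bar>h * B * Q\<bar> \<le> g * k * Q"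
    by (intro ab mg og n k Q)+
  have z4: "\<bar>n * q * (U * L)\<bar> \<le> g * k * (U\<^sup>2 + r\<^sup>2 * L\<^sup>2)" "\<bar>m * q * (U * P)\<bar> \<le> g * k * (U\<^sup>2 + r\<^sup>2 * P\<^sup>2)"
    "\<bar>1 * q * (U * P)\<bar> \<le> g * k * (U\<^sup>2 + r\<^sup>2 * P\<^sup>2)" "\<bar>h * q * (U * L)\<bar> \<le> g * k * (U\<^sup>2 + r\<^sup>2 * L\<^sup>2)" "\<bar>1 * q * (U * L)\<bar> \<le> g * k * (U\<^sup>2 + r\<^sup>2 * L\<^sup>2)"
    by (intro UX mg og n)+
  define A1 where "A1 = g * k * (r\<^sup>2 * P\<^sup>2)"
  define A2 where "A2 = g * k * (r\<^sup>2 * L\<^sup>2)"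
  define A3 where "A3 = g * k * Q"
  define A4 where "A4 = g * k * U\<^sup>2"
  have gk: "0 \<le> g * k" using g k0 by simp
  have A: "0 \<le> A1" "0 \<le> A2" "0 \<le> A3" "0 \<le> A4" using gk Q by (simp_all add: A1_def A2_def A3_def A4_def)
  have d: "g * k * (U\<^sup>2 + r\<^sup>2 * X) = A4 + g * k * (r\<^sup>2 * X)" for X by (simp add: A4_def algebra_simps)
  have GN: "G * N = 10 * (A1 + A2 + A3 + A4)" by (simp add: G N_def A1_def A2_def A3_def A4_def algebra_simps)
  note y1 = z1[folded A4_def] and y2 = z2[folded A1_def A2_def] and y3 = z3[folded A3_def] and y4 = z4[unfolded d, folded A1_def A2_def]
  have ta: "\<bar>x + y\<bar> \<le> a + b" "\<bar>x - y\<bar> \<le> a + b" if "\<bar>x\<bar> \<le> a" "\<bar>y\<bar> \<le> b" for x y a b :: real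
    using that by linarith+
  have hf: "\<bar>x / 2\<bar> \<le> a" "\<bar>x / 4\<bar> \<le> a" if "\<bar>x\<bar> \<le> a" for x a :: real using that by linarith+
  have "slice_dens K M m r P L Q U = m * B * (r\<^sup>2 * P\<^sup>2) + n * Y * (r\<^sup>2 * L\<^sup>2) + (n * B * Q) / 2 + (m * Y * Q) / 2
     + n * q * (U * L) - m * q * (U * P) + m * b * U\<^sup>2 - 1 * a * U\<^sup>2 - (1 * q1 * U\<^sup>2) / 2 + ((m * h) * q1 * U\<^sup>2) / 2"
    unfolding slice_dens_def Let_def defs n_def[symmetric] by (simp add: field_simps)
  moreover have "\<bar>m * B * (r\<^sup>2 * P\<^sup>2) + n * Y * (r\<^sup>2 * L\<^sup>2) + (n * B * Q) / 2 + (m * Y * Q) / 2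
     + n * q * (U * L) - m * q * (U * P) + m * b * U\<^sup>2 - 1 * a * U\<^sup>2 - (1 * q1 * U\<^sup>2) / 2 + ((m * h) * q1 * U\<^sup>2) / 2\<bar>
     \<le> A1 + A2 + A3 + A3 + (A4 + A2) + (A4 + A1) + A4 + A4 + A4 + A4"
    by (intro ta hf y1 y2 y3 y4)
  ultimately have "\<bar>slice_dens K M m r P L Q U\<bar> \<le> A1 + A2 + A3 + A3 + (A4 + A2) + (A4 + A1) + A4 + A4 + A4 + A4" by simp
  moreover have "A1 + A2 + A3 + A3 + (A4 + A2) + (A4 + A1) + A4 + A4 + A4 + A4 \<le> 10 * (A1 + A2 + A3 + A4)" using A by simp
  ultimately show "\<bar>slice_dens K M m r P L Q U\<bar> \<le> G * N" unfolding GN by (rule order_trans)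
  have "flux_dens K M r P L Q U = (h * Y * (r\<^sup>2 * L\<^sup>2)) / 2 - 1 * B * (r\<^sup>2 * P\<^sup>2) - (1 * Y * Q) / 2 + (h * B * Q) / 4
     + 1 * q * (U * P) + (h * q * (U * L)) / 2 - 1 * b * U\<^sup>2 - (h * q1 * U\<^sup>2) / 2"
    unfolding flux_dens_def Let_def defs by (simp add: field_simps)
  moreover have "\<bar>(h * Y * (r\<^sup>2 * L\<^sup>2)) / 2 - 1 * B * (r\<^sup>2 * P\<^sup>2) - (1 * Y * Q) / 2 + (h * B * Q) / 4
     + 1 * q * (U * P) + (h * q * (U * L)) / 2 - 1 * b * U\<^sup>2 - (h * q1 * U\<^sup>2) / 2\<bar>
     \<le> A2 + A1 + A3 + A3 + (A4 + A1) + (A4 + A2) + A4 + A4"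
    by (intro ta hf y1 y2 y3 y4)
  ultimately have "\<bar>flux_dens K M r P L Q U\<bar> \<le> A2 + A1 + A3 + A3 + (A4 + A1) + (A4 + A2) + A4 + A4" by simp
  moreover have "A2 + A1 + A3 + A3 + (A4 + A1) + (A4 + A2) + A4 + A4 \<le> 10 * (A1 + A2 + A3 + A4)" using A by simp
  ultimately show "\<bar>flux_dens K M r P L Q U\<bar> \<le> G * N" unfolding GN by (rule order_trans)
  have "long_dens K r L Q U = 1 * Y * (r\<^sup>2 * L\<^sup>2) + (1 * B * Q) / 2 + 1 * q * (U * L) - 1 * a * U\<^sup>2 - (1 * q1 * U\<^sup>2) / 2"
    unfolding long_dens_def defs by (simp add: field_simps)
  moreover have "\<bar>1 * Y * (r\<^sup>2 * L\<^sup>2) + (1 * B * Q) / 2 + 1 * q * (U * L) - 1 * a * U\<^sup>2 - (1 * q1 * U\<^sup>2) / 2\<bar>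
     \<le> A2 + A3 + (A4 + A2) + A4 + A4"
    by (intro ta hf y1 y2 y3 y4)
  ultimately have "\<bar>long_dens K r L Q U\<bar> \<le> A2 + A3 + (A4 + A2) + A4 + A4" by simp
  moreover have "A2 + A3 + (A4 + A2) + A4 + A4 \<le> 10 * (A1 + A2 + A3 + A4)" using A by simp
  ultimately show "\<bar>long_dens K r L Q U\<bar> \<le> G * N" unfolding GN by (rule order_trans)
qed

text \<open>\<open>morawetz_positive\<close> controls p without loss at r = 3M but w only with the
  factor (1 - 3M/r)^2. The radial derivative is still controlled without loss, since beyond 5M/2 it
  is p/h, while inside 5M/2 the factor is bounded below.\<close>

lemma exterior_bulk_coercive:
  fixes M r m P L Q U \<Lambda> :: real
  assumes M: "M > 0" and r: "r \<ge> 7*M/4" and m: "0 \<le> m" "m \<le> m1" and far: "r > 5*M/2 \<Longrightarrow> m = 1 / lapse M r" and Q: "Q \<ge> 0"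
  defines "w \<equiv> P - lapse M r / 2 * L"
  defines "ur \<equiv> L + m * w"
  shows "min (1/4) (M / (2 * 10^9 * (1 + m1\<^sup>2))) * (ur\<^sup>2 + (1 - 3*(M/r))\<^sup>2 * (w\<^sup>2 + Q / r) + (U / r)\<^sup>2)
    \<le> bulk_dens (exterior_coefs M \<Lambda>) M r P L Q U"
proof -
  define x where "x = M/r"
  define \<tau> where "\<tau> = max 0 (5/2 - r/M)"
  define h where "h = lapse M r"
  define p where "p = P + h / 2 * L"
  define z where "z = U / r"
  have rp: "r > 0" using r M by linarith
  have x: "0 < x" "x \<le> 4/7" using r M rp by (auto simp: x_def field_simps)
  have tx: "\<tau> = max 0 (5/2 - 1/x)" by (simp add: \<tau>_def x_def)
  have w: "w = P - h / 2 * L" by (simp add: w_def h_def)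
  have Q': "Q / M\<^sup>2 \<ge> 0" using Q by simp
  define c where "c = (1 - 3*x)\<^sup>2"
  define S where "S = p\<^sup>2/100 + z\<^sup>2/100 + 1/100000 * c * w\<^sup>2 + 1/1000 * \<tau> * L\<^sup>2 / 5"
  have bulk: "M * (S + x * c * (Q / M\<^sup>2) / 4) \<le> bulk_dens (exterior_coefs M \<Lambda>) M r P L Q U"
    unfolding exterior_bulk[OF M rp] x_def[symmetric] \<tau>_def[symmetric] h_def[symmetric] p_def[symmetric] w[symmetric] z_def[symmetric] S_def c_def
    by (rule mult_left_mono[OF morawetz_positive[OF x tx Q']]) (use M in simp)
  have c0: "0 \<le> c" by (simp add: c_def)
  have nn: "0 \<le> p\<^sup>2" "0 \<le> z\<^sup>2" "0 \<le> c * w\<^sup>2" "0 \<le> \<tau> * L\<^sup>2" "0 \<le> w\<^sup>2" "0 \<le> m1\<^sup>2" using c0 by (auto simp: \<tau>_def)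
  have S0: "S \<ge> 0" using nn by (simp add: S_def)
  have Sp: "p\<^sup>2 \<le> 100 * S" "z\<^sup>2 \<le> 100 * S" "c * w\<^sup>2 \<le> 100000 * S" "\<tau> * L\<^sup>2 \<le> 5000 * S" using nn by (simp_all add: S_def)
  \<comment> \<open>At r > 5M/2 the value m = 1/h turns L + m w into p/h. Elsewhere x \<ge> 2/5, so
    w is controlled, and L comes from the red-shift square for r < 9M/4 and from h L = p - w
    beyond.\<close>
  have ur: "ur\<^sup>2 \<le> (10^9 + 10^8 * m1\<^sup>2) * S"
  proof (cases "r > 5*M/2")
    case True
    have h5: "h \<ge> 1/5" using True rp M by (simp add: h_def lapse_def field_simps)
    have "ur = p / h" unfolding ur_def w p_def using far[OF True] h5 by (simp add: h_def field_simps)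
    then have "ur\<^sup>2 = p\<^sup>2 / h\<^sup>2" by (simp add: power_divide)
    also have "\<dots> \<le> p\<^sup>2 / (1/5)\<^sup>2" using h5 by (intro divide_left_mono power_mono) auto
    also have "\<dots> = 25 * p\<^sup>2" by (simp add: power_divide)
    also have "\<dots> \<le> 10^9 * S" using Sp S0 by simp
    also have "\<dots> \<le> (10^9 + 10^8 * m1\<^sup>2) * S" using S0 by (intro mult_right_mono) auto
    finally show ?thesis .
  next
    case False
    then have "x \<ge> 2/5" using rp M by (simp add: x_def field_simps)
    then have "(1/5)\<^sup>2 \<le> (3*x - 1)\<^sup>2" by (intro power_mono) auto
    moreover have "(3*x - 1)\<^sup>2 = c" unfolding c_def by (rule power2_commute)
    moreover have "(1/5)\<^sup>2 = (1/25 :: real)" by (simp add: power_divide)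
    ultimately have "1/25 \<le> c" by linarith
    from mult_right_mono[OF this nn(5)] have w2: "w\<^sup>2 \<le> 2500000 * S" using Sp(3) by linarith
    have L2: "L\<^sup>2 \<le> 410000000 * S"
    proof (cases "r < 9*M/4")
      case True
      then have "r / M < 9/4" using M by (simp add: field_simps)
      then have "1/4 \<le> \<tau>" unfolding \<tau>_def by (intro max.coboundedI2) linarith
      from mult_right_mono[OF this, of "L\<^sup>2"] show ?thesis using Sp(4) S0 by simp
    next
      case False
      then have h9: "h \<ge> 1/9" using rp M by (simp add: h_def lapse_def field_simps)
      have "(1/9)\<^sup>2 \<le> h\<^sup>2" using h9 by (intro power_mono) auto
      then have "(1/9)\<^sup>2 * L\<^sup>2 \<le> (h * L)\<^sup>2" unfolding power_mult_distrib by (intro mult_right_mono) auto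
      also have "h * L = p + - w" by (simp add: p_def w)
      also have "(p + - w)\<^sup>2 \<le> 2 * p\<^sup>2 + 2 * (- w)\<^sup>2" by (rule sq_sum_le)
      finally have "L\<^sup>2 \<le> 81 * (2 * p\<^sup>2 + 2 * w\<^sup>2)" by (simp add: power_divide)
      moreover have "81 * (2 * p\<^sup>2 + 2 * w\<^sup>2) \<le> 81 * (2 * (100 * S) + 2 * (2500000 * S))" using Sp(1) w2 by (intro mult_left_mono add_mono) auto
      moreover have "81 * (2 * (100 * S) + 2 * (2500000 * S)) \<le> 410000000 * S" using S0 by simp
      ultimately show ?thesis by (meson order_trans)
    qed
    have "ur\<^sup>2 \<le> 2 * L\<^sup>2 + 2 * (m * w)\<^sup>2" unfolding ur_def by (rule sq_sum_le)
    also have "(m * w)\<^sup>2 \<le> m1\<^sup>2 * w\<^sup>2" unfolding power_mult_distrib using m by (intro mult_right_mono power_mono) auto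
    also have "m1\<^sup>2 * w\<^sup>2 \<le> m1\<^sup>2 * (2500000 * S)" using w2 by (intro mult_left_mono) auto
    finally have "ur\<^sup>2 \<le> 820000000 * S + 5000000 * (m1\<^sup>2 * S)" using L2 by simp
    moreover have "0 \<le> m1\<^sup>2 * S" using S0 by simp
    moreover have "(10^9 + 10^8 * m1\<^sup>2) * S = 1000000000 * S + 100000000 * (m1\<^sup>2 * S)" by (simp add: algebra_simps)
    ultimately show ?thesis using S0 by linarith
  qed
  define k where "k = min (1/4) (M / (2 * 10^9 * (1 + m1\<^sup>2)))"
  have pos: "2 * 10^9 * (1 + m1\<^sup>2) > 0" by (simp add: add_pos_nonneg)
  have k0: "0 \<le> k" using M pos by (simp add: k_def)
  have k1: "k \<le> 1/4" unfolding k_def by (rule min.cobounded1)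
  have "k \<le> M / (2 * 10^9 * (1 + m1\<^sup>2))" unfolding k_def by (rule min.cobounded2)
  then have k2: "k * (2 * 10^9 * (1 + m1\<^sup>2)) \<le> M" by (simp only: pos_le_divide_eq[OF pos])
  have "ur\<^sup>2 + c * w\<^sup>2 + z\<^sup>2 \<le> (2 * 10^9 * (1 + m1\<^sup>2)) * S"
  proof -
    have "0 \<le> m1\<^sup>2 * S" using S0 by simp
    moreover have "(10^9 + 10^8 * m1\<^sup>2) * S = 1000000000 * S + 100000000 * (m1\<^sup>2 * S)"
      "(2 * 10^9 * (1 + m1\<^sup>2)) * S = 2000000000 * S + 2000000000 * (m1\<^sup>2 * S)" by (simp_all add: algebra_simps)
    ultimately show ?thesis using ur Sp(2,3) S0 by linarith
  qed
  from mult_left_mono[OF this k0] have "k * (ur\<^sup>2 + c * w\<^sup>2 + z\<^sup>2) \<le> k * (2 * 10^9 * (1 + m1\<^sup>2)) * S"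
    by (simp only: mult.assoc)
  also have "\<dots> \<le> M * S" by (rule mult_right_mono[OF k2 S0])
  finally have f1: "k * (ur\<^sup>2 + c * w\<^sup>2 + z\<^sup>2) \<le> M * S" .
  have f2: "k * (c * (Q / r)) \<le> M * (x * c * (Q / M\<^sup>2) / 4)"
  proof -
    have "k * (c * (Q / r)) \<le> (1/4) * (c * (Q / r))"
      by (rule mult_right_mono[OF k1]) (use c0 Q rp in simp)
    moreover have "M * (x * c * (Q / M\<^sup>2) / 4) = (1/4) * (c * (Q / r))" using M rp by (simp add: x_def field_simps power2_eq_square)
    ultimately show ?thesis by linarith
  qed
  have "k * (ur\<^sup>2 + c * (w\<^sup>2 + Q / r) + z\<^sup>2) = k * (ur\<^sup>2 + c * w\<^sup>2 + z\<^sup>2) + k * (c * (Q / r))" by (simp add: algebra_simps)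
  moreover have "M * (S + x * c * (Q / M\<^sup>2) / 4) = M * S + M * (x * c * (Q / M\<^sup>2) / 4)" by (rule distrib_left)
  ultimately have "k * (ur\<^sup>2 + c * (w\<^sup>2 + Q / r) + z\<^sup>2) \<le> M * (S + x * c * (Q / M\<^sup>2) / 4)"
    using f1 f2 by linarith
  with bulk show ?thesis unfolding k_def c_def x_def z_def by linarith
qed

text \<open>Young's inequality for c X against r^2 f / c. With c = 1 - 3M/r the first factor is
  controlled by the degenerate bulk, the second is the integrand of the dual norm.\<close>

lemma source_split:
  fixes f r c X le :: real
  assumes c: "c \<noteq> 0" and X: "c\<^sup>2 * X\<^sup>2 \<le> K * le" and K: "K > 0" and k: "k > 0"
  shows "r\<^sup>2 * f * X \<le> k * le + K / (4 * k) * (inverse (c\<^sup>2) * r^2 * f\<^sup>2 * r^2)"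
proof -
  have "2 * (c * X) * (r\<^sup>2 * f / c) \<le> (2 * k / K) * (c * X)\<^sup>2 + (r\<^sup>2 * f / c)\<^sup>2 / (2 * k / K)"
    by (rule young) (use K k in simp)
  moreover have "(2 * k / K) * (c * X)\<^sup>2 \<le> 2 * k * le"
    using mult_left_mono[OF X, of "2 * k / K"] K k by (simp add: power_mult_distrib)
  moreover have "(r\<^sup>2 * f / c)\<^sup>2 / (2 * k / K) = 2 * (K / (4 * k) * (inverse (c\<^sup>2) * r^2 * f\<^sup>2 * r^2))"
    using K k c by (simp add: field_simps power2_eq_square)
  moreover have "2 * (c * X) * (r\<^sup>2 * f / c) = 2 * (r\<^sup>2 * f * X)" using c by simp
  ultimately show ?thesis by linarith
qed

lemma sq3_le: "(a + b + c)\<^sup>2 \<le> 3 * (a\<^sup>2 + b\<^sup>2 + c\<^sup>2)" for a b c :: real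
proof -
  have "0 \<le> (a - b)\<^sup>2 + (b - c)\<^sup>2 + (a - c)\<^sup>2" by simp
  then show ?thesis by (simp add: power2_eq_square algebra_simps)
qed

lemma frame_density:
  fixes r m P L Q U :: real
  assumes m: "0 \<le> m" "m \<le> m1" and h: "\<bar>lapse M r\<bar> \<le> h1" and Q: "Q \<ge> 0"
  defines "K \<equiv> 2 + (2 + h1\<^sup>2) * (1 + 2 * m1\<^sup>2)" and "N \<equiv> r\<^sup>2 * (P\<^sup>2 + L\<^sup>2) + Q"
  shows "N \<le> K * en_of M r m P L Q" "en_of M r m P L Q \<le> K * N" "K \<ge> 1"
proof -
  define w where "w = ut_of M r P L"
  define ur where "ur = ur_of M r m P L"
  have e: "L = ur - m * w" "P = w + lapse M r / 2 * L" by (simp_all add: ur_def w_def ur_of_def ut_of_def)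
  note f = frame_equiv[OF m h e, folded K_def]
  have K2: "0 \<le> (2 + h1\<^sup>2) * (1 + 2 * m1\<^sup>2)" by (intro mult_nonneg_nonneg add_nonneg_nonneg) auto
  then show K1: "K \<ge> 1" by (simp add: K_def)
  have Q1: "Q \<le> K * Q" using mult_right_mono[OF K1 Q] by simp
  have "r\<^sup>2 * (P\<^sup>2 + L\<^sup>2) \<le> r\<^sup>2 * (K * (ur\<^sup>2 + w\<^sup>2))" by (rule mult_left_mono[OF f(1)]) simp
  then show "N \<le> K * en_of M r m P L Q" using Q1
    by (simp add: N_def en_of_def ur_def[symmetric] w_def[symmetric] algebra_simps)
  have "r\<^sup>2 * (ur\<^sup>2 + w\<^sup>2) \<le> r\<^sup>2 * (K * (P\<^sup>2 + L\<^sup>2))" by (rule mult_left_mono[OF f(2)]) simp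
  then show "en_of M r m P L Q \<le> K * N" using Q1
    by (simp add: N_def en_of_def ur_def[symmetric] w_def[symmetric] algebra_simps)
qed

context exterior_constants
begin

text \<open>The slice and flux constants are combined by a minimum, the bulk constant comes from
  \<open>exterior_bulk_coercive\<close>, and the upper bounds combine \<open>dens_growth\<close>
  with the change of frame. What remains is the source term.\<close>

lemma exterior_ok:
  assumes r1: "2*M - M * d \<le> r1" "r1 < 2*M"
  shows "\<exists>\<kappa> k C2 G. ext_ok M r1 m0 m1 n0 n1 (exterior_coefs M \<Lambda>) \<kappa> C k C2 G"
proof -
  define \<kappa>1 where "\<kappa>1 = min n0 (min (m0 / (2 * m1\<^sup>2 + 2)) (n0 / 32000 / (2 * n1\<^sup>2 + 1)))"
  define \<kappa>2 where "\<kappa>2 = min (1/32000) (min (1 / (2 * m1\<^sup>2 + 2)) (- lapse M r1 / 32000 / (2 * n1\<^sup>2 + 1)))"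
  define \<kappa> where "\<kappa> = min \<kappa>1 \<kappa>2"
  define k where "k = min (1/4) (M / (2 * 10^9 * (1 + m1\<^sup>2)))"
  define Km where "Km = 3 * (9 + (3 * m1 + \<Lambda> + 2)\<^sup>2 + 4)"
  define C2 where "C2 = Km / (4 * (k/2))"
  define Kf where "Kf = 2 + (2 + 1\<^sup>2) * (1 + 2 * m1\<^sup>2)"
  define G0 where "G0 = 10 * (1 + 1) * (1 + m1) * (1 + m1 * 1) * (\<Lambda> + 10)"
  have m1p: "m1 > 0" using m0 m01 by simp
  have pos: "2 * m1\<^sup>2 + 2 > 0" "2 * n1\<^sup>2 + 1 > 0" "1 + m1\<^sup>2 > 0" by (simp_all add: add_nonneg_pos add_pos_nonneg)
  have r1p: "r1 > 0" using r1_lower[OF r1] M by simp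
  have lp: "- lapse M r1 > 0" using r1 r1p by (simp add: lapse_def field_simps)
  have kp: "0 < m0 / (2 * m1\<^sup>2 + 2)" "0 < n0 / 32000 / (2 * n1\<^sup>2 + 1)" "0 < 1 / (2 * m1\<^sup>2 + 2)"
    "0 < - lapse M r1 / 32000 / (2 * n1\<^sup>2 + 1)"
    by (rule divide_pos_pos; (intro divide_pos_pos pos m0 n0 lp)?; simp)+
  have \<kappa>: "\<kappa> > 0" unfolding \<kappa>_def \<kappa>1_def \<kappa>2_def min_less_iff_conj by (intro conjI kp n0) simp
  have k: "k > 0" unfolding k_def using M pos by simp
  have Km: "Km > 0" unfolding Km_def by (simp add: add_pos_nonneg add_nonneg_pos)
  have C2: "C2 > 0" unfolding C2_def using Km k by simp
  have Kf: "Kf \<ge> 1" unfolding Kf_def by simp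
  have G0: "G0 \<ge> 0" unfolding G0_def using m1p cpos by simp
  have "ext_ok M r1 m0 m1 n0 n1 (exterior_coefs M \<Lambda>) \<kappa> C k C2 (G0 * Kf)"
    unfolding ext_ok_def
  proof (intro conjI allI impI)
    show "0 < \<kappa>" "0 \<le> C" "0 < k" "0 < C2" "0 \<le> G0 * Kf" using \<kappa> cpos k C2 G0 Kf by auto
    fix r m P L Q U f :: real
    assume r: "r1 \<le> r" and mok: "m_ok M m0 m1 n0 n1 r m" and Q: "0 \<le> Q"
    note mm = mok[unfolded m_ok_def, THEN conjunct1] mok[unfolded m_ok_def, THEN conjunct2, THEN conjunct1]
    have nn: "n0 \<le> 1 - m * lapse M r / 2" "1 - m * lapse M r / 2 \<le> n1" and far: "r > 5*M/2 \<Longrightarrow> m = 1 / lapse M r"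
      using mok unfolding m_ok_def by auto
    have m00: "0 \<le> m" using mm m0 by simp
    define w where "w = ut_of M r P L"
    define ur where "ur = ur_of M r m P L"
    define x where "x = M/r"
    define h where "h = lapse M r"
    have ur: "ur = (1 - m * lapse M r / 2) * L + m * P" by (simp add: ur_def ur_of_def ut_of_def algebra_simps)
    have w: "w = P - lapse M r / 2 * L" by (simp add: w_def ut_of_def)
    have en0: "0 \<le> r\<^sup>2 * (ur\<^sup>2 + w\<^sup>2) + Q" using Q by simp
    have en: "en_of M r m P L Q = r\<^sup>2 * (ur\<^sup>2 + w\<^sup>2) + Q" by (simp add: en_of_def ur_def w_def)
    have le: "le_of M r m P L Q U = ur\<^sup>2 + (1 - 3*(M/r))\<^sup>2 * (w\<^sup>2 + Q / r) + (U / r)\<^sup>2" by (simp add: le_of_def ur_def w_def)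
    note s = exterior_setup[OF r1 r, folded h_def x_def]
    have r7: "r \<ge> 7*M/4" using r1_lower[OF r1] r by simp
    have "\<kappa> * (r\<^sup>2 * (ur\<^sup>2 + w\<^sup>2) + Q) \<le> \<kappa>1 * (r\<^sup>2 * (ur\<^sup>2 + w\<^sup>2) + Q)"
      by (rule mult_right_mono[OF _ en0]) (simp add: \<kappa>_def)
    then show "\<kappa> * en_of M r m P L Q + C * (4 * (r - r1)\<^sup>2 * (ur_of M r m P L)\<^sup>2 - U\<^sup>2) \<le> slice_dens (exterior_coefs M \<Lambda>) M m r P L Q U"
      using exterior_slice[OF r1 r mm nn Q, of L P U, folded ur w, folded \<kappa>1_def]
      unfolding en ur_def[symmetric] by linarith
    show "\<kappa> * (en_of M r m P L Q + U\<^sup>2) \<le> - flux_dens (exterior_coefs M \<Lambda>) M r P L Q U" if "r = r1"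
    proof -
      have "\<kappa> * (r\<^sup>2 * (ur\<^sup>2 + w\<^sup>2) + Q + U\<^sup>2) \<le> \<kappa>2 * (r\<^sup>2 * (ur\<^sup>2 + w\<^sup>2) + Q + U\<^sup>2)"
        by (rule mult_right_mono) (use en0 in \<open>auto simp: \<kappa>_def\<close>)
      also have "\<dots> \<le> - flux_dens (exterior_coefs M \<Lambda>) M r P L Q U"
        using exterior_flux(1)[OF r1 mm nn[unfolded that] Q, of L P U, folded \<kappa>2_def]
        unfolding ur w that by simp
      finally show ?thesis unfolding en .
    qed
    show bulk: "k * le_of M r m P L Q U \<le> bulk_dens (exterior_coefs M \<Lambda>) M r P L Q U"
      using exterior_bulk_coercive[OF M r7 m00 mm(2) far Q, of L P U \<Lambda>, folded k_def]
      unfolding le_of_def ur_of_def ut_of_def by simp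
    define F where "F = 1 - x - 6 * x\<^sup>2"
    define y where "y = redshift M r"
    have x0: "0 \<le> x" using s(2) by simp
    have F: "\<bar>F\<bar> \<le> 2" using poly_bounds(4,5)[OF x0 s(3)] by (simp add: F_def abs_le_iff)
    have y: "0 \<le> y" "y \<le> 1" using redshift_bounds[OF M r7] by (simp_all add: y_def)
    have h1: "\<bar>h\<bar> \<le> 1" by (rule s(4))
    have Fh: "\<bar>F * h\<bar> \<le> 2" using mult_mono[OF F h1] by (simp add: abs_mult)
    obtain ph where ph: "\<bar>ph\<bar> \<le> 2" "cq (exterior_coefs M \<Lambda>) r * r\<^sup>2 = r * h * ph"
      using exterior_q(1)[OF r1 r] by (auto simp: h_def)
    have hp: "\<bar>h * ph\<bar> \<le> 2" using mult_mono[OF h1 ph(1)] by (simp add: abs_mult)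
    have cBY: "cB (exterior_coefs M \<Lambda>) r = \<Lambda> + F" "cY (exterior_coefs M \<Lambda>) r = (\<Lambda> - F) * (h/2) + y/1000"
      "ca (exterior_coefs M \<Lambda>) r = x" "cb (exterior_coefs M \<Lambda>) r = h * x + y/4000"
      by (simp_all add: exterior_coefs_def F_def x_def h_def y_def)
    have x1: "\<bar>x\<bar> \<le> 1" using s(2,3) by simp
    have hx: "\<bar>h * x\<bar> \<le> 1" using mult_mono[OF h1 x1] by (simp add: abs_mult)
    have Lh: "\<bar>\<Lambda> * h\<bar> \<le> \<Lambda>" using mult_left_mono[OF h1, of \<Lambda>] cpos by (simp add: abs_mult)
    have "\<bar>slice_dens (exterior_coefs M \<Lambda>) M m r P L Q U\<bar> \<le> G0 * (r\<^sup>2 * (P\<^sup>2 + L\<^sup>2) + Q + U\<^sup>2) \<and>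
      \<bar>long_dens (exterior_coefs M \<Lambda>) r L Q U\<bar> \<le> G0 * (r\<^sup>2 * (P\<^sup>2 + L\<^sup>2) + Q + U\<^sup>2)"
    proof -
      have k1: "\<bar>cB (exterior_coefs M \<Lambda>) r\<bar> \<le> \<Lambda> + 10" using F cpos(3) unfolding cBY by linarith
      have "(\<Lambda> - F) * (h/2) = (\<Lambda> * h) / 2 - (F * h) / 2" by (simp only: times_divide_eq_right left_diff_distrib diff_divide_distrib)
      then have k2: "\<bar>cY (exterior_coefs M \<Lambda>) r\<bar> \<le> \<Lambda> + 10" using Lh Fh y cpos(3) unfolding cBY by linarith
      have "\<bar>r * (h * ph)\<bar> \<le> r * 2" unfolding abs_mult[of r] using s(1) hp by (simp add: mult_left_mono)
      also have "\<dots> \<le> (\<Lambda> + 10) * r" using s(1) cpos(3) by simp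
      finally have k3: "\<bar>cq (exterior_coefs M \<Lambda>) r * r\<^sup>2\<bar> \<le> (\<Lambda> + 10) * r" unfolding ph(2) by (simp only: mult.assoc)
      have k4: "\<bar>cq' (exterior_coefs M \<Lambda>) r * r\<^sup>2\<bar> \<le> \<Lambda> + 10" using exterior_q(2)[OF r1 r] cpos(3) by linarith
      have k5: "\<bar>ca (exterior_coefs M \<Lambda>) r\<bar> \<le> \<Lambda> + 10" using x1 cpos(3) unfolding cBY by linarith
      have k6: "\<bar>cb (exterior_coefs M \<Lambda>) r\<bar> \<le> \<Lambda> + 10" using hx y cpos(3) unfolding cBY by linarith
      show ?thesis unfolding G0_def
        by (intro conjI dens_growth(1,3)[OF s(1) m00 mm(2) h1[unfolded h_def] Q k1 k2 k3 k4 k5 k6])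
    qed
    moreover have "G0 * (r\<^sup>2 * (P\<^sup>2 + L\<^sup>2) + Q + U\<^sup>2) \<le> G0 * Kf * (en_of M r m P L Q + U\<^sup>2)"
    proof -
      have "r\<^sup>2 * (P\<^sup>2 + L\<^sup>2) + Q \<le> Kf * en_of M r m P L Q"
        using frame_density(1)[OF m00 mm(2) h1[unfolded h_def] Q] by (simp add: Kf_def)
      moreover have "1 * U\<^sup>2 \<le> Kf * U\<^sup>2" by (rule mult_right_mono[OF Kf]) simp
      moreover have "Kf * (en_of M r m P L Q + U\<^sup>2) = Kf * en_of M r m P L Q + Kf * U\<^sup>2" by (rule distrib_left)
      ultimately have "r\<^sup>2 * (P\<^sup>2 + L\<^sup>2) + Q + U\<^sup>2 \<le> Kf * (en_of M r m P L Q + U\<^sup>2)" by linarith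
      from mult_left_mono[OF this G0] show ?thesis by (simp add: mult.assoc)
    qed
    ultimately show "\<bar>slice_dens (exterior_coefs M \<Lambda>) M m r P L Q U\<bar> \<le> G0 * Kf * (en_of M r m P L Q + U\<^sup>2)"
      "\<bar>long_dens (exterior_coefs M \<Lambda>) r L Q U\<bar> \<le> G0 * Kf * (en_of M r m P L Q + U\<^sup>2)" by linarith+
    assume r3: "r \<noteq> 3*M"
    define c where "c = 1 - 3*(M/r)"
    define \<alpha> where "\<alpha> = y/1000 - F * h"
    define X where "X = mult_dens (exterior_coefs M \<Lambda>) r P L U"
    define g where "g = lapse M r / 2"
    have hg: "lapse M r = 2 * g" by (simp add: g_def)
    define y3 where "y3 = y / 1000"
    have yg: "y = 1000 * y3" by (simp add: y3_def)
    have "cq (exterior_coefs M \<Lambda>) r * U = (cq (exterior_coefs M \<Lambda>) r * r\<^sup>2) * U / r\<^sup>2" using s(1) by simp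
    also have "\<dots> = h * ph * (U / r)" unfolding ph(2) using s(1) by (simp add: power2_eq_square)
    \<comment> \<open>In the coordinate frame the coefficient of the time derivative contains
      \<Lambda> and does not vanish at r = 3M, so the square of the multiplier is dominated by the
      bulk only after multiplication by c^2.\<close>
    finally have X: "X = \<alpha> * ur + (- (\<alpha> * m + (\<Lambda> + F))) * w + (h * ph) * (U/r)"
      unfolding X_def mult_dens_def cBY by (simp add: \<alpha>_def ur w h_def hg yg algebra_simps)
    have \<alpha>3: "\<bar>\<alpha>\<bar> \<le> 3" using Fh y unfolding \<alpha>_def by linarith
    have "\<bar>\<alpha> * m\<bar> \<le> 3 * m1" unfolding abs_mult using \<alpha>3 m00 mm by (intro mult_mono) auto
    then have \<beta>: "\<bar>- (\<alpha> * m + (\<Lambda> + F))\<bar> \<le> 3 * m1 + \<Lambda> + 2" using F cpos(3) by linarith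
    have c1: "c\<^sup>2 \<le> 1" using poly_bounds(6)[OF x0 s(3)] by (simp add: c_def x_def)
    have sqb: "(g * z)\<^sup>2 \<le> b\<^sup>2 * z\<^sup>2" if "\<bar>g\<bar> \<le> b" for g z b :: real
      unfolding power_mult_distrib using that by (intro mult_right_mono) (auto simp: abs_le_square_iff[symmetric])
    define A1 where "A1 = ur\<^sup>2"
    define A2 where "A2 = w\<^sup>2"
    define A3 where "A3 = (U/r)\<^sup>2"
    have "X\<^sup>2 \<le> 3 * ((\<alpha> * ur)\<^sup>2 + ((- (\<alpha> * m + (\<Lambda> + F))) * w)\<^sup>2 + ((h * ph) * (U/r))\<^sup>2)" unfolding X by (rule sq3_le)
    also have "\<dots> \<le> 3 * (3\<^sup>2 * A1 + (3 * m1 + \<Lambda> + 2)\<^sup>2 * A2 + 2\<^sup>2 * A3)"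
      unfolding A1_def A2_def A3_def by (intro mult_left_mono add_mono sqb \<alpha>3 \<beta> hp) simp
    finally have X2: "X\<^sup>2 \<le> 3 * (9 * A1 + (3 * m1 + \<Lambda> + 2)\<^sup>2 * A2 + 4 * A3)" by simp
    have A0: "0 \<le> A1" "0 \<le> A2" "0 \<le> A3" "0 \<le> c\<^sup>2" by (simp_all add: A1_def A2_def A3_def)
    define b2 where "b2 = (3 * m1 + \<Lambda> + 2)\<^sup>2"
    have b2: "0 \<le> b2" by (simp add: b2_def)
    have "c\<^sup>2 * X\<^sup>2 \<le> c\<^sup>2 * (3 * (9 * A1 + b2 * A2 + 4 * A3))" using X2 by (intro mult_left_mono) (auto simp: b2_def)
    also have "\<dots> = 27 * (c\<^sup>2 * A1) + 3 * (b2 * (c\<^sup>2 * A2)) + 12 * (c\<^sup>2 * A3)" by (simp add: algebra_simps)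
    also have "\<dots> \<le> 27 * A1 + 3 * (b2 * (c\<^sup>2 * A2)) + 12 * A3"
      using mult_right_mono[OF c1 A0(1)] mult_right_mono[OF c1 A0(3)] by linarith
    also have "\<dots> \<le> Km * (A1 + c\<^sup>2 * A2 + A3)"
    proof -
      have "0 \<le> b2 * A1" "0 \<le> b2 * A3" "0 \<le> c\<^sup>2 * A2" using b2 A0 by auto
      then show ?thesis using A0 unfolding Km_def b2_def[symmetric] by (simp add: algebra_simps)
    qed
    also have "\<dots> \<le> Km * le_of M r m P L Q U"
    proof (rule mult_left_mono)
      have "0 \<le> c\<^sup>2 * (Q / r)" using Q s(1) by simp
      then show "A1 + c\<^sup>2 * A2 + A3 \<le> le_of M r m P L Q U" unfolding le A1_def A2_def A3_def c_def[symmetric] by (simp add: distrib_left)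
    qed (use Km in simp)
    finally have cX: "c\<^sup>2 * X\<^sup>2 \<le> Km * le_of M r m P L Q U" .
    have c0: "c \<noteq> 0" using r3 s(1) by (simp add: c_def field_simps)
    have "r\<^sup>2 * f * X \<le> k/2 * le_of M r m P L Q U + Km / (4 * (k/2)) * (inverse (c\<^sup>2) * r^2 * f\<^sup>2 * r^2)"
      by (rule source_split[OF c0 cX Km]) (use k in simp)
    then show "r\<^sup>2 * f * mult_dens (exterior_coefs M \<Lambda>) r P L U \<le> k/2 * le_of M r m P L Q U + C2 * (inverse ((1 - 3*M/r)\<^sup>2) * r\<^sup>2 * r\<^sup>2 * f\<^sup>2)"
      by (simp add: X_def C2_def c_def mult_ac)
  qed
  then show ?thesis by blast
qed

end

text \<open>The multiplier is exp(lam r) (L - P). Inside the horizon -r is a time function, and the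
  r-derivative of the weight yields lam times a positive definite density. \<open>cb\<close> adds
  the square of the solution with the same weight.\<close>

definition interior_coefs :: "real \<Rightarrow> coefs" where
  "interior_coefs lam = \<lparr>cB = \<lambda>r. exp (lam * r), cB' = \<lambda>r. lam * exp (lam * r), cY = \<lambda>r. exp (lam * r), cY' = \<lambda>r. lam * exp (lam * r),
     cq = \<lambda>_. 0, cq' = \<lambda>_. 0, cq'' = \<lambda>_. 0, ca = \<lambda>_. 0, cb = \<lambda>r. exp (lam * r), cb' = \<lambda>r. lam * exp (lam * r)\<rparr>"

lemma interior_coefs_on: "coefs_on r1 (interior_coefs lam)"
proof -
  have "((\<lambda>r. exp (lam * r)) has_real_derivative lam * exp (lam * r)) (at r)" for r
    by (auto intro!: derivative_eq_intros)
  moreover have "continuous_on {r1..} (\<lambda>r. lam * exp (lam * r))" by (intro continuous_intros)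
  ultimately show ?thesis unfolding coefs_on_def interior_coefs_def by simp
qed

text \<open>For h \<le> - \<eta> < 0 the bulk is lam times a definite form in P, L, Q and U plus
  terms free of lam, which a large lam absorbs. The constants may depend on \<open>r0\<close> and
  \<open>b\<close> through the exponential bounds \<open>E0\<close> and \<open>E1\<close>. The dual
  weight causes no trouble because r < 2M stays away from 3M.\<close>

lemma interior_ok:
  assumes M: "M > 0" and r0: "r0 > 0" and b: "r0 \<le> b" "b < 2*M" and m0: "m0 > 0" "m0 \<le> m1" and n0: "n0 > 0"
  shows "\<exists>lam \<kappa> k C2 G. int_ok M r0 b m0 m1 n0 n1 (interior_coefs lam) \<kappa> k C2 G"
proof -
  define h1 where "h1 = 1 + 2*M/r0"
  define \<eta> where "\<eta> = - lapse M b"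
  define i2 where "i2 = 1 / r0\<^sup>2"
  \<comment> \<open>2 + h1 covers the cross terms in the P^2 part, the term over \<eta> the L^2
    part, whose coefficient is only lam \<eta> / 2, and the last one the angular part, which loses M
    / (2 r^2).\<close>
  define lam where "lam = 2 + h1 + 2 * (1 + (h1 + 2) * i2) / \<eta> + 2 * (1 + M * i2)"
  define E0 where "E0 = exp (lam * r0)"
  define E1 where "E1 = exp (lam * b)"
  define Kf where "Kf = 2 + (2 + h1\<^sup>2) * (1 + 2 * m1\<^sup>2)"
  define k where "k = E0 / Kf"
  define mn where "mn = min (min m0 n0) (min (\<eta>/2) (1/2))"
  define \<kappa> where "\<kappa> = E0 * mn / Kf"
  define \<delta> where "\<delta> = k / (4 * Kf)"
  define C2 where "C2 = E1\<^sup>2 * (9 * M\<^sup>2 * i2 * i2) / (4 * \<delta>)"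
  define G0 where "G0 = 10 * (1 + h1) * (1 + m1) * (1 + m1 * h1) * E1"
  have bp: "b > 0" using r0 b by simp
  have \<eta>: "\<eta> > 0" using b bp by (simp add: \<eta>_def lapse_def field_simps)
  have i2: "i2 > 0" using r0 by (simp add: i2_def)
  have h1: "h1 \<ge> 1" using M r0 by (simp add: h1_def)
  have m1: "m1 > 0" using m0 by simp
  have l1: "0 \<le> 2 * (1 + (h1 + 2) * i2) / \<eta>" "0 \<le> M * i2" using h1 i2 \<eta> M by auto
  define tA where "tA = 2 * (1 + (h1 + 2) * i2) / \<eta>"
  define tB where "tB = M * i2"
  have lam_eq: "lam = 4 + h1 + tA + 2 * tB" by (simp add: lam_def tA_def tB_def)
  have l1': "0 \<le> tA" "0 \<le> tB" using l1 by (simp_all add: tA_def tB_def)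
  have lam0: "lam > 0" using l1' h1 unfolding lam_eq by linarith
  have E: "E0 > 0" "E1 > 0" by (simp_all add: E0_def E1_def)
  have K2: "0 \<le> (2 + h1\<^sup>2) * (1 + 2 * m1\<^sup>2)" by (intro mult_nonneg_nonneg add_nonneg_nonneg) auto
  then have Kf: "Kf \<ge> 1" by (simp add: Kf_def)
  have Kfp: "Kf \<noteq> 0" "Kf > 0" using Kf by auto
  have k: "k > 0" using E Kf by (simp add: k_def)
  have mn: "mn > 0" "mn \<le> m0" "mn \<le> n0" "mn \<le> \<eta>/2" "mn \<le> 1/2" using m0 n0 \<eta> by (auto simp: mn_def)
  have \<kappa>: "\<kappa> > 0" using E mn Kf by (simp add: \<kappa>_def)
  have \<delta>: "\<delta> > 0" using k Kf by (simp add: \<delta>_def)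
  have C2: "C2 > 0" using E M i2 \<delta> by (simp add: C2_def)
  have G0: "G0 \<ge> 0" using h1 m1 E by (simp add: G0_def)
  let ?K = "interior_coefs lam"
  have "int_ok M r0 b m0 m1 n0 n1 ?K \<kappa> k C2 (G0 * Kf)"
    unfolding int_ok_def
  proof (intro conjI allI impI)
    show "0 < \<kappa>" "0 < k" "0 < C2" "0 \<le> G0 * Kf" using \<kappa> k C2 G0 Kf by auto
    fix r m P L Q U f :: real
    assume r: "r0 \<le> r" "r \<le> b" and mok: "m_ok M m0 m1 n0 n1 r m" and Q: "0 \<le> Q"
    have rp: "r > 0" using r r0 by simp
    define h where "h = lapse M r"
    define n where "n = 1 - m * h / 2"
    have mm: "m0 \<le> m" "m \<le> m1" "n0 \<le> n" using mok unfolding m_ok_def n_def h_def by auto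
    have m00: "0 \<le> m" using mm m0 by simp
    have h\<eta>: "- h \<ge> \<eta>" using r rp bp M by (simp add: h_def \<eta>_def lapse_def field_simps)
    have hh: "\<bar>h\<bar> \<le> h1"
    proof -
      have "2*M/r \<le> 2*M/r0" using r r0 M by (intro divide_left_mono) auto
      moreover have "0 \<le> 2*M/r" using M rp by simp
      ultimately show ?thesis unfolding h_def lapse_def h1_def by linarith
    qed
    define e where "e = exp (lam * r)"
    have e: "E0 \<le> e" "e \<le> E1" "e > 0" using r lam0 by (simp_all add: e_def E0_def E1_def)
    define pp where "pp = r\<^sup>2 * P\<^sup>2"
    define ll where "ll = r\<^sup>2 * L\<^sup>2"
    have pl: "0 \<le> pp" "0 \<le> ll" "0 \<le> U\<^sup>2" by (simp_all add: pp_def ll_def)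
    define N where "N = pp + ll + Q"
    have N0: "N \<ge> 0" using pl Q by (simp add: N_def)
    have Neq: "N = r\<^sup>2 * (P\<^sup>2 + L\<^sup>2) + Q" by (simp add: N_def pp_def ll_def algebra_simps)
    note fd = frame_density(1,2)[OF m00 mm(2) hh[unfolded h_def] Q, of P L, folded Kf_def Neq]
    have en0: "0 \<le> en_of M r m P L Q" using Q by (simp add: en_of_def)
    have \<kappa>en: "\<kappa> * en_of M r m P L Q \<le> e * (mn * N)"
    proof -
      have "\<kappa> * en_of M r m P L Q \<le> \<kappa> * (Kf * N)" using fd(2) \<kappa> by (intro mult_left_mono) auto
      also have "\<dots> = E0 * (mn * N)" using Kfp by (simp add: \<kappa>_def)
      also have "\<dots> \<le> e * (mn * N)" using e mn N0 by (intro mult_right_mono) auto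
      finally show ?thesis .
    qed
    have sl: "slice_dens ?K M m r P L Q U = e * (m * pp + n * ll + (n + m) / 2 * Q + m * U\<^sup>2)"
      unfolding slice_dens_def Let_def interior_coefs_def coefs.select_convs h_def[symmetric] n_def[symmetric] e_def[symmetric] pp_def ll_def
      by (simp add: field_simps)
    have "mn * N \<le> m * pp + n * ll + (n + m) / 2 * Q + m * U\<^sup>2"
    proof -
      have "mn * Q \<le> (n + m) / 2 * Q" by (rule mult_right_mono[OF _ Q]) (use mn mm in simp)
      moreover have "mn * pp \<le> m * pp" "mn * ll \<le> n * ll" by (rule mult_right_mono; use mn mm pl in simp)+
      moreover have "0 \<le> m * U\<^sup>2" using m00 by simp
      ultimately have "mn * pp + mn * ll + mn * Q + 0 \<le> m * pp + n * ll + (n + m) / 2 * Q + m * U\<^sup>2" by (intro add_mono)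
      moreover have "mn * N = mn * pp + mn * ll + mn * Q + 0" by (simp add: N_def distrib_left)
      ultimately show ?thesis by simp
    qed
    then show "\<kappa> * en_of M r m P L Q \<le> slice_dens ?K M m r P L Q U"
      unfolding sl by (rule order_trans[OF \<kappa>en mult_left_mono[OF _ less_imp_le[OF e(3)]]])
    have fl: "- flux_dens ?K M r P L Q U = e * (pp + (- h) / 2 * ll + (1 - h/2) / 2 * Q + U\<^sup>2)"
      unfolding flux_dens_def Let_def interior_coefs_def coefs.select_convs h_def[symmetric] e_def[symmetric] pp_def ll_def
      by (simp add: field_simps)
    have "mn * N \<le> pp + (- h) / 2 * ll + (1 - h/2) / 2 * Q + U\<^sup>2"
    proof -
      have "mn * Q \<le> (1 - h/2) / 2 * Q" by (rule mult_right_mono[OF _ Q]) (use mn h\<eta> \<eta> in simp)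
      moreover have "mn * pp \<le> 1 * pp" by (rule mult_right_mono) (use mn pl in simp_all)
      moreover have "mn * ll \<le> (- h) / 2 * ll" by (rule mult_right_mono) (use mn h\<eta> pl in simp_all)
      ultimately have "mn * pp + mn * ll + mn * Q + 0 \<le> 1 * pp + (- h) / 2 * ll + (1 - h/2) / 2 * Q + U\<^sup>2" using pl(3) by (intro add_mono)
      moreover have "mn * N = mn * pp + mn * ll + mn * Q + 0" by (simp add: N_def distrib_left)
      ultimately show ?thesis by simp
    qed
    then show "\<kappa> * en_of M r m P L Q \<le> - flux_dens ?K M r P L Q U"
      unfolding fl by (rule order_trans[OF \<kappa>en mult_left_mono[OF _ less_imp_le[OF e(3)]]])
    define md where "md = M / r\<^sup>2"
    have md2: "2*M/r\<^sup>2 = 2 * md" by (simp add: md_def)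
    have bu: "bulk_dens ?K M r P L Q U = e * (lam * pp + M * L\<^sup>2 + lam * ((- h) / 2) * ll + 2 * (1 - h/2) * (r * P * L)
        + (lam * ((1 - h/2) / 2) - md / 2) * Q + lam * U\<^sup>2 + 2 * (U * L))"
      unfolding bulk_dens_def Let_def interior_coefs_def coefs.select_convs h_def[symmetric] e_def[symmetric] pp_def ll_def md2
      by (simp add: field_simps)
    have r2: "L\<^sup>2 \<le> i2 * ll" "md \<le> M * i2"
    proof -
      have r02: "r0\<^sup>2 \<le> r\<^sup>2" using r r0 by (intro power_mono) auto
      then have "1 \<le> i2 * r\<^sup>2" using r0 by (simp add: i2_def)
      from mult_right_mono[OF this, of "L\<^sup>2"] show "L\<^sup>2 \<le> i2 * ll" by (simp add: ll_def mult.assoc)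
      show "md \<le> M * i2" unfolding i2_def md_def using r02 M r0 by (simp add: frac_le)
    qed
    have hb: "h \<le> h1" "- h \<le> h1" using hh by (auto simp: abs_le_iff)
    have hn: "\<bar>1 - h/2\<bar> \<le> h1 + 1" by (rule abs_leI) (use hb h1 in simp_all)
    have q1: "- (2 * (1 - h/2) * (r * P * L)) \<le> (h1 + 1) * (pp + L\<^sup>2)"
    proof -
      have "\<bar>2 * (1 - h/2) * (r * P * L)\<bar> = \<bar>1 - h/2\<bar> * (2 * \<bar>(r * P) * L\<bar>)" by (simp only: abs_mult abs_numeral mult_ac)
      also have "\<dots> \<le> (h1 + 1) * ((r * P)\<^sup>2 + L\<^sup>2)" by (rule mult_mono[OF hn abs_two_mult_le]) (use h1 in auto)
      finally have "- (2 * (1 - h/2) * (r * P * L)) \<le> (h1 + 1) * ((r * P)\<^sup>2 + L\<^sup>2)" by (rule abs_le_D2)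
      then show ?thesis by (simp only: pp_def power_mult_distrib)
    qed
    have q2: "- (2 * (U * L)) \<le> U\<^sup>2 + L\<^sup>2" using abs_two_mult_le[of U L] abs_ge_minus_self[of "U * L"] by linarith
    have lam: "h1 + 1 + 1 \<le> lam" using l1' h1 unfolding lam_eq by linarith
    have lam2: "1 + (h1 + 2) * i2 \<le> lam * ((- h) / 2)"
    proof -
      have lamA: "tA \<le> lam" using l1' h1 unfolding lam_eq by linarith
      have "1 + (h1 + 2) * i2 = tA * (\<eta> / 2)" using \<eta> by (simp add: tA_def field_simps)
      also have "\<dots> \<le> lam * (\<eta> / 2)" by (rule mult_right_mono) (use lamA \<eta> in auto)
      also have "\<dots> \<le> lam * ((- h) / 2)" by (rule mult_left_mono) (use h\<eta> lam0 in auto)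
      finally show ?thesis .
    qed
    have lam3: "1 \<le> lam * ((1 - h/2) / 2) - md / 2"
    proof -
      define t where "t = lam * ((1 - h/2) / 2)"
      have "lam * (1/2) \<le> t" unfolding t_def by (rule mult_left_mono) (use h\<eta> \<eta> lam0 in auto)
      then have "lam \<le> 2 * t" by simp
      moreover have "2 + 2 * tB \<le> lam" using l1' h1 unfolding lam_eq by linarith
      moreover have "md \<le> tB" using r2(2) by (simp add: tB_def)
      ultimately show ?thesis using l1'(2) unfolding t_def[symmetric] by linarith
    qed
    have core: "N + U\<^sup>2 \<le> lam * pp + M * L\<^sup>2 + lam * ((- h) / 2) * ll + 2 * (1 - h/2) * (r * P * L)
        + (lam * ((1 - h/2) / 2) - md / 2) * Q + lam * U\<^sup>2 + 2 * (U * L)"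
    proof -
      define s1 where "s1 = (h1 + 1) * pp"
      define s2 where "s2 = (h1 + 1) * L\<^sup>2"
      define s3 where "s3 = (h1 + 2) * (i2 * ll)"
      define t1 where "t1 = lam * pp"
      define t2 where "t2 = lam * ((- h) / 2) * ll"
      define t3 where "t3 = 2 * (1 - h/2) * (r * P * L)"
      define t4 where "t4 = (lam * ((1 - h/2) / 2) - md / 2) * Q"
      define t5 where "t5 = lam * U\<^sup>2"
      define t6 where "t6 = M * L\<^sup>2"
      have "(h1 + 1 + 1) * pp \<le> t1" unfolding t1_def using lam pl by (intro mult_right_mono)
      moreover have "(h1 + 1 + 1) * pp = s1 + pp" by (simp add: s1_def algebra_simps)
      ultimately have a1: "s1 + pp \<le> t1" by simp
      have "(1 + (h1 + 2) * i2) * ll \<le> t2" unfolding t2_def using lam2 pl by (intro mult_right_mono)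
      moreover have "(1 + (h1 + 2) * i2) * ll = ll + s3" by (simp add: s3_def algebra_simps)
      ultimately have a2: "ll + s3 \<le> t2" by simp
      have "1 * Q \<le> t4" unfolding t4_def using lam3 Q by (intro mult_right_mono)
      then have a3: "Q \<le> t4" by simp
      have "2 \<le> lam" using lam h1 by linarith
      then have a4: "2 * U\<^sup>2 \<le> t5" unfolding t5_def by (intro mult_right_mono) auto
      have "(h1 + 2) * L\<^sup>2 \<le> s3" unfolding s3_def using r2(1) h1 by (intro mult_left_mono) auto
      moreover have "(h1 + 2) * L\<^sup>2 = s2 + L\<^sup>2" by (simp add: s2_def algebra_simps)
      ultimately have a5: "s2 + L\<^sup>2 \<le> s3" by simp
      have a6: "0 \<le> t6" using M by (simp add: t6_def)
      have "- t3 \<le> (h1 + 1) * (pp + L\<^sup>2)" unfolding t3_def by (rule q1)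
      moreover have "(h1 + 1) * (pp + L\<^sup>2) = s1 + s2" unfolding s1_def s2_def by (rule distrib_left)
      ultimately have a7: "- t3 \<le> s1 + s2" by simp
      show ?thesis unfolding N_def t1_def[symmetric] t2_def[symmetric] t3_def[symmetric] t4_def[symmetric] t5_def[symmetric] t6_def[symmetric]
        using a1 a2 a3 a4 a5 a6 a7 q2 by linarith
    qed
    have kw: "k * (en_of M r m P L Q + U\<^sup>2) \<le> e * (N + U\<^sup>2)"
    proof -
      have "1 * U\<^sup>2 \<le> Kf * U\<^sup>2" by (rule mult_right_mono[OF Kf pl(3)])
      moreover have "Kf * (N + U\<^sup>2) = Kf * N + Kf * U\<^sup>2" by (rule distrib_left)
      ultimately have "en_of M r m P L Q + U\<^sup>2 \<le> Kf * (N + U\<^sup>2)" using fd(2) by linarith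
      then have "k * (en_of M r m P L Q + U\<^sup>2) \<le> k * (Kf * (N + U\<^sup>2))" using k by (intro mult_left_mono) auto
      also have "\<dots> = E0 * (N + U\<^sup>2)" using Kfp by (simp add: k_def)
      also have "\<dots> \<le> e * (N + U\<^sup>2)" using e N0 pl by (intro mult_right_mono) auto
      finally show ?thesis .
    qed
    show "k * (en_of M r m P L Q + U\<^sup>2) \<le> bulk_dens ?K M r P L Q U"
      unfolding bu by (rule order_trans[OF kw mult_left_mono[OF core less_imp_le[OF e(3)]]])
    have NK: "N + U\<^sup>2 \<le> Kf * (en_of M r m P L Q + U\<^sup>2)"
    proof -
      have "1 * U\<^sup>2 \<le> Kf * U\<^sup>2" by (rule mult_right_mono[OF Kf pl(3)])
      moreover have "Kf * (en_of M r m P L Q + U\<^sup>2) = Kf * en_of M r m P L Q + Kf * U\<^sup>2" by (rule distrib_left)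
      ultimately show ?thesis using fd(1) by linarith
    qed
    have ks: "\<bar>cB ?K r\<bar> \<le> E1" "\<bar>cY ?K r\<bar> \<le> E1" "\<bar>cq ?K r * r\<^sup>2\<bar> \<le> E1 * r" "\<bar>cq' ?K r * r\<^sup>2\<bar> \<le> E1" "\<bar>ca ?K r\<bar> \<le> E1" "\<bar>cb ?K r\<bar> \<le> E1"
      using e E rp by (simp_all add: interior_coefs_def e_def[symmetric])
    note dg = dens_growth(1,2)[OF rp m00 mm(2) hh[unfolded h_def] Q ks, where P = P and L = L and U = U, folded G0_def, folded Neq]
    have GN: "G0 * (N + U\<^sup>2) \<le> G0 * Kf * (en_of M r m P L Q + U\<^sup>2)" using mult_left_mono[OF NK G0] by (simp add: mult.assoc)
    show "\<bar>slice_dens ?K M m r P L Q U\<bar> \<le> G0 * Kf * (en_of M r m P L Q + U\<^sup>2)"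
      "\<bar>flux_dens ?K M r P L Q U\<bar> \<le> G0 * Kf * (en_of M r m P L Q + U\<^sup>2)" using dg(1,2) GN by linarith+
    define g where "g = r\<^sup>2 * f\<^sup>2"
    have yg: "2 * (r * (L - P)) * (r * e * f) \<le> (2 * \<delta>) * (r * (L - P))\<^sup>2 + (r * e * f)\<^sup>2 / (2 * \<delta>)" by (rule young) (use \<delta> in simp)
    have mu: "mult_dens ?K r P L U = e * (L - P)" by (simp add: mult_dens_def interior_coefs_def e_def[symmetric] algebra_simps)
    have e1: "2 * (r * (L - P)) * (r * e * f) = 2 * (r\<^sup>2 * f * (e * (L - P)))" by (simp add: power2_eq_square algebra_simps)
    define B where "B = e\<^sup>2 * g / (4 * \<delta>)"
    have e2: "(r * e * f)\<^sup>2 / (2 * \<delta>) = 2 * B" by (simp add: B_def g_def power_mult_distrib)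
    have e3: "(2 * \<delta>) * (r * (L - P))\<^sup>2 = 2 * (\<delta> * (r * (L - P))\<^sup>2)" by simp
    have "r\<^sup>2 * f * mult_dens ?K r P L U \<le> \<delta> * (r * (L - P))\<^sup>2 + e\<^sup>2 * g / (4 * \<delta>)"
      using yg[unfolded e1 e2 e3] unfolding mu B_def[symmetric] by linarith
    also have "\<delta> * (r * (L - P))\<^sup>2 \<le> k/2 * (en_of M r m P L Q + U\<^sup>2)"
    proof -
      have plK: "pp + ll \<le> Kf * (en_of M r m P L Q + U\<^sup>2)" using NK[unfolded N_def] Q pl by linarith
      have "(r * (L - P))\<^sup>2 \<le> r\<^sup>2 * (2 * L\<^sup>2 + 2 * P\<^sup>2)" unfolding power_mult_distrib using sq_sum_le[of L "- P"] by (intro mult_left_mono) auto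
      also have "\<dots> = 2 * (pp + ll)" by (simp add: pp_def ll_def algebra_simps)
      also have "\<dots> \<le> 2 * (Kf * (en_of M r m P L Q + U\<^sup>2))" by (intro mult_left_mono plK) simp
      finally have "\<delta> * (r * (L - P))\<^sup>2 \<le> \<delta> * (2 * (Kf * (en_of M r m P L Q + U\<^sup>2)))" using \<delta> by (intro mult_left_mono) auto
      also have "\<dots> = k/2 * (en_of M r m P L Q + U\<^sup>2)" using Kfp by (simp add: \<delta>_def)
      finally show ?thesis .
    qed
    also have "e\<^sup>2 * g / (4 * \<delta>) \<le> C2 * (inverse ((1 - 3*M/r)\<^sup>2) * r\<^sup>2 * r\<^sup>2 * f\<^sup>2)"
    proof -
      define c where "c = 1 - 3*M/r"
      have c0: "c < 0" using r b rp M by (simp add: c_def field_simps)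
      have cr: "(c * r)\<^sup>2 \<le> (3*M)\<^sup>2"
      proof -
        have "c * r = r - 3*M" using rp by (simp add: c_def field_simps)
        moreover have "\<bar>r - 3*M\<bar> \<le> 3*M" by (rule abs_leI) (use r b rp M in linarith)+
        ultimately have "\<bar>c * r\<bar> \<le> \<bar>3*M\<bar>" using M by simp
        then show ?thesis by (simp only: abs_le_square_iff)
      qed
      have i2r: "1 \<le> i2 * r\<^sup>2" using power_mono[of r0 r 2] r r0 by (simp add: i2_def)
      have "c\<^sup>2 \<le> c\<^sup>2 * (i2 * r\<^sup>2)" using mult_left_mono[OF i2r, of "c\<^sup>2"] by simp
      also have "\<dots> = i2 * (c * r)\<^sup>2" by (simp add: power_mult_distrib)
      also have "\<dots> \<le> i2 * (9 * M\<^sup>2)" using cr i2 by (intro mult_left_mono) (auto simp: power_mult_distrib)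
      finally have "c\<^sup>2 \<le> i2 * (9 * M\<^sup>2)" .
      moreover have cp: "0 < c\<^sup>2" using c0 by simp
      ultimately have "1 \<le> (9 * M\<^sup>2 * i2) * inverse (c\<^sup>2)" unfolding inverse_eq_divide by (simp add: pos_le_divide_eq mult_ac)
      then have "1 * 1 \<le> (9 * M\<^sup>2 * i2) * inverse (c\<^sup>2) * (i2 * r\<^sup>2)" using i2r i2 by (intro mult_mono) auto
      then have "1 * g \<le> (9 * M\<^sup>2 * i2) * inverse (c\<^sup>2) * (i2 * r\<^sup>2) * g" by (intro mult_right_mono) (auto simp: g_def)
      moreover have "(9 * M\<^sup>2 * i2) * inverse (c\<^sup>2) * (i2 * r\<^sup>2) * g = (9 * M\<^sup>2 * i2 * i2) * (inverse (c\<^sup>2) * r\<^sup>2 * r\<^sup>2 * f\<^sup>2)"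
        by (simp add: g_def mult_ac)
      ultimately have gg: "g \<le> (9 * M\<^sup>2 * i2 * i2) * (inverse (c\<^sup>2) * r\<^sup>2 * r\<^sup>2 * f\<^sup>2)" by simp
      have "e\<^sup>2 * g \<le> E1\<^sup>2 * ((9 * M\<^sup>2 * i2 * i2) * (inverse (c\<^sup>2) * r\<^sup>2 * r\<^sup>2 * f\<^sup>2))"
        by (rule mult_mono[OF power_mono gg]) (use e in \<open>auto simp: g_def\<close>)
      then have "e\<^sup>2 * g / (4 * \<delta>) \<le> E1\<^sup>2 * ((9 * M\<^sup>2 * i2 * i2) * (inverse (c\<^sup>2) * r\<^sup>2 * r\<^sup>2 * f\<^sup>2)) / (4 * \<delta>)"
        using \<delta> by (intro divide_right_mono) auto
      then show ?thesis by (simp add: C2_def c_def mult.assoc)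
    qed
    finally show "r\<^sup>2 * f * mult_dens ?K r P L U \<le> k/2 * (en_of M r m P L Q + U\<^sup>2) + C2 * (inverse ((1 - 3*M/r)\<^sup>2) * r\<^sup>2 * r\<^sup>2 * f\<^sup>2)"
      by simp
  qed
  then show ?thesis by blast
qed

section \<open>The energy norms\<close>

lemma nn_integral_cbox:
  fixes g :: "'a::euclidean_space \<Rightarrow> real"
  assumes "continuous_on (cbox a b) g" "\<And>x. x \<in> cbox a b \<Longrightarrow> 0 \<le> g x"
  shows "(\<integral>\<^sup>+x\<in>cbox a b. ennreal (g x) \<partial>lborel) = ennreal (integral (cbox a b) g)"
proof -
  note int = borel_integrable_compact[OF compact_cbox assms(1)]
  have "(\<integral>\<^sup>+x\<in>cbox a b. ennreal (g x) \<partial>lborel) = (\<integral>\<^sup>+x. ennreal (indicator (cbox a b) x *\<^sub>R g x) \<partial>lborel)"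
    by (intro nn_integral_cong) (auto simp: indicator_def)
  also have "\<dots> = ennreal (\<integral>x. indicator (cbox a b) x *\<^sub>R g x \<partial>lborel)"
    by (rule nn_integral_eq_integral[OF int]) (auto simp: indicator_def assms intro!: AE_I2)
  also have "(\<integral>x. indicator (cbox a b) x *\<^sub>R g x \<partial>lborel) = integral (cbox a b) g"
    using set_borel_integral_eq_integral(2)[of "cbox a b" g] int
    unfolding set_integrable_def set_lebesgue_integral_def by blast
  finally show ?thesis .
qed

text \<open>Monotone convergence over growing boxes turns the uniform bounds for gauge integrals
  into bounds for the improper integrals of the norms.\<close>

lemma nn_integral_exhaust_le:
  fixes g :: "'a::euclidean_space \<Rightarrow> real" and b :: "nat \<Rightarrow> 'a"
  assumes g: "continuous_on S g" "\<And>x. x \<in> S \<Longrightarrow> 0 \<le> g x"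
    and S: "S = (\<Union>n. cbox a (b n))" "\<And>n. cbox a (b n) \<subseteq> cbox a (b (Suc n))"
    and B: "\<And>n. integral (cbox a (b n)) g \<le> B"
  shows "(\<integral>\<^sup>+x\<in>S. ennreal (g x) \<partial>lborel) \<le> ennreal B"
proof -
  have sub: "cbox a (b n) \<subseteq> S" for n using S by auto
  have mono: "cbox a (b i) \<subseteq> cbox a (b j)" if "i \<le> j" for i j
    using lift_Suc_mono_le[of "\<lambda>n. cbox a (b n)", OF S(2) that] .
  let ?f = "\<lambda>n x. ennreal (g x) * indicator (cbox a (b n)) x"
  have inc: "incseq ?f"
    by (rule incseq_SucI, rule le_funI) (use S(2) in \<open>auto simp: indicator_def\<close>)
  have meas: "?f n \<in> borel_measurable lborel" for n
  proof -
    have "(\<lambda>x. indicator (cbox a (b n)) x *\<^sub>R g x) \<in> borel_measurable borel"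
      by (intro borel_measurable_continuous_on_indicator continuous_on_subset[OF g(1) sub]) auto
    then have "(\<lambda>x. ennreal (indicator (cbox a (b n)) x *\<^sub>R g x)) \<in> borel_measurable lborel" by simp
    moreover have "?f n = (\<lambda>x. ennreal (indicator (cbox a (b n)) x *\<^sub>R g x))" by (auto simp: indicator_def fun_eq_iff)
    ultimately show ?thesis by simp
  qed
  have sup: "ennreal (g x) * indicator S x = (SUP n. ?f n x)" for x
  proof (cases "x \<in> S")
    case True
    then obtain n where n: "x \<in> cbox a (b n)" using S(1) by auto
    show ?thesis
    proof (rule antisym)
      show "ennreal (g x) * indicator S x \<le> (SUP n. ?f n x)"
        by (rule SUP_upper2[of n]) (use n True in auto)
      show "(SUP n. ?f n x) \<le> ennreal (g x) * indicator S x"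
        by (rule SUP_least) (use True in \<open>auto simp: indicator_def\<close>)
    qed
  next
    case False
    then have "x \<notin> cbox a (b n)" for n using sub by auto
    then show ?thesis using False by simp
  qed
  have "(\<integral>\<^sup>+x\<in>S. ennreal (g x) \<partial>lborel) = (SUP n. \<integral>\<^sup>+x. ?f n x \<partial>lborel)"
    unfolding sup by (rule nn_integral_monotone_convergence_SUP[OF inc meas])
  also have "\<dots> \<le> ennreal B"
  proof (rule SUP_least)
    fix n
    have "(\<integral>\<^sup>+x. ?f n x \<partial>lborel) = ennreal (integral (cbox a (b n)) g)"
      by (rule nn_integral_cbox[OF continuous_on_subset[OF g(1) sub]]) (use g(2) sub in blast)
    then show "(\<integral>\<^sup>+x. ?f n x \<partial>lborel) \<le> ennreal B" using B[of n] by (simp add: ennreal_leI)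
  qed
  finally show ?thesis .
qed

lemma nn_integral_iterated:
  fixes g :: "real \<times> real \<Rightarrow> real"
  assumes "continuous_on S g" "S \<in> sets borel"
  shows "(\<integral>\<^sup>+v. (\<integral>\<^sup>+r. ennreal (g (v,r)) * indicator S (v,r) \<partial>lborel) \<partial>lborel) = (\<integral>\<^sup>+x\<in>S. ennreal (g x) \<partial>lborel)"
proof -
  have "(\<lambda>x. indicator S x *\<^sub>R g x) \<in> borel_measurable borel"
    by (intro borel_measurable_continuous_on_indicator assms)
  then have "(\<lambda>x. ennreal (indicator S x *\<^sub>R g x)) \<in> borel_measurable (lborel \<Otimes>\<^sub>M lborel)" unfolding lborel_prod by simp
  moreover have "(\<lambda>x. ennreal (indicator S x *\<^sub>R g x)) = (\<lambda>x. ennreal (g x) * indicator S x)" by (auto simp: indicator_def fun_eq_iff)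
  ultimately have "(\<lambda>x. ennreal (g x) * indicator S x) \<in> borel_measurable (lborel \<Otimes>\<^sub>M lborel)" by simp
  from lborel.nn_integral_fst[OF this] show ?thesis unfolding lborel_prod by simp
qed

text \<open>c1 bounds the right side of the exterior estimate per unit of data. c2 does so for the
  interior one, where the exterior flux c1 / \<kappa>1 reappears as data. \<open>Cl\<close> compares
  \<open>lee\<close> with \<open>ww\<close> inside.\<close>

definition est_const :: "real \<Rightarrow> real \<Rightarrow> real \<Rightarrow> real \<Rightarrow> real \<Rightarrow> real \<Rightarrow> real \<Rightarrow> real \<Rightarrow> real \<Rightarrow> real" where
  "est_const \<kappa>1 k1 C1 G1 \<kappa>2 k2 C2 G2 Cl = (let c1 = 5 * G1 + C1; c2 = 5 * G2 + G2 * (c1 / \<kappa>1) + C2 in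
     c1 / \<kappa>1 + 2 * c1 / k1 + c2 / \<kappa>2 + Cl * (2 * c2 / k2))"

context schw_wave
begin

lemma frame_fields:
  "ut_of M r (PP v r \<omega>) (LL v r \<omega>) = ut v r \<omega>" "ur_of M r (m r) (PP v r \<omega>) (LL v r \<omega>) = ur v r \<omega>"
  "en_of M r (m r) (PP v r \<omega>) (LL v r \<omega>) (QQ v r \<omega>) = ee v r \<omega>"
  "le_of M r (m r) (PP v r \<omega>) (LL v r \<omega>) (QQ v r \<omega>) (u v r \<omega>) = lee v r \<omega>"
proof -
  show 1: "ut_of M r (PP v r \<omega>) (LL v r \<omega>) = ut v r \<omega>" by (simp add: ut_of_def PP_def)
  show 2: "ur_of M r (m r) (PP v r \<omega>) (LL v r \<omega>) = ur v r \<omega>" by (simp add: ur_of_def 1) (simp add: LL_def)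
  show "en_of M r (m r) (PP v r \<omega>) (LL v r \<omega>) (QQ v r \<omega>) = ee v r \<omega>"
    "le_of M r (m r) (PP v r \<omega>) (LL v r \<omega>) (QQ v r \<omega>) (u v r \<omega>) = lee v r \<omega>"
    by (simp_all add: en_of_def le_of_def ee_def lee_def 1 2)
qed

lemma box_split:
  assumes G: "ctd r0 G" and a: "r0 \<le> a" "a \<le> R"
  shows "integral (cbox (0,r0) (T,R)) (\<lambda>x. G (fst x) (snd x))
    = integral (cbox (0,r0) (T,a)) (\<lambda>x. G (fst x) (snd x)) + integral (cbox (0,a) (T,R)) (\<lambda>x. G (fst x) (snd x))"
proof -
  have it: "integral (cbox (0,x) (T,y)) (\<lambda>x. G (fst x) (snd x)) = integral {0..T} (\<lambda>v. integral {x..y} (G v))" if "x \<ge> r0" for x y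
    using integral_prod_continuous[OF ctd_box[OF G that]] by simp
  have c: "(\<lambda>v. integral {x..y} (G v)) integrable_on {0..T}" if "x \<ge> r0" for x y
  proof -
    have "continuous_on {0..T} (\<lambda>v. integral {x..y} (\<lambda>r. G v r))"
      by (rule integral_continuous_on_param[where a = x and b = y, unfolded cbox_interval])
         (unfold case_prod_unfold, rule continuous_on_subset[OF G], use that in auto)
    then show ?thesis by (rule integrable_continuous_real)
  qed
  have "integral {0..T} (\<lambda>v. integral {r0..R} (G v)) = integral {0..T} (\<lambda>v. integral {r0..a} (G v) + integral {a..R} (G v))"
  proof (rule integral_cong)
    fix v assume "v \<in> {0..T}"
    then have "G v integrable_on {r0..R}" by (intro integrable_continuous_real ctd_slice[OF G]) auto
    then show "integral {r0..R} (G v) = integral {r0..a} (G v) + integral {a..R} (G v)"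
      using Henstock_Kurzweil_Integration.integral_combine[OF a] by metis
  qed
  also have "\<dots> = integral {0..T} (\<lambda>v. integral {r0..a} (G v)) + integral {0..T} (\<lambda>v. integral {a..R} (G v))"
    by (rule integral_add) (use c a in auto)
  finally show ?thesis using it[OF order_refl] it[OF a(1)] by simp
qed

lemma lee_le_ww:
  assumes r: "r \<ge> r0"
  shows "lee v r \<omega> \<le> (2 / r0\<^sup>2 + (1 + 3*(M/r0))\<^sup>2 * (1 / r0\<^sup>2 + 1 / r0)) * ww v r \<omega>"
proof -
  have rp: "r > 0" using r r0 by simp
  define q where "q = 2 / r0\<^sup>2 + (1 + 3*(M/r0))\<^sup>2 * (1 / r0\<^sup>2 + 1 / r0)"
  define e where "e = ee v r \<omega>"
  have e0: "e \<ge> 0" using ee_nonneg by (simp add: e_def)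
  have r2: "r0\<^sup>2 \<le> r\<^sup>2" "0 < r0\<^sup>2" using r r0 by (auto intro: power_mono)
  have Q: "0 \<le> QQ v r \<omega>" by (rule QQ_nonneg)
  have e1: "r\<^sup>2 * (ur v r \<omega>)\<^sup>2 \<le> e" "r\<^sup>2 * (ut v r \<omega>)\<^sup>2 \<le> e" "QQ v r \<omega> \<le> e"
    using Q by (auto simp: e_def ee_def distrib_left add_nonneg_nonneg intro: order_trans)
  have dv: "x \<le> y / r0\<^sup>2" if "r\<^sup>2 * x \<le> y" "0 \<le> x" for x y
  proof -
    have "r0\<^sup>2 * x \<le> y" using mult_right_mono[OF r2(1) that(2)] that(1) by simp
    then show ?thesis using r2 by (simp add: pos_le_divide_eq mult.commute)
  qed
  have a1: "(ur v r \<omega>)\<^sup>2 \<le> e / r0\<^sup>2" "(ut v r \<omega>)\<^sup>2 \<le> e / r0\<^sup>2" using dv e1 by auto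
  have a2: "QQ v r \<omega> / r \<le> e / r0" using e1(3) r r0 e0 Q by (intro frac_le) auto
  have a3: "(u v r \<omega> / r)\<^sup>2 \<le> (u v r \<omega>)\<^sup>2 / r0\<^sup>2" unfolding power_divide using r2 rp by (intro divide_left_mono mult_pos_pos) auto
  have a4: "(1 - 3*(M/r))\<^sup>2 \<le> (1 + 3*(M/r0))\<^sup>2"
  proof -
    have "M/r \<le> M/r0" "0 \<le> M/r" using r r0 rp M by (auto intro: divide_left_mono)
    then have "\<bar>1 - 3*(M/r)\<bar> \<le> \<bar>1 + 3*(M/r0)\<bar>" by linarith
    then show ?thesis by (simp only: abs_le_square_iff)
  qed
  have "(1 - 3*(M/r))\<^sup>2 * ((ut v r \<omega>)\<^sup>2 + QQ v r \<omega> / r) \<le> (1 + 3*(M/r0))\<^sup>2 * (e / r0\<^sup>2 + e / r0)"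
    using a1(2) a2 a4 Q rp by (intro mult_mono add_mono) auto
  then have "lee v r \<omega> \<le> e / r0\<^sup>2 + (1 + 3*(M/r0))\<^sup>2 * (e / r0\<^sup>2 + e / r0) + (u v r \<omega>)\<^sup>2 / r0\<^sup>2"
    unfolding lee_def using a1(1) a3 by linarith
  also have "\<dots> = e * (1 / r0\<^sup>2 + (1 + 3*(M/r0))\<^sup>2 * (1 / r0\<^sup>2 + 1 / r0)) + (u v r \<omega>)\<^sup>2 * (1 / r0\<^sup>2)"
    by (simp add: algebra_simps)
  also have "\<dots> \<le> e * q + (u v r \<omega>)\<^sup>2 * q"
    unfolding q_def using r0 e0 by (intro add_mono mult_left_mono) (auto intro!: divide_right_mono add_increasing2 mult_nonneg_nonneg)
  also have "\<dots> = q * ww v r \<omega>" by (simp add: ww_def e_def algebra_simps)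
  finally show ?thesis unfolding q_def .
qed

lemma dual_bound_nonneg: "dual_bound T LS \<Longrightarrow> LS \<ge> 0"
proof -
  assume DB: "dual_bound T LS"
  have "integral (cbox (0,r0) (T,r0)) (\<lambda>x::real\<times>real. 0::real) \<le> LS"
  proof (rule DB[unfolded dual_bound_def, rule_format, OF order_refl])
    fix x assume "x \<in> cbox (0,r0) (T,r0)"
    then have "av f2 (fst x) (snd x) \<ge> 0" by (cases x) (auto simp: cbox_Pair_eq intro!: av_sq_nonneg)
    then show "0 \<le> (0::real) \<and> (snd x \<noteq> 3*M \<longrightarrow> 0 \<le> wt (snd x) * av f2 (fst x) (snd x))" by (simp add: wt_def)
  qed simp
  then show ?thesis by simp
qed

text \<open>The exterior bound for \<open>ww\<close> on r = a is the incoming flux of the interior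
  estimate. Each left side is a sum of nonnegative terms, so every term is bounded separately and
  inner and outer parts are added.\<close>

lemma local_energy_estimate:
  assumes a: "r0 \<le> a" "a < 2*M" and mok: "\<And>r. r \<ge> r0 \<Longrightarrow> m_ok M m0 m1 n0 n1 r (m r)"
    and ext: "ext_ok M a m0 m1 n0 n1 K1 \<kappa>1 C k1 C1 G1" "coefs_on a K1"
    and int: "int_ok M r0 a m0 m1 n0 n1 K2 \<kappa>2 k2 C2 G2" "coefs_on r0 K2"
    and T: "T > 0" and E0: "\<And>R. R \<ge> r0 \<Longrightarrow> integral {r0..R} (av ee 0) \<le> E" and DB: "dual_bound T LS"
    and R: "R \<ge> a"
  defines "Z \<equiv> est_const \<kappa>1 k1 C1 G1 \<kappa>2 k2 C2 G2 (2 / r0\<^sup>2 + (1 + 3*(M/r0))\<^sup>2 * (1 / r0\<^sup>2 + 1 / r0))"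
  shows "integral {r0..R} (av ee T) \<le> Z * (E + LS)" "integral {0..T} (\<lambda>v. av ee v r0) \<le> Z * (E + LS)"
    "integral (cbox (0,r0) (T,R)) (\<lambda>x. av lee (fst x) (snd x)) \<le> Z * (E + LS)" and "Z \<ge> 0"
proof -
  define Cl where "Cl = 2 / r0\<^sup>2 + (1 + 3*(M/r0))\<^sup>2 * (1 / r0\<^sup>2 + 1 / r0)"
  have Cl: "Cl \<ge> 0" unfolding Cl_def using r0 by (intro add_nonneg_nonneg mult_nonneg_nonneg) auto
  have LS: "LS \<ge> 0" by (rule dual_bound_nonneg[OF DB])
  have E: "E \<ge> 0" using E0[of r0] by simp
  have p1: "\<kappa>1 > 0" "C \<ge> 0" "k1 > 0" "C1 > 0" "G1 \<ge> 0" using ext(1) unfolding ext_ok_def by auto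
  have p2: "\<kappa>2 > 0" "k2 > 0" "C2 > 0" "G2 \<ge> 0" using int(1) unfolding int_ok_def by auto
  have T0: "T \<ge> 0" using T by simp
  note ac = av_continuous[OF cdom_ee] cdom_sq[THEN av_continuous]
  note nn = av_sq_nonneg
  have i1: "(g v) integrable_on {x..y}" if "ctd r0 g" "v \<ge> 0" "x \<ge> r0" for g :: "real \<Rightarrow> real \<Rightarrow> real" and v x y
    by (rule integrable_continuous_real[OF ctd_slice[OF that]])
  have ic: "(\<lambda>v. g v r) integrable_on {0..T}" if "ctd r0 g" "r \<ge> r0" for g :: "real \<Rightarrow> real \<Rightarrow> real" and r
    by (rule integrable_continuous_real[OF ctd_col[OF that]])
  have Ea: "integral {a..R} (av ee 0) \<le> E" if "R \<ge> a" for R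
  proof -
    have "integral {a..R} (av ee 0) \<le> integral {r0..R} (av ee 0)"
      by (rule integral_subset_le) (use a i1[OF ac(1)] nn in auto)
    then show ?thesis using E0[of R] that a by linarith
  qed
  define c1 where "c1 = 5 * G1 + C1"
  define c2 where "c2 = 5 * G2 + G2 * (c1 / \<kappa>1) + C2"
  have c0: "c1 \<ge> 0" "c2 \<ge> 0" using p1 p2 by (auto simp: c1_def c2_def)
  have S1: "\<kappa>1 * integral {a..R} (av ee T) + \<kappa>1 * integral {0..T} (\<lambda>v. av ww v a)
     + k1/2 * integral (cbox (0,a) (T,R)) (\<lambda>x. av lee (fst x) (snd x)) \<le> 5 * G1 * E + C1 * LS"
  proof (rule stage1[OF ext(2) a(1) _ T p1 _ _ _ _ _ _ Ea DB R])
    show "a < 3*M" using a M by simp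
    fix v r :: real and \<omega> :: "real^3"
    assume v: "v \<ge> 0" and w: "\<omega> \<in> sphere 0 1"
    have X: "\<kappa>1 * ee v r \<omega> + C * (4 * (r - a)\<^sup>2 * (ur v r \<omega>)\<^sup>2 - (u v r \<omega>)\<^sup>2) \<le> slice K1 v r \<omega> \<and>
      (r = a \<longrightarrow> \<kappa>1 * ww v r \<omega> \<le> - flux K1 v r \<omega>) \<and> k1 * lee v r \<omega> \<le> bulk K1 v r \<omega> \<and>
      (r \<noteq> 3*M \<longrightarrow> source K1 v r \<omega> \<le> k1/2 * lee v r \<omega> + C1 * (wt r * f2 v r \<omega>)) \<and>
      \<bar>slice K1 v r \<omega>\<bar> \<le> G1 * ww v r \<omega> \<and> \<bar>long K1 v r \<omega>\<bar> \<le> G1 * ww v r \<omega>" if r: "r \<ge> a" for r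
    proof -
      have r': "r \<ge> r0" using r a by simp
      have "\<forall>r m P L Q U f. r \<ge> a \<longrightarrow> m_ok M m0 m1 n0 n1 r m \<longrightarrow> Q \<ge> 0 \<longrightarrow>
        \<kappa>1 * en_of M r m P L Q + C * (4 * (r - a)\<^sup>2 * (ur_of M r m P L)\<^sup>2 - U\<^sup>2) \<le> slice_dens K1 M m r P L Q U \<and>
        (r = a \<longrightarrow> \<kappa>1 * (en_of M r m P L Q + U\<^sup>2) \<le> - flux_dens K1 M r P L Q U) \<and>
        k1 * le_of M r m P L Q U \<le> bulk_dens K1 M r P L Q U \<and>
        (r \<noteq> 3*M \<longrightarrow> r\<^sup>2 * f * mult_dens K1 r P L U \<le> k1/2 * le_of M r m P L Q U + C1 * (inverse ((1 - 3*M/r)\<^sup>2) * r\<^sup>2 * r\<^sup>2 * f\<^sup>2)) \<and>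
        \<bar>slice_dens K1 M m r P L Q U\<bar> \<le> G1 * (en_of M r m P L Q + U\<^sup>2) \<and>
        \<bar>long_dens K1 r L Q U\<bar> \<le> G1 * (en_of M r m P L Q + U\<^sup>2)"
        using ext(1) unfolding ext_ok_def by blast
      from this[rule_format, OF r mok[OF r'] QQ_nonneg[of v r \<omega>], of "PP v r \<omega>" "LL v r \<omega>" "u v r \<omega>" "f v r \<omega>"]
      show ?thesis unfolding frame_fields slice_def flux_def long_def bulk_def source_def ww_def wt_def f2_def by blast
    qed
    show "\<kappa>1 * ww v a \<omega> \<le> - flux K1 v a \<omega>" using X[OF order_refl] by blast
    assume r: "r \<ge> a"
    note Y = X[OF r]
    show "\<kappa>1 * ee v r \<omega> + C * (4 * (r - a)\<^sup>2 * (ur v r \<omega>)\<^sup>2 - (u v r \<omega>)\<^sup>2) \<le> slice K1 v r \<omega>"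
      "k1 * lee v r \<omega> \<le> bulk K1 v r \<omega>"
      "\<bar>slice K1 v r \<omega>\<bar> \<le> G1 * ww v r \<omega>" "\<bar>long K1 v r \<omega>\<bar> \<le> G1 * ww v r \<omega>" using Y by blast+
    show "source K1 v r \<omega> \<le> k1/2 * lee v r \<omega> + C1 * (wt r * f2 v r \<omega>)" if "r \<noteq> 3*M" using Y that by blast
  qed
  have X1: "5 * G1 * E + C1 * LS \<le> c1 * (E + LS)"
  proof -
    have "0 \<le> G1 * LS" "0 \<le> C1 * E" using p1 E LS by auto
    then show ?thesis by (simp add: c1_def algebra_simps)
  qed
  have n1: "0 \<le> integral {a..R} (av ee T)" by (rule integral_nonneg) (use i1[OF ac(1) T0] a nn T0 in auto)
  have n2: "0 \<le> integral {0..T} (\<lambda>v. av ww v a)" by (rule integral_nonneg) (use ic[OF ac(5)] a nn in auto)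
  have n3: "0 \<le> integral (cbox (0,x) (T,y)) (\<lambda>x. av G (fst x) (snd x))" if "ctd r0 (av G)" "\<And>v r. v \<ge> 0 \<Longrightarrow> r \<ge> r0 \<Longrightarrow> av G v r \<ge> 0" "x \<ge> r0" for x y G
  proof (rule integral_nonneg)
    show "(\<lambda>x. av G (fst x) (snd x)) integrable_on cbox (0,x) (T,y)" by (rule integrable_continuous[OF ctd_box[OF that(1,3)]])
    show "0 \<le> av G (fst z) (snd z)" if "z \<in> cbox (0,x) (T,y)" for z
      using that \<open>x \<ge> r0\<close> by (cases z) (auto simp: cbox_Pair_eq intro!: \<open>\<And>v r. v \<ge> 0 \<Longrightarrow> r \<ge> r0 \<Longrightarrow> av G v r \<ge> 0\<close>)
  qed
  have n3l: "0 \<le> integral (cbox (0,x) (T,y)) (\<lambda>x. av lee (fst x) (snd x))" if "x \<ge> r0" for x y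
    by (rule n3[OF ac(6)]) (use nn(5) that in auto)
  have n3w: "0 \<le> integral (cbox (0,x) (T,y)) (\<lambda>x. av ww (fst x) (snd x))" if "x \<ge> r0" for x y
    by (rule n3[OF ac(5)]) (use nn(4) that in auto)
  have pr: "x \<le> b / p" if "p * x + y \<le> b" "0 \<le> y" "p > 0" for x y b p :: real
    using that by (simp add: pos_le_divide_eq mult.commute)
  define W where "W = E + LS"
  have W0: "W \<ge> 0" using E LS by (simp add: W_def)
  have S1': "\<kappa>1 * integral {a..R} (av ee T) + \<kappa>1 * integral {0..T} (\<lambda>v. av ww v a)
     + k1/2 * integral (cbox (0,a) (T,R)) (\<lambda>x. av lee (fst x) (snd x)) \<le> c1 * W" using S1 X1 by (simp add: W_def)
  have q1: "0 \<le> \<kappa>1 * integral {a..R} (av ee T)" "0 \<le> \<kappa>1 * integral {0..T} (\<lambda>v. av ww v a)"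
    "0 \<le> k1/2 * integral (cbox (0,a) (T,R)) (\<lambda>x. av lee (fst x) (snd x))"
    using n1 n2 n3l[OF a(1)] p1 by (auto intro!: mult_nonneg_nonneg)
  have r1: "integral {a..R} (av ee T) \<le> c1 * W / \<kappa>1"
    by (rule pr[of \<kappa>1 _ "\<kappa>1 * integral {0..T} (\<lambda>v. av ww v a) + k1/2 * integral (cbox (0,a) (T,R)) (\<lambda>x. av lee (fst x) (snd x))"]) (use S1' q1 p1 in linarith)+
  have r2: "integral {0..T} (\<lambda>v. av ww v a) \<le> c1 * W / \<kappa>1"
    by (rule pr[of \<kappa>1 _ "\<kappa>1 * integral {a..R} (av ee T) + k1/2 * integral (cbox (0,a) (T,R)) (\<lambda>x. av lee (fst x) (snd x))"]) (use S1' q1 p1 in linarith)+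
  have r3: "integral (cbox (0,a) (T,R)) (\<lambda>x. av lee (fst x) (snd x)) \<le> c1 * W / (k1/2)"
    by (rule pr[of "k1/2" _ "\<kappa>1 * integral {a..R} (av ee T) + \<kappa>1 * integral {0..T} (\<lambda>v. av ww v a)"]) (use S1' q1 p1 in linarith)+
  have S2: "\<kappa>2 * integral {r0..a} (av ee T) + \<kappa>2 * integral {0..T} (\<lambda>v. av ee v r0)
     + k2/2 * integral (cbox (0,r0) (T,a)) (\<lambda>x. av ww (fst x) (snd x))
     \<le> G2 * integral {r0..a} (av ww 0) + G2 * integral {0..T} (\<lambda>v. av ww v a) + C2 * LS"
  proof (rule stage2[OF int(2) a(1) T p2 _ _ _ _ _ _ DB])
    fix v :: real and \<omega> :: "real^3"
    assume v: "v \<ge> 0" and w: "\<omega> \<in> sphere 0 1"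
    have X: "\<kappa>2 * ee v r \<omega> \<le> slice K2 v r \<omega> \<and> \<kappa>2 * ee v r \<omega> \<le> - flux K2 v r \<omega> \<and> k2 * ww v r \<omega> \<le> bulk K2 v r \<omega> \<and>
      source K2 v r \<omega> \<le> k2/2 * ww v r \<omega> + C2 * (wt r * f2 v r \<omega>) \<and>
      \<bar>slice K2 v r \<omega>\<bar> \<le> G2 * ww v r \<omega> \<and> \<bar>flux K2 v r \<omega>\<bar> \<le> G2 * ww v r \<omega>" if r: "r0 \<le> r" "r \<le> a" for r
    proof -
      have "\<forall>r m P L Q U f. r0 \<le> r \<longrightarrow> r \<le> a \<longrightarrow> m_ok M m0 m1 n0 n1 r m \<longrightarrow> Q \<ge> 0 \<longrightarrow>
        \<kappa>2 * en_of M r m P L Q \<le> slice_dens K2 M m r P L Q U \<and>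
        \<kappa>2 * en_of M r m P L Q \<le> - flux_dens K2 M r P L Q U \<and>
        k2 * (en_of M r m P L Q + U\<^sup>2) \<le> bulk_dens K2 M r P L Q U \<and>
        r\<^sup>2 * f * mult_dens K2 r P L U \<le> k2/2 * (en_of M r m P L Q + U\<^sup>2) + C2 * (inverse ((1 - 3*M/r)\<^sup>2) * r\<^sup>2 * r\<^sup>2 * f\<^sup>2) \<and>
        \<bar>slice_dens K2 M m r P L Q U\<bar> \<le> G2 * (en_of M r m P L Q + U\<^sup>2) \<and>
        \<bar>flux_dens K2 M r P L Q U\<bar> \<le> G2 * (en_of M r m P L Q + U\<^sup>2)"
        using int(1) unfolding int_ok_def by blast
      from this[rule_format, OF r mok[OF r(1)] QQ_nonneg[of v r \<omega>], of "PP v r \<omega>" "LL v r \<omega>" "u v r \<omega>" "f v r \<omega>"]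
      show ?thesis unfolding frame_fields slice_def flux_def bulk_def source_def ww_def wt_def f2_def by blast
    qed
    show "\<kappa>2 * ee v r0 \<omega> \<le> - flux K2 v r0 \<omega>" using X[OF order_refl a(1)] by blast
    show "\<bar>flux K2 v a \<omega>\<bar> \<le> G2 * ww v a \<omega>" using X[OF a(1) order_refl] by blast
    fix r assume r: "r \<in> {r0..a}"
    have Y: "r0 \<le> r" "r \<le> a" using r by auto
    show "\<kappa>2 * ee v r \<omega> \<le> slice K2 v r \<omega>" "\<bar>slice K2 v r \<omega>\<bar> \<le> G2 * ww v r \<omega>" "k2 * ww v r \<omega> \<le> bulk K2 v r \<omega>"
      "source K2 v r \<omega> \<le> k2/2 * ww v r \<omega> + C2 * (wt r * f2 v r \<omega>)" using X[OF Y] by blast+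
  qed
  have X2: "G2 * integral {r0..a} (av ww 0) + G2 * integral {0..T} (\<lambda>v. av ww v a) + C2 * LS \<le> c2 * W"
  proof -
    have "G2 * integral {r0..a} (av ww 0) \<le> G2 * (5 * E)"
      using energy_controls_ww[OF order_refl order_refl E0 a(1)] p2 by (intro mult_left_mono) auto
    moreover have "G2 * (5 * E) \<le> G2 * (5 * W)" using p2 LS by (intro mult_left_mono) (auto simp: W_def)
    moreover have "G2 * integral {0..T} (\<lambda>v. av ww v a) \<le> G2 * (c1 * W / \<kappa>1)" using r2 p2 by (intro mult_left_mono) auto
    moreover have "C2 * LS \<le> C2 * W" using p2 E by (intro mult_left_mono) (auto simp: W_def)
    moreover have "c2 * W = G2 * (5 * W) + G2 * (c1 * W / \<kappa>1) + C2 * W" by (simp add: c2_def algebra_simps)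
    ultimately show ?thesis by linarith
  qed
  have m1: "0 \<le> integral {r0..a} (av ee T)" by (rule integral_nonneg) (use i1[OF ac(1) T0] a nn T0 in auto)
  have m2: "0 \<le> integral {0..T} (\<lambda>v. av ee v r0)" by (rule integral_nonneg) (use ic[OF ac(1)] a nn in auto)
  have q2: "0 \<le> \<kappa>2 * integral {r0..a} (av ee T)" "0 \<le> \<kappa>2 * integral {0..T} (\<lambda>v. av ee v r0)"
    "0 \<le> k2/2 * integral (cbox (0,r0) (T,a)) (\<lambda>x. av ww (fst x) (snd x))"
    using m1 m2 n3w[OF order_refl] p2 by (auto intro!: mult_nonneg_nonneg)
  note S2' = order_trans[OF S2 X2]
  have s1: "integral {r0..a} (av ee T) \<le> c2 * W / \<kappa>2"
    by (rule pr[of \<kappa>2 _ "\<kappa>2 * integral {0..T} (\<lambda>v. av ee v r0) + k2/2 * integral (cbox (0,r0) (T,a)) (\<lambda>x. av ww (fst x) (snd x))"]) (use S2' q2 p2 in linarith)+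
  have s2: "integral {0..T} (\<lambda>v. av ee v r0) \<le> c2 * W / \<kappa>2"
    by (rule pr[of \<kappa>2 _ "\<kappa>2 * integral {r0..a} (av ee T) + k2/2 * integral (cbox (0,r0) (T,a)) (\<lambda>x. av ww (fst x) (snd x))"]) (use S2' q2 p2 in linarith)+
  have s3: "integral (cbox (0,r0) (T,a)) (\<lambda>x. av ww (fst x) (snd x)) \<le> c2 * W / (k2/2)"
    by (rule pr[of "k2/2" _ "\<kappa>2 * integral {r0..a} (av ee T) + \<kappa>2 * integral {0..T} (\<lambda>v. av ee v r0)"]) (use S2' q2 p2 in linarith)+
  have s4: "integral (cbox (0,r0) (T,a)) (\<lambda>x. av lee (fst x) (snd x)) \<le> Cl * (c2 * W / (k2/2))"
  proof -
    have "integral (cbox (0,r0) (T,a)) (\<lambda>x. av lee (fst x) (snd x)) \<le> integral (cbox (0,r0) (T,a)) (\<lambda>x. Cl * av ww (fst x) (snd x))"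
    proof (rule integral_le)
      show "(\<lambda>x. av lee (fst x) (snd x)) integrable_on cbox (0,r0) (T,a)" by (rule integrable_continuous[OF ctd_box[OF ac(6) order_refl]])
      show "(\<lambda>x. Cl * av ww (fst x) (snd x)) integrable_on cbox (0,r0) (T,a)"
        by (intro integrable_on_mult_right integrable_continuous[OF ctd_box[OF ac(5) order_refl]])
      fix x assume "x \<in> cbox (0,r0) (T,a)"
      then have x: "fst x \<ge> 0" "snd x \<ge> r0" by (cases x, auto simp: cbox_Pair_eq)+
      have "1 * av lee (fst x) (snd x) + (- Cl) * av ww (fst x) (snd x) + 0 * av ww (fst x) (snd x) + 0 * av ww (fst x) (snd x) \<le> 0"
        by (rule av_lin[OF cdom_sq(5) cdom_sq(4) cdom_sq(4) cdom_sq(4) x]) (use lee_le_ww[OF x(2), folded Cl_def] in simp)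
      then show "av lee (fst x) (snd x) \<le> Cl * av ww (fst x) (snd x)" by simp
    qed
    also have "\<dots> = Cl * integral (cbox (0,r0) (T,a)) (\<lambda>x. av ww (fst x) (snd x))" by simp
    also have "\<dots> \<le> Cl * (c2 * W / (k2/2))" using s3 Cl by (intro mult_left_mono)
    finally show ?thesis .
  qed
  have Z: "Z = c1 / \<kappa>1 + 2 * c1 / k1 + c2 / \<kappa>2 + Cl * (2 * c2 / k2)"
    unfolding Z_def est_const_def Let_def Cl_def[symmetric] c1_def c2_def by simp
  have ZW: "Z * W = c1 * W / \<kappa>1 + c1 * W / (k1/2) + c2 * W / \<kappa>2 + Cl * (c2 * W / (k2/2))"
    unfolding Z by (simp add: algebra_simps)
  have z0: "0 \<le> c1 * W / \<kappa>1" "0 \<le> c1 * W / (k1/2)" "0 \<le> c2 * W / \<kappa>2" "0 \<le> Cl * (c2 * W / (k2/2))"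
    using c0 W0 p1 p2 Cl by auto
  show "Z \<ge> 0" unfolding Z using c0 p1 p2 Cl by (intro add_nonneg_nonneg mult_nonneg_nonneg) auto
  have "integral {r0..R} (av ee T) = integral {r0..a} (av ee T) + integral {a..R} (av ee T)"
    by (rule Henstock_Kurzweil_Integration.integral_combine[symmetric]) (use a R i1[OF ac(1) T0] in auto)
  then show "integral {r0..R} (av ee T) \<le> Z * (E + LS)" unfolding W_def[symmetric] ZW using r1 s1 z0 by linarith
  show "integral {0..T} (\<lambda>v. av ee v r0) \<le> Z * (E + LS)" unfolding W_def[symmetric] ZW using s2 z0 by linarith
  show "integral (cbox (0,r0) (T,R)) (\<lambda>x. av lee (fst x) (snd x)) \<le> Z * (E + LS)"
    unfolding W_def[symmetric] ZW box_split[OF ac(6) a(1) R] using r3 s4 z0 by linarith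
qed

end

text \<open>Compactness of the radii up to 5M/2; beyond, \<mu>' = 1/h lies between 1 and 5 and 1 -
  \<mu>' h/2 is exactly 1/2.\<close>

lemma time_function_bounds:
  fixes M r0 :: real and \<mu> :: "real \<Rightarrow> real"
  assumes M: "M > 0" and r0: "0 < r0" "r0 < 2*M"
    and mu_smooth: "\<And>n r. r \<ge> r0 \<Longrightarrow> (deriv ^^ n) \<mu> differentiable (at r)"
    and mu_eq: "\<And>r. r > 5*M/2 \<Longrightarrow> \<mu> r = tortoise M r"
    and mu_incr: "\<And>r. r \<ge> r0 \<Longrightarrow> deriv \<mu> r > 0"
    and mu_spacelike: "\<And>r. r \<ge> r0 \<Longrightarrow> 2 - lapse M r * deriv \<mu> r > 0"
  shows "\<exists>m0 m1 n0 n1. exterior_constants M m0 m1 n0 n1 \<and> (\<forall>r\<ge>r0. m_ok M m0 m1 n0 n1 r (deriv \<mu> r))"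
proof -
  define I where "I = {r0..5*M/2}"
  have I: "compact I" "I \<noteq> {}" using M r0 by (auto simp: I_def)
  have "(deriv \<mu> has_real_derivative deriv (deriv \<mu>) r) (at r)" if "r \<ge> r0" for r
    using mu_smooth[OF that, of "Suc 0"] by (simp add: DERIV_deriv_iff_real_differentiable)
  then have mc: "continuous_on I (deriv \<mu>)"
    unfolding I_def by (intro continuous_at_imp_continuous_on ballI) (auto intro: DERIV_isCont)
  define N where "N r = 1 - deriv \<mu> r * lapse M r / 2" for r
  have nc: "continuous_on I N" unfolding N_def lapse_def
    by (intro continuous_on_diff continuous_on_divide continuous_on_mult continuous_on_const continuous_on_id mc) (use r0 in \<open>auto simp: I_def\<close>)
  obtain x1 where x1: "x1 \<in> I" "\<And>r. r \<in> I \<Longrightarrow> deriv \<mu> x1 \<le> deriv \<mu> r" using continuous_attains_inf[OF I mc] by blast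
  obtain x2 where x2: "x2 \<in> I" "\<And>r. r \<in> I \<Longrightarrow> deriv \<mu> r \<le> deriv \<mu> x2" using continuous_attains_sup[OF I mc] by blast
  obtain x3 where x3: "x3 \<in> I" "\<And>r. r \<in> I \<Longrightarrow> N x3 \<le> N r" using continuous_attains_inf[OF I nc] by blast
  obtain x4 where x4: "x4 \<in> I" "\<And>r. r \<in> I \<Longrightarrow> N r \<le> N x4" using continuous_attains_sup[OF I nc] by blast
  have p: "deriv \<mu> x1 > 0" "N x3 > 0"
    using mu_incr[of x1] mu_spacelike[of x3] x1(1) x3(1) by (auto simp: I_def N_def mult.commute)
  have far: "deriv \<mu> r = 1 / lapse M r" "1/5 \<le> lapse M r" "lapse M r \<le> 1" if "r > 5*M/2" for r
  proof -
    have r: "r > 2*M" "r > 0" using that M r0 by auto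
    have "(tortoise M has_real_derivative 1 + 2 * M * (1 / (r - 2 * M))) (at r)"
      unfolding tortoise_def[abs_def] using r by (auto intro!: derivative_eq_intros)
    then have "(\<mu> has_real_derivative 1 + 2 * M * (1 / (r - 2 * M))) (at r)"
      by (rule has_field_derivative_transform_within_open[of _ _ _ "{5*M/2<..}"]) (use that mu_eq in auto)
    then have "deriv \<mu> r = 1 + 2 * M * (1 / (r - 2 * M))" by (rule DERIV_imp_deriv)
    also have "\<dots> = 1 / lapse M r" using r by (simp add: lapse_def field_simps)
    finally show "deriv \<mu> r = 1 / lapse M r" .
    show "1/5 \<le> lapse M r" "lapse M r \<le> 1" using that r M by (auto simp: lapse_def field_simps)
  qed
  define m0 where "m0 = min (deriv \<mu> x1) 1"
  define m1 where "m1 = max (deriv \<mu> x2) 5"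
  define n0 where "n0 = min (N x3) (1/2)"
  define n1 where "n1 = max (N x4) (1/2)"
  have "exterior_constants M m0 m1 n0 n1"
    by unfold_locales (use M p in \<open>auto simp: m0_def m1_def n0_def n1_def\<close>)
  moreover have "m_ok M m0 m1 n0 n1 r (deriv \<mu> r)" if r: "r \<ge> r0" for r
  proof (cases "r > 5*M/2")
    case True
    note f = far[OF True]
    have "1 \<le> 1 / lapse M r" "1 / lapse M r \<le> 5" using f by (auto simp: field_simps)
    moreover have b: "m0 \<le> 1" "5 \<le> m1" "n0 \<le> 1/2" "1/2 \<le> n1" by (simp_all add: m0_def m1_def n0_def n1_def)
    ultimately have c: "m0 \<le> deriv \<mu> r" "deriv \<mu> r \<le> m1" unfolding f(1) by linarith+
    have e: "1 - deriv \<mu> r * lapse M r / 2 = 1/2" using f by simp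
    show ?thesis unfolding m_ok_def e by (intro conjI impI b c f(1))
  next
    case False
    then have "r \<in> I" using r by (simp add: I_def)
    then show ?thesis unfolding m_ok_def N_def[symmetric] using x1(2) x2(2) x3(2) x4(2) False
      by (simp add: m0_def m1_def n0_def n1_def min.coboundedI1 max.coboundedI1)
  qed
  ultimately show ?thesis by blast
qed

context schw_wave
begin

lemma sphere_eq:
  assumes "cdom r0 G" "v \<ge> 0" "r \<ge> r0" "\<And>\<omega>. \<omega> \<in> sphere 0 1 \<Longrightarrow> F \<omega> = G v r \<omega>" "\<And>\<omega>. \<omega> \<in> sphere 0 1 \<Longrightarrow> 0 \<le> G v r \<omega>"
  shows "(\<integral>\<^sup>+\<omega>. ennreal (F \<omega>) \<partial>sphere_measure) = ennreal (av G v r)"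
proof -
  have "(\<integral>\<^sup>+\<omega>. ennreal (F \<omega>) \<partial>sphere_measure) = (\<integral>\<^sup>+\<omega>. ennreal (G v r \<omega>) \<partial>sphere_measure)"
    by (rule nn_integral_cong_AE) (use AE_sphere_measure in \<open>eventually_elim, simp add: assms(4)\<close>)
  also have "\<dots> = ennreal (av G v r)"
    unfolding av_def by (rule nn_integral_sphere_int[OF cdom_slice[OF assms(1-3)] assms(5)])
  finally show ?thesis .
qed

text \<open>At r = 3M the weight evaluates to 0 and the comparison with g may fail, but this is one
  radius out of a continuum, hence a null set in the inner integral.\<close>

lemma dual_bound_of_norm:
  assumes hf: "\<And>v r \<omega>. v \<ge> 0 \<Longrightarrow> r \<ge> r0 \<Longrightarrow> \<omega> \<in> sphere 0 1 \<Longrightarrow> f' (pt v r \<omega>) = f v r \<omega>"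
    and LS: "LE0_dual_norm_sq M r0 f' = ennreal LS" "LS \<ge> 0"
  shows "dual_bound T LS"
  unfolding dual_bound_def
proof (intro allI impI)
  fix a R :: real and g :: "real \<times> real \<Rightarrow> real"
  let ?C = "cbox (0,a) (T,R)"
  assume a: "r0 \<le> a" and g: "continuous_on ?C g"
    and gb: "\<forall>x\<in>?C. 0 \<le> g x \<and> (snd x \<noteq> 3*M \<longrightarrow> g x \<le> wt (snd x) * av f2 (fst x) (snd x))"
  have inner: "(\<integral>\<^sup>+\<omega>. ennreal (inverse ((1 - 3*M/r)^2) * r^2 * (f' (pt v r \<omega>))^2 * r^2) \<partial>sphere_measure) = ennreal (wt r * av f2 v r)"
    if "v \<ge> 0" "r \<ge> r0" for v r
  proof -
    have "(\<integral>\<^sup>+\<omega>. ennreal (inverse ((1 - 3*M/r)^2) * r^2 * (f' (pt v r \<omega>))^2 * r^2) \<partial>sphere_measure) = ennreal (av (\<lambda>v' r' \<omega>. wt r * f2 v' r' \<omega>) v r)"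
      by (rule sphere_eq[OF continuous_on_mult_left[OF cdom_sq(3)] that])
         (use hf[OF that] in \<open>simp_all add: wt_def f2_def mult_ac\<close>)
    also have "av (\<lambda>v' r' \<omega>. wt r * f2 v' r' \<omega>) v r = wt r * av f2 v r" by (rule av_cmult[of "\<lambda>_ _. wt r"])
    finally show ?thesis .
  qed
  have "ennreal (integral ?C g) = (\<integral>\<^sup>+x\<in>?C. ennreal (g x) \<partial>lborel)"
    by (rule nn_integral_cbox[OF g, symmetric]) (use gb in blast)
  also have "\<dots> = (\<integral>\<^sup>+v. (\<integral>\<^sup>+r. ennreal (g (v,r)) * indicator ?C (v,r) \<partial>lborel) \<partial>lborel)"
    by (rule nn_integral_iterated[OF g, symmetric]) simp
  also have "\<dots> \<le> LE0_dual_norm_sq M r0 f'"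
    unfolding LE0_dual_norm_sq_def
  proof (rule nn_integral_mono)
    fix v :: real
    show "(\<integral>\<^sup>+r. ennreal (g (v,r)) * indicator ?C (v,r) \<partial>lborel)
      \<le> (\<integral>\<^sup>+r\<in>{r0..}. (\<integral>\<^sup>+\<omega>. ennreal (inverse ((1 - 3*M/r)^2) * r^2 * (f' (pt v r \<omega>))^2 * r^2) \<partial>sphere_measure) \<partial>lborel) * indicator {0..} v"
    proof (cases "v \<ge> 0")
      case True
      have "(\<integral>\<^sup>+r. ennreal (g (v,r)) * indicator ?C (v,r) \<partial>lborel)
        \<le> (\<integral>\<^sup>+r\<in>{r0..}. (\<integral>\<^sup>+\<omega>. ennreal (inverse ((1 - 3*M/r)^2) * r^2 * (f' (pt v r \<omega>))^2 * r^2) \<partial>sphere_measure) \<partial>lborel)"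
      proof (rule nn_integral_mono_AE)
        show "AE r in lborel. ennreal (g (v,r)) * indicator ?C (v,r)
          \<le> (\<integral>\<^sup>+\<omega>. ennreal (inverse ((1 - 3*M/r)^2) * r^2 * (f' (pt v r \<omega>))^2 * r^2) \<partial>sphere_measure) * indicator {r0..} r"
          using AE_lborel_singleton[of "3*M"]
        proof eventually_elim
          case (elim r)
          show ?case
          proof (cases "(v,r) \<in> ?C")
            case C: True
            then have r: "r \<ge> r0" using a by (simp add: cbox_Pair_eq)
            have "g (v,r) \<le> wt r * av f2 v r" using gb[rule_format, OF C] elim by simp
            then show ?thesis using inner[OF True r] C r by (simp add: ennreal_leI)
          qed simp
        qed
      qed
      then show ?thesis using True by simp
    next
      case False
      then have "(v,r) \<notin> ?C" for r by (simp add: cbox_Pair_eq)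
      then show ?thesis by simp
    qed
  qed
  finally show "integral ?C g \<le> LS" unfolding LS(1) using LS(2) by (simp add: ennreal_le_iff)
qed

text \<open>Pure measure theory: with the sphere integrals rewritten as averages, the bounds on all
  finite boxes pass to the norms.\<close>

lemma final_estimate:
  fixes \<phi> f' :: "real^4 \<Rightarrow> real" and Z a :: real
  assumes hf: "\<And>v r \<omega>. v \<ge> 0 \<Longrightarrow> r \<ge> r0 \<Longrightarrow> \<omega> \<in> sphere 0 1 \<Longrightarrow> f' (pt v r \<omega>) = f v r \<omega>"
    and he: "\<And>v r \<omega>. v \<ge> 0 \<Longrightarrow> r \<ge> r0 \<Longrightarrow> \<omega> \<in> sphere 0 1 \<Longrightarrow> energy_density \<phi> v r \<omega> * r^2 = ee v r \<omega>"
    and hl: "\<And>v r \<omega>. v \<ge> 0 \<Longrightarrow> r \<ge> r0 \<Longrightarrow> \<omega> \<in> sphere 0 1 \<Longrightarrow>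
      ((d_r \<phi> v r \<omega>)^2 / r^2 + (1 - 3*M/r)^2 * ((d_v \<phi> v r \<omega>)^2 / r^2 + ang_sq \<phi> v r \<omega> / r) + (\<phi> (pt v r \<omega>))^2 / r^4) * r^2 = lee v r \<omega>"
    and a: "a \<ge> r0" and Z: "Z \<ge> 0"
    and est: "\<And>T E LS R. T > 0 \<Longrightarrow> (\<And>R. R \<ge> r0 \<Longrightarrow> integral {r0..R} (av ee 0) \<le> E) \<Longrightarrow> dual_bound T LS \<Longrightarrow> R \<ge> a \<Longrightarrow>
      integral {r0..R} (av ee T) \<le> Z * (E + LS) \<and> integral {0..T} (\<lambda>v. av ee v r0) \<le> Z * (E + LS) \<and>
      integral (cbox (0,r0) (T,R)) (\<lambda>x. av lee (fst x) (snd x)) \<le> Z * (E + LS)"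
  shows "energy_plus r0 \<phi> + (SUP v\<in>{0..}. energy r0 \<phi> v) + LE0_norm_sq M r0 \<phi>
       \<le> ennreal (3 * (Z + 1)) * (energy_minus r0 \<phi> + LE0_dual_norm_sq M r0 f')"
\<comment> \<open>With infinite data the right side is infinite because the constant is positive;
  otherwise the data are real numbers and \<open>est\<close> applies.\<close>
proof (cases "energy_minus r0 \<phi> = \<infinity> \<or> LE0_dual_norm_sq M r0 f' = \<infinity>")
  case True
  then have inf: "energy_minus r0 \<phi> + LE0_dual_norm_sq M r0 f' = top" by (auto simp: infinity_ennreal_def)
  have ne: "ennreal (3 * (Z + 1)) \<noteq> 0"
  proof
    assume "ennreal (3 * (Z + 1)) = 0"
    then have "3 * (Z + 1) \<le> 0" by (simp only: ennreal_eq_0_iff)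
    then show False using Z by simp
  qed
  show ?thesis unfolding inf ennreal_mult_top if_not_P[OF ne] by (rule top_greatest)
next
  case False
  define E where "E = enn2real (energy_minus r0 \<phi>)"
  define LS where "LS = enn2real (LE0_dual_norm_sq M r0 f')"
  have E: "energy_minus r0 \<phi> = ennreal E" "E \<ge> 0" and LS: "LE0_dual_norm_sq M r0 f' = ennreal LS" "LS \<ge> 0"
    using False by (auto simp: E_def LS_def less_top)
  note ac = av_continuous[OF cdom_ee] cdom_sq[THEN av_continuous]
  note nn = av_sq_nonneg
  have en: "energy r0 \<phi> v = (\<integral>\<^sup>+r\<in>{r0..}. ennreal (av ee v r) \<partial>lborel)" if "v \<ge> 0" for v
    unfolding energy_def
  proof (rule nn_integral_cong)
    fix r :: real
    show "(\<integral>\<^sup>+\<omega>. ennreal (energy_density \<phi> v r \<omega> * r^2) \<partial>sphere_measure) * indicator {r0..} r = ennreal (av ee v r) * indicator {r0..} r"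
    proof (cases "r \<ge> r0")
      case r: True
      show ?thesis using sphere_eq[OF cdom_ee that r he[OF that r] ee_nonneg] r by simp
    qed simp
  qed
  have ep: "energy_plus r0 \<phi> = (\<integral>\<^sup>+v\<in>{0..}. ennreal (av ee v r0) \<partial>lborel)"
    unfolding energy_plus_def
  proof (rule nn_integral_cong)
    fix v :: real
    show "(\<integral>\<^sup>+\<omega>. ennreal (energy_density \<phi> v r0 \<omega> * r0^2) \<partial>sphere_measure) * indicator {0..} v = ennreal (av ee v r0) * indicator {0..} v"
    proof (cases "v \<ge> 0")
      case v: True
      show ?thesis using sphere_eq[OF cdom_ee v order_refl he[OF v order_refl] ee_nonneg] v by simp
    qed simp
  qed
  let ?S = "{0..} \<times> {r0..} :: (real \<times> real) set"
  have clS: "?S \<in> sets borel" by (intro borel_closed closed_Times closed_atLeast)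
  have le: "LE0_norm_sq M r0 \<phi> = (\<integral>\<^sup>+x\<in>?S. ennreal (av lee (fst x) (snd x)) \<partial>lborel)"
  proof -
    have "LE0_norm_sq M r0 \<phi> = (\<integral>\<^sup>+v. (\<integral>\<^sup>+r. ennreal (av lee v r) * indicator ?S (v,r) \<partial>lborel) \<partial>lborel)"
      unfolding LE0_norm_sq_def
    proof (rule nn_integral_cong)
      fix v :: real
      let ?in = "\<lambda>r. \<integral>\<^sup>+\<omega>. ennreal (((d_r \<phi> v r \<omega>)^2 / r^2 + (1 - 3*M/r)^2 * ((d_v \<phi> v r \<omega>)^2 / r^2 + ang_sq \<phi> v r \<omega> / r) + (\<phi> (pt v r \<omega>))^2 / r^4) * r^2) \<partial>sphere_measure"
      show "(\<integral>\<^sup>+r\<in>{r0..}. ?in r \<partial>lborel) * indicator {0..} v = (\<integral>\<^sup>+r. ennreal (av lee v r) * indicator ?S (v,r) \<partial>lborel)"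
      proof (cases "v \<ge> 0")
        case v: True
        have "(\<integral>\<^sup>+r\<in>{r0..}. ?in r \<partial>lborel) = (\<integral>\<^sup>+r. ennreal (av lee v r) * indicator ?S (v,r) \<partial>lborel)"
        proof (rule nn_integral_cong)
          fix r :: real
          show "?in r * indicator {r0..} r = ennreal (av lee v r) * indicator ?S (v,r)"
          proof (cases "r \<ge> r0")
            case r: True
            have "r > 0" using r r0 by simp
            show ?thesis using sphere_eq[OF cdom_sq(5) v r hl[OF v r] lee_nonneg[OF \<open>r > 0\<close>]] r v by simp
          qed simp
        qed
        then show ?thesis using v by simp
      qed simp
    qed
    also have "\<dots> = (\<integral>\<^sup>+x\<in>?S. ennreal (av lee (fst x) (snd x)) \<partial>lborel)"
      by (rule nn_integral_iterated[OF ac(6) clS, unfolded fst_conv snd_conv])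
    finally show ?thesis .
  qed
  have DB: "dual_bound T LS" for T by (rule dual_bound_of_norm[OF hf LS])
  have E0: "integral {r0..R} (av ee 0) \<le> E" if "R \<ge> r0" for R
  proof -
    have "ennreal (integral (cbox r0 R) (av ee 0)) = (\<integral>\<^sup>+r\<in>cbox r0 R. ennreal (av ee 0 r) \<partial>lborel)"
      by (rule nn_integral_cbox[symmetric]) (use ctd_slice[OF ac(1), of 0 r0 R] nn in auto)
    also have "\<dots> \<le> energy r0 \<phi> 0" unfolding en[OF order_refl]
      by (rule nn_integral_mono) (auto simp: indicator_def)
    also have "\<dots> = ennreal E" using E(1) by (simp add: energy_minus_def)
    finally show ?thesis using E(2) by (simp add: ennreal_le_iff)
  qed
  define W where "W = E + LS"
  have W: "W \<ge> 0" using E LS by (simp add: W_def)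
  \<comment> \<open>One more than \<open>Z\<close>, since the slice v = 0, excluded from
    \<open>est\<close> by T > 0, has energy at most W itself. The factor 3 in the result counts the
    three quantities on the left.\<close>
  define Y where "Y = (Z + 1) * W"
  have YW: "Z * W \<le> Y" "W \<le> Y" "Y \<ge> 0" using Z W by (simp_all add: Y_def algebra_simps)
  have est': "integral {r0..R} (av ee T) \<le> Y" "integral {0..T} (\<lambda>v. av ee v r0) \<le> Y"
    "integral (cbox (0,r0) (T,R)) (\<lambda>x. av lee (fst x) (snd x)) \<le> Y" if "T > 0" "R \<ge> a" for T R
    using est[OF that(1) E0 DB that(2)] YW(1) unfolding W_def[symmetric] by auto
  have b1: "energy r0 \<phi> v \<le> ennreal Y" if "v \<ge> 0" for v
  proof (cases "v = 0")
    case True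
    then show ?thesis using E YW LS by (simp add: energy_minus_def[symmetric] W_def ennreal_leI)
  next
    case False
    show ?thesis unfolding en[OF that]
    proof (rule nn_integral_exhaust_le[where a = r0 and b = "\<lambda>n. a + real n"])
      show "continuous_on {r0..} (av ee v)"
        by (rule continuous_on_compose2[OF ac(1), of _ "\<lambda>r. (v, r)", unfolded fst_conv snd_conv])
           (use that in \<open>auto intro!: continuous_on_Pair continuous_on_const continuous_on_id\<close>)
      show "{r0..} = (\<Union>n. cbox r0 (a + real n))"
      proof -
        have "\<exists>n. x \<le> a + real n" for x using real_arch_simple[of "x - a"] by (auto simp: algebra_simps)
        then show ?thesis by auto
      qed
    qed (use that False nn est' in auto)
  qed
  have b2: "energy_plus r0 \<phi> \<le> ennreal Y" unfolding ep
  proof (rule nn_integral_exhaust_le[where a = 0 and b = "\<lambda>n. 1 + real n"])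
    show "continuous_on {0..} (\<lambda>v. av ee v r0)"
      by (rule continuous_on_compose2[OF ac(1), of _ "\<lambda>v. (v, r0)", unfolded fst_conv snd_conv])
         (auto intro!: continuous_on_Pair continuous_on_const continuous_on_id)
    show "{0..} = (\<Union>n. cbox 0 (1 + real n))"
    proof -
      have "\<exists>n. x \<le> 1 + real n" for x using real_arch_simple[of "x - 1"] by (auto simp: algebra_simps)
      then show ?thesis by auto
    qed
    show "integral (cbox 0 (1 + real n)) (\<lambda>v. av ee v r0) \<le> Y" for n using est'(2)[of "1 + real n" a] by simp
  qed (use nn in auto)
  have b3: "LE0_norm_sq M r0 \<phi> \<le> ennreal Y" unfolding le
  proof (rule nn_integral_exhaust_le[OF ac(6), where a = "(0,r0)" and b = "\<lambda>n. (1 + real n, a + real n)"])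
    show "0 \<le> av lee (fst x) (snd x)" if "x \<in> ?S" for x using that nn(5) by (cases x) auto
    show "?S = (\<Union>n. cbox (0,r0) (1 + real n, a + real n))"
    proof (rule equalityI; rule subsetI)
      fix x assume x: "x \<in> ?S"
      obtain n where n: "max (fst x - 1) (snd x - a) \<le> real n" using real_arch_simple by blast
      then have "fst x \<le> 1 + real n" "snd x \<le> a + real n" by auto
      then show "x \<in> (\<Union>n. cbox (0,r0) (1 + real n, a + real n))" using x by (cases x) (auto simp: cbox_Pair_eq)
    qed (auto simp: cbox_Pair_eq)
    show "integral (cbox (0,r0) (1 + real n, a + real n)) (\<lambda>x. av lee (fst x) (snd x)) \<le> Y" for n by (rule est'(3)) auto
  qed (auto simp: cbox_Pair_eq)
  have "energy_plus r0 \<phi> + (SUP v\<in>{0..}. energy r0 \<phi> v) + LE0_norm_sq M r0 \<phi> \<le> ennreal Y + ennreal Y + ennreal Y"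
    by (intro add_mono b2 b3 SUP_least b1) auto
  also have "\<dots> = ennreal (Y + Y + Y)" by (simp only: ennreal_plus YW(3) add_nonneg_nonneg)
  also have "Y + Y + Y = 3 * (Z + 1) * W" by (simp add: Y_def algebra_simps)
  also have "ennreal (3 * (Z + 1) * W) = ennreal (3 * (Z + 1)) * ennreal W" using Z W by (intro ennreal_mult) auto
  also have "ennreal W = energy_minus r0 \<phi> + LE0_dual_norm_sq M r0 f'" unfolding E(1) LS(1) W_def using E LS by simp
  finally show ?thesis .
qed

end

theorem theorem2:
  fixes M r0 :: real and \<mu> :: "real \<Rightarrow> real"
  assumes "M > 0" and "0 < r0" and "r0 < 2*M"
    and mu_smooth: "\<And>n r. r \<ge> r0 \<Longrightarrow> (deriv ^^ n) \<mu> differentiable (at r)"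
    and mu_ge: "\<And>r. r > 2*M \<Longrightarrow> \<mu> r \<ge> tortoise M r"
    and mu_eq: "\<And>r. r > 5*M/2 \<Longrightarrow> \<mu> r = tortoise M r"
    and mu_incr: "\<And>r. r \<ge> r0 \<Longrightarrow> deriv \<mu> r > 0"
    and mu_spacelike: "\<And>r. r \<ge> r0 \<Longrightarrow> 2 - (1 - 2*M/r) * deriv \<mu> r > 0"
  shows "\<exists>C>0. \<forall>(\<phi> :: real^4 \<Rightarrow> real) (f :: real^4 \<Rightarrow> real).
     (\<exists>U. open U \<and> region r0 \<subseteq> U \<and> C2_on U \<phi>) \<longrightarrow>
     (\<forall>p\<in>region r0. dalembertian (schw_metric M \<mu>) \<phi> p = f p) \<longrightarrow>
     (\<forall>v\<ge>0. \<forall>\<omega>\<in>sphere 0 1. ((\<lambda>r. \<phi> (pt v r \<omega>)) \<longlongrightarrow> 0) at_top) \<longrightarrow>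
     energy_plus r0 \<phi> + (SUP v\<in>{0..}. energy r0 \<phi> v) + LE0_norm_sq M r0 \<phi>
       \<le> ennreal C * (energy_minus r0 \<phi> + LE0_dual_norm_sq M r0 f)"
proof -
  note M = assms(1) and r0 = assms(2,3)
  have spl: "2 - lapse M r * deriv \<mu> r > 0" if "r \<ge> r0" for r using mu_spacelike[OF that] by (simp add: lapse_def)
  obtain m0 m1 n0 n1 where ec: "exterior_constants M m0 m1 n0 n1" and mok: "\<And>r. r \<ge> r0 \<Longrightarrow> m_ok M m0 m1 n0 n1 r (deriv \<mu> r)"
    using time_function_bounds[OF M r0 mu_smooth mu_eq mu_incr spl] by blast
  interpret ec: exterior_constants M m0 m1 n0 n1 by (rule ec)
  \<comment> \<open>If \<open>r0\<close> already lies within the depth \<open>d\<close> below the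
    horizon, the interior region shrinks to the single radius \<open>r0\<close>, and the interior
    estimate supplies just the bound on the boundary.\<close>
  define a where "a = max r0 (2*M - M * ec.d)"
  have a: "r0 \<le> a" "2*M - M * ec.d \<le> a" "a < 2*M" "0 < a" using r0 M ec.cpos(4) by (auto simp: a_def)
  obtain \<kappa>1 k1 C1 G1 where ext: "ext_ok M a m0 m1 n0 n1 (exterior_coefs M ec.\<Lambda>) \<kappa>1 ec.C k1 C1 G1"
    using ec.exterior_ok[OF a(2,3)] by blast
  obtain lam \<kappa>2 k2 C2 G2 where int: "int_ok M r0 a m0 m1 n0 n1 (interior_coefs lam) \<kappa>2 k2 C2 G2"
    using interior_ok[OF M r0(1) a(1,3) ec.m0 ec.m01 ec.n0] by blast
  \<comment> \<open>The constant must be fixed before a solution is given, whereas its nonnegativity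
    is obtained in the context of one; the absolute value bridges this.\<close>
  define Z where "Z = \<bar>est_const \<kappa>1 k1 C1 G1 \<kappa>2 k2 C2 G2 (2 / r0\<^sup>2 + (1 + 3*(M/r0))\<^sup>2 * (1 / r0\<^sup>2 + 1 / r0))\<bar>"
  show ?thesis
  proof (intro exI[of _ "3 * (Z + 1)"] conjI allI impI)
    show "0 < 3 * (Z + 1)" by (simp add: Z_def)
    fix \<phi> f :: "real^4 \<Rightarrow> real"
    assume "\<exists>U. open U \<and> region r0 \<subseteq> U \<and> C2_on U \<phi>"
    then obtain U where U: "open U" "region r0 \<subseteq> U" "C2_on U \<phi>" by blast
    assume box: "\<forall>p\<in>region r0. dalembertian (schw_metric M \<mu>) \<phi> p = f p"
    assume dec: "\<forall>v\<ge>0. \<forall>\<omega>\<in>sphere 0 1. ((\<lambda>r. \<phi> (pt v r \<omega>)) \<longlongrightarrow> 0) at_top"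
    have pw: "polar_wave M r0 (deriv \<mu>) (deriv (deriv \<mu>))
      (\<lambda>v r \<omega>. \<phi> (pt v r \<omega>)) (\<lambda>v r \<omega>. partial 1 \<phi> (pt v r \<omega>)) (rad1 \<phi>)
      (\<lambda>v r \<omega>. partial 1 (partial 1 \<phi>) (pt v r \<omega>)) (rad1 (partial 1 \<phi>)) (rad2 \<phi>)
      (\<lambda>v r \<omega>. f (pt v r \<omega>))
      (\<lambda>a. rot1 a \<phi>) (\<lambda>a. rot1 a (partial 1 \<phi>))
      (\<lambda>a v r \<omega>. rot a (radgrad \<phi> v r \<omega>) \<omega>) (\<lambda>a v r \<omega>. rot a (rotgrad a \<phi> v r \<omega>) \<omega>)"
      by (rule polar_wave_of_solution[OF M r0(1) mu_smooth U box[rule_format]])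
    interpret schw_wave M r0 "deriv \<mu>" "deriv (deriv \<mu>)"
      "\<lambda>v r \<omega>. \<phi> (pt v r \<omega>)" "\<lambda>v r \<omega>. partial 1 \<phi> (pt v r \<omega>)" "rad1 \<phi>"
      "\<lambda>v r \<omega>. partial 1 (partial 1 \<phi>) (pt v r \<omega>)" "rad1 (partial 1 \<phi>)" "rad2 \<phi>"
      "\<lambda>v r \<omega>. f (pt v r \<omega>)"
      "\<lambda>a. rot1 a \<phi>" "\<lambda>a. rot1 a (partial 1 \<phi>)"
      "\<lambda>a v r \<omega>. rot a (radgrad \<phi> v r \<omega>) \<omega>" "\<lambda>a v r \<omega>. rot a (rotgrad a \<phi> v r \<omega>) \<omega>" \<mu>
    proof (rule schw_wave.intro[OF pw], rule schw_wave_axioms.intro)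
      show "(\<mu> has_real_derivative deriv \<mu> r) (at r)" if "r \<ge> r0" for r
        using mu_smooth[OF that, of 0] by (simp add: DERIV_deriv_iff_real_differentiable)
      show "((\<lambda>r. \<phi> (pt v r \<omega>)) \<longlongrightarrow> 0) at_top" if "v \<ge> 0" "\<omega> \<in> sphere 0 1" for v \<omega> using dec that by blast
    qed (use mu_incr spl mu_eq r0 in auto)
    have dd: "d_v \<phi> v r \<omega> = partial 1 \<phi> (pt v r \<omega>)" "d_r \<phi> v r \<omega> = rad1 \<phi> v r \<omega>" "ang_sq \<phi> v r \<omega> = QQ v r \<omega> / r\<^sup>2"
      if "v \<ge> 0" "r \<ge> r0" "\<omega> \<in> sphere 0 1" for v r \<omega>
    proof -
      show "d_v \<phi> v r \<omega> = partial 1 \<phi> (pt v r \<omega>)" unfolding d_v_def by (rule DERIV_imp_deriv[OF D(1)[OF that]])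
      show "d_r \<phi> v r \<omega> = rad1 \<phi> v r \<omega>" unfolding d_r_def by (rule DERIV_imp_deriv[OF D(2)[OF that]])
      have "pt v r \<omega> \<in> region r0" using that r0 by (simp add: region_def rad_pt)
      then have "\<phi> differentiable (at (pt v r \<omega>))" using U unfolding C2_on_def by blast
      from ang_sq_rot1[OF this _ that(3)] show "ang_sq \<phi> v r \<omega> = QQ v r \<omega> / r\<^sup>2" using that r0 by (simp add: QQ_def)
    qed
    show "energy_plus r0 \<phi> + (SUP v\<in>{0..}. energy r0 \<phi> v) + LE0_norm_sq M r0 \<phi>
       \<le> ennreal (3 * (Z + 1)) * (energy_minus r0 \<phi> + LE0_dual_norm_sq M r0 f)"
    proof (rule final_estimate[OF refl _ _ a(1)])
      fix v r :: real and \<omega> :: "real^3"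
      assume as: "v \<ge> 0" "r \<ge> r0" "\<omega> \<in> sphere 0 1"
      have r: "r > 0" using as r0 by simp
      note d = dd[OF as]
      show "energy_density \<phi> v r \<omega> * r^2 = ee v r \<omega>"
        unfolding energy_density_def d ee_def using r by (simp add: field_simps)
      show "((d_r \<phi> v r \<omega>)^2 / r^2 + (1 - 3*M/r)^2 * ((d_v \<phi> v r \<omega>)^2 / r^2 + ang_sq \<phi> v r \<omega> / r) + (\<phi> (pt v r \<omega>))^2 / r^4) * r^2 = lee v r \<omega>"
      proof -
        define c where "c = (1 - 3*(M/r))\<^sup>2"
        have c: "(1 - 3*M/r)^2 = c" by (simp add: c_def)
        show ?thesis unfolding d lee_def c c_def[symmetric] power_divide using r
          by (simp add: field_simps power2_eq_square eval_nat_numeral)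
      qed
    next
      show "Z \<ge> 0" by (simp add: Z_def)
    next
      fix T E LS R :: real
      assume T: "T > 0" and E0: "\<And>R. R \<ge> r0 \<Longrightarrow> integral {r0..R} (av ee 0) \<le> E" and DB: "dual_bound T LS" and R: "R \<ge> a"
      note L = local_energy_estimate[OF a(1,3) mok ext exterior_coefs_on[OF M a(4)] int interior_coefs_on T E0 DB R]
      have "Z = est_const \<kappa>1 k1 C1 G1 \<kappa>2 k2 C2 G2 (2 / r0\<^sup>2 + (1 + 3*(M/r0))\<^sup>2 * (1 / r0\<^sup>2 + 1 / r0))"
        unfolding Z_def using L(4) by simp
      then show "integral {r0..R} (av ee T) \<le> Z * (E + LS) \<and> integral {0..T} (\<lambda>v. av ee v r0) \<le> Z * (E + LS) \<and>
        integral (cbox (0,r0) (T,R)) (\<lambda>x. av lee (fst x) (snd x)) \<le> Z * (E + LS)"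
        using L(1-3) by simp
    qed
  qed
qed

end
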